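(* Let $U\in\mathcal C^2(\mathbb R^d)$ and $0<m\le L$ be such that for all $x,y\in\mathbb R^d$, $|\nabla U(x)-\nabla U(y)|\le L|x-y|$ and $(x-y)\cdot(\nabla U(x)-\nabla U(y))\ge m|x-y|^2$. Suppose moreover that $\gamma\ge 2\sqrt L$ and $0<\delta\le m/(33\gamma^3)$. Let $\pi_\delta$ be the unique invariant probability measure of the OBABO chain with parameters $\delta,\gamma$ and potential $U$, and let $\pi$ be the probability measure on $\mathbb R^{2d}$ with density proportional to $\exp(-U(x)-|v|^2/2)$. With the explicit constants $\kappa,K_1,K_2,K_5,K_6,K_7,K_8$ given in the context (in particular, as $\delta\to0$, $K_5\to \frac{L}{4\sqrt m}+\frac L6$, $K_6\to2^{\ell-2}(1+m^{-\ell/2})$, $K_7\to L$, $K_8\to2^{\ell+1}(1+m^{-(\ell+1)/2})$), the following holds. 1. Suppose that there exist $\ell\ge2$ and $L_\ell>0$ such that, $x_\star$ being the global minimiser of $U$, for all $x,y\in\mathbb R^d$, $$|\nabla^2U(y)-\nabla^2U(x)|\le \frac{L_\ell}{4}|x-y|\left(2+|x-x_\star|^{\ell-2}+|y-x_\star|^{\ell-2}\right).$$ Then for all $p\ge1$, $$\mathcal W_p(\pi_\delta,\pi)\le\delta^2(d+\ell p-2)^{\ell/2}\,\frac{2K_1(K_5+L_\ell K_6)}{\kappa},$$ $$\|\pi_\delta-\pi\|_{TV}\le\delta^2\left(2+|\ln(\delta^3(d+\ell-1))|\right)(d+\ell-1)^{(\ell+1)/2}\,\frac{2K_1^2K_2(K_5+L_\ell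 K_6)+K_7+L_\ell K_8}{\kappa}.$$ 2. Suppose that there exist an integer $\ell\ge2$, $L_\ell>0$, an orthogonal matrix $\mathcal Q\in\mathcal O(d)$ and potentials $U_1,\dots,U_d\in\mathcal C^2(\mathbb R)$ such that $U(\mathcal Qx)=\sum_{i=1}^dU_i(x_i)$ for all $x\in\mathbb R^d$ and, denoting by $x_{\star,i}$ the minimiser of $U_i$, for all $i\in\{1,\dots,d\}$ and $x,y\in\mathbb R$, $$|U_i''(y)-U_i''(x)|\le\frac{L_\ell}{4}|x-y|\left(2+|x-x_{\star,i}|^{\ell-2}+|y-x_{\star,i}|^{\ell-2}\right).$$ Then for all $p\ge2$, $$\mathcal W_p(\pi_\delta,\pi)\le\delta^2\sqrt d\ \frac{2K_1(K_5+L_\ell K_6)(\ell p-1)^{\ell/2}}{\kappa},$$ $$\|\pi_\delta-\pi\|_{TV}\le\delta^2d\left(2+|\ln(\delta^3\ell)|\right)\ell^{(\ell+1)/2}\,\frac{2K_1^2K_2(K_5+L_\ell K_6)+K_7+L_\ell K_8}{\kappa}.$$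
   Context: Given a time-step $\delta>0$ and a friction $\gamma>0$, set $\eta=e^{-\delta\gamma/2}$. The OBABO chain is the time-homogeneous Markov chain on $\mathbb R^d\times\mathbb R^d$ whose transition from $(x_0,v_0)$ to $(x_1,v_1)$ is $$x_1=x_0+\delta\left(\eta v_0+\sqrt{1-\eta^2}\,G\right)-\frac{\delta^2}{2}\nabla U(x_0),$$ $$v_1=\eta^2v_0-\frac{\delta\eta}{2}\left(\nabla U(x_0)+\nabla U(x_1)\right)+\sqrt{1-\eta^2}\left(\eta G+G'\right),$$ where $G,G'$ are independent standard Gaussian vectors in $\mathbb R^d$. Under the hypotheses of the claim it has a unique invariant probability measure $\pi_\delta$, with finite moments of all orders. $\mathcal W_p$ is the $p$-Wasserstein distance for the Euclidean norm, $\|\nu-\mu\|_{TV}=\inf_{X\sim\nu,Y\sim\mu}2\,\mathbb P(X\ne Y)$, and $|\cdot|$ of a matrix is the operator norm. The constants are (with $\pi$ the number in $K_2$): $$K_1=\sqrt3\max\left(L^{1/2},L^{-1/2}\right),\quad \kappa=\frac{m}{3\gamma},\quad K_2=\sqrt{\frac{\delta}{2\pi(1-\eta^2)}}\max\left(2+\frac{3\delta^2L}{2},3\delta\right),$$ $$K_5=\frac{L}{4\sqrt m}+\frac L6\left[1+\delta\frac{L+1}{2}+\delta^3\frac{L}{40}\right]e^{L\delta^2}\left(1+\frac{\delta L}{2\sqrt m}\right),$$ $$K_6=2^{\ell-2}\left(1+e^{L\delta^2}\frac{\delta^2}{12}\right)\left(1+\delta+e^{L\delta^2}\frac{\delta^3}{6}\right)^{\ell-2}\left(1+\frac{\delta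 L}{2}\right)^{\ell}\left(1+\frac{1}{m^{\ell/2}}\right),$$ $$K_7=L(1+\delta L)\left(1+\frac{\delta^2L^2}{4m}\right),$$ $$K_8=2^{\ell+1}\left(1+\delta+\frac{\delta^2L}{2}\right)^{\ell-2}\left(1+\frac{\delta L}{2}\right)^3\left(1+\frac{1}{m^{(\ell+1)/2}}\right).$$ *)

theory Defs
  imports "HOL-Probability.Probability"
begin

definition grad :: "(real^'n \<Rightarrow> real) \<Rightarrow> real^'n \<Rightarrow> real^'n"
  where "grad U x = (THE D. GDERIV U x :> D)"

definition hess :: "(real^'n \<Rightarrow> real) \<Rightarrow> real^'n \<Rightarrow> real^'n^'n"
  where "hess U x = jacobian (grad U) (at x)"

definition C2 :: "(real^'n \<Rightarrow> real) \<Rightarrow> bool"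
  where "C2 U \<longleftrightarrow> (\<forall>x. U differentiable (at x)) \<and> (\<forall>x. grad U differentiable (at x)) \<and>
           continuous_on UNIV (hess U)"

definition C2_real :: "(real \<Rightarrow> real) \<Rightarrow> bool"
  where "C2_real u \<longleftrightarrow> (\<forall>t. u differentiable (at t)) \<and> (\<forall>t. deriv u differentiable (at t)) \<and>
           continuous_on UNIV (deriv (deriv u))"

definition opnorm :: "real^'n^'m \<Rightarrow> real"
  where "opnorm A = onorm (\<lambda>h. A *v h)"

text \<open>Power of a nonnegative real with a nonnegative real exponent, with the usual convention that
  a zeroth power is 1, also at 0 (whereas \<open>0 powr 0 = 0\<close> in the library).\<close>

definition rpow :: "real \<Rightarrow> real \<Rightarrow> real"
  where "rpow t s = (if s = 0 then 1 else t powr s)"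

definition std_gaussian :: "(real^'n) measure"
  where "std_gaussian = density lborel (\<lambda>g. ennreal (\<Prod>i\<in>UNIV. std_normal_density (g $ i)))"

definition eta :: "real \<Rightarrow> real \<Rightarrow> real"
  where "eta \<delta> \<gamma> = exp (- \<delta> * \<gamma> / 2)"

definition obabo_step ::
    "(real^'n \<Rightarrow> real) \<Rightarrow> real \<Rightarrow> real \<Rightarrow> (real^'n) \<times> (real^'n) \<Rightarrow> (real^'n) \<times> (real^'n)
      \<Rightarrow> (real^'n) \<times> (real^'n)"
  where "obabo_step U \<delta> \<gamma> = (\<lambda>(x0, v0) (g, g').
    let \<eta> = eta \<delta> \<gamma>;
        x1 = x0 + \<delta> *\<^sub>R (\<eta> *\<^sub>R v0 + sqrt (1 - \<eta>\<^sup>2) *\<^sub>R g) - (\<delta>\<^sup>2 / 2) *\<^sub>R grad U x0;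
        v1 = \<eta>\<^sup>2 *\<^sub>R v0 - (\<delta> * \<eta> / 2) *\<^sub>R (grad U x0 + grad U x1)
               + sqrt (1 - \<eta>\<^sup>2) *\<^sub>R (\<eta> *\<^sub>R g + g')
    in (x1, v1))"

definition obabo_kernel ::
    "(real^'n \<Rightarrow> real) \<Rightarrow> real \<Rightarrow> real \<Rightarrow> (real^'n) \<times> (real^'n) \<Rightarrow> ((real^'n) \<times> (real^'n)) measure"
  where "obabo_kernel U \<delta> \<gamma> z = distr (std_gaussian \<Otimes>\<^sub>M std_gaussian) borel (obabo_step U \<delta> \<gamma> z)"

definition invariant_prob :: "('a::topological_space \<Rightarrow> 'a measure) \<Rightarrow> 'a measure \<Rightarrow> bool"
  where "invariant_prob K \<mu> \<longleftrightarrow> prob_space \<mu> \<and> sets \<mu> = sets borel \<and>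
           (\<forall>A\<in>sets borel. (\<integral>\<^sup>+z. emeasure (K z) A \<partial>\<mu>) = emeasure \<mu> A)"

definition gibbs_weight :: "(real^'n \<Rightarrow> real) \<Rightarrow> (real^'n) \<times> (real^'n) \<Rightarrow> real"
  where "gibbs_weight U = (\<lambda>(x, v). exp (- U x - (norm v)\<^sup>2 / 2))"

definition gibbs :: "(real^'n \<Rightarrow> real) \<Rightarrow> ((real^'n) \<times> (real^'n)) measure"
  where "gibbs U = density lborel
           (\<lambda>z. ennreal (gibbs_weight U z / (\<integral>w. gibbs_weight U w \<partial>lborel)))"

definition couplings :: "'a::euclidean_space measure \<Rightarrow> 'a measure \<Rightarrow> ('a \<times> 'a) measure set"
  where "couplings \<mu> \<nu> = {c. prob_space c \<and> sets c = sets (borel \<Otimes>\<^sub>M borel) \<and>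
           distr c borel fst = \<mu> \<and> distr c borel snd = \<nu>}"

text \<open>Both distances are \<open>ennreal\<close>-valued: the Wasserstein distance may be infinite. On a product of
  Euclidean spaces, \<open>dist\<close> is the Euclidean distance.\<close>

definition ennreal_root :: "real \<Rightarrow> ennreal \<Rightarrow> ennreal"
  where "ennreal_root p c = (if c = \<top> then \<top> else ennreal (enn2real c powr (1 / p)))"

definition wasserstein :: "real \<Rightarrow> 'a::euclidean_space measure \<Rightarrow> 'a measure \<Rightarrow> ennreal"
  where "wasserstein p \<mu> \<nu> = ennreal_root p
           (INF c\<in>couplings \<mu> \<nu>. \<integral>\<^sup>+z. ennreal (dist (fst z) (snd z) powr p) \<partial>c)"

text \<open>With the factor 2, this distance takes values in \<open>[0, 2]\<close>.\<close>

definition tv_dist :: "'a::euclidean_space measure \<Rightarrow> 'a measure \<Rightarrow> ennreal"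
  where "tv_dist \<mu> \<nu> = (INF c\<in>couplings \<mu> \<nu>. 2 * emeasure c {z \<in> space c. fst z \<noteq> snd z})"

definition K1 :: "real \<Rightarrow> real"
  where "K1 L = sqrt 3 * max (L powr (1/2)) (L powr (- 1/2))"

definition kappa :: "real \<Rightarrow> real \<Rightarrow> real"
  where "kappa m \<gamma> = m / (3 * \<gamma>)"

definition K2 :: "real \<Rightarrow> real \<Rightarrow> real \<Rightarrow> real"
  where "K2 \<delta> \<gamma> L = sqrt (\<delta> / (2 * pi * (1 - (eta \<delta> \<gamma>)\<^sup>2))) * max (2 + 3 * \<delta>\<^sup>2 * L / 2) (3 * \<delta>)"

definition K5 :: "real \<Rightarrow> real \<Rightarrow> real \<Rightarrow> real"
  where "K5 \<delta> m L = L / (4 * sqrt m)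
           + L / 6 * (1 + \<delta> * ((L + 1) / 2) + \<delta>^3 * (L / 40)) * exp (L * \<delta>\<^sup>2) * (1 + \<delta> * L / (2 * sqrt m))"

definition K6 :: "real \<Rightarrow> real \<Rightarrow> real \<Rightarrow> real \<Rightarrow> real"
  where "K6 \<delta> m L l = 2 powr (l - 2) * (1 + exp (L * \<delta>\<^sup>2) * (\<delta>\<^sup>2 / 12))
           * (1 + \<delta> + exp (L * \<delta>\<^sup>2) * (\<delta>^3 / 6)) powr (l - 2)
           * (1 + \<delta> * L / 2) powr l * (1 + 1 / m powr (l / 2))"

definition K7 :: "real \<Rightarrow> real \<Rightarrow> real \<Rightarrow> real"
  where "K7 \<delta> m L = L * (1 + \<delta> * L) * (1 + \<delta>\<^sup>2 * L\<^sup>2 / (4 * m))"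

definition K8 :: "real \<Rightarrow> real \<Rightarrow> real \<Rightarrow> real \<Rightarrow> real"
  where "K8 \<delta> m L l = 2 powr (l + 1) * (1 + \<delta> + \<delta>\<^sup>2 * L / 2) powr (l - 2)
           * (1 + \<delta> * L / 2)^3 * (1 + 1 / m powr ((l + 1) / 2))"

end

theory Submission
  imports Defs
begin

text \<open>Driven by the same noise, two OBABO chains contract a twisted Euclidean norm by the factor
  \<open>1 - \<delta> \<kappa>\<close> per step, because the gradient is cocoercive. Replacing the Verlet map by the exact
  Hamiltonian flow gives a chain that preserves the Gibbs measure, and a single step of the two chains
  differs by \<open>O(\<delta>\<^sup>3)\<close>; the moments of this difference are Gibbs moments, computed by integration by
  parts. Summing the geometric series gives the Wasserstein bound of order \<open>\<delta>\<^sup>2 / \<kappa>\<close>.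

  For the total variation bound, a test function is first propagated for about
  \<open>|ln \<delta>\<^sup>3| / (2 \<kappa> \<delta>)\<close> steps: the Gaussian noise of one step makes it Lipschitz and the contraction
  makes its Lipschitz constant small, so the Wasserstein bound applies. The price is the
  distance by which these steps move the Gibbs measure. It is of order \<open>\<delta>\<^sup>3\<close> per step after passing to the
  modified measure with density \<open>exp (\<delta>\<^sup>2 |\<nabla>U|\<^sup>2 / 8)\<close> relative to the Gibbs measure, for which
  the energy error of the Verlet map is exactly the error of the trapezoidal rule for \<open>U\<close>.

  The general and the separable case are one statement about a family of orthogonal
  components; the powers of their number come from \<open>\<ell>\<^sup>1\<close> and \<open>\<ell>\<^sup>2\<close> sums over it.\<close>

section \<open>Strongly convex potentials\<close>

text \<open>Noise and friction act on the velocity only. The cross term 2 x.v / \<gamma> of the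
  twisted norm is what lets convexity contract positions, and \<gamma> \<ge> 2 sqrt L keeps that
  norm equivalent to the Euclidean one. The gain per step is only of order \<delta> m / \<gamma>;
  the bound on \<delta> makes it dominate discretisation errors of order (\<delta> \<gamma>)^2.

  All error terms are powers normalised by the scale R = d + q - 2 produced by the integration by
  parts, d being the dimension of a component. Each normalised Gibbs moment is then at most one, and
  coefficients simply add up.

  Relative to the Gibbs measure, the energy error of a Verlet step also contains (\<delta>^2 / 8)
  (|\<nabla>U(x1)|^2 - |\<nabla>U(x0)|^2), which telescopes along the chain. The modified measure
  absorbs it, so it is paid once, as a change of normalisation, and not at every step. Moments under
  the modified measure are comparable with Gibbs moments when l \<delta>^2 L^2 / m is small;
  otherwise the claimed bound is at least 2, the largest value of the distance.\<close>

locale potential =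
  fixes U :: "'a::euclidean_space \<Rightarrow> real" and g :: "'a \<Rightarrow> 'a" and H :: "'a \<Rightarrow> 'a \<Rightarrow> 'a"
    and m L :: real and xs :: 'a
  assumes U_deriv: "\<And>x. (U has_derivative (\<lambda>h. g x \<bullet> h)) (at x)"
    and g_deriv: "\<And>x. (g has_derivative H x) (at x)"
    and H_cont: "\<And>h. continuous_on UNIV (\<lambda>x. H x h)"
    and m_pos: "0 < m" and m_le_L: "m \<le> L"
    and g_lip: "\<And>x y. norm (g x - g y) \<le> L * norm (x - y)"
    and g_mono: "\<And>x y. (x - y) \<bullet> (g x - g y) \<ge> m * (norm (x - y))\<^sup>2"
    and g_xs: "g xs = 0"
begin

lemma L_pos: "0 < L"
  using m_pos m_le_L by linarith

lemma g_cont: "continuous_on S g"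
  by (meson continuous_at_imp_continuous_on g_deriv has_derivative_continuous)

lemma U_cont: "continuous_on S U"
  by (meson continuous_at_imp_continuous_on U_deriv has_derivative_continuous)

lemma H_linear: "linear (H x)"
  using g_deriv has_derivative_linear by blast

text \<open>Difference quotients of \<open>g\<close> along \<open>h\<close> are paired with the
  fixed vector w = \<open>H x h\<close>; the limit gives |w|^2 \<le> L |h| |w|, and |w|
  cancels.\<close>

lemma norm_H_le: "norm (H x h) \<le> L * norm h"
proof -
  let ?w = "H x h"
  have "((\<lambda>t. g (x + t *\<^sub>R h) \<bullet> ?w) has_derivative (\<lambda>t. H x (t *\<^sub>R h) \<bullet> ?w)) (at 0)"
    by (rule has_derivative_inner_left, rule has_derivative_compose[of "\<lambda>t. x + t *\<^sub>R h" "\<lambda>t. t *\<^sub>R h" 0 UNIV g "H x"])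
       (auto intro!: derivative_eq_intros simp: g_deriv)
  then have "((\<lambda>t. g (x + t *\<^sub>R h) \<bullet> ?w) has_real_derivative (?w \<bullet> ?w)) (at 0)"
    by (simp add: has_field_derivative_def linear_cmul[OF H_linear] mult.commute[of _ "_ \<bullet> _"])
  then have lim: "((\<lambda>t. (g (x + t *\<^sub>R h) \<bullet> ?w - g x \<bullet> ?w) / t) \<longlongrightarrow> ?w \<bullet> ?w) (at 0)"
    by (simp add: DERIV_def)
  have "(g (x + t *\<^sub>R h) \<bullet> ?w - g x \<bullet> ?w) / t \<le> L * norm h * norm ?w" if "t \<noteq> 0" for t
  proof -
    have "\<bar>(g (x + t *\<^sub>R h) - g x) \<bullet> ?w\<bar> \<le> norm (g (x + t *\<^sub>R h) - g x) * norm ?w"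
      by (rule Cauchy_Schwarz_ineq2)
    also have "\<dots> \<le> L * (\<bar>t\<bar> * norm h) * norm ?w"
      using g_lip[of "x + t *\<^sub>R h" x] by (intro mult_right_mono) auto
    finally have "\<bar>(g (x + t *\<^sub>R h) \<bullet> ?w - g x \<bullet> ?w) / t\<bar> \<le> L * norm h * norm ?w"
      using that by (simp add: inner_diff_left abs_divide divide_le_eq algebra_simps)
    then show ?thesis by linarith
  qed
  then have "?w \<bullet> ?w \<le> L * norm h * norm ?w"
    by (intro tendsto_upperbound[OF lim]) (auto simp: eventually_at_filter)
  then have "norm ?w * norm ?w \<le> L * norm h * norm ?w"
    by (simp add: power2_norm_eq_inner[symmetric] power2_eq_square)
  then show ?thesis
    using L_pos by (cases "norm ?w = 0") auto
qed

lemma line_deriv: "((\<lambda>s. U (x + s *\<^sub>R h)) has_real_derivative (g (x + s *\<^sub>R h) \<bullet> h)) (at s)"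
proof -
  have "((\<lambda>s. U (x + s *\<^sub>R h)) has_derivative (\<lambda>t. g (x + s *\<^sub>R h) \<bullet> (t *\<^sub>R h))) (at s)"
    by (rule has_derivative_compose[of "\<lambda>s. x + s *\<^sub>R h" "\<lambda>t. t *\<^sub>R h" s UNIV U])
       (auto intro!: derivative_eq_intros simp: U_deriv)
  then show ?thesis
    by (simp add: has_field_derivative_def mult.commute[of _ "_ \<bullet> _"])
qed

lemma g_line_deriv: "((\<lambda>s. g (x + s *\<^sub>R h)) has_vector_derivative (H (x + s *\<^sub>R h) h)) (at s)"
proof -
  have "((\<lambda>s. g (x + s *\<^sub>R h)) has_derivative (\<lambda>t. H (x + s *\<^sub>R h) (t *\<^sub>R h))) (at s)"
    by (rule has_derivative_compose[of "\<lambda>s. x + s *\<^sub>R h" "\<lambda>t. t *\<^sub>R h" s UNIV g])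
       (auto intro!: derivative_eq_intros simp: g_deriv)
  then show ?thesis
    by (simp add: has_vector_derivative_def linear_cmul[OF H_linear])
qed

text \<open>The Lipschitz bound makes the derivative of s \<mapsto> U(y + s h) - s g(y).h at most L
  s |h|^2 in size; comparison with L s^2 |h|^2 / 2 gives the remainder with its factor 1/2.\<close>

lemma descent: "\<bar>U (y + h) - U y - g y \<bullet> h\<bar> \<le> L * (norm h)\<^sup>2 / 2"
proof -
  let ?f = "\<lambda>s. U (y + s *\<^sub>R h) - s * (g y \<bullet> h)"
  have d: "(?f has_vector_derivative (g (y + s *\<^sub>R h) \<bullet> h - g y \<bullet> h)) (at s)" for s
    by (auto intro!: derivative_eq_intros line_deriv
        simp: has_real_derivative_iff_has_vector_derivative[symmetric])
  have "norm (?f 1 - ?f 0) \<le> (\<lambda>s. L * (norm h)\<^sup>2 * s\<^sup>2 / 2) 1 - (\<lambda>s. L * (norm h)\<^sup>2 * s\<^sup>2 / 2) 0"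
  proof (rule differentiable_bound_general[where f'="\<lambda>s. g (y + s *\<^sub>R h) \<bullet> h - g y \<bullet> h"
        and \<phi>'="\<lambda>s. L * (norm h)\<^sup>2 * s"])
    show "continuous_on {0..1} ?f"
      by (intro continuous_at_imp_continuous_on ballI has_vector_derivative_continuous[OF d])
    show "continuous_on {0..1} (\<lambda>s. L * (norm h)\<^sup>2 * s\<^sup>2 / 2)" by (intro continuous_intros) auto
    show "((\<lambda>s. L * (norm h)\<^sup>2 * s\<^sup>2 / 2) has_vector_derivative L * (norm h)\<^sup>2 * s) (at s)" for s
      by (auto intro!: derivative_eq_intros simp: has_real_derivative_iff_has_vector_derivative[symmetric])
    fix s :: real assume s: "0 < s" "s < 1"
    have "norm (g (y + s *\<^sub>R h) \<bullet> h - g y \<bullet> h) = \<bar>(g (y + s *\<^sub>R h) - g y) \<bullet> h\<bar>"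
      by (simp add: inner_diff_left)
    also have "\<dots> \<le> norm (g (y + s *\<^sub>R h) - g y) * norm h" by (rule Cauchy_Schwarz_ineq2)
    also have "\<dots> \<le> (L * (s * norm h)) * norm h"
      using g_lip[of "y + s *\<^sub>R h" y] s by (intro mult_right_mono) auto
    finally show "norm (g (y + s *\<^sub>R h) \<bullet> h - g y \<bullet> h) \<le> L * (norm h)\<^sup>2 * s"
      by (simp add: power2_eq_square algebra_simps)
  qed (use d in auto)
  then show ?thesis by (simp add: algebra_simps)
qed

text \<open>Strong monotonicity makes U minus its linear part and minus the quadratic m s^2 |h|^2 /
  2 nondecreasing along the segment.\<close>

lemma strong_convexity: "U (y + h) \<ge> U y + g y \<bullet> h + m * (norm h)\<^sup>2 / 2"
proof -
  let ?f = "\<lambda>s. U (y + s *\<^sub>R h) - s * (g y \<bullet> h) - m * (norm h)\<^sup>2 * s\<^sup>2 / 2"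
  have "?f 0 \<le> ?f 1"
  proof (rule DERIV_nonneg_imp_nondecreasing[of 0 1 ?f])
    fix s :: real assume s: "0 \<le> s" "s \<le> 1"
    have "m * (s * norm h)\<^sup>2 \<le> s * (h \<bullet> (g (y + s *\<^sub>R h) - g y))"
      using g_mono[of "y + s *\<^sub>R h" y] s by simp
    then have "0 \<le> s * (g (y + s *\<^sub>R h) \<bullet> h - g y \<bullet> h - m * (norm h)\<^sup>2 * s)"
      by (simp add: inner_diff_right inner_commute algebra_simps power2_eq_square)
    then have "0 \<le> g (y + s *\<^sub>R h) \<bullet> h - g y \<bullet> h - m * (norm h)\<^sup>2 * s"
      using s by (cases "s = 0") (auto simp: zero_le_mult_iff)
    moreover have "(?f has_real_derivative g (y + s *\<^sub>R h) \<bullet> h - g y \<bullet> h - m * (norm h)\<^sup>2 * s) (at s)"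
      by (auto intro!: derivative_eq_intros line_deriv)
    ultimately show "\<exists>d. (?f has_real_derivative d) (at s) \<and> 0 \<le> d" by blast
  qed auto
  then show ?thesis by simp
qed

text \<open>The Baillon--Haddad inequality: compare the convex function \<open>z \<mapsto> U z - g x \<bullet> z\<close> at its
  minimiser \<open>x\<close> with its value after a gradient step of length \<open>1 / L\<close> from \<open>y\<close>.\<close>

lemma cocoercive: "(norm (g x - g y))\<^sup>2 \<le> L * ((x - y) \<bullet> (g x - g y))"
proof -
  have half: "(norm (g y - g x))\<^sup>2 / (2 * L) \<le> U y - U x - g x \<bullet> (y - x)" for x y
  proof -
    let ?G = "g y - g x"
    let ?h = "- (1 / L) *\<^sub>R ?G"
    have "U x + g x \<bullet> (y + ?h - x) \<le> U (y + ?h)"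
      using strong_convexity[of x "y + ?h - x"] m_pos
      by (smt (verit) add_diff_cancel_left' diff_add_cancel add.commute divide_nonneg_nonneg mult_nonneg_nonneg zero_le_power2)
    moreover have "U (y + ?h) \<le> U y + g y \<bullet> ?h + L * (norm ?h)\<^sup>2 / 2"
      using descent[of y ?h] by linarith
    moreover have "g y \<bullet> ?h - g x \<bullet> ?h = - (norm ?G)\<^sup>2 / L"
      by (simp add: power2_norm_eq_inner inner_diff_left inner_diff_right divide_simps algebra_simps)
    moreover have "L * (norm ?h)\<^sup>2 / 2 = (norm ?G)\<^sup>2 / (2 * L)"
      using L_pos by (simp add: power_mult_distrib power_divide power2_eq_square divide_simps)
    moreover have "- (norm ?G)\<^sup>2 / L = - 2 * ((norm ?G)\<^sup>2 / (2 * L))"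
      by simp
    ultimately show ?thesis
      unfolding inner_diff_right inner_add_right by linarith
  qed
  \<comment> \<open>Adding \<open>half\<close> for the two orders of the points cancels the values
    of \<open>U\<close>.\<close>
  have "(norm (g x - g y))\<^sup>2 / L \<le> (x - y) \<bullet> (g x - g y)"
    using half[of x y] half[of y x]
    by (simp add: norm_minus_commute inner_diff_left inner_diff_right inner_commute)
  then show ?thesis
    using L_pos by (simp add: field_simps)
qed

lemma norm_g_le: "norm (g x) \<le> L * norm (x - xs)"
  using g_lip[of x xs] g_xs by simp

end

section \<open>Contraction of the synchronous coupling\<close>

text \<open>The contraction estimate in units where the friction is 1: \<open>k = \<gamma>\<^sup>2 / L\<close>, \<open>\<alpha> = m / \<gamma>\<^sup>2\<close>,
  \<open>t = \<delta> \<gamma>\<close>; the vector \<open>y\<close> is the velocity difference after the first O-step.\<close>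

lemma contraction_scaled:
  fixes x y G0 G1 x1 w :: "'a::real_inner" and t k \<alpha> \<eta> :: real
  assumes t: "0 < t" "t \<le> \<alpha> / 33" and k: "4 \<le> k" "\<alpha> * k \<le> 1" and \<eta>: "\<eta> = exp (- t / 2)"
    and G0: "k * (G0 \<bullet> G0) \<le> x \<bullet> G0" "\<alpha> * (x \<bullet> x) \<le> x \<bullet> G0"
    and x1: "x1 = x + t *\<^sub>R y - (t\<^sup>2 / 2) *\<^sub>R G0"
    and G1: "k * (G1 \<bullet> G1) \<le> x1 \<bullet> G1" "\<alpha> * (x1 \<bullet> x1) \<le> x1 \<bullet> G1"
    and w: "w = y - (t / 2) *\<^sub>R (G0 + G1)"
  shows "x1 \<bullet> x1 + 2 * \<eta> * (x1 \<bullet> w) + \<eta>\<^sup>2 * k * (w \<bullet> w)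
           \<le> (1 - t * \<alpha> / 3)\<^sup>2 * (x \<bullet> x + 2 / \<eta> * (x \<bullet> y) + k / \<eta>\<^sup>2 * (y \<bullet> y))"
proof -
  define a b c where "a = x \<bullet> x" and "b = x \<bullet> y" and "c = y \<bullet> y"
  define p0 q0 r0 where "p0 = x \<bullet> G0" and "q0 = y \<bullet> G0" and "r0 = G0 \<bullet> G0"
  define p1 q1 r1 where "p1 = x1 \<bullet> G1" and "q1 = y \<bullet> G1" and "r1 = G1 \<bullet> G1"
  define zz where "zz = (G0 + G1) \<bullet> (G0 + G1)"
  define E where "E = 1 / \<eta>"
  have \<alpha>: "0 < \<alpha>" using t by linarith
  have \<alpha>4: "\<alpha> \<le> 1/4"
  proof -
    have "\<alpha> * 4 \<le> \<alpha> * k" using \<alpha> k by (intro mult_left_mono) auto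
    then show ?thesis using k by linarith
  qed
  have t1: "t \<le> 1/132" using t \<alpha>4 by linarith
  have nn: "0 \<le> a" "0 \<le> c" "0 \<le> r0" "0 \<le> r1" by (auto simp: a_def c_def r0_def r1_def)
  have young: "\<bar>u \<bullet> v\<bar> \<le> (u \<bullet> u * \<beta> + v \<bullet> v / \<beta>) / 2" if "\<beta> > 0" for u v :: 'a and \<beta>
  proof -
    have "\<bar>u \<bullet> v\<bar> \<le> norm u * norm v" by (rule Cauchy_Schwarz_ineq2)
    moreover have "0 \<le> (sqrt \<beta> * norm u - norm v / sqrt \<beta>)\<^sup>2" by simp
    moreover have "(sqrt \<beta> * norm u - norm v / sqrt \<beta>)\<^sup>2
        = \<beta> * (norm u)\<^sup>2 - 2 * (norm u * norm v) + (norm v)\<^sup>2 / \<beta>"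
      using that by (simp add: power2_diff power_mult_distrib power_divide)
    ultimately show ?thesis by (simp add: power2_norm_eq_inner algebra_simps)
  qed
  have x1x1: "x1 \<bullet> x1 = a + 2*t*b + t\<^sup>2*c - t\<^sup>2*p0 - t^3*q0 + t^4/4*r0"
    unfolding x1 a_def b_def c_def p0_def q0_def r0_def
    by (simp add: inner_add_left inner_add_right inner_diff_left inner_diff_right inner_commute
        power2_eq_square power3_eq_cube power4_eq_xxxx algebra_simps)
  have x1G0: "x1 \<bullet> G0 = p0 + t * q0 - t\<^sup>2/2*r0"
    unfolding x1 p0_def q0_def r0_def by (simp add: inner_add_left inner_diff_left)
  have x1y: "x1 \<bullet> y = b + t * c - t\<^sup>2/2*q0"
    unfolding x1 b_def c_def q0_def by (simp add: inner_add_left inner_diff_left inner_commute[of G0 y])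
  have x1w: "x1 \<bullet> w = b + t*c - t/2*(p0+p1) - t\<^sup>2*q0 + t^3/4*r0"
  proof -
    have "x1 \<bullet> w = x1 \<bullet> y - t/2 * (x1 \<bullet> G0 + p1)"
      unfolding w p1_def by (simp add: inner_diff_right inner_add_right)
    then show ?thesis unfolding x1y x1G0
      by (simp add: algebra_simps add_divide_distrib diff_divide_distrib power2_eq_square power3_eq_cube)
  qed
  have ww: "w \<bullet> w = c - t*(q0+q1) + t\<^sup>2/4*zz"
    unfolding w zz_def c_def q0_def q1_def
    by (simp add: inner_diff_left inner_diff_right inner_add_left inner_add_right inner_commute
        power2_eq_square algebra_simps)
  have s: "zz \<le> 2*r0 + 2*r1"
    using young[of 1 G0 G1] unfolding zz_def r0_def r1_def
    by (simp add: inner_add_left inner_add_right inner_commute)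
  have q: "\<bar>q0\<bar> \<le> (c+r0)/2" "\<bar>q1\<bar> \<le> (c+r1)/2"
    using young[of 1 y G0] young[of 1 y G1] by (simp_all add: q0_def q1_def c_def r0_def r1_def)
  have kr: "k*r0 \<le> p0" "k*r1 \<le> p1" using G0 G1 by (auto simp: r0_def r1_def p0_def p1_def)
  have p: "\<alpha> * a \<le> p0" "\<alpha> * (x1 \<bullet> x1) \<le> p1" using G0 G1 by (auto simp: p0_def p1_def a_def)
  have p0a: "p0 \<le> a/k"
  proof -
    have "2 * p0 \<le> a / k + k * r0"
      using young[of "1/k" x G0] k by (simp add: p0_def a_def r0_def mult.commute)
    then show ?thesis using kr by linarith
  qed
  have p0a4: "p0 \<le> a/4" using p0a k nn by (smt (verit) frac_le)
  have r04: "r0 \<le> p0/4" "r1 \<le> p1/4"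
    using kr k nn mult_right_mono[of 4 k r0] mult_right_mono[of 4 k r1] by linarith+
  have p_nn: "0 \<le> p0" "0 \<le> p1" using r04 nn by linarith+
  have e0: "0 < \<eta>" "\<eta> \<le> 1" "1 - t/2 \<le> \<eta>" using exp_ge_add_one_self[of "-t/2"] t by (auto simp: \<eta>)
  have E1: "E = exp (t/2)" by (simp add: E_def \<eta> exp_minus field_simps)
  have Elo: "1 + t/2 \<le> E" unfolding E1 by (rule exp_ge_add_one_self)
  have Eup: "E \<le> 1 + t/2 + (t/2)\<^sup>2" unfolding E1 using t t1 by (intro exp_bound) auto
  have E\<eta>: "E * \<eta> = 1" using e0 by (simp add: E_def)
  have \<eta>up: "\<eta> \<le> 1 - t/2 + t\<^sup>2/4"
  proof -
    have "(1+t/2) * (1 - t/2 + t\<^sup>2/4) = 1 + t^3/8" by (simp add: algebra_simps power2_eq_square power3_eq_cube)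
    also have "\<dots> \<ge> (1 + t/2) * \<eta>" using mult_right_mono[OF Elo, of \<eta>] e0 E\<eta> t
      by (smt (verit) divide_nonneg_nonneg zero_le_power)
    finally show ?thesis using t by simp
  qed
  have sq: "E\<^sup>2 = exp t" "\<eta>\<^sup>2 = exp (-t)" by (simp_all add: E1 \<eta> exp_double[symmetric] power2_eq_square exp_add[symmetric])
  have E2lo: "1 + t \<le> E\<^sup>2" "E\<^sup>2 \<le> 1 + t + t\<^sup>2" unfolding sq using exp_ge_add_one_self[of t] exp_bound[of t] t t1 by auto
  have \<eta>2up: "\<eta>\<^sup>2 \<le> 1 - t + t\<^sup>2"
  proof -
    have "(1+t) * \<eta>\<^sup>2 \<le> 1" using mult_right_mono[OF E2lo(1), of "\<eta>\<^sup>2"] E\<eta>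
      by (simp add: power_mult_distrib[symmetric])
    also have "1 \<le> (1+t)*(1 - t + t\<^sup>2)" using t by (simp add: algebra_simps power2_eq_square)
    finally show ?thesis using t by simp
  qed
  have \<eta>21: "\<eta>\<^sup>2 \<le> 1" "0 \<le> \<eta>\<^sup>2" using e0 by (auto simp: power_le_one)
  have t2: "t\<^sup>2 \<le> t * \<alpha> / 33" using t by (simp add: power2_eq_square mult_left_mono)
  have t21: "t\<^sup>2 \<le> t/132" using t1 t by (simp add: power2_eq_square mult_left_mono)
  have t3: "t^3 \<le> t\<^sup>2/132" "0 \<le> t^3" using t1 t by (simp_all add: power3_eq_cube power2_eq_square mult_left_mono)
  have t4: "t^4 \<le> t^3/132" "0 \<le> t^4" using t1 t by (simp_all add: power3_eq_cube power4_eq_xxxx mult_left_mono)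
  \<comment> \<open>\<open>p0\<close> and \<open>p1\<close> measure what the two kicks gain. Every
    \<open>q\<close> term is split by Young's inequality, and every \<open>r\<close> term is at most
    a quarter of a \<open>p\<close> term by cocoercivity and k \<ge> 4. About half of t (p0 + p1)
    survives all losses.\<close>
  have LHS: "x1 \<bullet> x1 + 2 * \<eta> * (x1 \<bullet> w) + \<eta>\<^sup>2 * k * (w \<bullet> w)
     \<le> a + (2*t+2*\<eta>)*b + c*(2*t+3*t\<^sup>2+k*\<eta>\<^sup>2+k*t) - 49/100*t*(p0+p1)"
  proof -
    have A: "x1 \<bullet> x1 \<le> a + 2*t*b + t\<^sup>2*c - t\<^sup>2*p0 + t^3*((c+r0)/2) + t^4/4*r0"
    proof -
      have "- (t^3*q0) \<le> t^3*((c+r0)/2)" using q t3 by (smt (verit) mult_left_mono minus_mult_right mult_minus_left)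
      then show ?thesis unfolding x1x1 by simp
    qed
    have B: "2 * \<eta> * (x1 \<bullet> w) \<le> 2*\<eta>*b + 2*t*c - t*\<eta>*(p0+p1) + t\<^sup>2*(c+r0) + t^3/2*r0"
    proof -
      have "- q0 \<le> (c+r0)/2" using q by linarith
      then have "\<eta> * t\<^sup>2 * (-q0) \<le> \<eta> * t\<^sup>2 * ((c+r0)/2)" using e0 by (intro mult_left_mono) auto
      also have "\<dots> \<le> 1 * t\<^sup>2 * ((c+r0)/2)" using e0 nn by (intro mult_right_mono) auto
      finally have 1: "- (\<eta> * t\<^sup>2 * q0) \<le> t\<^sup>2 * ((c+r0)/2)" by simp
      have 2: "\<eta> * (t*c) \<le> t*c" using e0 t nn by (intro mult_left_le_one_le) auto
      have 3: "\<eta> * (t^3/4*r0) \<le> t^3/4*r0" using e0 t nn by (intro mult_left_le_one_le) auto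
      have "2 * \<eta> * (x1 \<bullet> w) = 2*\<eta>*b + 2*(\<eta>*(t*c)) - t*\<eta>*(p0+p1) + 2 * (- (\<eta> * t\<^sup>2 * q0)) + 2*(\<eta> * (t^3/4*r0))"
        unfolding x1w by (simp add: algebra_simps add_divide_distrib diff_divide_distrib)
      then show ?thesis using 1 2 3 by (simp add: algebra_simps add_divide_distrib diff_divide_distrib)
    qed
    have C: "\<eta>\<^sup>2 * k * (w \<bullet> w) \<le> k*\<eta>\<^sup>2*c + k*t*c + \<eta>\<^sup>2*t/2*(p0+p1) + t\<^sup>2/2*(p0+p1)"
    proof -
      have "- k*(q0+q1) \<le> k * c + (p0+p1)/2"
      proof -
        have "-(q0+q1) \<le> c + (r0+r1)/2" using q by argo
        then have "k * (-(q0+q1)) \<le> k * (c + (r0+r1)/2)" using k by (intro mult_left_mono) auto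
        then show ?thesis using kr by (simp add: algebra_simps add_divide_distrib diff_divide_distrib)
      qed
      then have "\<eta>\<^sup>2 * t * (- k*(q0+q1)) \<le> \<eta>\<^sup>2 * t * (k * c + (p0+p1)/2)"
        using t by (intro mult_left_mono) auto
      moreover have "\<eta>\<^sup>2 * (t * k * c) \<le> t * k * c" using \<eta>21 t k nn by (intro mult_left_le_one_le) auto
      moreover have "\<eta>\<^sup>2 * (t\<^sup>2/4 * (k*zz)) \<le> t\<^sup>2/2*(p0+p1)"
      proof -
        have "k * zz \<le> k * (2*r0+2*r1)" using s k by (intro mult_left_mono) auto
        then have "k * zz \<le> 2 * (p0+p1)" using kr by (simp add: algebra_simps add_divide_distrib diff_divide_distrib)
        then have "t\<^sup>2/4 * (k*zz) \<le> t\<^sup>2/4 * (2*(p0+p1))" by (intro mult_left_mono) auto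
        moreover have "\<eta>\<^sup>2 * (t\<^sup>2/4 * (k*zz)) \<le> t\<^sup>2/4 * (k*zz)"
          using \<eta>21 k by (intro mult_left_le_one_le) (auto simp: zz_def)
        ultimately show ?thesis by linarith
      qed
      ultimately show ?thesis unfolding ww by (simp add: algebra_simps add_divide_distrib diff_divide_distrib)
    qed
    \<comment> \<open>The product of \<open>x1\<close> and \<open>w\<close> gains t \<eta> (p0 +
      p1), and Young's inequality inside \<open>w\<close> loses t \<eta>^2 (p0 + p1) / 2. The
      balance \<eta>^2 / 2 - \<eta> is -1/2 up to (1 - \<eta>)^2 / 2.\<close>
    have D: "-\<eta> + \<eta>\<^sup>2/2 \<le> -1/2 + t\<^sup>2/8"
    proof -
      have "(1-\<eta>)\<^sup>2 \<le> (t/2)\<^sup>2" using e0 by (intro power_mono) auto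
      then show ?thesis by (simp add: power2_eq_square algebra_simps)
    qed
    have "t * (p0+p1) * (-\<eta> + \<eta>\<^sup>2/2) \<le> t * (p0+p1) * (-1/2 + t\<^sup>2/8)"
      using D t p_nn by (intro mult_left_mono) auto
    moreover have "t * (p0+p1) * (t\<^sup>2/8) \<le> t * (p0 + p1) * (1/1000)"
      using t t21 t1 p_nn by (intro mult_left_mono) auto
    moreover have "t\<^sup>2/2*(p0+p1) \<le> t/264*(p0+p1)" using t21 p_nn by (intro mult_right_mono) auto
    moreover have tp: "0 \<le> p0 * t" "0 \<le> p1 * t" using t p_nn by auto
    ultimately have F: "- t*\<eta>*(p0+p1) + \<eta>\<^sup>2*t/2*(p0+p1) + t\<^sup>2/2*(p0+p1) \<le> - 49/100*t*(p0+p1)"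
      using tp by (simp add: algebra_simps add_divide_distrib diff_divide_distrib)
    have G: "t^3*((c+r0)/2) + t^4/4*r0 + t\<^sup>2*(c+r0) + t^3/2*r0 \<le> 2*t\<^sup>2*c + t\<^sup>2*p0"
    proof -
      have "t^3 * (c+r0) \<le> t\<^sup>2/132 * (c+r0)" "t^3*r0 \<le> t\<^sup>2/132*r0"
        using t3 nn by (intro mult_right_mono; simp)+
      moreover have "t^4 * r0 \<le> t\<^sup>2 * r0" using t3 t4 nn zero_le_power2[of t] by (intro mult_right_mono) linarith+
      moreover have "t\<^sup>2 * r0 \<le> t\<^sup>2 * (p0/4)" using r04 by (intro mult_left_mono) auto
      moreover have "0 \<le> t\<^sup>2 * c" "0 \<le> t\<^sup>2 * p0" "0 \<le> t\<^sup>2 * r0" using nn p_nn by auto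
      ultimately show ?thesis by (simp add: algebra_simps add_divide_distrib diff_divide_distrib)
    qed
    from A B C F G show ?thesis by (simp add: algebra_simps add_divide_distrib diff_divide_distrib)
  qed
  \<comment> \<open>Strong convexity at the old and at the new position converts the surviving gain
    into nearly 2 \<alpha> |x|^2.\<close>
  have PP: "\<alpha> * (198/100 * a) - \<alpha> * (2*t*c) \<le> p0 + p1"
  proof -
    have "2 * \<bar>b\<bar> \<le> a + c" using young[of 1 x y] by (simp add: a_def b_def c_def)
    then have "t * (2 * \<bar>b\<bar>) \<le> t * (a + c)" using t by (intro mult_left_mono) auto
    moreover have "t * (2 * b) \<ge> - (t * (2 * \<bar>b\<bar>))" using t abs_ge_minus_self[of "t * (2 * b)"] by (simp add: abs_mult)
    ultimately have 1: "2*t*b \<ge> - (t*a) - t*c" by (simp add: algebra_simps add_divide_distrib diff_divide_distrib)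
    have 2: "t\<^sup>2*p0 \<le> t\<^sup>2*(a/4)" using p0a4 by (intro mult_left_mono) auto
    have 3: "t^3*q0 \<le> t^3*((c+a)/2)" using q r04 p0a4 nn t3 p_nn by (intro mult_left_mono) auto
    have 4: "t\<^sup>2 * a \<le> t/132 * a" "t^3 * (a+c) \<le> t\<^sup>2/132*(a+c)" "t\<^sup>2 * c \<ge> 0" "t^4*r0 \<ge> 0"
      using mult_right_mono[OF t21, of a] mult_right_mono[OF t3(1), of "a + c"] nn by auto
    have 5: "t\<^sup>2/132*(a+c) \<le> t/10000 * (a+c)" using t21 nn t by (intro mult_right_mono) auto
    have 6: "t * a \<le> a/132" using t1 nn mult_right_mono[of t "1/132" a] by auto
    have "x1 \<bullet> x1 \<ge> a - t*a - t*c - t\<^sup>2*(a/4) - t^3*((c+a)/2)"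
      unfolding x1x1 using 1 2 3 4 by linarith
    moreover have tac: "0 \<le> c * t" "0 \<le> a * t" using t nn by auto
    ultimately have "x1 \<bullet> x1 \<ge> 98/100 * a - 2*t*c"
      using 4 5 6 nn tac by (simp add: algebra_simps add_divide_distrib diff_divide_distrib)
    then have "\<alpha> * (98/100 * a - 2*t*c) \<le> \<alpha> * (x1 \<bullet> x1)" using \<alpha> by (intro mult_left_mono) auto
    then show ?thesis using p by (simp add: algebra_simps add_divide_distrib diff_divide_distrib)
  qed
  \<comment> \<open>The coefficients of x.y on the two sides agree to first order, since E - \<eta>
    = t + O(t^2). The hypothesis t \<le> \<alpha> / 33 turns the remaining t^2 into a small multiple
    of t \<alpha>. The Young weight 2/5 keeps the share of |x|^2 below 49/100 * 198/100 - 2/3, the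
    part of the gain that is left after the claimed contraction.\<close>
  have cross: "\<bar>2*(E - \<eta>) - 2*t - 4*t*\<alpha>/3*E\<bar> * \<bar>b\<bar> \<le> t*\<alpha>*(28/100*a) + t*\<alpha>*(175/100*c)"
  proof -
    have e1: "E - \<eta> - t \<le> t\<^sup>2/2" proof -
      have "E \<le> 1 + t/2 + t\<^sup>2/4" using Eup by (simp add: power_divide)
      then show ?thesis using e0 zero_le_power2[of t] by linarith
    qed
    have e2: "- t\<^sup>2/2 \<le> E - \<eta> - t" using Elo \<eta>up zero_le_power2[of t] by linarith
    have "t * \<alpha> * E \<le> t * \<alpha> * (101/100)" using Eup t t1 t21 \<alpha> unfolding power_divide by (intro mult_left_mono) auto
    moreover have "0 \<le> t * \<alpha> * E" using t \<alpha> Elo by simp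
    moreover have "4*t*\<alpha>/3*E = 4/3 * (t * \<alpha> * E)" by simp
    moreover have "0 \<le> t * \<alpha>" using t \<alpha> by simp
    ultimately have "\<bar>2*(E - \<eta>) - 2*t - 4*t*\<alpha>/3*E\<bar> \<le> 138/100 * (t * \<alpha>)"
      using e1 e2 t2 unfolding abs_le_iff by argo
    then have "\<bar>2*(E - \<eta>) - 2*t - 4*t*\<alpha>/3*E\<bar> * \<bar>b\<bar> \<le> 138/100 * (t * \<alpha>) * ((a*(2/5) + c/(2/5))/2)"
      using young[of "2/5" x y] t \<alpha> by (intro mult_mono) (auto simp: a_def b_def c_def)
    also have "138/100 * (t * \<alpha>) * ((a*(2/5) + c/(2/5))/2) \<le> t*\<alpha>*(28/100*a) + t*\<alpha>*(175/100*c)"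
      using mult_nonneg_nonneg[OF mult_nonneg_nonneg[of t \<alpha>] nn(1)] mult_nonneg_nonneg[OF mult_nonneg_nonneg[of t \<alpha>] nn(2)] t \<alpha>
      by (auto simp: algebra_simps)
    finally show ?thesis .
  qed
  \<comment> \<open>Friction contributes k (E^2 - \<eta>^2), about 2 t k. Of this k t was spent on
    Young's inequality; k \<ge> 4 pays for 2 t, and \<alpha> \<le> 1/4 for the contraction and cross
    terms.\<close>
  have cc: "0 \<le> c * (k*E\<^sup>2*(1 - 2*t*\<alpha>/3) - (2*t+3*t\<^sup>2+k*\<eta>\<^sup>2+k*t) - t*\<alpha>*(175/100) - t*\<alpha>*t)"
  proof -
    have 1: "k * (2*t - t\<^sup>2) \<le> k * (E\<^sup>2 - \<eta>\<^sup>2)" using E2lo \<eta>2up k by (intro mult_left_mono) auto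
    have 2: "(t * \<alpha> * k) * E\<^sup>2 \<le> (t * \<alpha> * k) * (102/100)" using E2lo t1 t21 t \<alpha> k by (intro mult_left_mono) auto
    have 3: "t * \<alpha> * k \<le> t * k / 4" using \<alpha>4 t k by (simp add: mult_left_mono mult_right_mono)
    have 4: "4 * t \<le> t * k" using k t by simp
    have 5: "k * t\<^sup>2 \<le> k * (t/132)" using t21 k by (intro mult_left_mono) auto
    have 6: "t * \<alpha> \<le> t / 4" using \<alpha>4 t by simp
    have 7: "t * \<alpha> * t \<le> t * \<alpha> * 1" using t t1 \<alpha> by (intro mult_left_mono) auto
    have "0 \<le> k*E\<^sup>2*(1 - 2*t*\<alpha>/3) - (2*t+3*t\<^sup>2+k*\<eta>\<^sup>2+k*t) - t*\<alpha>*(175/100) - t*\<alpha>*t"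
    proof -
      have "k*E\<^sup>2*(1 - 2*t*\<alpha>/3) = k * E\<^sup>2 - 2/3 * ((t * \<alpha> * k) * E\<^sup>2)" by (simp add: algebra_simps)
      moreover have "k * (2*t - t\<^sup>2) = 2 * (t * k) - k * t\<^sup>2" "k * (E\<^sup>2 - \<eta>\<^sup>2) = k * E\<^sup>2 - k * \<eta>\<^sup>2"
        "k * (t/132) = t * k / 132" "k * t = t * k"
        by (simp_all add: algebra_simps)
      ultimately show ?thesis using 1 2 3 4 5 6 7 t21 t by argo
    qed
    then show ?thesis using nn by simp
  qed
  \<comment> \<open>Nonnegativity of the twisted form allows 1 - 2 t \<alpha> / 3 to be replaced by
    the larger (1 - t \<alpha> / 3)^2.\<close>
  have Q: "0 \<le> a + 2*E*b + k*E\<^sup>2*c"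
  proof -
    have "2 * \<bar>b\<bar> \<le> a / E + c * E" using young[of "1/E" x y] Elo t by (simp add: a_def b_def c_def)
    then have "E * (2 * \<bar>b\<bar>) \<le> E * (a / E + c * E)" using Elo t by (intro mult_left_mono) auto
    also have "\<dots> = a + E\<^sup>2 * c" using Elo t by (simp add: distrib_left power2_eq_square)
    also have "\<dots> \<le> a + k*E\<^sup>2*c" using mult_right_mono[of 1 k "E\<^sup>2*c"] k nn by simp
    finally have "\<bar>2 * E * b\<bar> \<le> a + k*E\<^sup>2*c" using Elo t by (simp add: abs_mult)
    then show ?thesis by linarith
  qed
  have "(1 - 2*t*\<alpha>/3) * (a + 2*E*b + k*E\<^sup>2*c) \<le> (1 - t*\<alpha>/3)\<^sup>2 * (a + 2*E*b + k*E\<^sup>2*c)"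
    using Q zero_le_square[of "t * \<alpha>"] by (intro mult_right_mono) (simp_all add: power2_eq_square algebra_simps add_divide_distrib diff_divide_distrib)
  moreover have "a + (2*t+2*\<eta>)*b + c*(2*t+3*t\<^sup>2+k*\<eta>\<^sup>2+k*t) - 49/100*t*(p0+p1)
       \<le> (1 - 2*t*\<alpha>/3) * (a + 2*E*b + k*E\<^sup>2*c)"
  proof -
    have pp: "49/100*t*(\<alpha> * (198/100 * a) - \<alpha> * (2*t*c)) \<le> 49/100*t*(p0+p1)"
      using PP t by (intro mult_left_mono) auto
    have b': "- ((2*(E - \<eta>) - 2*t - 4*t*\<alpha>/3*E) * b) \<le> t*\<alpha>*(28/100*a) + t*\<alpha>*(175/100*c)"
      using order_trans[OF abs_ge_minus_self] cross unfolding abs_mult[symmetric] by blast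
    have "0 \<le> t * \<alpha> * a" "0 \<le> t * \<alpha> * t * c" using t \<alpha> nn by auto
    then show ?thesis using pp b' cc by (simp add: algebra_simps add_divide_distrib diff_divide_distrib)
  qed
  ultimately show ?thesis
    using LHS unfolding a_def b_def c_def E_def by (simp add: power_divide mult.commute mult.left_commute)
qed

section \<open>The OBABO step\<close>

locale obabo = potential +
  fixes \<gamma> \<delta> :: real
  assumes \<gamma>_ge: "\<gamma> \<ge> 2 * sqrt L" and \<delta>_pos: "0 < \<delta>" and \<delta>_le: "\<delta> \<le> m / (33 * \<gamma>^3)"
begin

definition et :: real where "et = eta \<delta> \<gamma>"

definition sg :: real where "sg = sqrt (1 - et\<^sup>2)"

definition verlet :: "'a \<times> 'a \<Rightarrow> 'a \<times> 'a" where
  "verlet z = (let x1 = fst z + \<delta> *\<^sub>R snd z - (\<delta>\<^sup>2 / 2) *\<^sub>R g (fst z)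
     in (x1, snd z - (\<delta> / 2) *\<^sub>R (g (fst z) + g x1)))"

definition ostep :: "'a \<times> 'a \<Rightarrow> 'a \<Rightarrow> 'a \<times> 'a" where
  "ostep z \<xi> = (fst z, et *\<^sub>R snd z + sg *\<^sub>R \<xi>)"

definition step :: "'a \<times> 'a \<Rightarrow> 'a \<times> 'a \<Rightarrow> 'a \<times> 'a" where
  "step z \<xi> = ostep (verlet (ostep z (fst \<xi>))) (snd \<xi>)"

definition \<kappa> :: real where "\<kappa> = m / (3 * \<gamma>)"

text \<open>A linear square root of the form |x|^2 + (2 / \<gamma>) x.v + |v|^2 / L, see
  \<open>M_sq\<close>. Writing \<open>M\<close> as a norm composed with a linear map gives its
  triangle inequality and continuity at once.\<close>

definition twist :: "'a \<times> 'a \<Rightarrow> 'a \<times> 'a" where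
  "twist z = (fst z + (1 / \<gamma>) *\<^sub>R snd z, sqrt (1 / L - 1 / \<gamma>\<^sup>2) *\<^sub>R snd z)"

definition M :: "'a \<times> 'a \<Rightarrow> real" where "M z = norm (twist z)"

lemma \<gamma>_pos: "0 < \<gamma>"
  using \<gamma>_ge L_pos by (smt (verit) real_sqrt_gt_zero)

lemma \<gamma>_sq: "4 * L \<le> \<gamma>\<^sup>2"
proof -
  have "(2 * sqrt L)\<^sup>2 \<le> \<gamma>\<^sup>2" using \<gamma>_ge L_pos by (intro power_mono) auto
  then show ?thesis using L_pos by (simp add: power_mult_distrib)
qed

lemma et_bounds: "0 < et" "et < 1" "et\<^sup>2 < 1"
proof -
  show "0 < et" by (simp add: et_def eta_def)
  show *: "et < 1" using \<gamma>_pos \<delta>_pos by (simp add: et_def eta_def)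
  show "et\<^sup>2 < 1" using * \<open>0 < et\<close> by (simp add: power_less_one_iff)
qed

lemma sg_pos: "0 < sg" and sg_sq: "sg\<^sup>2 = 1 - et\<^sup>2"
  using et_bounds by (auto simp: sg_def)

lemma \<delta>\<gamma>: "\<delta> * \<gamma> \<le> m / \<gamma>\<^sup>2 / 33"
proof -
  have "\<delta> * \<gamma> \<le> m / (33 * \<gamma>^3) * \<gamma>" using \<delta>_le \<gamma>_pos by (intro mult_right_mono) auto
  then show ?thesis using \<gamma>_pos by (simp add: power2_eq_square power3_eq_cube field_simps)
qed

text \<open>This is the only form in which the smallness of the time step enters the error bounds.\<close>

lemma \<delta>_sqrt_L: "\<delta> * sqrt L \<le> 1 / 264" and \<delta>_sqrt_m: "\<delta> * L \<le> sqrt m / 264"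
proof -
  have "8 * (sqrt L)^3 \<le> \<gamma>^3" using power_mono[OF \<gamma>_ge, of 3] L_pos by (simp add: power_mult_distrib)
  then have "m / (33 * \<gamma>^3) \<le> m / (33 * (8 * (sqrt L)^3))"
    using L_pos m_pos by (intro divide_left_mono mult_left_mono mult_pos_pos) (auto intro: \<gamma>_pos)
  with \<delta>_le have d: "\<delta> \<le> m / (264 * (sqrt L)^3)" by simp
  have sL: "sqrt L > 0" "sqrt L * sqrt L = L" using L_pos by auto
  have e: "(sqrt L)^3 = L * sqrt L" using sL by (simp add: power3_eq_cube)
  have "\<delta> * sqrt L \<le> m / (264 * (L * sqrt L)) * sqrt L" using d sL unfolding e by (intro mult_right_mono) auto
  also have "\<dots> = m / L / 264" using sL L_pos by (simp add: field_simps)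
  also have "\<dots> \<le> 1 / 264" using m_le_L L_pos by (simp add: divide_le_eq)
  finally show "\<delta> * sqrt L \<le> 1 / 264" .
  have "\<delta> * L \<le> m / (264 * (L * sqrt L)) * L" using d L_pos unfolding e by (intro mult_right_mono) auto
  also have "\<dots> = m / sqrt L / 264" using sL L_pos by (simp add: field_simps)
  also have "\<dots> \<le> m / sqrt m / 264" using m_le_L m_pos by (intro divide_right_mono divide_left_mono) auto
  also have "m / sqrt m = sqrt m" using m_pos real_div_sqrt by simp
  finally show "\<delta> * L \<le> sqrt m / 264" .
qed

lemma \<delta>\<kappa>: "0 < \<delta> * \<kappa>" "\<delta> * \<kappa> < 1/100"
proof -
  show "0 < \<delta> * \<kappa>" using \<delta>_pos \<gamma>_pos m_pos by (simp add: \<kappa>_def)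
  have a4: "m / \<gamma>\<^sup>2 \<le> 1/4" "0 < m / \<gamma>\<^sup>2" using \<gamma>_sq m_le_L m_pos \<gamma>_pos by (auto simp: divide_le_eq)
  have d: "\<delta> * \<gamma> \<le> 1/4/33" using \<delta>\<gamma> a4 by argo
  have "\<delta> * \<kappa> = \<delta> * \<gamma> * (m / \<gamma>\<^sup>2) / 3" using \<gamma>_pos by (simp add: \<kappa>_def power2_eq_square)
  also have "\<dots> \<le> (1/4/33) * (1/4) / 3" using d a4 by (intro divide_right_mono mult_mono) auto
  finally show "\<delta> * \<kappa> < 1/100" by simp
qed

section \<open>The twisted norm and its comparison with the Euclidean norm\<close>

lemma linear_twist: "linear twist"
  by (rule linearI) (auto simp: twist_def algebra_simps)

lemma M_triangle: "M (z + w) \<le> M z + M w"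
  unfolding M_def linear_add[OF linear_twist] by (rule norm_triangle_ineq)

lemma M_sq: "(M z)\<^sup>2 = (norm (fst z))\<^sup>2 + 2 / \<gamma> * (fst z \<bullet> snd z) + (norm (snd z))\<^sup>2 / L"
proof -
  have n: "0 \<le> 1 / L - 1 / \<gamma>\<^sup>2"
    using \<gamma>_sq L_pos by (simp add: frac_le)
  have "(M z)\<^sup>2 = (norm (fst z + (1 / \<gamma>) *\<^sub>R snd z))\<^sup>2 + (1 / L - 1 / \<gamma>\<^sup>2) * (norm (snd z))\<^sup>2"
    using n by (simp add: M_def twist_def norm_Pair power_mult_distrib)
  also have "(norm (fst z + (1 / \<gamma>) *\<^sub>R snd z))\<^sup>2
      = (norm (fst z))\<^sup>2 + 2 / \<gamma> * (fst z \<bullet> snd z) + (norm (snd z))\<^sup>2 / \<gamma>\<^sup>2"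
    by (simp only: power2_norm_eq_inner inner_add_left inner_add_right inner_scaleR_left inner_scaleR_right)
       (simp add: inner_commute power2_eq_square add_divide_distrib)
  finally show ?thesis by (simp add: algebra_simps)
qed

lemma M_nonneg: "0 \<le> M z" by (simp add: M_def)

text \<open>Because \<gamma> \<ge> 2 sqrt L, the cross term is at most |x| |v| / sqrt L, hence at
  most half of the diagonal part.\<close>

lemma M_equiv:
  shows "(M z)\<^sup>2 \<le> 3/2 * ((norm (fst z))\<^sup>2 + (norm (snd z))\<^sup>2 / L)"
    and "((norm (fst z))\<^sup>2 + (norm (snd z))\<^sup>2 / L) / 2 \<le> (M z)\<^sup>2"
proof -
  let ?x = "norm (fst z)" and ?v = "norm (snd z) / sqrt L"
  have "\<bar>2 / \<gamma> * (fst z \<bullet> snd z)\<bar> \<le> 2 / \<gamma> * (?x * norm (snd z))"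
    using \<gamma>_pos mult_left_mono[OF Cauchy_Schwarz_ineq2[of "fst z" "snd z"], of "2 / \<gamma>"] by (simp add: abs_mult)
  also have "\<dots> \<le> 2 / (2 * sqrt L) * (?x * norm (snd z))"
    using \<gamma>_ge L_pos by (intro mult_right_mono divide_left_mono) (auto simp: \<gamma>_pos)
  also have "\<dots> = ?x * ?v" by simp
  also have "\<dots> \<le> (?x\<^sup>2 + ?v\<^sup>2) / 2" using sum_squares_bound[of ?x ?v] by argo
  also have "?v\<^sup>2 = (norm (snd z))\<^sup>2 / L" using L_pos by (simp add: power_divide)
  finally have "\<bar>2 / \<gamma> * (fst z \<bullet> snd z)\<bar> \<le> (?x\<^sup>2 + (norm (snd z))\<^sup>2 / L) / 2" .
  then show "(M z)\<^sup>2 \<le> 3/2 * (?x\<^sup>2 + (norm (snd z))\<^sup>2 / L)"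
    and "(?x\<^sup>2 + (norm (snd z))\<^sup>2 / L) / 2 \<le> (M z)\<^sup>2"
    unfolding M_sq by argo+
qed

lemma norm_fst_le_M: "norm (fst z) \<le> sqrt 2 * M z"
proof -
  have "(norm (fst z))\<^sup>2 \<le> (sqrt 2 * M z)\<^sup>2"
  proof -
    have "0 \<le> (norm (snd z))\<^sup>2 / L" using L_pos by simp
    then show ?thesis using M_equiv(2)[of z] by (simp add: power_mult_distrib)
  qed
  then show ?thesis by (rule power2_le_imp_le) (simp add: M_nonneg)
qed

lemma norm_snd_le_M: "norm (snd z) \<le> sqrt 2 * sqrt L * M z"
proof -
  have "(norm (snd z))\<^sup>2 / L \<le> 2 * (M z)\<^sup>2"
    using M_equiv(2)[of z] zero_le_power2[of "norm (fst z)"] by argo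
  then have "(norm (snd z))\<^sup>2 \<le> (sqrt 2 * sqrt L * M z)\<^sup>2"
    using L_pos by (simp add: power_mult_distrib divide_le_eq mult.commute mult.left_commute)
  then show ?thesis by (rule power2_le_imp_le) (simp add: M_nonneg L_pos less_imp_le)
qed

lemma norm_le_M: "norm z \<le> sqrt 2 * max 1 (sqrt L) * M z"
proof -
  let ?K = "max 1 (sqrt L)"
  have K: "1 \<le> ?K" "?K\<^sup>2 \<ge> 1" "?K\<^sup>2 \<ge> L"
    using L_pos power_mono[of "sqrt L" ?K 2] by (auto simp: one_le_power)
  have "(norm z)\<^sup>2 = (norm (fst z))\<^sup>2 + (norm (snd z))\<^sup>2"
    by (metis norm_Pair prod.collapse real_sqrt_pow2 sum_power2_ge_zero)
  also have "\<dots> \<le> ?K\<^sup>2 * (norm (fst z))\<^sup>2 + ?K\<^sup>2 * ((norm (snd z))\<^sup>2 / L)"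
  proof (rule add_mono)
    show "(norm (fst z))\<^sup>2 \<le> ?K\<^sup>2 * (norm (fst z))\<^sup>2" using K by (simp add: mult_le_cancel_right1)
    have "L * ((norm (snd z))\<^sup>2 / L) \<le> ?K\<^sup>2 * ((norm (snd z))\<^sup>2 / L)"
      using K L_pos by (intro mult_right_mono) auto
    then show "(norm (snd z))\<^sup>2 \<le> ?K\<^sup>2 * ((norm (snd z))\<^sup>2 / L)" using L_pos by simp
  qed
  also have "\<dots> = ?K\<^sup>2 * ((norm (fst z))\<^sup>2 + (norm (snd z))\<^sup>2 / L)" by (simp add: algebra_simps)
  also have "\<dots> \<le> ?K\<^sup>2 * (2 * (M z)\<^sup>2)" using M_equiv(2)[of z] by (intro mult_left_mono) auto
  also have "\<dots> = (sqrt 2 * ?K * M z)\<^sup>2" by (simp add: power_mult_distrib)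
  finally show ?thesis by (rule power2_le_imp_le) (simp add: M_nonneg)
qed

text \<open>A last O-step with common noise only damps the velocity difference, so an error
  committed before it is seen by \<open>M\<close> through the upper equivalence constant. This is
  the origin of the factor sqrt (3/2) in all later error bounds.\<close>

lemma M_ostep_diff:
  "M (ostep z \<xi> - ostep w \<xi>) \<le> sqrt (3/2) * sqrt ((norm (fst z - fst w))\<^sup>2 + (norm (snd z - snd w))\<^sup>2 / L)"
proof -
  have "(M (ostep z \<xi> - ostep w \<xi>))\<^sup>2
     \<le> 3/2 * ((norm (fst z - fst w))\<^sup>2 + (norm (et *\<^sub>R (snd z - snd w)))\<^sup>2 / L)"
    using M_equiv(1)[of "ostep z \<xi> - ostep w \<xi>"] by (simp add: ostep_def algebra_simps)
  also have "\<dots> \<le> 3/2 * ((norm (fst z - fst w))\<^sup>2 + (norm (snd z - snd w))\<^sup>2 / L)"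
  proof -
    have "(norm (et *\<^sub>R (snd z - snd w)))\<^sup>2 \<le> 1 * (norm (snd z - snd w))\<^sup>2"
      unfolding norm_scaleR power_mult_distrib power2_abs using et_bounds by (intro mult_right_mono) auto
    then show ?thesis using L_pos by (intro mult_left_mono add_left_mono divide_right_mono) auto
  qed
  finally show ?thesis
    unfolding real_sqrt_mult[symmetric] by (rule real_le_rsqrt)
qed

text \<open>The common noise cancels in the difference. Velocities are measured in units of \<gamma>
  and gradient differences in units of \<gamma>^2; \<open>y\<close> is the velocity difference after
  the first O-step. Cocoercivity and strong monotonicity, before and after the drift, are the
  hypotheses of \<open>contraction_scaled\<close>; dividing by \<open>et\<close> undoes the first
  O-step on its right-hand side.\<close>

lemma step_contraction: "M (step z \<xi> - step w \<xi>) \<le> (1 - \<delta> * \<kappa>) * M (z - w)"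
proof -
  define x where "x = fst z - fst w"
  define y where "y = (et / \<gamma>) *\<^sub>R (snd z - snd w)"
  define z1 where "z1 = ostep z (fst \<xi>)"
  define w1 where "w1 = ostep w (fst \<xi>)"
  define G0 where "G0 = (1 / \<gamma>\<^sup>2) *\<^sub>R (g (fst z) - g (fst w))"
  define X where "X = fst (verlet z1)"
  define Y where "Y = fst (verlet w1)"
  define G1 where "G1 = (1 / \<gamma>\<^sup>2) *\<^sub>R (g X - g Y)"
  define x1 where "x1 = X - Y"
  define u where "u = y - (\<delta> * \<gamma> / 2) *\<^sub>R (G0 + G1)"
  let ?t = "\<delta> * \<gamma>" and ?k = "\<gamma>\<^sup>2 / L" and ?a = "m / \<gamma>\<^sup>2"
  have \<gamma>0: "\<gamma> \<noteq> 0" using \<gamma>_pos by simp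
  have coc: "?k * (((1 / \<gamma>\<^sup>2) *\<^sub>R (g p - g q)) \<bullet> ((1 / \<gamma>\<^sup>2) *\<^sub>R (g p - g q))) \<le> (p - q) \<bullet> ((1 / \<gamma>\<^sup>2) *\<^sub>R (g p - g q))"
    for p q
  proof -
    have "?k * (((1 / \<gamma>\<^sup>2) *\<^sub>R (g p - g q)) \<bullet> ((1 / \<gamma>\<^sup>2) *\<^sub>R (g p - g q))) = (norm (g p - g q))\<^sup>2 / L / \<gamma>\<^sup>2"
      using \<gamma>0 by (simp only: inner_scaleR_left inner_scaleR_right power2_norm_eq_inner)
        (simp add: power2_eq_square)
    also have "\<dots> \<le> ((p - q) \<bullet> (g p - g q)) / \<gamma>\<^sup>2"
      using cocoercive[of p q] L_pos by (intro divide_right_mono) (auto simp: divide_le_eq mult.commute)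
    finally show ?thesis by simp
  qed
  have mon: "?a * ((p - q) \<bullet> (p - q)) \<le> (p - q) \<bullet> ((1 / \<gamma>\<^sup>2) *\<^sub>R (g p - g q))" for p q
    using divide_right_mono[OF g_mono[of p q], of "\<gamma>\<^sup>2"] by (simp add: power2_norm_eq_inner)
  have x1: "x1 = x + ?t *\<^sub>R y - (?t\<^sup>2 / 2) *\<^sub>R G0"
    using \<gamma>0 unfolding x1_def X_def Y_def z1_def w1_def G0_def x_def y_def
    by (simp add: verlet_def ostep_def Let_def algebra_simps power_mult_distrib)
  have "x1 \<bullet> x1 + 2 * et * (x1 \<bullet> u) + et\<^sup>2 * ?k * (u \<bullet> u)
     \<le> (1 - ?t * ?a / 3)\<^sup>2 * (x \<bullet> x + 2 / et * (x \<bullet> y) + ?k / et\<^sup>2 * (y \<bullet> y))"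
  proof (rule contraction_scaled[OF _ _ _ _ _ _ _ x1 _ _ u_def])
    show "0 < ?t" using \<delta>_pos \<gamma>_pos by simp
    show "?t \<le> ?a / 33" by (rule \<delta>\<gamma>)
    show "4 \<le> ?k" using \<gamma>_sq L_pos by (simp add: le_divide_eq)
    show "?a * ?k \<le> 1" using m_le_L L_pos \<gamma>0 by (simp add: divide_le_eq)
    show "et = exp (- ?t / 2)" by (simp add: et_def eta_def)
    show "?k * (G0 \<bullet> G0) \<le> x \<bullet> G0" "?a * (x \<bullet> x) \<le> x \<bullet> G0"
      unfolding G0_def x_def by (rule coc mon)+
    show "?k * (G1 \<bullet> G1) \<le> x1 \<bullet> G1" "?a * (x1 \<bullet> x1) \<le> x1 \<bullet> G1"
      unfolding G1_def x1_def by (rule coc mon)+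
  qed
  moreover have "x1 \<bullet> x1 + 2 * et * (x1 \<bullet> u) + et\<^sup>2 * ?k * (u \<bullet> u) = (M (step z \<xi> - step w \<xi>))\<^sup>2"
  proof -
    have "fst (step z \<xi> - step w \<xi>) = x1"
      by (simp add: step_def ostep_def x1_def X_def Y_def z1_def w1_def)
    moreover have "snd (step z \<xi> - step w \<xi>) = (\<gamma> * et) *\<^sub>R u"
    proof -
      have "snd (verlet z1) - snd (verlet w1) = \<gamma> *\<^sub>R u"
        using \<gamma>0 unfolding u_def G1_def X_def Y_def G0_def y_def z1_def w1_def
        by (simp add: verlet_def ostep_def Let_def algebra_simps power2_eq_square)
      then show ?thesis
        by (simp add: step_def ostep_def z1_def[unfolded ostep_def, symmetric] w1_def[unfolded ostep_def, symmetric]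
            scaleR_diff_right[symmetric] mult.commute)
    qed
    ultimately show ?thesis
      unfolding M_sq using \<gamma>0 by (simp add: power2_norm_eq_inner[symmetric] power_mult_distrib)
  qed
  moreover have "x \<bullet> x + 2 / et * (x \<bullet> y) + ?k / et\<^sup>2 * (y \<bullet> y) = (M (z - w))\<^sup>2"
    unfolding M_sq y_def x_def using \<gamma>0 et_bounds
    by (simp add: power2_norm_eq_inner[symmetric] power_mult_distrib power_divide)
  moreover have "?t * ?a / 3 = \<delta> * \<kappa>"
    using \<gamma>0 by (simp add: \<kappa>_def power2_eq_square)
  ultimately have "(M (step z \<xi> - step w \<xi>))\<^sup>2 \<le> ((1 - \<delta> * \<kappa>) * M (z - w))\<^sup>2"
    by (simp add: power_mult_distrib)
  then show ?thesis
    by (rule power2_le_imp_le) (use \<delta>\<kappa> M_nonneg in auto)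
qed

end

section \<open>Volume-preserving maps\<close>

text \<open>Encoded as invariance of Lebesgue measure under push-forward, so that Fubini and
  translation invariance apply directly to shears, and everything else is a composition or a limit
  of shears.\<close>

definition vol_pres :: "('a::euclidean_space \<Rightarrow> 'a) \<Rightarrow> bool" where
  "vol_pres T \<longleftrightarrow> T \<in> borel_measurable borel \<and> distr lborel borel T = lborel"

lemma vol_pres_measurable: "vol_pres T \<Longrightarrow> T \<in> borel_measurable borel"
  by (simp add: vol_pres_def)

lemma vol_pres_compose:
  assumes "vol_pres S" "vol_pres T"
  shows "vol_pres (\<lambda>x. S (T x))"
proof -
  have [measurable]: "S \<in> borel_measurable borel" "T \<in> borel_measurable borel"
    using assms by (auto simp: vol_pres_def)
  have "distr lborel borel (\<lambda>x. S (T x)) = distr (distr lborel borel T) borel S"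
    by (subst distr_distr) (auto simp: o_def)
  then show ?thesis using assms by (simp add: vol_pres_def)
qed

lemma nn_integral_vol_pres:
  assumes "vol_pres T" and [measurable]: "f \<in> borel_measurable borel"
  shows "(\<integral>\<^sup>+x. f (T x) \<partial>lborel) = (\<integral>\<^sup>+x. f x \<partial>lborel)"
proof -
  have [measurable]: "T \<in> borel_measurable borel" using assms by (simp add: vol_pres_def)
  have "(\<integral>\<^sup>+x. f x \<partial>lborel) = (\<integral>\<^sup>+x. f x \<partial>distr lborel borel T)"
    using assms by (simp add: vol_pres_def)
  also have "\<dots> = (\<integral>\<^sup>+x. f (T x) \<partial>lborel)" by (rule nn_integral_distr) auto
  finally show ?thesis by simp
qed

lemma vol_presI:
  assumes [measurable]: "T \<in> borel_measurable borel"
    and "\<And>f. f \<in> borel_measurable borel \<Longrightarrow> (\<integral>\<^sup>+x. f (T x) \<partial>lborel) = (\<integral>\<^sup>+x. f x \<partial>lborel)"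
  shows "vol_pres T"
  unfolding vol_pres_def
proof (intro conjI measure_eqI)
  fix A assume "A \<in> sets (distr lborel borel T)"
  then have [measurable]: "A \<in> sets borel" by simp
  have "emeasure (distr lborel borel T) A = (\<integral>\<^sup>+x. indicator A x \<partial>distr lborel borel T)"
    by (rule nn_integral_indicator[symmetric]) simp
  also have "\<dots> = (\<integral>\<^sup>+x. indicator A (T x) \<partial>lborel)" by (rule nn_integral_distr) auto
  also have "\<dots> = (\<integral>\<^sup>+x. indicator A x \<partial>lborel)" by (rule assms(2)) simp
  also have "\<dots> = emeasure lborel A" by simp
  finally show "emeasure (distr lborel borel T) A = emeasure lborel A" .
qed auto

lemma nn_integral_lborel_translation:
  fixes f :: "'a::euclidean_space \<Rightarrow> ennreal"
  assumes [measurable]: "f \<in> borel_measurable borel"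
  shows "(\<integral>\<^sup>+x. f (x + c) \<partial>lborel) = (\<integral>\<^sup>+x. f x \<partial>lborel)"
proof -
  have "(\<integral>\<^sup>+x. f x \<partial>lborel) = (\<integral>\<^sup>+x. f x \<partial>distr lborel borel ((+) c))"
    by (simp add: lborel_distr_plus)
  also have "\<dots> = (\<integral>\<^sup>+x. f (c + x) \<partial>lborel)" by (rule nn_integral_distr) auto
  finally show ?thesis by (simp add: add.commute)
qed

lemma nn_integral_lborel_pair:
  fixes f :: "'a::euclidean_space \<times> 'b::euclidean_space \<Rightarrow> ennreal"
  assumes [measurable]: "f \<in> borel_measurable borel"
  shows "(\<integral>\<^sup>+z. f z \<partial>lborel) = (\<integral>\<^sup>+x. \<integral>\<^sup>+y. f (x, y) \<partial>lborel \<partial>lborel)"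
    and "(\<integral>\<^sup>+z. f z \<partial>lborel) = (\<integral>\<^sup>+y. \<integral>\<^sup>+x. f (x, y) \<partial>lborel \<partial>lborel)"
proof -
  have [measurable]: "f \<in> borel_measurable (lborel \<Otimes>\<^sub>M lborel)"
    using assms by (simp add: lborel_prod)
  show "(\<integral>\<^sup>+z. f z \<partial>lborel) = (\<integral>\<^sup>+x. \<integral>\<^sup>+y. f (x, y) \<partial>lborel \<partial>lborel)"
    by (subst lborel.nn_integral_fst) (auto simp: lborel_prod)
  show "(\<integral>\<^sup>+z. f z \<partial>lborel) = (\<integral>\<^sup>+y. \<integral>\<^sup>+x. f (x, y) \<partial>lborel \<partial>lborel)"
    by (subst lborel_pair.nn_integral_snd) (auto simp: lborel_prod)
qed

text \<open>On each fibre of the first coordinate a shear is a translation, so Fubini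
  suffices.\<close>

lemma vol_pres_shear_snd:
  fixes h :: "'a::euclidean_space \<Rightarrow> 'b::euclidean_space"
  assumes [measurable]: "h \<in> borel_measurable borel"
  shows "vol_pres (\<lambda>z. (fst z, snd z + h (fst z)))"
proof (rule vol_presI)
  show m[measurable]: "(\<lambda>z::'a \<times> 'b. (fst z, snd z + h (fst z))) \<in> borel_measurable borel"
    by (simp add: borel_prod[symmetric])
  fix f :: "'a \<times> 'b \<Rightarrow> ennreal" assume f[measurable]: "f \<in> borel_measurable borel"
  then have f'[measurable]: "f \<in> borel_measurable (borel \<Otimes>\<^sub>M borel)" by (simp add: borel_prod)
  show "(\<integral>\<^sup>+z. f (fst z, snd z + h (fst z)) \<partial>lborel) = (\<integral>\<^sup>+z. f z \<partial>lborel)"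
    by (subst (1 2) nn_integral_lborel_pair(1))
       (auto intro!: nn_integral_cong nn_integral_lborel_translation)
qed

lemma vol_pres_shear_fst:
  fixes h :: "'b::euclidean_space \<Rightarrow> 'a::euclidean_space"
  assumes [measurable]: "h \<in> borel_measurable borel"
  shows "vol_pres (\<lambda>z. (fst z + h (snd z), snd z))"
proof (rule vol_presI)
  show m[measurable]: "(\<lambda>z::'a \<times> 'b. (fst z + h (snd z), snd z)) \<in> borel_measurable borel"
    by (simp add: borel_prod[symmetric])
  fix f :: "'a \<times> 'b \<Rightarrow> ennreal" assume f[measurable]: "f \<in> borel_measurable borel"
  then have f'[measurable]: "f \<in> borel_measurable (borel \<Otimes>\<^sub>M borel)" by (simp add: borel_prod)
  show "(\<integral>\<^sup>+z. f (fst z + h (snd z), snd z) \<partial>lborel) = (\<integral>\<^sup>+z. f z \<partial>lborel)"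
    by (subst (1 2) nn_integral_lborel_pair(2))
       (auto intro!: nn_integral_cong nn_integral_lborel_translation)
qed

text \<open>A plane rotation is a product of three shears.\<close>

lemma vol_pres_rotation:
  fixes c s :: real
  assumes "c\<^sup>2 + s\<^sup>2 = 1" "s \<noteq> 0"
  shows "vol_pres (\<lambda>z::'a::euclidean_space \<times> 'a. (c *\<^sub>R fst z + s *\<^sub>R snd z, c *\<^sub>R snd z - s *\<^sub>R fst z))"
proof -
  \<comment> \<open>The tangent of half the rotation angle.\<close>
  let ?t = "(1 - c) / s"
  let ?A = "\<lambda>z::'a \<times> 'a. (fst z + ?t *\<^sub>R snd z, snd z)"
  let ?B = "\<lambda>z::'a \<times> 'a. (fst z, snd z + (- s) *\<^sub>R fst z)"
  have A: "vol_pres ?A" and B: "vol_pres ?B"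
    by (intro vol_pres_shear_fst vol_pres_shear_snd; simp)+
  have st: "s * ?t = 1 - c" using assms by simp
  have t2: "?t + c * ?t = s"
  proof -
    have "?t + c * ?t = (1 - c\<^sup>2) / s" by (simp add: power2_eq_square algebra_simps add_divide_distrib diff_divide_distrib)
    also have "\<dots> = s" using assms by (simp add: power2_eq_square field_simps)
    finally show ?thesis .
  qed
  have "?A (?B (?A z)) = (c *\<^sub>R fst z + s *\<^sub>R snd z, c *\<^sub>R snd z - s *\<^sub>R fst z)" for z
  proof -
    have 1: "snd (?B (?A z)) = c *\<^sub>R snd z - s *\<^sub>R fst z"
      using st by (simp add: scaleR_right_distrib scaleR_left_diff_distrib)
    have "fst (?A (?B (?A z))) = (fst z + ?t *\<^sub>R snd z) + ?t *\<^sub>R (c *\<^sub>R snd z - s *\<^sub>R fst z)"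
      using 1 by simp
    also have "\<dots> = (1 - s * ?t) *\<^sub>R fst z + (?t + c * ?t) *\<^sub>R snd z"
      by (simp add: algebra_simps)
    also have "\<dots> = c *\<^sub>R fst z + s *\<^sub>R snd z" unfolding st t2 by simp
    finally show ?thesis using 1 by simp
  qed
  then have "(\<lambda>z. ?A (?B (?A z))) = (\<lambda>z. (c *\<^sub>R fst z + s *\<^sub>R snd z, c *\<^sub>R snd z - s *\<^sub>R fst z))"
    by (rule ext)
  then show ?thesis
    using vol_pres_compose[OF A vol_pres_compose[OF B A]] by argo
qed

context obabo begin

lemma g_measurable[measurable]: "g \<in> borel_measurable borel"
  by (rule borel_measurable_continuous_onI[OF g_cont])

text \<open>Half kick, drift, half kick: three shears.\<close>

lemma vol_pres_verlet: "vol_pres verlet"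
proof -
  let ?B = "\<lambda>z::'a \<times> 'a. (fst z, snd z + (- (\<delta> / 2)) *\<^sub>R g (fst z))"
  let ?A = "\<lambda>z::'a \<times> 'a. (fst z + \<delta> *\<^sub>R snd z, snd z)"
  have B: "vol_pres ?B" by (rule vol_pres_shear_snd) simp
  have A: "vol_pres ?A" by (rule vol_pres_shear_fst) simp
  have "verlet = (\<lambda>z. ?B (?A (?B z)))"
    by (rule ext) (simp add: verlet_def Let_def algebra_simps power2_eq_square)
  then show ?thesis using vol_pres_compose[OF B vol_pres_compose[OF A B]] by simp
qed

end

section \<open>Moments of log-concave measures\<close>

text \<open>Polynomial growth is the only property of integrands that is tracked; with the quadratic
  growth of the energy it yields integrability through closure rules.\<close>

definition poly_bdd :: "('a::real_normed_vector \<Rightarrow> real) \<Rightarrow> bool" where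
  "poly_bdd f \<longleftrightarrow> (\<exists>C k. \<forall>z. \<bar>f z\<bar> \<le> C * (1 + norm z) ^ k)"

lemma poly_bddE:
  assumes "poly_bdd f"
  obtains C k where "0 \<le> C" "\<And>z. \<bar>f z\<bar> \<le> C * (1 + norm z) ^ k"
proof -
  obtain C k where *: "\<And>z. \<bar>f z\<bar> \<le> C * (1 + norm z) ^ k"
    using assms unfolding poly_bdd_def by blast
  have "0 \<le> C" using *[of 0] by simp
  then show ?thesis using * that by blast
qed

lemma poly_bdd_mono:
  assumes "poly_bdd f" "\<And>z. \<bar>h z\<bar> \<le> \<bar>f z\<bar>"
  shows "poly_bdd h"
  using assms unfolding poly_bdd_def by (meson order_trans)

lemma poly_bdd_const: "poly_bdd (\<lambda>_. c)"
  unfolding poly_bdd_def by (intro exI[of _ "\<bar>c\<bar>"] exI[of _ 0]) simp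

lemma poly_bdd_norm: "poly_bdd norm"
  unfolding poly_bdd_def by (intro exI[of _ 1] exI[of _ 1]) simp

lemma poly_bdd_add:
  assumes "poly_bdd f" "poly_bdd h" shows "poly_bdd (\<lambda>z. f z + h z)"
proof -
  obtain C k where f: "0 \<le> C" "\<And>z. \<bar>f z\<bar> \<le> C * (1 + norm z) ^ k" using poly_bddE[OF assms(1)] by metis
  obtain D l where h: "0 \<le> D" "\<And>z. \<bar>h z\<bar> \<le> D * (1 + norm z) ^ l" using poly_bddE[OF assms(2)] by metis
  have "\<bar>f z + h z\<bar> \<le> (C + D) * (1 + norm z) ^ (max k l)" for z
  proof -
    have "C * (1 + norm z) ^ k \<le> C * (1 + norm z) ^ (max k l)" "D * (1 + norm z) ^ l \<le> D * (1 + norm z) ^ (max k l)"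
      using f h by (auto intro!: mult_left_mono power_increasing)
    then show ?thesis using f(2)[of z] h(2)[of z] by (simp add: distrib_right)
  qed
  then show ?thesis unfolding poly_bdd_def by blast
qed

lemma poly_bdd_mult:
  assumes "poly_bdd f" "poly_bdd h" shows "poly_bdd (\<lambda>z. f z * h z)"
proof -
  obtain C k where f: "0 \<le> C" "\<And>z. \<bar>f z\<bar> \<le> C * (1 + norm z) ^ k" using poly_bddE[OF assms(1)] by metis
  obtain D l where h: "0 \<le> D" "\<And>z. \<bar>h z\<bar> \<le> D * (1 + norm z) ^ l" using poly_bddE[OF assms(2)] by metis
  have "\<bar>f z * h z\<bar> \<le> (C * D) * (1 + norm z) ^ (k + l)" for z
  proof -
    have "\<bar>f z\<bar> * \<bar>h z\<bar> \<le> (C * (1 + norm z) ^ k) * (D * (1 + norm z) ^ l)"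
      using f h by (intro mult_mono) auto
    then show ?thesis by (simp add: abs_mult power_add mult_ac)
  qed
  then show ?thesis unfolding poly_bdd_def by blast
qed

lemma poly_bdd_power: "poly_bdd f \<Longrightarrow> poly_bdd (\<lambda>z. f z ^ n)"
  by (induction n) (auto intro: poly_bdd_const poly_bdd_mult)

lemma poly_bdd_powr:
  assumes "poly_bdd f" "0 \<le> s" shows "poly_bdd (\<lambda>z. \<bar>f z\<bar> powr s)"
proof -
  obtain n :: nat where n: "s \<le> real n" using real_arch_simple by blast
  have "poly_bdd (\<lambda>z. (1 + \<bar>f z\<bar>) ^ n)"
    by (intro poly_bdd_power poly_bdd_add poly_bdd_const) (rule poly_bdd_mono[OF assms(1)], simp)
  then show ?thesis
  proof (rule poly_bdd_mono)
    fix z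
    have "\<bar>f z\<bar> powr s \<le> (1 + \<bar>f z\<bar>) powr s" using assms by (intro powr_mono2) auto
    also have "\<dots> \<le> (1 + \<bar>f z\<bar>) powr real n" using n by (intro powr_mono) auto
    also have "\<dots> = (1 + \<bar>f z\<bar>) ^ n" by (rule powr_realpow) (simp add: add_pos_nonneg)
    finally show "\<bar>\<bar>f z\<bar> powr s\<bar> \<le> \<bar>(1 + \<bar>f z\<bar>) ^ n\<bar>" by simp
  qed
qed

lemma poly_bdd_minus: "poly_bdd f \<Longrightarrow> poly_bdd (\<lambda>z. - f z)"
  by (erule poly_bdd_mono) simp

lemma poly_bdd_inner:
  fixes f h :: "'a::real_normed_vector \<Rightarrow> 'b::real_inner"
  assumes "poly_bdd (\<lambda>z. norm (f z))" "poly_bdd (\<lambda>z. norm (h z))" shows "poly_bdd (\<lambda>z. f z \<bullet> h z)"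
  by (rule poly_bdd_mono[OF poly_bdd_mult[OF assms]]) (simp add: Cauchy_Schwarz_ineq2)

lemma exp_neg_sq_integrable:
  fixes c :: real assumes "0 < c"
  shows "integrable lborel (\<lambda>z::'a::euclidean_space. exp (- c * (norm z)\<^sup>2))"
proof (rule integrableI_nonneg)
  have 1: "(\<integral>\<^sup>+x. ennreal (exp (- c * x\<^sup>2)) \<partial>lborel) < \<infinity>"
  proof -
    let ?\<sigma> = "sqrt (1 / (2 * c))"
    have "integrable lborel (\<lambda>x. normal_density 0 ?\<sigma> x * (x - 0)^0 * sqrt (2 * pi * ?\<sigma>\<^sup>2))"
      using integrable_normal_moment[of ?\<sigma> 0 0] assms by (intro integrable_mult_left) auto
    moreover have "normal_density 0 ?\<sigma> x * (x - 0)^0 * sqrt (2 * pi * ?\<sigma>\<^sup>2) = exp (- c * x\<^sup>2)" for x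
      using assms by (simp add: normal_density_def)
    ultimately have "integrable lborel (\<lambda>x. exp (- c * x\<^sup>2))" by (simp only:)
    then show ?thesis by (simp add: real_integrable_def less_top)
  qed
  have "(\<integral>\<^sup>+z. ennreal (exp (- c * (norm (z::'a))\<^sup>2)) \<partial>lborel)
      = (\<integral>\<^sup>+z. (\<Prod>b\<in>Basis. ennreal (exp (- c * ((z::'a) \<bullet> b)\<^sup>2))) \<partial>lborel)"
  proof (intro nn_integral_cong)
    fix z :: 'a
    have "(norm z)\<^sup>2 = (\<Sum>b\<in>Basis. (z \<bullet> b)\<^sup>2)"
      unfolding power2_norm_eq_inner euclidean_inner[of z z] by (simp add: power2_eq_square)
    then have "exp (- c * (norm z)\<^sup>2) = (\<Prod>b\<in>Basis. exp (- c * (z \<bullet> b)\<^sup>2))"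
      by (simp add: sum_distrib_left exp_sum[symmetric] sum_negf)
    then show "ennreal (exp (- c * (norm z)\<^sup>2)) = (\<Prod>b\<in>Basis. ennreal (exp (- c * (z \<bullet> b)\<^sup>2)))"
      by (simp add: prod_ennreal)
  qed
  also have "\<dots> = (\<Prod>b\<in>(Basis::'a set). \<integral>\<^sup>+x. ennreal (exp (- c * x\<^sup>2)) \<partial>lborel)"
    by (rule nn_integral_lborel_prod) auto
  also have "\<dots> < \<infinity>" using 1 by (simp add: power_less_top_ennreal)
  finally show "(\<integral>\<^sup>+z. ennreal (exp (- c * (norm (z::'a))\<^sup>2)) \<partial>lborel) < \<infinity>" .
qed auto

lemma power_le_exp:
  fixes x :: real assumes "0 \<le> x" shows "x ^ n \<le> real n ^ n * exp x"
proof (cases "n = 0")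
  case False
  have "x / n \<le> exp (x / n)" using exp_ge_add_one_self[of "x / n"] by linarith
  then have "(x / n) ^ n \<le> exp (x / n) ^ n" using assms by (intro power_mono) auto
  also have "\<dots> = exp x" using False by (simp add: exp_of_nat_mult[symmetric])
  finally show ?thesis using False by (simp add: power_divide divide_le_eq mult.commute)
qed (use assms in simp)

text \<open>A power of 1 + |z| is dominated by a multiple of exp (1 + |z|), and half of the
  quadratic lower bound of \<open>H\<close> absorbs the linear exponent, leaving a Gaussian.\<close>

lemma poly_exp_integrable:
  fixes f H :: "'a::euclidean_space \<Rightarrow> real"
  assumes "poly_bdd f" and [measurable]: "f \<in> borel_measurable borel" "H \<in> borel_measurable borel"
    and c: "0 < c" and H: "\<And>z. c * (norm z)\<^sup>2 - C \<le> H z"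
  shows "integrable lborel (\<lambda>z. f z * exp (- H z))"
proof -
  obtain A k where f: "0 \<le> A" "\<And>z. \<bar>f z\<bar> \<le> A * (1 + norm z) ^ k" using poly_bddE[OF assms(1)] by metis
  let ?B = "A * (real k ^ k * exp (1 + 1 / (2 * c) + C))"
  have "integrable lborel (\<lambda>z::'a. ?B * exp (- (c / 2) * (norm z)\<^sup>2))"
    using c by (intro integrable_mult_right exp_neg_sq_integrable) auto
  then show ?thesis
  proof (rule Bochner_Integration.integrable_bound)
    show "AE z in lborel. norm (f z * exp (- H z)) \<le> norm (?B * exp (- (c / 2) * (norm z)\<^sup>2))"
    proof (rule AE_I2)
      fix z :: 'a
      let ?r = "norm z"
      have "?r \<le> c / 2 * ?r\<^sup>2 + 1 / (2 * c)"
      proof -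
        have "0 \<le> (c * ?r - 1)\<^sup>2 / (2 * c)" using c by simp
        also have "\<dots> = c / 2 * ?r\<^sup>2 + 1 / (2 * c) - ?r"
          using c by (simp add: power2_diff power_mult_distrib add_divide_distrib diff_divide_distrib) (simp add: power2_eq_square)
        finally show ?thesis by simp
      qed
      then have e: "1 + ?r - H z \<le> (1 + 1 / (2 * c) + C) + (- (c / 2) * ?r\<^sup>2)"
        using H[of z] by (simp add: algebra_simps) argo?
      have "\<bar>f z\<bar> * exp (- H z) \<le> (A * (real k ^ k * exp (1 + ?r))) * exp (- H z)"
        using f power_le_exp[of "1 + ?r" k] by (intro mult_right_mono order_trans[OF f(2)] mult_left_mono) auto
      also have "\<dots> = A * (real k ^ k * exp (1 + ?r - H z))" by (simp add: exp_diff exp_minus field_simps)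
      also have "\<dots> \<le> A * (real k ^ k * exp ((1 + 1 / (2 * c) + C) + (- (c / 2) * ?r\<^sup>2)))"
        using e f by (intro mult_left_mono) auto
      also have "\<dots> = ?B * exp (- (c / 2) * ?r\<^sup>2)" by (simp only: exp_add mult.assoc)
      finally show "norm (f z * exp (- H z)) \<le> norm (?B * exp (- (c / 2) * ?r\<^sup>2))"
        using f(1) by (simp add: abs_mult)
    qed
  qed simp
qed

text \<open>The integral of \<open>D\<close> is averaged over translations by t b with t in [0,1],
  which a volume-preserving shear permits. The inner integral over t is f(z + b) - f(z), whose
  integral vanishes by translation invariance. Thus integrability alone rules out boundary
  terms.\<close>

lemma integral_directional_derivative:
  fixes f D :: "'a::euclidean_space \<Rightarrow> real"
  assumes D: "\<And>z t. ((\<lambda>t. f (z + t *\<^sub>R b)) has_real_derivative D (z + t *\<^sub>R b)) (at t)"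
    and cont: "continuous_on UNIV D" and f: "integrable lborel f" and Di: "integrable lborel D"
  shows "(\<integral>z. D z \<partial>lborel) = 0"
proof -
  let ?T = "\<lambda>z::'a \<times> real. (fst z + snd z *\<^sub>R b, snd z)"
  let ?F = "\<lambda>z::'a \<times> real. D (fst z) * indicator {0..1} (snd z)"
  have T: "vol_pres ?T" by (rule vol_pres_shear_fst) simp
  have Tm: "?T \<in> lborel \<rightarrow>\<^sub>M borel" using vol_pres_measurable[OF T] by simp
  have [measurable]: "D \<in> borel_measurable borel" by (rule borel_measurable_continuous_onI[OF cont])
  have F: "integrable (lborel \<Otimes>\<^sub>M lborel) ?F"
    by (rule lborel_pair.Fubini_integrable) (use Di in \<open>auto simp: abs_mult integrable_abs\<close>)
  have Fb: "integrable lborel ?F" using F by (simp add: lborel_prod)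
  have Fm: "?F \<in> borel_measurable borel" using borel_measurable_integrable[OF Fb] by simp
  have i1: "integrable lborel (\<lambda>z. ?F (?T z))"
    using T Fb Tm Fm integrable_distr_eq[OF Tm Fm] by (simp add: vol_pres_def)
  have e1: "(\<integral>z. ?F (?T z) \<partial>lborel) = (\<integral>z. ?F z \<partial>lborel)"
    using T integral_distr[OF Tm Fm] by (simp add: vol_pres_def)
  have "(\<integral>z. ?F z \<partial>lborel) = (\<integral>z. D z \<partial>lborel)"
    using lborel_pair.integral_fst'[OF F] by (simp add: lborel_prod)
  moreover have "(\<integral>z. ?F (?T z) \<partial>lborel) = (\<integral>z. (\<integral>t. ?F (?T (z, t)) \<partial>lborel) \<partial>lborel)"
    using lborel_pair.integral_fst'[of "\<lambda>z. ?F (?T z)"] i1 by (simp add: lborel_prod)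
  moreover have "(\<integral>t. ?F (?T (z, t)) \<partial>lborel) = f (z + b) - f z" for z
  proof -
    have "(\<integral>t. indicator {0..1} t *\<^sub>R D (z + t *\<^sub>R b) \<partial>lborel) = f (z + 1 *\<^sub>R b) - f (z + 0 *\<^sub>R b)"
    proof (rule integral_FTC_atLeastAtMost)
      show "((\<lambda>t. f (z + t *\<^sub>R b)) has_vector_derivative D (z + t *\<^sub>R b)) (at t within {0..1})" for t
        using D has_real_derivative_iff_has_vector_derivative has_vector_derivative_at_within by blast
      show "continuous_on {0..1} (\<lambda>t. D (z + t *\<^sub>R b))"
        by (intro continuous_on_compose2[OF cont] continuous_intros) auto
    qed simp
    then show ?thesis by (simp add: mult.commute)
  qed
  moreover have "(\<integral>z. f (z + b) - f z \<partial>lborel) = 0"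
  proof -
    have fm: "f \<in> borel_measurable borel" using borel_measurable_integrable[OF f] by simp
    have "integrable (distr lborel borel ((+) b)) f" using f by (simp add: lborel_distr_plus)
    then have "integrable lborel (\<lambda>z. f (z + b))"
      using integrable_distr_eq[of "(+) b" lborel borel f] fm by (simp add: add.commute)
    moreover have "(\<integral>z. f (z + b) \<partial>lborel) = (\<integral>z. f z \<partial>lborel)"
      using integral_distr[of "(+) b" lborel borel f] fm by (simp add: lborel_distr_plus add.commute)
    ultimately show ?thesis using f by simp
  qed
  ultimately show ?thesis using e1 by simp
qed

text \<open>Young's inequality for P^(s - 1) K with the exponents s / (s - 1) and s. Besides the
  moment bound it yields the tangent of t^l at 1 and Bernoulli's inequality.\<close>

lemma young_powr:
  fixes P K s :: real assumes "0 < P" "0 < K" "1 \<le> s"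
  shows "P powr (s - 1) * (K - P) \<le> (K powr s - P powr s) / s"
proof -
  have "(P powr s) powr (1 - 1 / s) * (K powr s) powr (1 / s) \<le> (1 - 1 / s) * P powr s + 1 / s * K powr s"
    using assms by (intro Youngs_inequality_0) auto
  moreover have "(P powr s) powr (1 - 1 / s) = P powr (s - 1)" "(K powr s) powr (1 / s) = K"
    using assms by (simp_all add: powr_powr right_diff_distrib)
  moreover have "P powr (s - 1) * P = P powr s"
    using assms by (metis powr_one powr_add diff_add_cancel less_imp_le)
  ultimately show ?thesis by (simp add: algebra_simps diff_divide_distrib)
qed

text \<open>Integration by parts against the vector field \<open>(\<epsilon> + |G|\<^sup>2)\<^bsup>q/2 - 1\<^esup> G\<close>; the positive
  \<open>\<epsilon>\<close> makes it continuously differentiable.\<close>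

lemma moment_bound:
  fixes H :: "'a::euclidean_space \<Rightarrow> real" and nH G :: "'a \<Rightarrow> 'a" and DG :: "'a \<Rightarrow> 'a \<Rightarrow> 'a"
  assumes H: "\<And>z. (H has_derivative (\<lambda>h. nH z \<bullet> h)) (at z)" and nH: "continuous_on UNIV nH"
      "poly_bdd (\<lambda>z. norm (nH z))"
    and Hc: "0 < c0" "\<And>z. c0 * (norm z)\<^sup>2 - C0 \<le> H z"
    and G: "\<And>z. (G has_derivative DG z) (at z)" "\<And>h. continuous_on UNIV (\<lambda>z. DG z h)"
      "poly_bdd (\<lambda>z. norm (G z))" "\<And>h. poly_bdd (\<lambda>z. norm (DG z h))"
    and tr: "\<And>z. (\<Sum>b\<in>Basis. DG z b \<bullet> b) \<le> Lc * D"
    and sym: "\<And>z. G z \<bullet> DG z (G z) \<le> Lc * (norm (G z))\<^sup>2"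
    and drift: "\<And>z. c * (norm (G z))\<^sup>2 \<le> G z \<bullet> nH z"
    and pos: "0 < c" "0 < Lc" "1 \<le> D" "2 \<le> q"
  shows "integrable lborel (\<lambda>z. norm (G z) powr q * exp (- H z))" (is ?int)
    and "(\<integral>z. norm (G z) powr q * exp (- H z) \<partial>lborel)
       \<le> (Lc * (D + q - 2) / c) powr (q / 2) * (\<integral>z. exp (- H z) \<partial>lborel)" (is ?bound)
proof -
  have Gcont: "continuous_on UNIV G"
    by (intro continuous_at_imp_continuous_on ballI has_derivative_continuous[OF G(1)])
  have Hcont: "continuous_on UNIV H"
    by (intro continuous_at_imp_continuous_on ballI has_derivative_continuous[OF H])
  have [measurable]: "G \<in> borel_measurable borel" "H \<in> borel_measurable borel"
    by (rule borel_measurable_continuous_onI[OF Gcont] borel_measurable_continuous_onI[OF Hcont])+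
  have linG: "linear (DG z)" for z using G(1) has_derivative_linear by blast
  have pG: "poly_bdd (\<lambda>z. norm (G z) powr q)" using poly_bdd_powr[OF G(3), of q] pos by simp
  show ?int by (rule poly_exp_integrable[OF pG _ _ Hc]) auto
  define s where "s = q / 2"
  have s: "1 \<le> s" using pos by (simp add: s_def)
  define Z where "Z = (\<integral>z. exp (- H z) \<partial>lborel)"
  have "integrable lborel (\<lambda>z. 1 * exp (- H z))"
    by (rule poly_exp_integrable[OF poly_bdd_const _ _ Hc]) auto
  then have Zi: "integrable lborel (\<lambda>z. exp (- H z))" by simp
  have main: "(\<integral>z. norm (G z) powr q * exp (- H z) \<partial>lborel) \<le> (Lc * (D + q - 2) / c + \<epsilon>) powr s * Z"
    if \<epsilon>: "0 < \<epsilon>" for \<epsilon>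
  proof -
    define P where "P z = \<epsilon> + (norm (G z))\<^sup>2" for z
    \<comment> \<open>The level of \<open>P\<close> at which the drift c (P - \<epsilon>) balances
      the trace term Lc D and the term 2 (s - 1) Lc from differentiating the power.\<close>
    define K where "K = Lc * (D + q - 2) / c + \<epsilon>"
    have P0: "0 < P z" "\<epsilon> \<le> P z" for z using \<epsilon> by (auto simp: P_def add_pos_nonneg)
    have K0: "0 < K" using pos \<epsilon> by (simp add: K_def add_nonneg_pos)
    define f where "f b z = P z powr (s - 1) * (G z \<bullet> b) * exp (- H z)" for b z
    \<comment> \<open>\<open>R b\<close> times exp (- H) is the derivative of \<open>f b\<close> in
      direction \<open>b\<close>.\<close>
    define R where "R b z = P z powr (s - 1) * (2 * (s - 1) * (G z \<bullet> DG z b) / P z * (G z \<bullet> b) + DG z b \<bullet> b - (G z \<bullet> b) * (nH z \<bullet> b))" for b z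
    have Pcont: "continuous_on UNIV P" unfolding P_def by (intro continuous_intros Gcont)
    have Rcont: "continuous_on UNIV (R b)" for b
      unfolding R_def using P0 by (intro continuous_intros Pcont Gcont G(2) nH) (auto simp: less_imp_neq[symmetric])
    have Ppb: "poly_bdd P" unfolding P_def by (intro poly_bdd_add poly_bdd_const poly_bdd_power G)
    have Pinv: "poly_bdd (\<lambda>z. 1 / P z)"
    proof (rule poly_bdd_mono[OF poly_bdd_const])
      show "\<bar>1 / P z\<bar> \<le> \<bar>1 / \<epsilon>\<bar>" for z using P0[of z] \<epsilon> by (simp add: frac_le)
    qed
    have Ppow: "poly_bdd (\<lambda>z. P z powr (s - 1))" "poly_bdd (\<lambda>z. P z powr s)"
    proof -
      have a: "\<bar>P z\<bar> = P z" for z using P0(1)[of z] by simp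
      show "poly_bdd (\<lambda>z. P z powr (s - 1))" "poly_bdd (\<lambda>z. P z powr s)"
        using poly_bdd_powr[OF Ppb, of "s - 1"] poly_bdd_powr[OF Ppb, of s] s unfolding a by simp_all
    qed
    have nb: "poly_bdd (\<lambda>z. norm b)" for b :: 'a by (rule poly_bdd_const)
    have Rpb: "poly_bdd (R b)" for b
    proof -
      have "poly_bdd (\<lambda>z. P z powr (s - 1) * ((2 * (s - 1)) * (G z \<bullet> DG z b) * (1 / P z) * (G z \<bullet> b) + DG z b \<bullet> b + - ((G z \<bullet> b) * (nH z \<bullet> b))))"
        by (intro poly_bdd_mult poly_bdd_add poly_bdd_minus poly_bdd_inner poly_bdd_const Ppow Pinv G nH)
      then show ?thesis by (simp add: R_def[abs_def])
    qed
    have [measurable]: "R b \<in> borel_measurable borel" "P \<in> borel_measurable borel" for b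
      by (rule borel_measurable_continuous_onI[OF Rcont] borel_measurable_continuous_onI[OF Pcont])+
    have Ri: "integrable lborel (\<lambda>z. R b z * exp (- H z))" for b
      by (rule poly_exp_integrable[OF Rpb _ _ Hc]) auto
    have zero: "(\<integral>z. R b z * exp (- H z) \<partial>lborel) = 0" for b
    proof (rule integral_directional_derivative[where f="f b" and b=b])
      show "continuous_on UNIV (\<lambda>z. R b z * exp (- H z))" by (intro continuous_intros Rcont Hcont)
      have "poly_bdd (\<lambda>z. P z powr (s - 1) * (G z \<bullet> b))"
        by (intro poly_bdd_mult Ppow poly_bdd_inner G poly_bdd_const)
      then show "integrable lborel (f b)"
        unfolding f_def by (rule poly_exp_integrable[OF _ _ _ Hc]) auto
      show "integrable lborel (\<lambda>z. R b z * exp (- H z))" by (rule Ri)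
      fix z t
      let ?y = "z + t *\<^sub>R b"
      have dP: "(P has_derivative (\<lambda>h. 2 * (G y \<bullet> DG y h))) (at y)" for y
        unfolding P_def power2_norm_eq_inner
        by (auto intro!: derivative_eq_intros G(1) simp: inner_commute)
      have df: "(f b has_derivative (\<lambda>h. (P y powr (s - 1) * (2 * (G y \<bullet> DG y h) * (s - 1) / P y) * (G y \<bullet> b)
           + P y powr (s - 1) * (DG y h \<bullet> b)) * exp (- H y)
           + P y powr (s - 1) * (G y \<bullet> b) * (exp (- H y) * - (nH y \<bullet> h)))) (at y)" for y
        unfolding f_def
        by (rule derivative_eq_intros dP H G(1) refl P0 UNIV_I | simp)+
          (rule ext, simp add: algebra_simps)
      have "((\<lambda>t. f b (z + t *\<^sub>R b)) has_derivative (\<lambda>\<tau>. (P ?y powr (s - 1) * (2 * (G ?y \<bullet> DG ?y (\<tau> *\<^sub>R b)) * (s - 1) / P ?y) * (G ?y \<bullet> b)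
           + P ?y powr (s - 1) * (DG ?y (\<tau> *\<^sub>R b) \<bullet> b)) * exp (- H ?y)
           + P ?y powr (s - 1) * (G ?y \<bullet> b) * (exp (- H ?y) * - (nH ?y \<bullet> (\<tau> *\<^sub>R b))))) (at t)"
        by (rule has_derivative_compose[of "\<lambda>t. z + t *\<^sub>R b" "\<lambda>\<tau>. \<tau> *\<^sub>R b", OF _ df])
           (auto intro!: derivative_eq_intros)
      then show "((\<lambda>t. f b (z + t *\<^sub>R b)) has_real_derivative R b ?y * exp (- H ?y)) (at t)"
        unfolding has_field_derivative_def R_def
        by (rule has_derivative_eq_rhs) (auto simp: linear_cmul[OF linG] algebra_simps)
    qed
    \<comment> \<open>Summation over the basis produces the weighted divergence of the vector field;
      each summand integrates to zero.\<close>
    have "0 = (\<Sum>b\<in>Basis. \<integral>z. R b z * exp (- H z) \<partial>lborel)" by (simp add: zero)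
    also have "\<dots> = (\<integral>z. (\<Sum>b\<in>Basis. R b z * exp (- H z)) \<partial>lborel)"
      by (rule Bochner_Integration.integral_sum[symmetric]) (rule Ri)
    also have "\<dots> \<le> (\<integral>z. c / s * (K powr s * exp (- H z) - P z powr s * exp (- H z)) \<partial>lborel)"
    proof (rule integral_mono)
      show "integrable lborel (\<lambda>z. \<Sum>b\<in>Basis. R b z * exp (- H z))" by (intro Bochner_Integration.integrable_sum Ri)
      show "integrable lborel (\<lambda>z. c / s * (K powr s * exp (- H z) - P z powr s * exp (- H z)))"
        by (intro integrable_mult_right Bochner_Integration.integrable_diff Zi poly_exp_integrable[OF Ppow(2) _ _ Hc]) auto
      fix z
      have "(\<Sum>b\<in>Basis. R b z) = P z powr (s - 1) * (2 * (s - 1) * (G z \<bullet> DG z (G z)) / P z + (\<Sum>b\<in>Basis. DG z b \<bullet> b) - G z \<bullet> nH z)"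
      proof -
        have "G z \<bullet> DG z (G z) = G z \<bullet> DG z (\<Sum>b\<in>Basis. (G z \<bullet> b) *\<^sub>R b)" by (simp add: euclidean_representation)
        also have "\<dots> = (\<Sum>b\<in>Basis. (G z \<bullet> DG z b) * (G z \<bullet> b))"
          unfolding linear_sum[OF linG] linear_cmul[OF linG] inner_sum_right inner_scaleR_right by (simp add: mult.commute)
        finally show ?thesis
          unfolding R_def euclidean_inner[of "G z" "nH z"]
          by (simp add: sum_distrib_left[symmetric] sum.distrib sum_subtractf sum_divide_distrib mult_ac)
             (simp add: sum_distrib_left sum_divide_distrib mult_ac)
      qed
      also have "\<dots> \<le> P z powr (s - 1) * (2 * (s - 1) * Lc + Lc * D - c * (P z - \<epsilon>))"
      proof (rule mult_left_mono)
        have "(G z \<bullet> DG z (G z)) / P z \<le> Lc"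
        proof -
          have "G z \<bullet> DG z (G z) \<le> Lc * (norm (G z))\<^sup>2" by (rule sym)
          also have "\<dots> \<le> Lc * P z" using pos \<epsilon> by (simp add: P_def)
          finally show ?thesis using P0 by (simp add: divide_le_eq)
        qed
        then have "2 * (s - 1) * ((G z \<bullet> DG z (G z)) / P z) \<le> 2 * (s - 1) * Lc" using s by (intro mult_left_mono) auto
        moreover have "c * (P z - \<epsilon>) \<le> G z \<bullet> nH z" using drift[of z] by (simp add: P_def)
        ultimately show "2 * (s - 1) * (G z \<bullet> DG z (G z)) / P z + (\<Sum>b\<in>Basis. DG z b \<bullet> b) - G z \<bullet> nH z
           \<le> 2 * (s - 1) * Lc + Lc * D - c * (P z - \<epsilon>)" using tr[of z] by simp
      qed simp
      also have "2 * (s - 1) * Lc + Lc * D - c * (P z - \<epsilon>) = c * (K - P z)"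
      proof -
        have "c * K = Lc * (D + q - 2) + c * \<epsilon>" using pos by (simp add: K_def distrib_left)
        then show ?thesis by (simp add: s_def algebra_simps)
      qed
      \<comment> \<open>Young's inequality replaces K - P by a difference of s-th powers, so that
        the vanishing integral compares the moment of \<open>P\<close> with K^s.\<close>
      also have "P z powr (s - 1) * (c * (K - P z)) \<le> c * ((K powr s - P z powr s) / s)"
        using mult_left_mono[OF young_powr[OF P0(1) K0 s, of z], of c] pos by (simp add: mult.left_commute)
      finally have "(\<Sum>b\<in>Basis. R b z) * exp (- H z) \<le> c * ((K powr s - P z powr s) / s) * exp (- H z)"
        by (rule mult_right_mono) simp
      then show "(\<Sum>b\<in>Basis. R b z * exp (- H z)) \<le> c / s * (K powr s * exp (- H z) - P z powr s * exp (- H z))"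
        unfolding sum_distrib_right[symmetric] by (simp add: algebra_simps diff_divide_distrib)
    qed
    also have "\<dots> = c / s * (K powr s * Z - (\<integral>z. P z powr s * exp (- H z) \<partial>lborel))"
      unfolding Z_def
      by (subst integral_mult_right_zero, subst Bochner_Integration.integral_diff)
         (auto intro!: Zi poly_exp_integrable[OF Ppow(2) _ _ Hc])
    finally have "0 \<le> c / s * (K powr s * Z - (\<integral>z. P z powr s * exp (- H z) \<partial>lborel))" .
    then have "(\<integral>z. P z powr s * exp (- H z) \<partial>lborel) \<le> K powr s * Z"
    proof -
      assume "0 \<le> c / s * (K powr s * Z - (\<integral>z. P z powr s * exp (- H z) \<partial>lborel))"
      moreover have "0 < c / s" using pos s by simp
      ultimately show ?thesis by (simp only: zero_le_mult_iff) argo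
    qed
    moreover have "(\<integral>z. norm (G z) powr q * exp (- H z) \<partial>lborel) \<le> (\<integral>z. P z powr s * exp (- H z) \<partial>lborel)"
    proof (rule integral_mono)
      show "integrable lborel (\<lambda>z. P z powr s * exp (- H z))" by (rule poly_exp_integrable[OF Ppow(2) _ _ Hc]) auto
      fix z
      have "norm (G z) powr q = ((norm (G z))\<^sup>2) powr s"
        unfolding s_def by (cases "norm (G z) = 0") (simp_all add: powr_powr flip: powr_numeral)
      also have "\<dots> \<le> P z powr s" using \<epsilon> s by (intro powr_mono2) (auto simp: P_def)
      finally show "norm (G z) powr q * exp (- H z) \<le> P z powr s * exp (- H z)" by (simp add: mult_right_mono)
    qed (fact \<open>?int\<close>)
    ultimately show ?thesis unfolding K_def by linarith
  qed
  \<comment> \<open>The left-hand side of \<open>main\<close> is free of \<epsilon>, so the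
    regularisation may be removed in the bound.\<close>
  have "((\<lambda>\<epsilon>. (Lc * (D + q - 2) / c + \<epsilon>) powr s * Z) \<longlongrightarrow> (Lc * (D + q - 2) / c + 0) powr s * Z) (at_right 0)"
    using pos by (intro tendsto_intros) auto
  moreover have "eventually (\<lambda>\<epsilon>. (\<integral>z. norm (G z) powr q * exp (- H z) \<partial>lborel) \<le> (Lc * (D + q - 2) / c + \<epsilon>) powr s * Z) (at_right 0)"
    unfolding eventually_at_right_field by (intro exI[of _ 1]) (auto intro: main)
  ultimately have "(\<integral>z. norm (G z) powr q * exp (- H z) \<partial>lborel) \<le> (Lc * (D + q - 2) / c + 0) powr s * Z"
    by (intro tendsto_lowerbound) auto
  then show ?bound by (simp add: s_def Z_def)
qed

section \<open>The Hamiltonian flow preserves the Gibbs measure\<close>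

lemma vector_derivative_continuous_on:
  assumes "\<And>r. r \<in> S \<Longrightarrow> (f has_vector_derivative f' r) (at r within S)"
  shows "continuous_on S f"
  using assms has_vector_derivative_continuous unfolding continuous_on_eq_continuous_within by blast

text \<open>Paths have derivatives relative to the whole closed interval only. This form of the mean
  value inequality accepts such derivatives while asking for the majorant just on the subinterval in
  question.\<close>

lemma vector_derivative_bound:
  fixes f :: "real \<Rightarrow> 'a::real_normed_vector"
  assumes f: "\<And>r. r \<in> {0..T} \<Longrightarrow> (f has_vector_derivative f' r) (at r within {0..T})"
    and \<phi>: "\<And>r. r \<in> {0..T} \<Longrightarrow> (\<phi> has_vector_derivative \<phi>' r) (at r within {0..T})"
    and le: "\<And>r. r \<in> {0..T} \<Longrightarrow> r \<in> {a..b} \<Longrightarrow> norm (f' r) \<le> \<phi>' r" and ab: "0 \<le> a" "a \<le> b" "b \<le> T"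
  shows "norm (f b - f a) \<le> \<phi> b - \<phi> a"
proof (cases "a < b")
  case True
  have sub: "{a..b} \<subseteq> {0..T}" using ab by auto
  show ?thesis
  proof (rule differentiable_bound_general[OF True])
    show "continuous_on {a..b} f"
      by (rule continuous_on_subset[OF vector_derivative_continuous_on[OF f] sub])
    show "continuous_on {a..b} \<phi>"
      by (rule continuous_on_subset[OF vector_derivative_continuous_on[OF \<phi>] sub])
    fix r assume r: "a < r" "r < b"
    then have at: "at r within {0..T} = at r" using ab by (intro at_within_Icc_at) auto
    show "(f has_vector_derivative f' r) (at r)" "(\<phi> has_vector_derivative \<phi>' r) (at r)"
      using f[of r] \<phi>[of r] r ab by (auto simp: at)
    show "norm (f' r) \<le> \<phi>' r" using le[of r] r ab by auto
  qed
qed (use ab in simp)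

lemma norm_add_diff_le: "norm (a + b - c) \<le> norm a + norm b + norm (c :: 'a::real_normed_vector)"
  using norm_triangle_ineq4[of "a + b" c] norm_triangle_ineq[of a b] by linarith

context obabo begin

definition is_path :: "'a \<times> 'a \<Rightarrow> (real \<Rightarrow> 'a) \<Rightarrow> (real \<Rightarrow> 'a) \<Rightarrow> bool" where
  "is_path z X V \<longleftrightarrow> X 0 = fst z \<and> V 0 = snd z \<and>
     (\<forall>s\<in>{0..\<delta>}. (X has_vector_derivative V s) (at s within {0..\<delta>}) \<and>
        (V has_vector_derivative - g (X s)) (at s within {0..\<delta>}))"

lemma L\<delta>2: "L * \<delta>\<^sup>2 \<le> 1 / 69696"
proof -
  have "(\<delta> * sqrt L)\<^sup>2 \<le> (1 / 264)\<^sup>2"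
    using \<delta>_sqrt_L \<delta>_pos L_pos by (intro power_mono) auto
  then show ?thesis using L_pos by (simp add: power_mult_distrib power2_eq_square[of 264] power_divide mult.commute)
qed

text \<open>Picard iteration for the integrated second-order equation; the contraction factor
  \<open>L \<delta>\<^sup>2\<close> makes weighted norms unnecessary.\<close>

lemma path_exists: "\<exists>X V. is_path z X V"
proof -
  obtain x v where z: "z = (x, v)" by (cases z)
  \<comment> \<open>Clamping time to [0, \<delta>] makes the iterates bounded continuous functions
    on the line, a complete space.\<close>
  define cl where "cl s = max 0 (min \<delta> s)" for s :: real
  have cl: "cl s \<in> {0..\<delta>}" for s using \<delta>_pos by (auto simp: cl_def)
  have cl_id: "cl s = s" if "s \<in> {0..\<delta>}" for s using that by (auto simp: cl_def)
  have cl_cont: "continuous_on A cl" for A unfolding cl_def by (intro continuous_intros)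
  \<comment> \<open>The velocity is a functional of the position, so the fixed point is sought among
    positions only.\<close>
  define W where "W X r = v - integral {0..r} (\<lambda>u. g (X u))" for X and r :: real
  define F where "F X s = x + integral {0..cl s} (W X)" for X s
  have gX: "continuous_on {0..\<delta>} (\<lambda>u. g (X u))" if "continuous_on UNIV X" for X :: "real \<Rightarrow> 'a"
    by (rule continuous_on_compose2[OF g_cont continuous_on_subset[OF that]]) auto
  have Wc: "continuous_on {0..\<delta>} (W X)" if "continuous_on UNIV X" for X
    unfolding W_def by (intro continuous_intros indefinite_integral_continuous_1 integrable_continuous_interval gX that)
  have Fb: "F X \<in> bcontfun" if "continuous_on UNIV X" for X
  proof -
    let ?I = "\<lambda>s. x + integral {0..s} (W X)"
    have Ic: "continuous_on {0..\<delta>} ?I"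
      by (intro continuous_intros indefinite_integral_continuous_1 integrable_continuous_interval Wc that)
    have "continuous_on UNIV (F X)"
      unfolding F_def by (rule continuous_on_compose2[OF Ic cl_cont]) (use cl in auto)
    moreover have "bounded (range (F X))"
    proof (rule bounded_subset)
      show "bounded (?I ` {0..\<delta>})" by (intro compact_imp_bounded compact_continuous_image Ic compact_Icc)
      show "range (F X) \<subseteq> ?I ` {0..\<delta>}" using cl by (auto simp: F_def)
    qed
    ultimately show ?thesis by (simp add: bcontfun_def)
  qed
  have "\<exists>!X. Bcontfun (F (apply_bcontfun X)) = X"
  proof (rule banach_fix_type)
    show "0 \<le> L * \<delta>\<^sup>2" using L_pos by simp
    show "L * \<delta>\<^sup>2 < 1" using L\<delta>2 by simp
    show "\<forall>X Y. dist (Bcontfun (F (apply_bcontfun X))) (Bcontfun (F (apply_bcontfun Y))) \<le> L * \<delta>\<^sup>2 * dist X Y"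
    proof (intro allI dist_bound)
      fix X Y :: "real \<Rightarrow>\<^sub>C 'a" and s
      let ?X = "apply_bcontfun X" and ?Y = "apply_bcontfun Y"
      have c: "continuous_on UNIV ?X" "continuous_on UNIV ?Y" by auto
      have W: "norm (W ?X r - W ?Y r) \<le> L * dist X Y * \<delta>" if r: "r \<in> {0..\<delta>}" for r
      proof -
        have sub: "{0..r} \<subseteq> {0..\<delta>}" using r by auto
        have i: "(\<lambda>u. g (?X u)) integrable_on {0..r}" "(\<lambda>u. g (?Y u)) integrable_on {0..r}"
          by (intro integrable_continuous_interval continuous_on_subset[OF gX sub] c)+
        have "norm (W ?X r - W ?Y r) = norm (integral {0..r} (\<lambda>u. g (?X u) - g (?Y u)))"
          using i by (simp add: W_def integral_diff norm_minus_commute)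
        also have "\<dots> \<le> (L * dist X Y) * (r - 0)"
        proof (rule integral_bound)
          show "continuous_on {0..r} (\<lambda>u. g (?X u) - g (?Y u))"
            by (intro continuous_intros continuous_on_subset[OF gX sub] c)
          fix u
          have "norm (g (?X u) - g (?Y u)) \<le> L * norm (?X u - ?Y u)" by (rule g_lip)
          also have "\<dots> \<le> L * dist X Y"
            using dist_bounded[of X u Y] L_pos by (intro mult_left_mono) (auto simp: dist_norm)
          finally show "norm (g (?X u) - g (?Y u)) \<le> L * dist X Y" .
        qed (use r in auto)
        also have "\<dots> \<le> L * dist X Y * \<delta>" using r L_pos by (intro mult_left_mono) auto
        finally show ?thesis .
      qed
      let ?s = "cl s"
      have sub: "{0..?s} \<subseteq> {0..\<delta>}" using cl[of s] by auto
      have i: "W ?X integrable_on {0..?s}" "W ?Y integrable_on {0..?s}"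
        by (intro integrable_continuous_interval continuous_on_subset[OF Wc sub] c)+
      have "dist (F ?X s) (F ?Y s) = norm (integral {0..?s} (\<lambda>r. W ?X r - W ?Y r))"
        using i by (simp add: F_def integral_diff dist_norm)
      also have "\<dots> \<le> (L * dist X Y * \<delta>) * (?s - 0)"
      proof (rule integral_bound)
        show "continuous_on {0..?s} (\<lambda>r. W ?X r - W ?Y r)"
          by (intro continuous_intros continuous_on_subset[OF Wc sub] c)
      qed (use cl[of s] W in auto)
      also have "\<dots> \<le> (L * dist X Y * \<delta>) * \<delta>" using cl[of s] L_pos \<delta>_pos by (intro mult_left_mono) auto
      finally show "dist (apply_bcontfun (Bcontfun (F ?X)) s) (apply_bcontfun (Bcontfun (F ?Y)) s) \<le> L * \<delta>\<^sup>2 * dist X Y"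
        using Fb c by (simp add: Bcontfun_inverse power2_eq_square mult_ac)
    qed
  qed
  then obtain X0 where X0: "Bcontfun (F (apply_bcontfun X0)) = X0" by blast
  let ?X = "apply_bcontfun X0"
  have Xc: "continuous_on UNIV ?X" by auto
  have Xeq: "?X = F ?X" using X0 Fb[OF Xc] by (metis Bcontfun_inverse)
  have "is_path z ?X (W ?X)"
    unfolding is_path_def
  proof (intro conjI ballI)
    have "?X 0 = F ?X 0" using Xeq by metis
    then show "?X 0 = fst z" using cl_id[of 0] \<delta>_pos by (simp add: F_def z)
    show "W ?X 0 = snd z" by (simp add: W_def z)
    fix s assume s: "s \<in> {0..\<delta>}"
    have d: "((\<lambda>s. x + integral {0..s} (W ?X)) has_vector_derivative W ?X s) (at s within {0..\<delta>})"
      using integral_has_vector_derivative[OF Wc[OF Xc] s] by (auto intro!: derivative_eq_intros)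
    show "(?X has_vector_derivative W ?X s) (at s within {0..\<delta>})"
    proof (rule has_vector_derivative_transform[OF s _ d])
      fix r assume "r \<in> {0..\<delta>}"
      then show "?X r = x + integral {0..r} (W ?X)" using Xeq cl_id[of r] by (metis F_def)
    qed
    show "(W ?X has_vector_derivative - g (?X s)) (at s within {0..\<delta>})"
      unfolding W_def using integral_has_vector_derivative[OF gX[OF Xc] s]
      by (auto intro!: derivative_eq_intros)
  qed
  then show ?thesis by blast
qed

text \<open>A path is selected by choice. Its end point does not depend on the selection:
  \<open>euler_iter_tendsto\<close> holds for every path and its approximations depend on
  \<open>z\<close> alone.\<close>

definition Xp :: "'a \<times> 'a \<Rightarrow> real \<Rightarrow> 'a" where
  "Xp z = (SOME X. \<exists>V. is_path z X V)"

definition Vp :: "'a \<times> 'a \<Rightarrow> real \<Rightarrow> 'a" where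
  "Vp z = (SOME V. is_path z (Xp z) V)"

definition flow :: "'a \<times> 'a \<Rightarrow> 'a \<times> 'a" where
  "flow z = (Xp z \<delta>, Vp z \<delta>)"

lemma is_path: "is_path z (Xp z) (Vp z)"
proof -
  have "\<exists>V. is_path z (Xp z) V"
    unfolding Xp_def using path_exists[of z] by (rule someI_ex)
  then show ?thesis unfolding Vp_def by (rule someI_ex)
qed

definition energy :: "'a \<times> 'a \<Rightarrow> real" where
  "energy z = U (fst z) + (norm (snd z))\<^sup>2 / 2"

lemma energy_cont: "continuous_on UNIV energy"
  unfolding energy_def by (intro continuous_intros continuous_on_compose2[OF U_cont]) auto

lemma energy_path:
  assumes "is_path z X V" shows "energy (X \<delta>, V \<delta>) = energy z"
proof -
  let ?f = "\<lambda>s. U (X s) + (V s \<bullet> V s) / 2"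
  have "norm (?f \<delta> - ?f 0) \<le> (\<lambda>_. 0::real) \<delta> - (\<lambda>_. 0) 0"
  proof (rule vector_derivative_bound[where f="?f" and \<phi>="\<lambda>_. 0" and f'="\<lambda>_. 0" and \<phi>'="\<lambda>_. 0" and T=\<delta> and a=0 and b=\<delta>])
    fix r assume r: "r \<in> {0..\<delta>}"
    have dX: "(X has_derivative (\<lambda>t. t *\<^sub>R V r)) (at r within {0..\<delta>})"
      and dV: "(V has_derivative (\<lambda>t. t *\<^sub>R - g (X r))) (at r within {0..\<delta>})"
      using assms r by (auto simp: is_path_def has_vector_derivative_def)
    have "((\<lambda>s. U (X s)) has_derivative (\<lambda>t. g (X r) \<bullet> (t *\<^sub>R V r))) (at r within {0..\<delta>})"
      by (rule has_derivative_compose[OF dX U_deriv])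
    then show "(?f has_vector_derivative 0) (at r within {0..\<delta>})"
      unfolding has_vector_derivative_def
      by (auto intro!: derivative_eq_intros dV simp: inner_commute algebra_simps)
  qed (use \<delta>_pos in auto)
  then show ?thesis using assms by (simp add: energy_def is_path_def power2_norm_eq_inner)
qed

lemma energy_flow: "energy (flow z) = energy z"
  using energy_path[OF is_path] by (simp add: flow_def)

section \<open>The exact flow as a limit of symplectic Euler schemes\<close>

definition euler :: "real \<Rightarrow> 'a \<times> 'a \<Rightarrow> 'a \<times> 'a" where
  "euler h z = (let x1 = fst z + h *\<^sub>R snd z in (x1, snd z - h *\<^sub>R g x1))"

text \<open>n + 1 steps of size \<delta> / (n + 1); the successor keeps the step size meaningful at
  n = 0.\<close>

definition euler_iter :: "nat \<Rightarrow> 'a \<times> 'a \<Rightarrow> 'a \<times> 'a" where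
  "euler_iter n = (euler (\<delta> / real (Suc n)) ^^ Suc n)"

lemma vol_pres_euler: "vol_pres (euler h)"
proof -
  let ?B = "\<lambda>z::'a \<times> 'a. (fst z, snd z + (- h) *\<^sub>R g (fst z))"
  let ?A = "\<lambda>z::'a \<times> 'a. (fst z + h *\<^sub>R snd z, snd z)"
  have B: "vol_pres ?B" by (rule vol_pres_shear_snd) simp
  have A: "vol_pres ?A" by (rule vol_pres_shear_fst) simp
  have "euler h = (\<lambda>z. ?B (?A z))" by (rule ext) (simp add: euler_def Let_def)
  then show ?thesis using vol_pres_compose[OF B A] by simp
qed

lemma vol_pres_funpow: "vol_pres T \<Longrightarrow> vol_pres (T ^^ n)"
proof (induction n)
  case 0
  show ?case unfolding vol_pres_def by (simp add: id_def distr_id2)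
next
  case (Suc n)
  then show ?case using vol_pres_compose[of T "T ^^ n"] by (simp add: o_def)
qed

lemma vol_pres_euler_iter: "vol_pres (euler_iter n)"
  unfolding euler_iter_def by (intro vol_pres_funpow vol_pres_euler)

text \<open>Approximation by compositions of shears transfers measurability and, in the limit,
  invariance of the Gibbs weight to the exact flow. The local error is O(h^2), since velocity and
  force are bounded along the path, and errors grow by at most 1 + K h per step.\<close>

lemma euler_iter_tendsto:
  assumes path: "is_path z X V"
  shows "(\<lambda>n. euler_iter n z) \<longlonglongrightarrow> (X \<delta>, V \<delta>)"
proof -
  have dX: "(X has_vector_derivative V s) (at s within {0..\<delta>})"
    and dV: "(V has_vector_derivative - g (X s)) (at s within {0..\<delta>})" if "s \<in> {0..\<delta>}" for s
    using path that by (auto simp: is_path_def)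
  have Xc: "continuous_on {0..\<delta>} X" and Vc: "continuous_on {0..\<delta>} V"
    by (rule vector_derivative_continuous_on[OF dX] vector_derivative_continuous_on[OF dV]; assumption)+
  have gXc: "continuous_on {0..\<delta>} (\<lambda>s. g (X s))" by (rule continuous_on_compose2[OF g_cont Xc]) auto
  obtain B1 where B1: "\<And>s. s \<in> {0..\<delta>} \<Longrightarrow> norm (V s) \<le> B1"
    using compact_imp_bounded[OF compact_continuous_image[OF Vc compact_Icc]] unfolding bounded_iff by (metis imageI)
  obtain B2 where B2: "\<And>s. s \<in> {0..\<delta>} \<Longrightarrow> norm (g (X s)) \<le> B2"
    using compact_imp_bounded[OF compact_continuous_image[OF gXc compact_Icc]] unfolding bounded_iff by (metis (no_types, lifting) imageI)
  define B where "B = max B1 B2"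
  have B: "norm (V s) \<le> B" "norm (g (X s)) \<le> B" if "s \<in> {0..\<delta>}" for s
    using B1[OF that] B2[OF that] by (auto simp: B_def)
  have B0: "0 \<le> B" using B(1)[of 0] \<delta>_pos by (auto intro: order_trans[OF norm_ge_zero])
  define K where "K = 1 + L + L * \<delta>"
  have K0: "0 < K" using L_pos \<delta>_pos by (simp add: K_def add_pos_pos)
  have lipX: "norm (X b - X a) \<le> B * b - B * a" if "0 \<le> a" "a \<le> b" "b \<le> \<delta>" for a b
    by (rule vector_derivative_bound[where \<phi>="\<lambda>s. B * s", OF dX _ _ that])
       (auto intro!: derivative_eq_intros B)
  have lipV: "norm (V b - V a) \<le> B * b - B * a" if "0 \<le> a" "a \<le> b" "b \<le> \<delta>" for a b
    by (rule vector_derivative_bound[where \<phi>="\<lambda>s. B * s", OF dV _ _ that])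
       (auto intro!: derivative_eq_intros B)
  have err: "dist (euler_iter n z) (X \<delta>, V \<delta>) \<le> B * K * \<delta> * exp (K * \<delta>) * (\<delta> / real (Suc n))" for n
  proof -
    define h where "h = \<delta> / real (Suc n)"
    have h: "0 < h" "h \<le> \<delta>" "h * real (Suc n) = \<delta>" using \<delta>_pos by (auto simp: h_def divide_le_eq mult_le_cancel_left1)
    define e where "e k = norm (fst ((euler h ^^ k) z) - X (real k * h)) + norm (snd ((euler h ^^ k) z) - V (real k * h))" for k
    have e_step: "e (Suc k) \<le> (1 + K * h) * e k + B * K * h\<^sup>2" if k: "k < Suc n" for k
    proof -
      let ?s = "real k * h" and ?t = "real (Suc k) * h"
      have t: "?t = ?s + h" by (simp add: algebra_simps)
      have "?t \<le> real (Suc n) * h" using k h by (intro mult_right_mono) auto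
      then have st: "0 \<le> ?s" "?s \<le> ?t" "?t \<le> \<delta>" using h by (auto simp: t mult.commute)
      define y where "y = (euler h ^^ k) z"
      define y1 where "y1 = fst y + h *\<^sub>R snd y"
      have y': "(euler h ^^ Suc k) z = (y1, snd y - h *\<^sub>R g y1)"
        by (simp add: y_def y1_def euler_def Let_def)
      have x_exact: "norm (X ?t - X ?s - h *\<^sub>R V ?s) \<le> B * h\<^sup>2"
      proof -
        have "norm ((X ?t - ?t *\<^sub>R V ?s) - (X ?s - ?s *\<^sub>R V ?s)) \<le> (B * h) * ?t - (B * h) * ?s"
        proof (rule vector_derivative_bound[where f="\<lambda>r. X r - r *\<^sub>R V ?s" and \<phi>="\<lambda>r. B * h * r" and T=\<delta> and f'="\<lambda>r. V r - V ?s" and \<phi>'="\<lambda>_. B * h", OF _ _ _ st])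
          fix r assume r: "r \<in> {0..\<delta>}"
          show "((\<lambda>r. X r - r *\<^sub>R V ?s) has_vector_derivative V r - V ?s) (at r within {0..\<delta>})"
            using dX[OF r] by (auto intro!: derivative_eq_intros)
          show "((\<lambda>r. B * h * r) has_vector_derivative B * h) (at r within {0..\<delta>})"
            by (auto intro!: derivative_eq_intros)
          assume r': "r \<in> {?s..?t}"
          have "norm (V r - V ?s) \<le> B * r - B * ?s" using r r' st by (intro lipV) auto
          also have "\<dots> = B * (r - ?s)" by (simp add: algebra_simps)
          also have "\<dots> \<le> B * h" using r' t B0 by (intro mult_left_mono) auto
          finally show "norm (V r - V ?s) \<le> B * h" .
        qed
        moreover have "(X ?t - ?t *\<^sub>R V ?s) - (X ?s - ?s *\<^sub>R V ?s) = X ?t - X ?s - h *\<^sub>R V ?s"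
          unfolding t by (simp add: algebra_simps)
        moreover have "(B * h) * ?t - (B * h) * ?s = B * h\<^sup>2" unfolding t by (simp add: algebra_simps power2_eq_square)
        ultimately show ?thesis by (simp only:)
      qed
      have v_exact: "norm (V ?t - V ?s + h *\<^sub>R g (X ?t)) \<le> L * B * h\<^sup>2"
      proof -
        have "norm ((V ?t + ?t *\<^sub>R g (X ?t)) - (V ?s + ?s *\<^sub>R g (X ?t))) \<le> (L * B * h) * ?t - (L * B * h) * ?s"
        proof (rule vector_derivative_bound[where f="\<lambda>r. V r + r *\<^sub>R g (X ?t)" and \<phi>="\<lambda>r. L * B * h * r" and T=\<delta> and f'="\<lambda>r. - g (X r) + g (X ?t)" and \<phi>'="\<lambda>_. L * B * h", OF _ _ _ st])
          fix r assume r: "r \<in> {0..\<delta>}"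
          show "((\<lambda>r. V r + r *\<^sub>R g (X ?t)) has_vector_derivative - g (X r) + g (X ?t)) (at r within {0..\<delta>})"
            using dV[OF r] by (auto intro!: derivative_eq_intros)
          show "((\<lambda>r. L * B * h * r) has_vector_derivative L * B * h) (at r within {0..\<delta>})"
            by (auto intro!: derivative_eq_intros)
          assume r': "r \<in> {?s..?t}"
          have "norm (- g (X r) + g (X ?t)) \<le> L * norm (X ?t - X r)" using g_lip[of "X ?t" "X r"] by simp
          also have "\<dots> \<le> L * (B * ?t - B * r)" using r r' st L_pos by (intro mult_left_mono lipX) auto
          also have "\<dots> = (L * B) * (?t - r)" by (simp add: algebra_simps)
          also have "\<dots> \<le> (L * B) * h" using r' t B0 L_pos by (intro mult_left_mono) auto
          finally show "norm (- g (X r) + g (X ?t)) \<le> L * B * h" .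
        qed
        moreover have "(V ?t + ?t *\<^sub>R g (X ?t)) - (V ?s + ?s *\<^sub>R g (X ?t)) = V ?t - V ?s + h *\<^sub>R g (X ?t)"
          unfolding t by (simp add: algebra_simps)
        moreover have "(L * B * h) * ?t - (L * B * h) * ?s = L * B * h\<^sup>2" unfolding t by (simp add: algebra_simps power2_eq_square)
        ultimately show ?thesis by (simp only:)
      qed
      let ?ex = "norm (fst y - X ?s)" and ?ev = "norm (snd y - V ?s)"
      have ek: "e k = ?ex + ?ev" by (simp add: e_def y_def)
      have ex': "norm (y1 - X ?t) \<le> ?ex + h * ?ev + B * h\<^sup>2"
      proof -
        have "y1 - X ?t = (fst y - X ?s) + h *\<^sub>R (snd y - V ?s) - (X ?t - X ?s - h *\<^sub>R V ?s)"
          by (simp add: y1_def algebra_simps)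
        then have "norm (y1 - X ?t) \<le> norm (fst y - X ?s) + norm (h *\<^sub>R (snd y - V ?s)) + norm (X ?t - X ?s - h *\<^sub>R V ?s)"
          by (simp only: norm_add_diff_le)
        then show ?thesis using x_exact h by simp
      qed
      have ev': "norm (snd y - h *\<^sub>R g y1 - V ?t) \<le> ?ev + h * (L * norm (y1 - X ?t)) + L * B * h\<^sup>2"
      proof -
        have "snd y - h *\<^sub>R g y1 - V ?t = (snd y - V ?s) + h *\<^sub>R (g (X ?t) - g y1) - (V ?t - V ?s + h *\<^sub>R g (X ?t))"
          by (simp add: algebra_simps)
        then have "norm (snd y - h *\<^sub>R g y1 - V ?t) \<le> ?ev + norm (h *\<^sub>R (g (X ?t) - g y1)) + norm (V ?t - V ?s + h *\<^sub>R g (X ?t))"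
          by (simp only: norm_add_diff_le)
        moreover have "norm (h *\<^sub>R (g (X ?t) - g y1)) \<le> h * (L * norm (y1 - X ?t))"
          using g_lip[of "X ?t" y1] h by (simp add: norm_minus_commute mult_left_mono)
        ultimately show ?thesis using v_exact by linarith
      qed
      have "e (Suc k) = norm (y1 - X ?t) + norm (snd y - h *\<^sub>R g y1 - V ?t)"
        unfolding e_def y' by simp
      also have "\<dots> \<le> (1 + h * L) * norm (y1 - X ?t) + ?ev + L * B * h\<^sup>2" using ev' by (simp add: algebra_simps)
      also have "\<dots> \<le> (1 + h * L) * (?ex + h * ?ev + B * h\<^sup>2) + ?ev + L * B * h\<^sup>2"
        using ex' h L_pos by (intro add_right_mono mult_left_mono) auto
      also have "\<dots> = ?ex + ?ev + h * (L * ?ex + ?ev + (h * L) * ?ev) + (B + (h * L) * B + L * B) * h\<^sup>2"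
        by (simp add: algebra_simps power2_eq_square)
      also have "\<dots> \<le> ?ex + ?ev + h * (K * (?ex + ?ev)) + (B * K) * h\<^sup>2"
      proof -
        have hL: "(h * L) * a \<le> (\<delta> * L) * a" if "0 \<le> a" for a
          using that h L_pos by (intro mult_right_mono) auto
        have nn: "0 \<le> ?ex" "0 \<le> L * \<delta> * ?ex" "0 \<le> L * ?ev" using L_pos \<delta>_pos by auto
        have "K * (?ex + ?ev) = ?ex + L * ?ex + L * \<delta> * ?ex + ?ev + L * ?ev + (\<delta> * L) * ?ev"
          by (simp add: K_def algebra_simps)
        then have "L * ?ex + ?ev + (h * L) * ?ev \<le> K * (?ex + ?ev)"
          using nn hL[OF norm_ge_zero[of "snd y - V ?s"]] by linarith
        then have 1: "h * (L * ?ex + ?ev + (h * L) * ?ev) \<le> h * (K * (?ex + ?ev))"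
          using h by (intro mult_left_mono) auto
        have "B + (h * L) * B + L * B \<le> B * K" using hL[OF B0] by (simp add: K_def algebra_simps)
        then have "(B + (h * L) * B + L * B) * h\<^sup>2 \<le> (B * K) * h\<^sup>2" by (rule mult_right_mono) simp
        with 1 show ?thesis by linarith
      qed
      finally show ?thesis unfolding ek by (simp add: algebra_simps)
    qed
    \<comment> \<open>Discrete Gronwall inequality, with every weight of the sum replaced by the
      largest one.\<close>
    have e_bound: "e k \<le> real k * (B * K * h\<^sup>2) * (1 + K * h) ^ k" if "k \<le> Suc n" for k
      using that
    proof (induction k)
      case 0
      then show ?case using path by (simp add: e_def is_path_def)
    next
      case (Suc k)
      let ?q = "1 + K * h" and ?c = "B * K * h\<^sup>2"
      have q: "1 \<le> ?q" using K0 h by simp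
      have c: "0 \<le> ?c" using B0 K0 by simp
      have "e (Suc k) \<le> ?q * e k + ?c" using e_step Suc by simp
      also have "\<dots> \<le> ?q * (real k * ?c * ?q ^ k) + ?c * ?q ^ Suc k"
        using Suc q c one_le_power[OF q, of "Suc k"] mult_left_mono[of 1 "?q ^ Suc k" ?c]
        by (intro add_mono mult_left_mono) auto
      also have "\<dots> = real (Suc k) * ?c * ?q ^ Suc k" by (simp add: algebra_simps)
      finally show ?case .
    qed
    have "dist (euler_iter n z) (X \<delta>, V \<delta>) \<le> e (Suc n)"
    proof -
      have "dist (euler_iter n z) (X \<delta>, V \<delta>) = norm ((euler h ^^ Suc n) z - (X \<delta>, V \<delta>))"
        by (simp add: euler_iter_def h_def dist_norm del: funpow.simps)
      also have "\<dots> \<le> norm (fst ((euler h ^^ Suc n) z) - X \<delta>) + norm (snd ((euler h ^^ Suc n) z) - V \<delta>)"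
        using norm_Pair_le[of "fst ((euler h ^^ Suc n) z) - X \<delta>" "snd ((euler h ^^ Suc n) z) - V \<delta>"]
        by (metis fst_diff snd_diff fst_conv snd_conv prod.collapse)
      also have "\<dots> = e (Suc n)" unfolding e_def using h(3) by (simp add: mult.commute del: funpow.simps of_nat_Suc)
      finally show ?thesis .
    qed
    also have "\<dots> \<le> real (Suc n) * (B * K * h\<^sup>2) * (1 + K * h) ^ Suc n" by (rule e_bound) simp
    also have "\<dots> \<le> real (Suc n) * (B * K * h\<^sup>2) * exp (K * \<delta>)"
    proof (rule mult_left_mono)
      have "(1 + K * h) ^ Suc n \<le> exp (K * h) ^ Suc n"
        using exp_ge_add_one_self[of "K * h"] K0 h by (intro power_mono) auto
      also have "\<dots> = exp (real (Suc n) * (K * h))" by (rule exp_of_nat_mult[symmetric])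
      also have "\<dots> = exp (K * \<delta>)" using h(3) by (simp add: mult_ac)
      finally show "(1 + K * h) ^ Suc n \<le> exp (K * \<delta>)" .
    qed (use B0 K0 in auto)
    also have "\<dots> = B * K * h * exp (K * \<delta>) * (h * real (Suc n))"
      by (simp only: power2_eq_square mult_ac)
    also have "\<dots> = B * K * \<delta> * exp (K * \<delta>) * h" unfolding h(3) by (simp only: mult_ac)
    finally show ?thesis by (simp only: h_def)
  qed
  have "(\<lambda>n. B * K * \<delta> * exp (K * \<delta>) * (\<delta> * inverse (real (Suc n)))) \<longlonglongrightarrow> B * K * \<delta> * exp (K * \<delta>) * (\<delta> * 0)"
    by (intro tendsto_mult_left LIMSEQ_inverse_real_of_nat)
  then have lim: "(\<lambda>n. B * K * \<delta> * exp (K * \<delta>) * (\<delta> / real (Suc n))) \<longlonglongrightarrow> 0"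
    by (simp only: divide_inverse mult_zero_right)
  have "(\<lambda>n. dist (euler_iter n z) (X \<delta>, V \<delta>)) \<longlonglongrightarrow> 0"
    by (rule Lim_null_comparison[OF always_eventually lim]) (use err in \<open>auto simp del: of_nat_Suc\<close>)
  then show ?thesis by (rule iffD2[OF tendsto_dist_iff])
qed

lemma euler_iter_flow: "(\<lambda>n. euler_iter n z) \<longlonglongrightarrow> flow z"
  unfolding flow_def by (rule euler_iter_tendsto[OF is_path])

lemma flow_measurable[measurable]: "flow \<in> borel_measurable borel"
  by (rule borel_measurable_LIMSEQ_metric[OF vol_pres_measurable[OF vol_pres_euler_iter] euler_iter_flow])

lemma energy_measurable[measurable]: "energy \<in> borel_measurable borel"
  by (rule borel_measurable_continuous_onI[OF energy_cont])

definition boltzmann :: "('a \<times> 'a) measure" where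
  "boltzmann = density lborel (\<lambda>z. ennreal (exp (- energy z)))"

lemma sets_boltzmann[simp, measurable_cong]: "sets boltzmann = sets borel"
  by (simp add: boltzmann_def)

lemma space_boltzmann[simp]: "space boltzmann = UNIV"
  by (simp add: boltzmann_def)

text \<open>On an open set the indicator is lower semicontinuous, so Fatou's lemma along the
  volume-preserving Euler schemes gives an inequality; energy conservation moves the weight to the
  image point. Outer regularity extends the inequality to Borel sets, and equality of the finite
  total masses, applied to complements, turns it into an equality.\<close>

lemma flow_boltzmann:
  assumes fin: "emeasure boltzmann UNIV \<noteq> \<infinity>"
  shows "distr boltzmann borel flow = boltzmann"
proof -
  have open_le: "emeasure (distr boltzmann borel flow) A \<le> emeasure boltzmann A" if A: "open A" for A
  proof -
    have [measurable]: "A \<in> sets borel" using A by simp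
    have [measurable]: "euler_iter n \<in> borel_measurable borel" for n
      by (rule vol_pres_measurable[OF vol_pres_euler_iter])
    let ?f = "\<lambda>z. indicator A z * ennreal (exp (- energy z))"
    have "emeasure (distr boltzmann borel flow) A = (\<integral>\<^sup>+z. indicator A (flow z) \<partial>boltzmann)"
      by (subst nn_integral_indicator[symmetric], simp, subst nn_integral_distr) (auto simp: boltzmann_def)
    also have "\<dots> = (\<integral>\<^sup>+z. ?f (flow z) \<partial>lborel)"
      unfolding boltzmann_def by (subst nn_integral_density) (auto simp: energy_flow mult.commute)
    also have "\<dots> \<le> (\<integral>\<^sup>+z. liminf (\<lambda>n. ?f (euler_iter n z)) \<partial>lborel)"
    proof (rule nn_integral_mono)
      fix z
      show "?f (flow z) \<le> liminf (\<lambda>n. ?f (euler_iter n z))"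
      proof (cases "flow z \<in> A")
        case True
        have ev: "\<forall>\<^sub>F n in sequentially. euler_iter n z \<in> A"
          by (rule topological_tendstoD[OF euler_iter_flow A True])
        have "(\<lambda>n. ennreal (exp (- energy (euler_iter n z)))) \<longlonglongrightarrow> ennreal (exp (- energy (flow z)))"
          by (intro tendsto_ennrealI tendsto_intros continuous_on_tendsto_compose[OF energy_cont euler_iter_flow]) auto
        then have "(\<lambda>n. ?f (euler_iter n z)) \<longlonglongrightarrow> ennreal (exp (- energy (flow z)))"
          by (rule Lim_transform_eventually) (use ev in \<open>auto elim!: eventually_mono\<close>)
        then show ?thesis using True by (simp add: lim_imp_Liminf)
      qed simp
    qed
    also have "\<dots> \<le> liminf (\<lambda>n. \<integral>\<^sup>+z. ?f (euler_iter n z) \<partial>lborel)"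
      by (rule nn_integral_liminf) simp
    also have "\<dots> = liminf (\<lambda>n. \<integral>\<^sup>+z. ?f z \<partial>lborel)"
      by (subst nn_integral_vol_pres[OF vol_pres_euler_iter]) auto
    also have "\<dots> = emeasure boltzmann A"
      by (simp add: Liminf_const boltzmann_def emeasure_density mult.commute)
    finally show ?thesis .
  qed
  have le: "emeasure (distr boltzmann borel flow) B \<le> emeasure boltzmann B" if B: "B \<in> sets borel" for B
  proof -
    have "emeasure boltzmann B = (INF A\<in>{A. B \<subseteq> A \<and> open A}. emeasure boltzmann A)"
      using fin B by (intro outer_regular) auto
    moreover have "emeasure (distr boltzmann borel flow) B \<le> emeasure boltzmann A" if "B \<subseteq> A" "open A" for A
      using open_le[of A] emeasure_mono[of B A "distr boltzmann borel flow"] that by (auto intro: order_trans)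
    ultimately show ?thesis by (auto intro!: INF_greatest)
  qed
  show ?thesis
  proof (rule measure_eqI)
    fix B assume "B \<in> sets (distr boltzmann borel flow)"
    then have B[measurable]: "B \<in> sets borel" by simp
    let ?N = "distr boltzmann borel flow"
    have tot: "emeasure ?N UNIV = emeasure boltzmann UNIV"
      by (subst emeasure_distr) (auto simp: boltzmann_def)
    have "emeasure boltzmann B + emeasure boltzmann (- B) = emeasure boltzmann UNIV"
      by (subst plus_emeasure) (auto simp: boltzmann_def)
    moreover have "emeasure ?N B + emeasure ?N (- B) = emeasure ?N UNIV"
      by (subst plus_emeasure) auto
    moreover have fin': "emeasure boltzmann (- B) \<noteq> \<infinity>"
      using fin emeasure_mono[of "- B" UNIV boltzmann] by (auto simp: top_unique)
    ultimately have "emeasure boltzmann B + emeasure boltzmann (- B) \<le> emeasure ?N B + emeasure boltzmann (- B)"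
      using tot le[of "- B"] B by (metis add_left_mono borel_comp)
    then have "emeasure boltzmann B \<le> emeasure ?N B"
      using fin' by (metis add.commute ennreal_add_left_cancel_le infinity_ennreal_def)
    then show "emeasure ?N B = emeasure boltzmann B" using le[OF B] by (rule antisym[rotated])
  qed simp
qed

end

section \<open>Local error of the Verlet step\<close>

lemma rpow_nonneg: "0 \<le> rpow t s"
  by (simp add: rpow_def)

lemma rpow_mono:
  assumes "0 \<le> a" "a \<le> b" "0 \<le> s" shows "rpow a s \<le> rpow b s"
  using assms by (auto simp: rpow_def intro: powr_mono2)

lemma rpow_powr:
  assumes "0 < A" shows "rpow A s = A powr s"
  using assms by (simp add: rpow_def)

text \<open>The tangent of t^l at t = 1. Its coefficients 1 / l and (l - 1) / l add up to one, so
  replacing t by an l-th power loses nothing if that power has mean at most one.\<close>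

lemma le_powr_affine:
  fixes t l :: real assumes "0 \<le> t" "1 \<le> l" shows "t \<le> (t powr l + (l - 1)) / l"
proof (cases "t = 0")
  case False
  then have "1 powr (l - 1) * (t - 1) \<le> (t powr l - 1 powr l) / l"
    using assms by (intro young_powr) auto
  then show ?thesis using assms by (simp add: field_simps)
qed (use assms in auto)

lemma square_le_one_plus_powr:
  fixes t l :: real assumes "0 \<le> t" "2 \<le> l" shows "t\<^sup>2 \<le> 1 + t powr l"
proof (cases "t \<le> 1")
  case True
  then have "t\<^sup>2 \<le> 1" using assms by (simp add: power_le_one)
  then show ?thesis by (smt (verit) powr_ge_zero)
next
  case False
  then have "t powr 2 \<le> t powr l" using assms by (intro powr_mono) auto
  then show ?thesis using False by (simp add: powr_numeral)
qed

lemma cube_le_one_plus_powr: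
  fixes t l :: real assumes "0 \<le> t" "3 \<le> l" shows "t^3 \<le> 1 + t powr l"
proof (cases "t \<le> 1")
  case True
  then have "t^3 \<le> 1" using assms by (simp add: power_le_one)
  then show ?thesis by (smt (verit) powr_ge_zero)
next
  case False
  then have "t powr 3 \<le> t powr l" using assms by (intro powr_mono) auto
  then show ?thesis using False by (simp add: powr_numeral)
qed

text \<open>The two summands on the right serve the cases m > 1 and m \<le> 1; this removes
  intermediate powers of m.\<close>

lemma powr_neg_le:
  fixes m a b :: real assumes "0 < m" "0 \<le> a" "a \<le> b" shows "m powr (- a) \<le> 1 + m powr (- b)"
proof (cases "m \<le> 1")
  case True
  have "m powr (- a) \<le> m powr (- b)" using True assms by (intro powr_mono') auto
  then show ?thesis by simp
next
  case False
  have "m powr (- a) \<le> m powr 0" using False assms by (intro powr_mono) auto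
  then show ?thesis using assms by (smt (verit) powr_ge_zero powr_zero_eq_one)
qed

lemma powr_max3_le:
  fixes a b c s :: real assumes "0 \<le> a" "0 \<le> b" "0 \<le> c"
  shows "(max a (max b c)) powr s \<le> a powr s + b powr s + c powr s"
  by (smt (verit) max_def powr_ge_zero)

locale growth = obabo +
  fixes l Ll :: real
  assumes l_ge: "2 \<le> l" and Ll_pos: "0 < Ll"
    and H_growth: "\<And>x y h. norm (H y h - H x h)
      \<le> Ll / 4 * norm (x - y) * (2 + rpow (norm (x - xs)) (l - 2) + rpow (norm (y - xs)) (l - 2)) * norm h"
begin

lemma H_growth_ball:
  assumes "norm (x - xs) \<le> r" "norm (y - xs) \<le> r"
  shows "norm (H y h - H x h) \<le> Ll / 2 * (1 + rpow r (l - 2)) * norm (x - y) * norm h"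
proof -
  have "rpow (norm (x - xs)) (l - 2) \<le> rpow r (l - 2)" "rpow (norm (y - xs)) (l - 2) \<le> rpow r (l - 2)"
    using assms l_ge by (auto intro: rpow_mono)
  then have "Ll / 4 * norm (x - y) * (2 + rpow (norm (x - xs)) (l - 2) + rpow (norm (y - xs)) (l - 2)) * norm h
      \<le> Ll / 4 * norm (x - y) * (2 + rpow r (l - 2) + rpow r (l - 2)) * norm h"
    using Ll_pos by (intro mult_right_mono mult_left_mono) auto
  also have "\<dots> = Ll / 2 * (1 + rpow r (l - 2)) * norm (x - y) * norm h" by (simp add: algebra_simps)
  finally show ?thesis using H_growth[of y h x] by linarith
qed

text \<open>\<open>S\<close> bounds the speed along the path, and integrating V = v - s g(x) +
  O(s^2) gives the position error. \<open>C\<close> is a Lipschitz constant in time of the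
  derivative of the force along the path, so the trapezoidal rule for the force is wrong by at most
  C \<delta>^3 / 12; the last term arises because Verlet evaluates the second force at its own end
  point.\<close>

lemma path_error:
  assumes path: "is_path (x, v) X V"
  defines "S \<equiv> 101/100 * (norm v + \<delta> * norm (g x))"
  defines "C \<equiv> L * (norm (g x) + L * \<delta> * S) + Ll / 2 * (1 + rpow (norm (x - xs) + \<delta> * S) (l - 2)) * S\<^sup>2"
  shows "norm (X \<delta> - fst (verlet (x, v))) \<le> L * S * \<delta>^3 / 6"
    and "norm (V \<delta> - snd (verlet (x, v))) \<le> C * \<delta>^3 / 12 + L\<^sup>2 * S * \<delta>^4 / 12"
proof -
  have dX: "(X has_vector_derivative V s) (at s within {0..\<delta>})"
    and dV: "(V has_vector_derivative - g (X s)) (at s within {0..\<delta>})" if "s \<in> {0..\<delta>}" for s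
    using path that by (auto simp: is_path_def)
  have ini: "X 0 = x" "V 0 = v" using path by (auto simp: is_path_def)
  have Vc: "continuous_on {0..\<delta>} V" by (rule vector_derivative_continuous_on[OF dV])
  let ?G = "norm (g x)"
  have V_bound: "norm (V s) \<le> S" if s: "s \<in> {0..\<delta>}" for s
  proof -
    \<comment> \<open>The maximal speed is bounded in terms of itself with the factor L \<delta>^2,
      which is then absorbed; this explains the constant 101/100 in \<open>S\<close>.\<close>
    obtain t where t: "t \<in> {0..\<delta>}" and tmax: "\<And>r. r \<in> {0..\<delta>} \<Longrightarrow> norm (V r) \<le> norm (V t)"
    proof -
      have "\<exists>t\<in>{0..\<delta>}. \<forall>r\<in>{0..\<delta>}. norm (V r) \<le> norm (V t)"
        using \<delta>_pos by (intro continuous_attains_sup continuous_on_norm Vc) auto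
      then show ?thesis using that by blast
    qed
    let ?B = "norm (V t)"
    have X1: "norm (X r - x) \<le> ?B * \<delta>" if r: "r \<in> {0..\<delta>}" for r
    proof -
      have "norm (X r - X 0) \<le> ?B * r - ?B * 0"
        by (rule vector_derivative_bound[where f=X and \<phi>="\<lambda>s. ?B * s" and T=\<delta>, OF dX])
           (use r tmax in \<open>auto intro!: derivative_eq_intros\<close>)
      also have "\<dots> \<le> ?B * \<delta>" using r by (auto intro: mult_left_mono)
      finally show ?thesis by (simp add: ini)
    qed
    have "norm (V t - V 0) \<le> (?G + L * (?B * \<delta>)) * t - (?G + L * (?B * \<delta>)) * 0"
    proof (rule vector_derivative_bound[where f=V and \<phi>="\<lambda>s. (?G + L * (?B * \<delta>)) * s" and \<phi>'="\<lambda>_. ?G + L * (?B * \<delta>)" and T=\<delta>, OF dV])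
      fix r assume r: "r \<in> {0..\<delta>}"
      have "norm (g (X r)) \<le> ?G + norm (g (X r) - g x)" using norm_triangle_ineq2[of "g (X r)" "g x"] by linarith
      also have "norm (g (X r) - g x) \<le> L * (?B * \<delta>)"
        using g_lip[of "X r" x] X1[OF r] L_pos by (meson mult_left_mono less_imp_le order_trans)
      finally show "norm (- g (X r)) \<le> ?G + L * (?B * \<delta>)" by simp
    qed (use t in \<open>auto intro!: derivative_eq_intros\<close>)
    also have "\<dots> \<le> (?G + L * (?B * \<delta>)) * \<delta>" using t L_pos \<delta>_pos by (auto intro!: mult_left_mono)
    also have "\<dots> = \<delta> * ?G + (L * \<delta>\<^sup>2) * ?B" by (simp add: algebra_simps power2_eq_square)
    also have "\<dots> \<le> \<delta> * ?G + 1/69696 * ?B" using mult_right_mono[OF L\<delta>2, of ?B] by simp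
    finally have "norm (V t - v) \<le> \<delta> * ?G + 1/69696 * ?B" by (simp add: ini)
    moreover have "?B \<le> norm v + norm (V t - v)" using norm_triangle_ineq2[of "V t" v] by linarith
    moreover have "0 \<le> norm v" "0 \<le> \<delta> * ?G" using \<delta>_pos by auto
    ultimately have "?B \<le> S" unfolding S_def distrib_left by linarith
    then show ?thesis using tmax[OF s] by linarith
  qed
  have S0: "0 \<le> S" using \<delta>_pos by (simp add: S_def)
  have X_lip: "norm (X b - X a) \<le> S * (b - a)" if "0 \<le> a" "a \<le> b" "b \<le> \<delta>" for a b
  proof -
    have "norm (X b - X a) \<le> S * b - S * a"
      by (rule vector_derivative_bound[where f=X and \<phi>="\<lambda>s. S * s" and T=\<delta>, OF dX])
         (use V_bound that in \<open>auto intro!: derivative_eq_intros\<close>)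
    then show ?thesis by (simp add: algebra_simps)
  qed
  have X_bound: "norm (X s - x) \<le> S * s" if "s \<in> {0..\<delta>}" for s
    using X_lip[of 0 s] that by (auto simp: ini)
  have g_diff: "norm (g (X s) - g x) \<le> L * S * s" if "s \<in> {0..\<delta>}" for s
    using order_trans[OF g_lip mult_left_mono[OF X_bound[OF that]]] L_pos by (simp add: mult.assoc)
  have gX_bound: "norm (g (X s)) \<le> ?G + L * \<delta> * S" if s: "s \<in> {0..\<delta>}" for s
  proof -
    have "norm (g (X s)) \<le> ?G + norm (g (X s) - g x)" using norm_triangle_ineq2[of "g (X s)" "g x"] by linarith
    moreover have "L * S * s \<le> L * S * \<delta>" using s S0 L_pos by (intro mult_left_mono) auto
    ultimately show ?thesis using g_diff[OF s] by (simp add: mult_ac)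
  qed
  have V_lip: "norm (V b - V a) \<le> (?G + L * \<delta> * S) * (b - a)" if "0 \<le> a" "a \<le> b" "b \<le> \<delta>" for a b
  proof -
    have "norm (V b - V a) \<le> (?G + L * \<delta> * S) * b - (?G + L * \<delta> * S) * a"
      by (rule vector_derivative_bound[where f=V and \<phi>="\<lambda>s. (?G + L * \<delta> * S) * s" and \<phi>'="\<lambda>_. ?G + L * \<delta> * S" and T=\<delta>, OF dV])
         (use gX_bound that in \<open>auto intro!: derivative_eq_intros\<close>)
    then show ?thesis by (simp add: algebra_simps)
  qed
  have v1: "norm (V s - v + s *\<^sub>R g x) \<le> L * S * s\<^sup>2 / 2" if s: "s \<in> {0..\<delta>}" for s
  proof -
    have "norm ((V s + s *\<^sub>R g x) - (V 0 + 0 *\<^sub>R g x)) \<le> L * S * s\<^sup>2 / 2 - L * S * 0\<^sup>2 / 2"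
    proof (rule vector_derivative_bound[where f="\<lambda>s. V s + s *\<^sub>R g x" and \<phi>="\<lambda>s. L * S * s\<^sup>2 / 2"
          and f'="\<lambda>s. - g (X s) + g x" and \<phi>'="\<lambda>s. L * S * s" and T=\<delta>])
      fix r assume r: "r \<in> {0..\<delta>}"
      show "((\<lambda>s. V s + s *\<^sub>R g x) has_vector_derivative - g (X r) + g x) (at r within {0..\<delta>})"
        using dV[OF r] by (auto intro!: derivative_eq_intros)
      show "((\<lambda>s. L * S * s\<^sup>2 / 2) has_vector_derivative L * S * r) (at r within {0..\<delta>})"
        by (auto intro!: derivative_eq_intros simp: has_real_derivative_iff_has_vector_derivative[symmetric])
      show "norm (- g (X r) + g x) \<le> L * S * r" using g_diff[OF r] by (simp add: norm_minus_commute)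
    qed (use s in auto)
    then show ?thesis by (simp add: ini algebra_simps)
  qed
  have "norm ((X \<delta> - \<delta> *\<^sub>R v + (\<delta>\<^sup>2 / 2) *\<^sub>R g x) - (X 0 - 0 *\<^sub>R v + (0\<^sup>2 / 2) *\<^sub>R g x)) \<le> L * S * \<delta>^3 / 6 - L * S * 0^3 / 6"
  proof (rule vector_derivative_bound[where f="\<lambda>s. X s - s *\<^sub>R v + (s\<^sup>2 / 2) *\<^sub>R g x" and \<phi>="\<lambda>s. L * S * s^3 / 6"
        and f'="\<lambda>s. V s - v + s *\<^sub>R g x" and \<phi>'="\<lambda>s. L * S * s\<^sup>2 / 2" and T=\<delta>])
    fix r assume r: "r \<in> {0..\<delta>}"
    show "((\<lambda>s. X s - s *\<^sub>R v + (s\<^sup>2 / 2) *\<^sub>R g x) has_vector_derivative V r - v + r *\<^sub>R g x) (at r within {0..\<delta>})"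
      by (auto intro!: derivative_eq_intros dX[OF r] simp: has_real_derivative_iff_has_vector_derivative[symmetric])
    show "((\<lambda>s. L * S * s^3 / 6) has_vector_derivative L * S * r\<^sup>2 / 2) (at r within {0..\<delta>})"
      by (auto intro!: derivative_eq_intros simp: has_real_derivative_iff_has_vector_derivative[symmetric])
    show "norm (V r - v + r *\<^sub>R g x) \<le> L * S * r\<^sup>2 / 2" by (rule v1[OF r])
  qed (use \<delta>_pos in auto)
  moreover have "(X \<delta> - \<delta> *\<^sub>R v + (\<delta>\<^sup>2 / 2) *\<^sub>R g x) - (X 0 - 0 *\<^sub>R v + (0\<^sup>2 / 2) *\<^sub>R g x) = X \<delta> - fst (verlet (x, v))"
    by (simp add: verlet_def Let_def ini)
  ultimately show ex: "norm (X \<delta> - fst (verlet (x, v))) \<le> L * S * \<delta>^3 / 6" by (simp only:) simp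
  let ?r = "norm (x - xs) + \<delta> * S"
  let ?\<Lambda> = "Ll / 2 * (1 + rpow ?r (l - 2))"
  have \<Lambda>0: "0 \<le> ?\<Lambda>" using Ll_pos by (simp add: rpow_nonneg add_nonneg_nonneg)
  have C0: "0 \<le> C" using \<Lambda>0 L_pos \<delta>_pos S0 by (simp add: C_def)
  have X_ball: "norm (X s - xs) \<le> ?r" if s: "s \<in> {0..\<delta>}" for s
  proof -
    have "norm (X s - xs) \<le> norm (X s - x) + norm (x - xs)" using norm_triangle_ineq[of "X s - x" "x - xs"] by simp
    moreover have "S * s \<le> S * \<delta>" using s S0 by (intro mult_left_mono) auto
    ultimately show ?thesis using X_bound[OF s] by (simp add: mult.commute)
  qed
  have HV: "norm (H (X r) (V r) - H (X s) (V s)) \<le> C * (s - r)" if rs: "0 \<le> r" "r \<le> s" "s \<le> \<delta>" for r s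
  proof -
    have in': "r \<in> {0..\<delta>}" "s \<in> {0..\<delta>}" using rs by auto
    have "H (X r) (V r) - H (X s) (V s) = H (X r) (V r - V s) + (H (X r) (V s) - H (X s) (V s))"
      by (simp add: linear_diff[OF H_linear])
    then have "norm (H (X r) (V r) - H (X s) (V s)) \<le> norm (H (X r) (V r - V s)) + norm (H (X r) (V s) - H (X s) (V s))"
      by (metis norm_triangle_ineq)
    also have "norm (H (X r) (V r - V s)) \<le> L * ((?G + L * \<delta> * S) * (s - r))"
    proof -
      have "norm (H (X r) (V r - V s)) \<le> L * norm (V s - V r)" using norm_H_le by (metis norm_minus_commute)
      also have "\<dots> \<le> L * ((?G + L * \<delta> * S) * (s - r))" using V_lip[OF rs] L_pos by (intro mult_left_mono) auto
      finally show ?thesis .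
    qed
    also have "norm (H (X r) (V s) - H (X s) (V s)) \<le> ?\<Lambda> * (S * (s - r)) * S"
    proof -
      have "norm (H (X r) (V s) - H (X s) (V s)) \<le> ?\<Lambda> * norm (X s - X r) * norm (V s)"
        using H_growth_ball[OF X_ball[OF in'(2)] X_ball[OF in'(1)]] .
      also have "\<dots> \<le> ?\<Lambda> * (S * (s - r)) * S"
        using X_lip[OF rs] V_bound[OF in'(2)] \<Lambda>0 rs S0 by (intro mult_mono mult_left_mono) auto
      finally show ?thesis .
    qed
    also have "L * ((?G + L * \<delta> * S) * (s - r)) + ?\<Lambda> * (S * (s - r)) * S = C * (s - r)"
      by (simp add: C_def power2_eq_square distrib_right distrib_left mult_ac)
    finally show ?thesis by simp
  qed
  \<comment> \<open>The end time \<open>s\<close> is frozen in the subtracted term, so the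
    derivative in r is at most C (s - r), with integral C s^2 / 2.\<close>
  have gH: "norm (g (X s) - g x - s *\<^sub>R H (X s) (V s)) \<le> C * s\<^sup>2 / 2" if s: "s \<in> {0..\<delta>}" for s
  proof -
    have "norm ((g (X s) - s *\<^sub>R H (X s) (V s)) - (g (X 0) - 0 *\<^sub>R H (X s) (V s))) \<le> C * (s * s - s\<^sup>2 / 2) - C * (s * 0 - 0\<^sup>2 / 2)"
    proof (rule vector_derivative_bound[where f="\<lambda>r. g (X r) - r *\<^sub>R H (X s) (V s)" and \<phi>="\<lambda>r. C * (s * r - r\<^sup>2 / 2)"
          and f'="\<lambda>r. H (X r) (V r) - H (X s) (V s)" and \<phi>'="\<lambda>r. C * (s - r)" and T=\<delta>])
      fix r assume r: "r \<in> {0..\<delta>}"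
      have "(X has_derivative (\<lambda>t. t *\<^sub>R V r)) (at r within {0..\<delta>})"
        using dX[OF r] by (simp add: has_vector_derivative_def)
      then have "((\<lambda>s. g (X s)) has_derivative (\<lambda>t. H (X r) (t *\<^sub>R V r))) (at r within {0..\<delta>})"
        by (rule has_derivative_compose[OF _ g_deriv])
      then have "((\<lambda>s. g (X s)) has_vector_derivative H (X r) (V r)) (at r within {0..\<delta>})"
        by (simp add: has_vector_derivative_def linear_cmul[OF H_linear])
      then show "((\<lambda>r. g (X r) - r *\<^sub>R H (X s) (V s)) has_vector_derivative H (X r) (V r) - H (X s) (V s)) (at r within {0..\<delta>})"
        by (auto intro!: derivative_eq_intros)
      show "((\<lambda>r. C * (s * r - r\<^sup>2 / 2)) has_vector_derivative C * (s - r)) (at r within {0..\<delta>})"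
        by (auto intro!: derivative_eq_intros simp: has_real_derivative_iff_has_vector_derivative[symmetric])
      assume "r \<in> {0..s}"
      then show "norm (H (X r) (V r) - H (X s) (V s)) \<le> C * (s - r)" using s by (intro HV) auto
    qed (use s in auto)
    then show ?thesis by (simp add: ini algebra_simps power2_eq_square)
  qed
  \<comment> \<open>The trapezoid error is differentiated as a function of its end time; its
    derivative is half the quantity bounded in \<open>gH\<close>.\<close>
  have "norm ((V \<delta> + (\<delta> / 2) *\<^sub>R (g x + g (X \<delta>))) - (V 0 + (0 / 2) *\<^sub>R (g x + g (X 0)))) \<le> C * \<delta>^3 / 12 - C * 0^3 / 12"
  proof (rule vector_derivative_bound[where f="\<lambda>s. V s + (s / 2) *\<^sub>R (g x + g (X s))" and \<phi>="\<lambda>s. C * s^3 / 12"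
        and f'="\<lambda>s. - ((1 / 2) *\<^sub>R (g (X s) - g x - s *\<^sub>R H (X s) (V s)))" and \<phi>'="\<lambda>s. C * s\<^sup>2 / 4" and T=\<delta>])
    fix r assume r: "r \<in> {0..\<delta>}"
    have "(X has_derivative (\<lambda>t. t *\<^sub>R V r)) (at r within {0..\<delta>})"
      using dX[OF r] by (simp add: has_vector_derivative_def)
    then have "((\<lambda>s. g (X s)) has_derivative (\<lambda>t. H (X r) (t *\<^sub>R V r))) (at r within {0..\<delta>})"
      by (rule has_derivative_compose[OF _ g_deriv])
    then have dg: "((\<lambda>s. g (X s)) has_vector_derivative H (X r) (V r)) (at r within {0..\<delta>})"
      by (simp add: has_vector_derivative_def linear_cmul[OF H_linear])
    have "((\<lambda>s. V s + (s / 2) *\<^sub>R (g x + g (X s))) has_vector_derivative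
       (- g (X r) + ((r / 2) *\<^sub>R (0 + H (X r) (V r)) + (1 / 2) *\<^sub>R (g x + g (X r))))) (at r within {0..\<delta>})"
      by (intro has_vector_derivative_add has_vector_derivative_scaleR dV[OF r] dg has_vector_derivative_const)
         (auto intro!: derivative_eq_intros)
    moreover have "- g (X r) + ((r / 2) *\<^sub>R (0 + H (X r) (V r)) + (1 / 2) *\<^sub>R (g x + g (X r)))
       = - ((1 / 2) *\<^sub>R (g (X r) - g x - r *\<^sub>R H (X r) (V r)))"
    proof -
      have "- g (X r) = - ((1/2) *\<^sub>R g (X r)) - (1/2) *\<^sub>R g (X r)"
        by (metis add_divide_distrib add.inverse_distrib_swap diff_minus_eq_add field_sum_of_halves minus_diff_commute minus_diff_eq scaleR_half_double scaleR_add_right uminus_add_conv_diff)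
      then show ?thesis by (simp add: algebra_simps)
    qed
    ultimately show "((\<lambda>s. V s + (s / 2) *\<^sub>R (g x + g (X s))) has_vector_derivative
       - ((1 / 2) *\<^sub>R (g (X r) - g x - r *\<^sub>R H (X r) (V r)))) (at r within {0..\<delta>})" by simp
    show "((\<lambda>s. C * s^3 / 12) has_vector_derivative C * r\<^sup>2 / 4) (at r within {0..\<delta>})"
      by (auto intro!: derivative_eq_intros simp: has_real_derivative_iff_has_vector_derivative[symmetric])
    show "norm (- ((1 / 2) *\<^sub>R (g (X r) - g x - r *\<^sub>R H (X r) (V r)))) \<le> C * r\<^sup>2 / 4"
      unfolding norm_minus_cancel norm_scaleR using gH[OF r] by simp
  qed (use \<delta>_pos in auto)
  then have T: "norm (V \<delta> - v + (\<delta> / 2) *\<^sub>R (g x + g (X \<delta>))) \<le> C * \<delta>^3 / 12"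
    by (simp add: ini algebra_simps)
  \<comment> \<open>Exchanging the exact end point for that of Verlet costs \<delta> L / 2 times the
    position error.\<close>
  let ?x1 = "fst (verlet (x, v))"
  have "V \<delta> - snd (verlet (x, v)) = (V \<delta> - v + (\<delta> / 2) *\<^sub>R (g x + g (X \<delta>))) + (\<delta> / 2) *\<^sub>R (g ?x1 - g (X \<delta>))"
    by (simp add: verlet_def Let_def algebra_simps)
  then have "norm (V \<delta> - snd (verlet (x, v))) \<le> C * \<delta>^3 / 12 + norm ((\<delta> / 2) *\<^sub>R (g ?x1 - g (X \<delta>)))"
    using order_trans[OF norm_triangle_ineq add_right_mono[OF T]] by (simp only:)
  also have "norm ((\<delta> / 2) *\<^sub>R (g ?x1 - g (X \<delta>))) \<le> \<delta> / 2 * (L * (L * S * \<delta>^3 / 6))"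
  proof -
    have "norm (g ?x1 - g (X \<delta>)) \<le> L * (L * S * \<delta>^3 / 6)"
      using g_lip[of ?x1 "X \<delta>"] mult_left_mono[OF ex, of L] L_pos unfolding norm_minus_commute[of "X \<delta>"] by linarith
    then show ?thesis using \<delta>_pos by (simp add: mult_left_mono)
  qed
  also have "\<delta> / 2 * (L * (L * S * \<delta>^3 / 6)) = L\<^sup>2 * S * \<delta>^4 / 12"
    by (simp add: power2_eq_square power3_eq_cube power4_eq_xxxx)
  finally show "norm (V \<delta> - snd (verlet (x, v))) \<le> C * \<delta>^3 / 12 + L\<^sup>2 * S * \<delta>^4 / 12" by simp
qed

text \<open>The normalised powers of velocity, force and position in terms of which all errors are
  expressed; \<open>R\<close> is the dimension-dependent scale of their moments.\<close>

definition vel_pow :: "real \<Rightarrow> real \<Rightarrow> 'a \<times> 'a \<Rightarrow> real" where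
  "vel_pow R s z = (norm (snd z) / sqrt R) powr s"

definition grad_pow :: "real \<Rightarrow> real \<Rightarrow> 'a \<times> 'a \<Rightarrow> real" where
  "grad_pow R s z = (norm (g (fst z)) / sqrt L / sqrt R) powr s"

definition pos_pow :: "real \<Rightarrow> real \<Rightarrow> 'a \<times> 'a \<Rightarrow> real" where
  "pos_pow R s z = (sqrt m * norm (fst z - xs) / sqrt R) powr s"

text \<open>One number that dominates all three normalised quantities. A power of a maximum is at
  most the sum of the powers, with factor one for every exponent.\<close>

lemma amplitude:
  fixes z :: "'a \<times> 'a" and R :: real
  assumes R: "1 \<le> R"
  obtains A where "0 \<le> A" "norm (snd z) \<le> sqrt R * A" "norm (g (fst z)) \<le> sqrt L * (sqrt R * A)"
    "norm (fst z - xs) \<le> sqrt R * A / sqrt m" "\<And>s. A powr s \<le> vel_pow R s z + grad_pow R s z + pos_pow R s z"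
proof
  let ?A = "max (norm (snd z) / sqrt R) (max (norm (g (fst z)) / sqrt L / sqrt R) (sqrt m * norm (fst z - xs) / sqrt R))"
  have sR: "0 < sqrt R" "0 < sqrt L" "0 < sqrt m" using R L_pos m_pos by auto
  show "0 \<le> ?A" using sR by (simp add: le_max_iff_disj)
  have a: "norm (snd z) / sqrt R \<le> ?A" and b: "norm (g (fst z)) / sqrt L / sqrt R \<le> ?A"
    and c: "sqrt m * norm (fst z - xs) / sqrt R \<le> ?A" by auto
  show "norm (snd z) \<le> sqrt R * ?A" using a sR by (subst (asm) pos_divide_le_eq) (auto simp: mult.commute)
  show "norm (g (fst z)) \<le> sqrt L * (sqrt R * ?A)"
    using b sR by (subst (asm) pos_divide_le_eq, simp, subst (asm) pos_divide_le_eq) (auto simp: mult_ac)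
  show "norm (fst z - xs) \<le> sqrt R * ?A / sqrt m"
    using c sR by (subst pos_le_divide_eq, simp, subst (asm) pos_divide_le_eq) (auto simp: mult_ac)
  show "?A powr s \<le> vel_pow R s z + grad_pow R s z + pos_pow R s z" for s
    unfolding vel_pow_def grad_pow_def pos_pow_def using sR by (intro powr_max3_le) auto
qed

text \<open>Here \<open>A\<close> bounds all normalised quantities, and \<open>S\<close> is a velocity-like quantity.\<close>

lemma growth_power_bound:
  fixes A R y S k :: real
  assumes A: "0 \<le> A" and R: "1 \<le> R" and y: "0 \<le> y" "y \<le> sqrt R * A / sqrt m"
    and S: "0 \<le> S" "S \<le> 102/100 * (sqrt R * A)" and k: "k = 2 \<or> k = 3"
  shows "(1 + rpow (y + \<delta> * S) (l - 2)) * S powr k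
    \<le> 107/100 * 2 powr (l - 2) * (1 + m powr (- ((l - 2 + k) / 2))) * R powr ((l - 2 + k) / 2) * (1 + 2 * A powr (l - 2 + k))"
proof (cases "A = 0")
  case True
  then have "S = 0" using S by simp
  then show ?thesis using m_pos by (simp add: True)
next
  case False
  then have A0: "0 < A" using A by simp
  define B where "B = sqrt R * A"
  define j where "j = l - 2 + k"
  have j: "k \<le> j" "2 \<le> k" "k \<le> 3" "0 \<le> j - k" using l_ge k by (auto simp: j_def)
  have sR: "1 \<le> sqrt R" using R by simp
  have B0: "0 < B" using A0 sR by (simp add: B_def)
  have sm: "0 < sqrt m" using m_pos by simp
  have d: "\<delta> * sqrt m \<le> 1/264"
  proof -
    have "\<delta> * sqrt m \<le> \<delta> * sqrt L" using m_le_L \<delta>_pos by simp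
    then show ?thesis using \<delta>_sqrt_L by linarith
  qed
  have "y + \<delta> * S \<le> B / sqrt m + \<delta> * (102/100 * B)"
    using y S \<delta>_pos by (intro add_mono mult_left_mono) (auto simp: B_def)
  also have "\<dots> = B / sqrt m * (1 + 102/100 * (\<delta> * sqrt m))" using sm by (simp add: field_simps)
  also have "\<dots> \<le> B / sqrt m * 2" using d B0 sm by (intro mult_left_mono) auto
  finally have le: "y + \<delta> * S \<le> 2 * (B / sqrt m)" by (simp only: mult.commute)
  have "rpow (y + \<delta> * S) (l - 2) \<le> rpow (2 * (B / sqrt m)) (l - 2)"
    using le y S \<delta>_pos l_ge by (intro rpow_mono) auto
  also have "\<dots> = 2 powr (l - 2) * (B powr (l - 2) * m powr (- ((l - 2) / 2)))"
  proof -
    have "rpow (2 * (B / sqrt m)) (l - 2) = 2 powr (l - 2) * (B / sqrt m) powr (l - 2)"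
      using B0 sm rpow_powr[of "2 * (B / sqrt m)" "l - 2"] powr_mult[of 2 "B / sqrt m" "l - 2"] by simp
    also have "(B / sqrt m) powr (l - 2) = B powr (l - 2) / (sqrt m powr (l - 2))"
      using B0 sm by (simp add: powr_divide)
    also have "sqrt m powr (l - 2) = m powr ((l - 2) / 2)"
      using m_pos by (simp add: powr_half_sqrt[symmetric] powr_powr)
    also have "B powr (l - 2) / m powr ((l - 2) / 2) = B powr (l - 2) * m powr (- ((l - 2) / 2))"
      by (simp add: powr_minus_divide)
    finally show ?thesis .
  qed
  finally have \<rho>: "rpow (y + \<delta> * S) (l - 2) \<le> 2 powr (l - 2) * (B powr (l - 2) * m powr (- ((l - 2) / 2)))" .
  \<comment> \<open>k \<le> 3, and 1.02^3 \<le> 1.07.\<close>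
  have Sk: "S powr k \<le> 107/100 * B powr k"
  proof -
    have "S powr k \<le> (102/100 * B) powr k" using S j by (intro powr_mono2) (auto simp: B_def)
    also have "\<dots> = (102/100) powr k * B powr k" by (rule powr_mult)
    also have "(102/100::real) powr k \<le> (102/100) powr 3" using j by (intro powr_mono) auto
    also have "(102/100::real) powr 3 \<le> 107/100" by (simp add: powr_numeral power3_eq_cube)
    finally show ?thesis by (simp add: mult_right_mono)
  qed
  have Rj: "R powr (k / 2) \<le> R powr (j / 2)" using R j by (intro powr_mono) auto
  have Bj: "B powr j = R powr (j / 2) * A powr j"
    unfolding B_def using R A0 by (simp add: powr_mult powr_half_sqrt[symmetric] powr_powr)
  have Bk: "B powr k \<le> R powr (j / 2) * (1 + A powr j)"
  proof -
    have "B powr k = R powr (k / 2) * A powr k"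
      unfolding B_def using R A0 by (simp add: powr_mult powr_half_sqrt[symmetric] powr_powr)
    also have "\<dots> \<le> R powr (j / 2) * (1 + A powr j)"
    proof (rule mult_mono[OF Rj])
      show "A powr k \<le> 1 + A powr j"
        using k square_le_one_plus_powr[OF A, of j] cube_le_one_plus_powr[OF A, of j] j A0
        by (auto simp: powr_numeral)
    qed auto
    finally show ?thesis .
  qed
  have mm: "m powr (- ((l - 2) / 2)) \<le> 1 + m powr (- (j / 2))" using l_ge j by (intro powr_neg_le m_pos) (auto simp: j_def)
  have two: "1 \<le> 2 powr (l - 2)" using l_ge by (simp add: ge_one_powr_ge_zero)
  let ?m = "1 + m powr (- (j / 2))"
  have "(1 + rpow (y + \<delta> * S) (l - 2)) * S powr k
      \<le> (1 + 2 powr (l - 2) * (B powr (l - 2) * m powr (- ((l - 2) / 2)))) * (107/100 * B powr k)"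
    using \<rho> Sk by (intro mult_mono) (auto simp: add_nonneg_nonneg)
  also have "\<dots> = 107/100 * (B powr k + 2 powr (l - 2) * m powr (- ((l - 2) / 2)) * B powr j)"
  proof -
    have "B powr (l - 2) * B powr k = B powr j" by (simp add: j_def powr_add)
    then show ?thesis by (simp add: algebra_simps)
  qed
  also have "\<dots> \<le> 107/100 * (2 powr (l - 2) * ?m * (R powr (j / 2) * (1 + A powr j)) + 2 powr (l - 2) * ?m * (R powr (j / 2) * A powr j))"
  proof (intro mult_left_mono add_mono)
    have "1 * 1 \<le> 2 powr (l - 2) * ?m" using two by (intro mult_mono) auto
    then have "B powr k * 1 \<le> (R powr (j / 2) * (1 + A powr j)) * (2 powr (l - 2) * ?m)"
      using Bk by (intro mult_mono) auto
    then show "B powr k \<le> 2 powr (l - 2) * ?m * (R powr (j / 2) * (1 + A powr j))" by (simp add: mult_ac)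
    show "2 powr (l - 2) * m powr (- ((l - 2) / 2)) * B powr j \<le> 2 powr (l - 2) * ?m * (R powr (j / 2) * A powr j)"
      unfolding Bj using mm by (intro mult_right_mono mult_left_mono) auto
  qed auto
  also have "\<dots> = 107/100 * 2 powr (l - 2) * ?m * R powr (j / 2) * (1 + 2 * A powr j)"
    by (simp add: algebra_simps)
  finally show ?thesis by (simp add: j_def)
qed

text \<open>Terms linear in velocity and force are raised to the power l by
  \<open>le_powr_affine\<close>; terms carrying the growth of the Hessian are l-th powers already.
  The result is affine in quantities whose moments will be at most one, so the moments of the error
  come down to the sum of its coefficients.\<close>

lemma local_error:
  assumes R: "1 \<le> R" and path: "is_path z X V"
  shows "norm (X \<delta> - fst (verlet z)) + norm (V \<delta> - snd (verlet z)) / sqrt L \<le>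
    \<delta>^3 * R powr (l / 2) * (L * (1/5 * ((vel_pow R l z + (l - 1)) / l) + 1/10 * ((grad_pow R l z + (l - 1)) / l))
      + Ll * 2 powr (l - 2) * (1 + m powr (- (l / 2))) / sqrt L * (1/22)
         * (1 + 2 * (vel_pow R l z + grad_pow R l z + pos_pow R l z)))"
proof -
  obtain x v where z: "z = (x, v)" by (cases z)
  define w G y a where "w = norm v" and "G = norm (g x) / sqrt L" and "y = norm (x - xs)" and "a = sqrt L"
  define S where "S = 101/100 * (norm v + \<delta> * norm (g x))"
  have a0: "0 < a" "a * a = L" "a \<noteq> 0" using L_pos by (auto simp: a_def)
  have da: "\<delta> * a \<le> 1/264" "0 \<le> \<delta> * a" using \<delta>_sqrt_L \<delta>_pos a0 by (auto simp: a_def)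
  have wG: "0 \<le> w" "0 \<le> G" using L_pos by (auto simp: w_def G_def)
  have gG: "norm (g x) = a * G" using a0 by (simp add: G_def a_def)
  have S: "S = 101/100 * (w + (\<delta> * a) * G)" by (simp add: S_def w_def gG)
  have dG: "(\<delta> * a) * G \<le> 1/264 * G" using da wG by (intro mult_right_mono) auto
  have S0: "0 \<le> S" unfolding S using wG mult_nonneg_nonneg[OF da(2) wG(2)] by simp
  define \<rho> where "\<rho> = rpow (y + \<delta> * S) (l - 2)"
  obtain A where A: "0 \<le> A" "norm (snd z) \<le> sqrt R * A" "norm (g (fst z)) \<le> sqrt L * (sqrt R * A)"
    "norm (fst z - xs) \<le> sqrt R * A / sqrt m" and Ap: "A powr l \<le> vel_pow R l z + grad_pow R l z + pos_pow R l z"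
    using amplitude[OF R, of z] by metis
  have GA: "G \<le> sqrt R * A" using A(3) a0 unfolding z by (simp add: G_def a_def[symmetric] pos_divide_le_eq mult.commute)
  have "S \<le> 102/100 * (sqrt R * A)"
  proof -
    have "0 \<le> sqrt R * A" using A(1) R by simp
    then show ?thesis using A(2) GA dG unfolding S by (simp add: z w_def)
  qed
  then have gp: "(1 + \<rho>) * S powr 2 \<le> 107/100 * 2 powr (l - 2) * (1 + m powr (- (l / 2))) * R powr (l / 2) * (1 + 2 * A powr l)"
    using growth_power_bound[OF A(1) R _ _ S0, of y 2] A(4) by (simp add: \<rho>_def y_def z)
  have "S powr 2 = S\<^sup>2" by (cases "S = 0") (use S0 in \<open>auto simp: powr_numeral\<close>)
  note gp = gp[unfolded this]
  have e1: "norm (X \<delta> - fst (verlet z)) \<le> L * S * \<delta>^3 / 6"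
    and e2: "norm (V \<delta> - snd (verlet z)) \<le> (L * (norm (g x) + L * \<delta> * S) + Ll / 2 * (1 + \<rho>) * S\<^sup>2) * \<delta>^3 / 12 + L\<^sup>2 * S * \<delta>^4 / 12"
    using path_error[OF path[unfolded z]] by (simp_all add: z S_def \<rho>_def y_def)
  have "norm (V \<delta> - snd (verlet z)) / a \<le> ((L * (norm (g x) + L * \<delta> * S) + Ll / 2 * (1 + \<rho>) * S\<^sup>2) * \<delta>^3 / 12 + L\<^sup>2 * S * \<delta>^4 / 12) / a"
    using e2 a0 by (intro divide_right_mono) auto
  also have "\<dots> = \<delta>^3 * (L * G / 12 + L * ((\<delta> * a) * S) / 6 + Ll / 24 / a * ((1 + \<rho>) * S\<^sup>2))"
    unfolding gG a0(2)[symmetric] using a0(3)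
    by (simp add: field_simps power2_eq_square power3_eq_cube power4_eq_xxxx)
  finally have e2': "norm (V \<delta> - snd (verlet z)) / a \<le> \<delta>^3 * (L * G / 12 + L * ((\<delta> * a) * S) / 6 + Ll / 24 / a * ((1 + \<rho>) * S\<^sup>2))" .
  have "norm (X \<delta> - fst (verlet z)) + norm (V \<delta> - snd (verlet z)) / a
     \<le> \<delta>^3 * (L * (S / 6 + G / 12 + (\<delta> * a) * S / 6) + Ll / 24 / a * ((1 + \<rho>) * S\<^sup>2))"
    using e1 e2' by (simp add: algebra_simps add_divide_distrib)
  also have "\<dots> \<le> \<delta>^3 * (R powr (l/2) * (L * (1/5 * ((vel_pow R l z + (l - 1)) / l) + 1/10 * ((grad_pow R l z + (l - 1)) / l)))
      + R powr (l/2) * (Ll * 2 powr (l - 2) * (1 + m powr (- (l / 2))) / a * (1/22)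
         * (1 + 2 * (vel_pow R l z + grad_pow R l z + pos_pow R l z))))"
  proof (intro mult_left_mono add_mono)
    have "(\<delta> * a) * S \<le> 1/264 * S" using da S0 by (intro mult_right_mono) auto
    then have 1: "S / 6 + G / 12 + (\<delta> * a) * S / 6 \<le> w / 5 + G / 10" using dG wG unfolding S by argo
    have sR: "0 < sqrt R" "sqrt R \<le> R powr (l / 2)"
    proof -
      show "0 < sqrt R" using R by simp
      have "R powr (1/2) \<le> R powr (l / 2)" using R l_ge by (intro powr_mono) auto
      then show "sqrt R \<le> R powr (l / 2)" using R by (simp add: powr_half_sqrt)
    qed
    have 2: "w \<le> R powr (l / 2) * ((vel_pow R l z + (l - 1)) / l)"
    proof -
      have "w = sqrt R * (w / sqrt R)" using sR by simp
      also have "\<dots> \<le> sqrt R * ((vel_pow R l z + (l - 1)) / l)"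
        using le_powr_affine[of "w / sqrt R" l] sR wG l_ge by (intro mult_left_mono) (auto simp: vel_pow_def z w_def)
      also have "\<dots> \<le> R powr (l / 2) * ((vel_pow R l z + (l - 1)) / l)"
        using sR l_ge by (intro mult_right_mono) (auto simp: vel_pow_def)
      finally show ?thesis .
    qed
    have 3: "G \<le> R powr (l / 2) * ((grad_pow R l z + (l - 1)) / l)"
    proof -
      have "G = sqrt R * (G / sqrt R)" using sR by simp
      also have "\<dots> \<le> sqrt R * ((grad_pow R l z + (l - 1)) / l)"
        using le_powr_affine[of "G / sqrt R" l] sR wG l_ge L_pos by (intro mult_left_mono) (auto simp: grad_pow_def z G_def)
      also have "\<dots> \<le> R powr (l / 2) * ((grad_pow R l z + (l - 1)) / l)"
        using sR l_ge by (intro mult_right_mono) (auto simp: grad_pow_def)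
      finally show ?thesis .
    qed
    have "S / 6 + G / 12 + (\<delta> * a) * S / 6
        \<le> R powr (l / 2) * (1/5 * ((vel_pow R l z + (l - 1)) / l) + 1/10 * ((grad_pow R l z + (l - 1)) / l))"
      using 1 2 3 unfolding distrib_left by linarith
    then have "L * (S / 6 + G / 12 + (\<delta> * a) * S / 6)
        \<le> L * (R powr (l / 2) * (1/5 * ((vel_pow R l z + (l - 1)) / l) + 1/10 * ((grad_pow R l z + (l - 1)) / l)))"
      using L_pos by (intro mult_left_mono) auto
    then show "L * (S / 6 + G / 12 + (\<delta> * a) * S / 6)
        \<le> R powr (l / 2) * (L * (1/5 * ((vel_pow R l z + (l - 1)) / l) + 1/10 * ((grad_pow R l z + (l - 1)) / l)))"
      by (simp only: mult.left_commute)
    let ?P = "vel_pow R l z + grad_pow R l z + pos_pow R l z"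
    let ?q = "Ll * 2 powr (l - 2) * (1 + m powr (- (l / 2))) / a * R powr (l / 2)"
    have q0: "0 \<le> ?q" using Ll_pos a0 by (intro mult_nonneg_nonneg divide_nonneg_nonneg) auto
    have "Ll / 24 / a * ((1 + \<rho>) * S\<^sup>2)
      \<le> Ll / 24 / a * (107/100 * 2 powr (l - 2) * (1 + m powr (- (l / 2))) * R powr (l / 2) * (1 + 2 * A powr l))"
      using gp Ll_pos a0 by (intro mult_left_mono) auto
    also have "\<dots> = ?q * (107/2400 * (1 + 2 * A powr l))" by (simp add: mult_ac)
    \<comment> \<open>107/2400 \<le> 1/22.\<close>
    also have "\<dots> \<le> ?q * (1/22 * (1 + 2 * ?P))"
      using Ap by (intro mult_left_mono[OF _ q0] mult_mono) auto
    finally show "Ll / 24 / a * ((1 + \<rho>) * S\<^sup>2)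
      \<le> R powr (l/2) * (Ll * 2 powr (l - 2) * (1 + m powr (- (l / 2))) / a * (1/22) * (1 + 2 * ?P))" by (simp add: mult_ac)
  qed (use \<delta>_pos in auto)
  finally show ?thesis by (simp add: a_def algebra_simps)
qed

text \<open>The argument of \<open>path_error\<close> along a segment: two derivative comparisons
  give 1/12 of the Lipschitz constant of the second derivative, and that constant is Ll / 2 times
  the growth factor times |d|^3.\<close>

lemma trapezoid_error:
  "\<bar>U (x + d) - U x - d \<bullet> (g x + g (x + d)) / 2\<bar> \<le> Ll / 24 * (1 + rpow (norm (x - xs) + norm d) (l - 2)) * norm d ^ 3"
proof -
  let ?r = "norm (x - xs) + norm d"
  let ?\<Lambda> = "Ll / 2 * (1 + rpow ?r (l - 2))"
  define C where "C = ?\<Lambda> * norm d ^ 3"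
  have \<Lambda>0: "0 \<le> ?\<Lambda>" using Ll_pos by (simp add: rpow_nonneg add_nonneg_nonneg)
  have ball: "norm (x + s *\<^sub>R d - xs) \<le> ?r" if "0 \<le> s" "s \<le> 1" for s
  proof -
    have "norm (x + s *\<^sub>R d - xs) \<le> norm (x - xs) + norm (s *\<^sub>R d)"
      using norm_triangle_ineq[of "x - xs" "s *\<^sub>R d"] by (simp add: algebra_simps)
    also have "norm (s *\<^sub>R d) \<le> norm d" using that by (simp add: mult_left_le_one_le)
    finally show ?thesis by simp
  qed
  have inner: "\<bar>d \<bullet> (g (x + s *\<^sub>R d) - g x - s *\<^sub>R H (x + s *\<^sub>R d) d)\<bar> \<le> C * s\<^sup>2 / 2" if s: "0 \<le> s" "s \<le> 1" for s
  proof -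
    let ?h = "H (x + s *\<^sub>R d) d"
    have "norm (d \<bullet> (g (x + s *\<^sub>R d) - s *\<^sub>R ?h) - d \<bullet> (g (x + 0 *\<^sub>R d) - 0 *\<^sub>R ?h)) \<le> C * (s * s - s\<^sup>2 / 2) - C * (s * 0 - 0\<^sup>2 / 2)"
    proof (rule vector_derivative_bound[where f="\<lambda>r. d \<bullet> (g (x + r *\<^sub>R d) - r *\<^sub>R ?h)" and \<phi>="\<lambda>r. C * (s * r - r\<^sup>2 / 2)"
          and f'="\<lambda>r. d \<bullet> (H (x + r *\<^sub>R d) d - ?h)" and \<phi>'="\<lambda>r. C * (s - r)" and T=1])
      fix r :: real assume r: "r \<in> {0..1}"
      have "((\<lambda>r. g (x + r *\<^sub>R d)) has_derivative (\<lambda>t. t *\<^sub>R H (x + r *\<^sub>R d) d)) (at r within {0..1})"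
        using has_vector_derivative_at_within[OF g_line_deriv] by (simp add: has_vector_derivative_def)
      then show "((\<lambda>r. d \<bullet> (g (x + r *\<^sub>R d) - r *\<^sub>R ?h)) has_vector_derivative d \<bullet> (H (x + r *\<^sub>R d) d - ?h)) (at r within {0..1})"
        unfolding has_vector_derivative_def
        by (auto intro!: derivative_eq_intros simp: inner_diff_right algebra_simps)
      show "((\<lambda>r. C * (s * r - r\<^sup>2 / 2)) has_vector_derivative C * (s - r)) (at r within {0..1})"
        by (auto intro!: derivative_eq_intros simp: has_real_derivative_iff_has_vector_derivative[symmetric])
      assume r': "r \<in> {0..s}"
      have "norm (d \<bullet> (H (x + r *\<^sub>R d) d - ?h)) \<le> norm d * norm (H (x + r *\<^sub>R d) d - ?h)"
        using Cauchy_Schwarz_ineq2[of d "H (x + r *\<^sub>R d) d - ?h"] by simp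
      also have "\<dots> \<le> norm d * (?\<Lambda> * norm ((x + s *\<^sub>R d) - (x + r *\<^sub>R d)) * norm d)"
        using s r by (intro mult_left_mono H_growth_ball ball) auto
      also have "norm ((x + s *\<^sub>R d) - (x + r *\<^sub>R d)) = (s - r) * norm d"
        using r' by (simp add: scaleR_diff_left[symmetric])
      also have "norm d * (?\<Lambda> * ((s - r) * norm d) * norm d) = C * (s - r)"
        by (simp add: C_def power3_eq_cube)
      finally show "norm (d \<bullet> (H (x + r *\<^sub>R d) d - ?h)) \<le> C * (s - r)" .
    qed (use s in auto)
    then show ?thesis by (simp add: inner_diff_right algebra_simps power2_eq_square)
  qed
  have "norm ((U (x + 1 *\<^sub>R d) - 1 / 2 * (d \<bullet> (g x + g (x + 1 *\<^sub>R d)))) - (U (x + 0 *\<^sub>R d) - 0 / 2 * (d \<bullet> (g x + g (x + 0 *\<^sub>R d)))))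
      \<le> C * 1^3 / 12 - C * 0^3 / 12"
  proof (rule vector_derivative_bound[where f="\<lambda>s. U (x + s *\<^sub>R d) - s / 2 * (d \<bullet> (g x + g (x + s *\<^sub>R d)))" and \<phi>="\<lambda>s. C * s^3 / 12"
          and f'="\<lambda>s. 1 / 2 * (d \<bullet> (g (x + s *\<^sub>R d) - g x - s *\<^sub>R H (x + s *\<^sub>R d) d))" and \<phi>'="\<lambda>s. C * s\<^sup>2 / 4" and T=1])
    fix r :: real assume r: "r \<in> {0..1}"
    have dg: "((\<lambda>r. g (x + r *\<^sub>R d)) has_derivative (\<lambda>t. t *\<^sub>R H (x + r *\<^sub>R d) d)) (at r within {0..1})"
      using has_vector_derivative_at_within[OF g_line_deriv] by (simp add: has_vector_derivative_def)
    have dU: "((\<lambda>s. U (x + s *\<^sub>R d)) has_derivative (*) (g (x + r *\<^sub>R d) \<bullet> d)) (at r within {0..1})"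
      using has_field_derivative_at_within[OF line_deriv] by (simp add: has_field_derivative_def)
    show "((\<lambda>s. U (x + s *\<^sub>R d) - s / 2 * (d \<bullet> (g x + g (x + s *\<^sub>R d)))) has_vector_derivative
       1 / 2 * (d \<bullet> (g (x + r *\<^sub>R d) - g x - r *\<^sub>R H (x + r *\<^sub>R d) d))) (at r within {0..1})"
      unfolding has_vector_derivative_def
      by (auto intro!: derivative_eq_intros dg dU simp: inner_commute[of "g (x + r *\<^sub>R d)"] inner_diff_right inner_add_right algebra_simps add_divide_distrib diff_divide_distrib)
    show "((\<lambda>s. C * s^3 / 12) has_vector_derivative C * r\<^sup>2 / 4) (at r within {0..1})"
      by (auto intro!: derivative_eq_intros simp: has_real_derivative_iff_has_vector_derivative[symmetric])
    show "norm (1 / 2 * (d \<bullet> (g (x + r *\<^sub>R d) - g x - r *\<^sub>R H (x + r *\<^sub>R d) d))) \<le> C * r\<^sup>2 / 4"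
      using inner[of r] r by (simp add: abs_mult)
  qed auto
  then have A: "\<bar>U (x + d) - d \<bullet> (g x + g (x + d)) / 2 - U x\<bar> \<le> C / 12" by simp
  have "U (x + d) - U x - d \<bullet> (g x + g (x + d)) / 2 = U (x + d) - d \<bullet> (g x + g (x + d)) / 2 - U x" by simp
  with A have "\<bar>U (x + d) - U x - d \<bullet> (g x + g (x + d)) / 2\<bar> \<le> C / 12" by (simp only:)
  also have "C / 12 = Ll / 24 * (1 + rpow ?r (l - 2)) * norm d ^ 3" by (simp add: C_def)
  finally show ?thesis .
qed

text \<open>The displacement of a Verlet step is \<delta> (v - (\<delta> / 2) g), so the cube in the
  trapezoid error supplies \<delta>^3 and the cube of a velocity. By \<open>defect_eq\<close> the
  left-hand side is the change of the modified energy in one step.\<close>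

lemma energy_defect:
  assumes R: "1 \<le> R"
  defines "x1 \<equiv> \<lambda>z. fst (verlet z)"
  shows "\<bar>U (x1 z) - U (fst z) - (x1 z - fst z) \<bullet> (g (fst z) + g (x1 z)) / 2\<bar>
    \<le> \<delta>^3 * Ll * 2 powr (l - 2) * (1 + m powr (- ((l + 1) / 2))) * R powr ((l + 1) / 2) * (1/22)
         * (1 + 2 * (vel_pow R (l + 1) z + grad_pow R (l + 1) z + pos_pow R (l + 1) z))"
proof -
  define S where "S = norm (snd z - (\<delta> / 2) *\<^sub>R g (fst z))"
  define d where "d = x1 z - fst z"
  have d: "d = \<delta> *\<^sub>R (snd z - (\<delta> / 2) *\<^sub>R g (fst z))"
    by (simp add: d_def x1_def verlet_def Let_def algebra_simps power2_eq_square)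
  have nd: "norm d = \<delta> * S" using \<delta>_pos by (simp add: d S_def)
  obtain A where A: "0 \<le> A" "norm (snd z) \<le> sqrt R * A" "norm (g (fst z)) \<le> sqrt L * (sqrt R * A)"
    "norm (fst z - xs) \<le> sqrt R * A / sqrt m"
    and Ap: "A powr (l + 1) \<le> vel_pow R (l + 1) z + grad_pow R (l + 1) z + pos_pow R (l + 1) z"
    using amplitude[OF R, of z] by metis
  have S0: "0 \<le> S" by (simp add: S_def)
  have S: "S \<le> 102/100 * (sqrt R * A)"
  proof -
    have RA: "0 \<le> sqrt R * A" using A(1) R by simp
    have "S \<le> norm (snd z) + norm ((\<delta> / 2) *\<^sub>R g (fst z))" unfolding S_def by (rule norm_triangle_ineq4)
    also have "norm ((\<delta> / 2) *\<^sub>R g (fst z)) \<le> \<delta> / 2 * (sqrt L * (sqrt R * A))"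
      using A(3) \<delta>_pos by (simp add: mult_left_mono)
    also have "\<delta> / 2 * (sqrt L * (sqrt R * A)) = (\<delta> * sqrt L) * (sqrt R * A / 2)" by simp
    also have "\<dots> \<le> 1/264 * (sqrt R * A / 2)" using \<delta>_sqrt_L RA by (intro mult_right_mono) auto
    finally show ?thesis using A(2) RA by linarith
  qed
  have e: "l - 2 + 3 = l + 1" by simp
  have gp: "(1 + rpow (norm (fst z - xs) + \<delta> * S) (l - 2)) * S powr 3 \<le> 107/100 * 2 powr (l - 2) * (1 + m powr (- ((l + 1) / 2))) * R powr ((l + 1) / 2) * (1 + 2 * A powr (l + 1))"
    using growth_power_bound[OF A(1) R _ A(4) S0 S, of 3] unfolding e by simp
  have "S powr 3 = S^3" by (cases "S = 0") (use S0 in \<open>auto simp: powr_numeral\<close>)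
  note gp = gp[unfolded this]
  have "\<bar>U (fst z + d) - U (fst z) - d \<bullet> (g (fst z) + g (fst z + d)) / 2\<bar>
      \<le> Ll / 24 * (1 + rpow (norm (fst z - xs) + norm d) (l - 2)) * norm d ^ 3"
    by (rule trapezoid_error)
  also have "\<dots> = Ll / 24 * \<delta>^3 * ((1 + rpow (norm (fst z - xs) + \<delta> * S) (l - 2)) * S^3)"
    by (simp add: nd power_mult_distrib)
  also have "\<dots> \<le> Ll / 24 * \<delta>^3 * (107/100 * 2 powr (l - 2) * (1 + m powr (- ((l + 1) / 2))) * R powr ((l + 1) / 2) * (1 + 2 * A powr (l + 1)))"
    using gp Ll_pos \<delta>_pos by (intro mult_left_mono) auto
  also have "\<dots> = (\<delta>^3 * Ll * 2 powr (l - 2) * (1 + m powr (- ((l + 1) / 2))) * R powr ((l + 1) / 2)) * (107/2400 * (1 + 2 * A powr (l + 1)))"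
    by simp
  also have "\<dots> \<le> (\<delta>^3 * Ll * 2 powr (l - 2) * (1 + m powr (- ((l + 1) / 2))) * R powr ((l + 1) / 2))
     * (1/22 * (1 + 2 * (vel_pow R (l + 1) z + grad_pow R (l + 1) z + pos_pow R (l + 1) z)))"
    using Ap Ll_pos \<delta>_pos by (intro mult_left_mono mult_mono) (auto intro!: mult_nonneg_nonneg)
  finally show ?thesis by (simp add: d_def)
qed

end

section \<open>Gaussian noise\<close>

text \<open>Stated for every Euclidean space, so that the pair of noises of a step is again
  distributed as \<open>gauss\<close>, on the product space.\<close>

definition gd :: "'a::euclidean_space \<Rightarrow> real" where
  "gd x = (1 / sqrt (2 * pi)) ^ DIM('a) * exp (- (norm x)\<^sup>2 / 2)"

definition gauss :: "'a::euclidean_space measure" where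
  "gauss = density lborel (\<lambda>x. ennreal (gd x))"

lemma gd_pos: "0 < gd x"
  by (simp add: gd_def)

lemma gd_measurable[measurable]: "gd \<in> borel_measurable borel"
  unfolding gd_def[abs_def] by measurable

lemma sets_gauss[simp, measurable_cong]: "sets gauss = sets borel"
  by (simp add: gauss_def)

lemma space_gauss[simp]: "space gauss = UNIV"
  by (simp add: gauss_def)

lemma gd_prod: "gd (x::'a::euclidean_space) = (\<Prod>b\<in>Basis. std_normal_density (x \<bullet> b))"
proof -
  have "(norm x)\<^sup>2 = (\<Sum>b\<in>Basis. (x \<bullet> b)\<^sup>2)"
    unfolding power2_norm_eq_inner euclidean_inner[of x x] by (simp add: power2_eq_square)
  then have "exp (- (norm x)\<^sup>2 / 2) = (\<Prod>b\<in>Basis. exp (- (x \<bullet> b)\<^sup>2 / 2))"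
    by (simp add: exp_sum[symmetric] sum_negf sum_divide_distrib)
  then show ?thesis by (simp add: gd_def std_normal_density_def prod.distrib power_divide prod_dividef)
qed

lemma nn_integral_gd: "(\<integral>\<^sup>+x. ennreal (gd (x::'a::euclidean_space)) \<partial>lborel) = 1"
proof -
  have 1: "(\<integral>\<^sup>+x. ennreal (std_normal_density x) \<partial>lborel) = 1"
    by (subst nn_integral_eq_integral) auto
  have "(\<integral>\<^sup>+x. ennreal (gd (x::'a)) \<partial>lborel) = (\<integral>\<^sup>+x. (\<Prod>b\<in>Basis. ennreal (std_normal_density ((x::'a) \<bullet> b))) \<partial>lborel)"
    by (simp add: gd_prod prod_ennreal)
  also have "\<dots> = (\<Prod>b\<in>(Basis::'a set). \<integral>\<^sup>+x. ennreal (std_normal_density x) \<partial>lborel)"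
    by (rule nn_integral_lborel_prod) auto
  finally show ?thesis by (simp add: 1)
qed

lemma prob_space_gauss: "prob_space gauss"
  by (rule prob_spaceI) (simp add: gauss_def emeasure_density nn_integral_gd)

lemma nn_integral_gauss:
  assumes [measurable]: "f \<in> borel_measurable borel"
  shows "(\<integral>\<^sup>+x. f x \<partial>gauss) = (\<integral>\<^sup>+x. f x * ennreal (gd x) \<partial>lborel)"
  unfolding gauss_def by (subst nn_integral_density) (auto simp: mult.commute)

lemma std_gaussian_eq: "std_gaussian = (gauss :: (real^'n) measure)"
proof -
  have "(\<Prod>i\<in>UNIV. std_normal_density (x $ i)) = gd x" for x :: "real^'n"
  proof -
    have B: "(Basis :: (real^'n) set) = (\<lambda>i. axis i 1) ` UNIV" by (auto simp: Basis_vec_def)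
    have "inj (\<lambda>i::'n. axis i (1::real))" by (rule injI) (simp add: axis_eq_axis)
    then show ?thesis unfolding gd_prod B by (subst prod.reindex) (auto simp: inner_axis)
  qed
  then show ?thesis by (simp add: std_gaussian_def gauss_def)
qed

text \<open>The O-step velocity is a coordinate of the rotated pair (v, \<xi>). The rotation
  preserves Lebesgue measure and the sum of squares, hence the joint weight; the other coordinate
  then integrates out.\<close>

lemma gauss_rotation:
  fixes F :: "'a::euclidean_space \<Rightarrow> ennreal" and c s :: real
  assumes F[measurable]: "F \<in> borel_measurable borel" and cs: "c\<^sup>2 + s\<^sup>2 = 1" "s \<noteq> 0"
  shows "(\<integral>\<^sup>+v. (\<integral>\<^sup>+\<xi>. F (c *\<^sub>R v + s *\<^sub>R \<xi>) * ennreal (gd \<xi>) \<partial>lborel) * ennreal (exp (- (norm v)\<^sup>2 / 2)) \<partial>lborel)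
     = (\<integral>\<^sup>+v. F v * ennreal (exp (- (norm v)\<^sup>2 / 2)) \<partial>lborel)"
proof -
  let ?R = "\<lambda>z::'a \<times> 'a. (c *\<^sub>R fst z + s *\<^sub>R snd z, c *\<^sub>R snd z - s *\<^sub>R fst z)"
  let ?K = "\<lambda>z::'a \<times> 'a. F (fst z) * ennreal (exp (- (norm (fst z))\<^sup>2 / 2)) * ennreal (gd (snd z))"
  have R: "vol_pres ?R" using cs by (rule vol_pres_rotation)
  have [measurable]: "fst \<in> borel_measurable (borel :: ('a \<times> 'a) measure)" "snd \<in> borel_measurable (borel :: ('a \<times> 'a) measure)"
    by (simp_all add: borel_prod[symmetric])
  have Km: "?K \<in> borel_measurable borel" by measurable
  have Rm: "?R \<in> borel_measurable borel" by (rule vol_pres_measurable[OF R])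
  have rot: "(norm (c *\<^sub>R v + s *\<^sub>R \<xi>))\<^sup>2 + (norm (c *\<^sub>R \<xi> - s *\<^sub>R v))\<^sup>2 = (norm v)\<^sup>2 + (norm \<xi>)\<^sup>2" for v \<xi> :: 'a
  proof -
    have "(norm (c *\<^sub>R v + s *\<^sub>R \<xi>))\<^sup>2 + (norm (c *\<^sub>R \<xi> - s *\<^sub>R v))\<^sup>2 = (c\<^sup>2 + s\<^sup>2) * ((norm v)\<^sup>2 + (norm \<xi>)\<^sup>2)"
      unfolding power2_norm_eq_inner
      by (simp add: inner_add_left inner_add_right inner_diff_left inner_diff_right inner_commute power2_eq_square algebra_simps)
    then show ?thesis using cs by simp
  qed
  have KR: "?K (?R (v, \<xi>)) = F (c *\<^sub>R v + s *\<^sub>R \<xi>) * ennreal (gd \<xi>) * ennreal (exp (- (norm v)\<^sup>2 / 2))" for v \<xi>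
  proof -
    have "exp (- (norm (c *\<^sub>R v + s *\<^sub>R \<xi>))\<^sup>2 / 2) * gd (c *\<^sub>R \<xi> - s *\<^sub>R v) = gd \<xi> * exp (- (norm v)\<^sup>2 / 2)"
    proof -
      have "exp (- (norm (c *\<^sub>R v + s *\<^sub>R \<xi>))\<^sup>2 / 2) * exp (- (norm (c *\<^sub>R \<xi> - s *\<^sub>R v))\<^sup>2 / 2)
         = exp (- ((norm (c *\<^sub>R v + s *\<^sub>R \<xi>))\<^sup>2 + (norm (c *\<^sub>R \<xi> - s *\<^sub>R v))\<^sup>2) / 2)"
        by (simp add: exp_add[symmetric] add_divide_distrib diff_divide_distrib)
      also have "\<dots> = exp (- (norm \<xi>)\<^sup>2 / 2) * exp (- (norm v)\<^sup>2 / 2)"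
        unfolding rot by (simp add: exp_add[symmetric] add_divide_distrib diff_divide_distrib)
      finally show ?thesis by (simp add: gd_def mult_ac)
    qed
    then show ?thesis by (simp add: mult.assoc ennreal_mult[symmetric] gd_pos less_imp_le)
  qed
  have "(\<integral>\<^sup>+v. (\<integral>\<^sup>+\<xi>. F (c *\<^sub>R v + s *\<^sub>R \<xi>) * ennreal (gd \<xi>) \<partial>lborel) * ennreal (exp (- (norm v)\<^sup>2 / 2)) \<partial>lborel)
     = (\<integral>\<^sup>+v. (\<integral>\<^sup>+\<xi>. ?K (?R (v, \<xi>)) \<partial>lborel) \<partial>lborel)"
    unfolding KR by (subst nn_integral_multc) auto
  also have "\<dots> = (\<integral>\<^sup>+z. ?K (?R z) \<partial>lborel)"
    by (rule nn_integral_lborel_pair(1)[symmetric]) (rule measurable_compose[OF Rm Km])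
  also have "\<dots> = (\<integral>\<^sup>+z. ?K z \<partial>lborel)" by (rule nn_integral_vol_pres[OF R Km])
  also have "\<dots> = (\<integral>\<^sup>+v. (\<integral>\<^sup>+\<xi>. ?K (v, \<xi>) \<partial>lborel) \<partial>lborel)" by (rule nn_integral_lborel_pair(1)[OF Km])
  also have "\<dots> = (\<integral>\<^sup>+v. F v * ennreal (exp (- (norm v)\<^sup>2 / 2)) \<partial>lborel)"
    by (intro nn_integral_cong) (simp add: nn_integral_cmult nn_integral_gd)
  finally show ?thesis .
qed

text \<open>Left unnormalised and with a free position potential: O-steps preserve it for every
  measurable \<open>W\<close>, in particular for \<open>U\<close> and for its modification.\<close>

definition phase :: "('a::euclidean_space \<Rightarrow> real) \<Rightarrow> ('a \<times> 'a) measure" where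
  "phase W = density lborel (\<lambda>z. ennreal (exp (- W (fst z) - (norm (snd z))\<^sup>2 / 2)))"

lemma sets_phase[simp, measurable_cong]: "sets (phase W) = sets borel"
  by (simp add: phase_def)

lemma space_phase[simp]: "space (phase W) = UNIV"
  by (simp add: phase_def)

lemma fst_snd_borel[measurable]:
  "fst \<in> borel_measurable (borel :: ('a::second_countable_topology \<times> 'b::second_countable_topology) measure)"
  "snd \<in> borel_measurable (borel :: ('a::second_countable_topology \<times> 'b::second_countable_topology) measure)"
  by (simp_all add: borel_prod[symmetric])

context obabo begin

lemma boltzmann_phase: "boltzmann = phase U"
  by (simp add: boltzmann_def phase_def energy_def)

lemma ostep_measurable[measurable]: "(\<lambda>p. ostep (fst p) (snd p)) \<in> borel_measurable (borel \<Otimes>\<^sub>M borel)"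
  unfolding ostep_def borel_prod[symmetric] by measurable

lemma ostep_measurable'[measurable]:
  assumes [measurable]: "f \<in> borel_measurable N" "h \<in> borel_measurable N"
  shows "(\<lambda>p. ostep (f p) (h p)) \<in> borel_measurable N"
proof -
  have "(\<lambda>p. ostep (fst p) (snd p)) \<circ> (\<lambda>p. (f p, h p)) \<in> borel_measurable N"
    by (rule measurable_comp[OF _ ostep_measurable]) measurable
  then show ?thesis by (simp add: o_def)
qed

lemma ostep_invariant:
  fixes f :: "'a \<times> 'a \<Rightarrow> ennreal"
  assumes f[measurable]: "f \<in> borel_measurable borel" and W[measurable]: "W \<in> borel_measurable borel"
  shows "(\<integral>\<^sup>+z. (\<integral>\<^sup>+\<xi>. f (ostep z \<xi>) \<partial>gauss) \<partial>phase W) = (\<integral>\<^sup>+z. f z \<partial>phase W)"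
proof -
  have f'[measurable]: "f \<in> borel_measurable (borel \<Otimes>\<^sub>M borel)" by (simp add: borel_prod)
  let ?I = "\<lambda>z. \<integral>\<^sup>+\<xi>. f (ostep z \<xi>) \<partial>gauss"
  have g0: "sigma_finite_measure (gauss :: 'a measure)"
    using prob_space_gauss prob_space_imp_sigma_finite by blast
  interpret G: sigma_finite_measure "gauss :: 'a measure" by (rule g0)
  have Im[measurable]: "?I \<in> borel_measurable borel" by measurable
  have w: "ennreal (exp (- W x - (norm v)\<^sup>2 / 2)) = ennreal (exp (- W x)) * ennreal (exp (- (norm v)\<^sup>2 / 2))" for x and v :: 'a
    by (simp add: ennreal_mult[symmetric] exp_add[symmetric])
  have c: "et\<^sup>2 + sg\<^sup>2 = 1" "sg \<noteq> 0" using sg_sq sg_pos by auto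
  have "(\<integral>\<^sup>+z. ?I z \<partial>phase W) = (\<integral>\<^sup>+x. \<integral>\<^sup>+v. ennreal (exp (- W x - (norm v)\<^sup>2 / 2)) * ?I (x, v) \<partial>lborel \<partial>lborel)"
    unfolding phase_def by (subst nn_integral_density, simp, simp, subst nn_integral_lborel_pair(1)) auto
  also have "\<dots> = (\<integral>\<^sup>+x. \<integral>\<^sup>+v. ennreal (exp (- W x - (norm v)\<^sup>2 / 2)) * f (x, v) \<partial>lborel \<partial>lborel)"
  proof (rule nn_integral_cong)
    fix x :: 'a
    have I: "?I (x, v) = (\<integral>\<^sup>+\<xi>. f (x, et *\<^sub>R v + sg *\<^sub>R \<xi>) * ennreal (gd \<xi>) \<partial>lborel)" for v
      by (subst nn_integral_gauss) (auto simp: ostep_def)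
    have 1: "(\<integral>\<^sup>+v. ennreal (exp (- W x - (norm v)\<^sup>2 / 2)) * h v \<partial>lborel)
      = ennreal (exp (- W x)) * (\<integral>\<^sup>+v. h v * ennreal (exp (- (norm v)\<^sup>2 / 2)) \<partial>lborel)"
      if [measurable]: "h \<in> borel_measurable borel" for h :: "'a \<Rightarrow> ennreal"
      unfolding w by (subst nn_integral_cmult[symmetric]) (auto simp: mult_ac)
    have 2: "(\<integral>\<^sup>+v. ?I (x, v) * ennreal (exp (- (norm v)\<^sup>2 / 2)) \<partial>lborel) = (\<integral>\<^sup>+v. f (x, v) * ennreal (exp (- (norm v)\<^sup>2 / 2)) \<partial>lborel)"
      unfolding I by (rule gauss_rotation[OF _ c]) measurable
    have m: "(\<lambda>v. ?I (x, v)) \<in> borel_measurable borel" "(\<lambda>v. f (x, v)) \<in> borel_measurable borel" by measurable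
    show "(\<integral>\<^sup>+v. ennreal (exp (- W x - (norm v)\<^sup>2 / 2)) * ?I (x, v) \<partial>lborel)
      = (\<integral>\<^sup>+v. ennreal (exp (- W x - (norm v)\<^sup>2 / 2)) * f (x, v) \<partial>lborel)"
      by (simp only: 1[OF m(1)] 1[OF m(2)] 2)
  qed
  also have "\<dots> = (\<integral>\<^sup>+z. f z \<partial>phase W)"
    unfolding phase_def by (subst nn_integral_density, simp, simp, subst nn_integral_lborel_pair(1)) auto
  finally show ?thesis .
qed

end

section \<open>Decomposition into components\<close>

lemma sum_Basis_pair:
  fixes f :: "'a::euclidean_space \<times> 'b::euclidean_space \<Rightarrow> real"
  shows "sum f Basis = (\<Sum>i\<in>Basis. f (i, 0)) + (\<Sum>i\<in>Basis. f (0, i))"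
  unfolding Basis_prod_def
  by (subst sum.union_disjoint) (auto simp: sum.reindex inj_on_def)

text \<open>Jensen's inequality with unnormalised weights. The y's are divided by their weighted
  mean and \<open>le_powr_affine\<close> is summed. With suitable weights it serves as Minkowski's
  inequality.\<close>

lemma powr_sum_le:
  fixes c y :: "'i \<Rightarrow> real" and p :: real
  assumes fin: "finite I" and c: "\<And>i. i \<in> I \<Longrightarrow> 0 \<le> c i" and y: "\<And>i. i \<in> I \<Longrightarrow> 0 \<le> y i" and p: "1 \<le> p"
  shows "(\<Sum>i\<in>I. c i * y i) powr p \<le> (\<Sum>i\<in>I. c i) powr (p - 1) * (\<Sum>i\<in>I. c i * y i powr p)"
proof (cases "(\<Sum>i\<in>I. c i * y i) = 0")
  case True
  then show ?thesis using c by (auto intro!: mult_nonneg_nonneg sum_nonneg)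
next
  case False
  let ?C = "\<Sum>i\<in>I. c i" and ?s = "\<Sum>i\<in>I. c i * y i"
  have s0: "0 < ?s" using False c y by (simp add: less_le sum_nonneg)
  have C0: "0 < ?C"
  proof (rule ccontr)
    assume "\<not> 0 < ?C"
    then have "?C = 0" using c by (simp add: sum_nonneg antisym)
    then have "\<And>i. i \<in> I \<Longrightarrow> c i = 0" using c fin by (simp add: sum_nonneg_eq_0_iff)
    then show False using False by simp
  qed
  define t where "t = ?s / ?C"
  have t0: "0 < t" using s0 C0 by (simp add: t_def)
  have "p * ?C = p * (?s / t)" using s0 C0 by (simp add: t_def)
  also have "?s / t = (\<Sum>i\<in>I. c i * (y i / t))" by (simp add: sum_divide_distrib)
  also have "p * \<dots> \<le> (\<Sum>i\<in>I. c i * ((y i / t) powr p + (p - 1)))"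
    unfolding sum_distrib_left
  proof (rule sum_mono)
    fix i assume i: "i \<in> I"
    have "c i * (p * (y i / t)) \<le> c i * ((y i / t) powr p + (p - 1))"
      using le_powr_affine[of "y i / t" p] c[OF i] y[OF i] t0 p
      by (intro mult_left_mono) (auto simp: le_divide_eq mult.commute)
    then show "p * (c i * (y i / t)) \<le> c i * ((y i / t) powr p + (p - 1))" by (simp add: mult_ac)
  qed
  also have "\<dots> = (\<Sum>i\<in>I. c i * y i powr p) / t powr p + (p - 1) * ?C"
    using y t0 by (simp add: powr_divide distrib_left sum.distrib sum_divide_distrib sum_distrib_left mult.commute)
  finally have "?C \<le> (\<Sum>i\<in>I. c i * y i powr p) / t powr p" by (simp add: algebra_simps)
  then have "?C * t powr p \<le> (\<Sum>i\<in>I. c i * y i powr p)" using t0 by (simp add: pos_le_divide_eq)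
  then have "?C powr (p - 1) * (?C * t powr p) \<le> ?C powr (p - 1) * (\<Sum>i\<in>I. c i * y i powr p)"
    by (intro mult_left_mono) auto
  moreover have "?C powr (p - 1) * (?C * t powr p) = ?s powr p"
  proof -
    have "?C powr (p - 1) * ?C = ?C powr p" using C0 by (metis diff_add_cancel powr_add powr_one less_imp_le)
    moreover have "?C powr p * t powr p = ?s powr p"
      using C0 s0 by (simp add: powr_mult[symmetric] t_def)
    ultimately show ?thesis by (simp add: mult.assoc[symmetric])
  qed
  ultimately show ?thesis by simp
qed

text \<open>The dynamics splits into the components \<open>Pr j\<close>. The general case is a single component; for a
  separable potential the components are the coordinates in the separating orthonormal basis.\<close>

locale split = obabo U g H m L xs \<gamma> \<delta>
  for U :: "'a::euclidean_space \<Rightarrow> real" and g H m L xs \<gamma> \<delta> +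
  fixes J :: "'j set" and Pr :: "'j \<Rightarrow> 'a \<Rightarrow> 'b::euclidean_space" and E :: "'j \<Rightarrow> 'b \<Rightarrow> 'a"
    and Uj :: "'j \<Rightarrow> 'b \<Rightarrow> real" and gj :: "'j \<Rightarrow> 'b \<Rightarrow> 'b" and Hj :: "'j \<Rightarrow> 'b \<Rightarrow> 'b \<Rightarrow> 'b"
    and xj :: "'j \<Rightarrow> 'b" and l Ll :: real
  assumes finJ: "finite J" and J_ne: "J \<noteq> {}"
    and Pr_linear: "\<And>j. linear (Pr j)" and E_linear: "\<And>j. linear (E j)"
    and Pr_inner: "\<And>x y. x \<bullet> y = (\<Sum>j\<in>J. Pr j x \<bullet> Pr j y)"
    and Pr_E: "\<And>i j y. i \<in> J \<Longrightarrow> j \<in> J \<Longrightarrow> Pr i (E j y) = (if i = j then y else 0)"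
    and Pr_g: "\<And>j x. j \<in> J \<Longrightarrow> Pr j (g x) = gj j (Pr j x)"
    and U_split: "\<And>x. U x = (\<Sum>j\<in>J. Uj j (Pr j x))"
    and comp: "\<And>j. j \<in> J \<Longrightarrow> growth (Uj j) (gj j) (Hj j) m L (xj j) \<gamma> \<delta> l Ll"
begin

lemma l_ge: "2 \<le> l"
  using comp J_ne growth.l_ge by blast

lemma Ll_pos: "0 < Ll"
  using comp J_ne growth.Ll_pos by blast

lemma inner_E: "j \<in> J \<Longrightarrow> E j y \<bullet> x = y \<bullet> Pr j x"
  unfolding Pr_inner[of "E j y" x] using finJ
  by (subst sum.remove[of J j]) (auto simp: Pr_E intro!: sum.neutral)

lemma norm_E: "j \<in> J \<Longrightarrow> norm (E j y) = norm y"
  by (simp add: norm_eq_sqrt_inner inner_E Pr_E)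

lemma norm_sq_split: "(norm x)\<^sup>2 = (\<Sum>j\<in>J. (norm (Pr j x))\<^sup>2)"
  unfolding power2_norm_eq_inner by (rule Pr_inner)

lemma norm_Pr_le: "j \<in> J \<Longrightarrow> norm (Pr j x) \<le> norm x"
proof -
  assume j: "j \<in> J"
  have "(norm (Pr j x))\<^sup>2 \<le> (norm x)\<^sup>2"
    unfolding norm_sq_split[of x] using finJ j by (intro member_le_sum) auto
  then show ?thesis by (rule power2_le_imp_le) simp
qed

text \<open>Differentiating the splitting of the gradient shows that the Hessian respects the
  components; uniqueness of derivatives does the rest.\<close>

lemma Pr_H: "j \<in> J \<Longrightarrow> Pr j (H x h) = Hj j (Pr j x) (Pr j h)"
proof -
  assume j: "j \<in> J"
  interpret C: growth "Uj j" "gj j" "Hj j" m L "xj j" \<gamma> \<delta> l Ll by (rule comp[OF j])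
  have bl: "bounded_linear (Pr j)" using Pr_linear by (simp add: linear_conv_bounded_linear)
  have "((\<lambda>x. Pr j (g x)) has_derivative (\<lambda>h. Pr j (H x h))) (at x)"
    by (rule bounded_linear.has_derivative[OF bl g_deriv])
  moreover have "((\<lambda>x. gj j (Pr j x)) has_derivative (\<lambda>h. Hj j (Pr j x) (Pr j h))) (at x)"
    by (rule has_derivative_compose[OF bounded_linear_imp_has_derivative[OF bl] C.g_deriv])
  moreover have "(\<lambda>x. Pr j (g x)) = (\<lambda>x. gj j (Pr j x))" using Pr_g[OF j] by auto
  ultimately have "(\<lambda>h. Pr j (H x h)) = (\<lambda>h. Hj j (Pr j x) (Pr j h))"
    by (metis has_derivative_unique)
  then show ?thesis by meson
qed

lemma g_H_E: "j \<in> J \<Longrightarrow> g x \<bullet> H x (E j y) = gj j (Pr j x) \<bullet> Hj j (Pr j x) y"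
proof -
  assume j: "j \<in> J"
  have z: "Hj i (Pr i x) 0 = 0" if "i \<in> J" for i
  proof -
    interpret C: growth "Uj i" "gj i" "Hj i" m L "xj i" \<gamma> \<delta> l Ll by (rule comp[OF that])
    show ?thesis using C.H_linear linear_0 by blast
  qed
  have "g x \<bullet> H x (E j y) = (\<Sum>i\<in>J. gj i (Pr i x) \<bullet> Hj i (Pr i x) (Pr i (E j y)))"
    by (subst Pr_inner) (simp add: Pr_g Pr_H)
  also have "\<dots> = gj j (Pr j x) \<bullet> Hj j (Pr j x) y"
    using finJ j by (subst sum.remove[of J j]) (auto simp: Pr_E z intro!: sum.neutral)
  finally show ?thesis .
qed

text \<open>The trace of the orthogonal projection onto component j, evaluated by exchanging two
  basis sums. It is why the moments of a component see its own dimension and not that of the whole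
  space.\<close>

lemma sum_norm_Pr_Basis: "j \<in> J \<Longrightarrow> (\<Sum>b\<in>Basis. (norm (Pr j b))\<^sup>2) = DIM('b)"
proof -
  assume j: "j \<in> J"
  have "(\<Sum>b\<in>Basis. (norm (Pr j b))\<^sup>2) = (\<Sum>b\<in>(Basis::'a set). \<Sum>c\<in>(Basis::'b set). (E j c \<bullet> b)\<^sup>2)"
  proof (rule sum.cong[OF refl])
    fix b :: 'a
    have "(norm (Pr j b))\<^sup>2 = (\<Sum>c\<in>Basis. (Pr j b \<bullet> c) * (Pr j b \<bullet> c))"
      unfolding power2_norm_eq_inner by (rule euclidean_inner)
    moreover have "E j c \<bullet> b = Pr j b \<bullet> c" for c by (subst inner_E[OF j]) (rule inner_commute)
    ultimately show "(norm (Pr j b))\<^sup>2 = (\<Sum>c\<in>(Basis::'b set). (E j c \<bullet> b)\<^sup>2)"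
      by (simp only: power2_eq_square)
  qed
  also have "\<dots> = (\<Sum>c\<in>(Basis::'b set). \<Sum>b\<in>(Basis::'a set). (E j c \<bullet> b)\<^sup>2)" by (rule sum.swap)
  also have "\<dots> = (\<Sum>c\<in>(Basis::'b set). (norm (E j c))\<^sup>2)"
  proof (rule sum.cong[OF refl])
    fix c :: 'b
    show "(\<Sum>b\<in>(Basis::'a set). (E j c \<bullet> b)\<^sup>2) = (norm (E j c))\<^sup>2"
      unfolding power2_norm_eq_inner euclidean_inner[of "E j c" "E j c"] by (simp add: power2_eq_square)
  qed
  also have "\<dots> = DIM('b)" by (simp add: norm_E[OF j])
  finally show ?thesis .
qed

text \<open>The family of measures contains the Gibbs measure (\<open>\<theta> = 0\<close>) and, up to normalisation, the
  measure with density \<open>exp (\<delta>\<^sup>2 |\<nabla>U|\<^sup>2 / 8)\<close> with respect to it (\<open>\<theta> = 1\<close>), which the Verlet step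
  preserves up to the trapezoid error.\<close>

definition Wt :: "real \<Rightarrow> 'a \<Rightarrow> real" where
  "Wt \<theta> x = U x - \<theta> * (\<delta>\<^sup>2 / 8 * (norm (g x))\<^sup>2)"

text \<open>The gradient of \<open>Wt \<theta>\<close>; the basis sum is the adjoint of
  \<open>H x\<close> applied to \<open>g x\<close>.\<close>

definition nW :: "real \<Rightarrow> 'a \<Rightarrow> 'a" where
  "nW \<theta> x = g x - (\<theta> * (\<delta>\<^sup>2 / 4)) *\<^sub>R (\<Sum>b\<in>Basis. (g x \<bullet> H x b) *\<^sub>R b)"

definition Ht :: "real \<Rightarrow> 'a \<times> 'a \<Rightarrow> real" where
  "Ht \<theta> z = Wt \<theta> (fst z) + (norm (snd z))\<^sup>2 / 2"

definition Zt :: "real \<Rightarrow> real" where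
  "Zt \<theta> = (\<integral>z. exp (- Ht \<theta> z) \<partial>lborel)"

lemma nW_inner: "nW \<theta> x \<bullet> h = g x \<bullet> h - \<theta> * (\<delta>\<^sup>2 / 4) * (g x \<bullet> H x h)"
proof -
  have "(\<Sum>b\<in>Basis. (g x \<bullet> H x b) *\<^sub>R b) \<bullet> h = (\<Sum>b\<in>Basis. (h \<bullet> b) * (g x \<bullet> H x b))"
    unfolding inner_sum_left inner_scaleR_left
    by (intro sum.cong refl) (simp add: inner_commute mult.commute)
  also have "\<dots> = g x \<bullet> H x (\<Sum>b\<in>Basis. (h \<bullet> b) *\<^sub>R b)"
    by (simp add: linear_sum[OF H_linear] linear_cmul[OF H_linear] inner_sum_right)
  finally show ?thesis by (simp add: nW_def inner_diff_left euclidean_representation)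
qed

lemma inner_nW: "h \<bullet> nW \<theta> x = h \<bullet> g x - \<theta> * (\<delta>\<^sup>2 / 4) * (g x \<bullet> H x h)"
  using nW_inner[of \<theta> x h] by (simp add: inner_commute)

lemma Ht_deriv: "(Ht \<theta> has_derivative (\<lambda>h. (nW \<theta> (fst z), snd z) \<bullet> h)) (at z)"
proof -
  have gd: "((\<lambda>z. g (fst z)) has_derivative (\<lambda>h. H (fst z) (fst h))) (at z)"
    by (rule has_derivative_compose[OF _ g_deriv]) (auto intro!: derivative_eq_intros)
  have ud: "((\<lambda>z. U (fst z)) has_derivative (\<lambda>h. g (fst z) \<bullet> fst h)) (at z)"
    by (rule has_derivative_compose[OF _ U_deriv]) (auto intro!: derivative_eq_intros)
  show ?thesis
    unfolding Ht_def Wt_def power2_norm_eq_inner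
    by (rule derivative_eq_intros gd ud refl | simp)+
       (auto simp: inner_prod_def inner_nW inner_commute algebra_simps)
qed

lemma nW_cont: "continuous_on UNIV (nW \<theta>)"
  unfolding nW_def by (intro continuous_intros g_cont H_cont)

lemma g_poly: "poly_bdd (\<lambda>z::'a \<times> 'a. norm (g (fst z)))"
proof (rule poly_bdd_mono)
  show "poly_bdd (\<lambda>z::'a \<times> 'a. L * (norm z + norm xs))"
    by (intro poly_bdd_mult poly_bdd_add poly_bdd_const poly_bdd_norm)
  fix z :: "'a \<times> 'a"
  have "norm (g (fst z)) \<le> L * norm (fst z - xs)" by (rule norm_g_le)
  also have "\<dots> \<le> L * (norm z + norm xs)"
    using norm_triangle_ineq4[of "fst z" xs] norm_fst_le[of "fst z" "snd z"] L_pos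
    by (intro mult_left_mono) auto
  finally show "\<bar>norm (g (fst z))\<bar> \<le> \<bar>L * (norm z + norm xs)\<bar>" by simp
qed

lemma nHt_poly: "poly_bdd (\<lambda>z::'a \<times> 'a. norm (nW \<theta> (fst z), snd z))"
proof (rule poly_bdd_mono)
  let ?c = "\<bar>\<theta> * (\<delta>\<^sup>2 / 4)\<bar>"
  show "poly_bdd (\<lambda>z::'a \<times> 'a. norm (g (fst z)) + (?c * L * DIM('a)) * norm (g (fst z)) + norm z)"
    by (intro poly_bdd_add poly_bdd_mult poly_bdd_const g_poly poly_bdd_norm)
  fix z :: "'a \<times> 'a"
  have "norm (\<Sum>b\<in>Basis. (g (fst z) \<bullet> H (fst z) b) *\<^sub>R b) \<le> (\<Sum>b\<in>(Basis::'a set). norm (g (fst z)) * L)"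
  proof (rule sum_norm_le)
    fix b :: 'a assume b: "b \<in> Basis"
    have "\<bar>g (fst z) \<bullet> H (fst z) b\<bar> \<le> norm (g (fst z)) * norm (H (fst z) b)" by (rule Cauchy_Schwarz_ineq2)
    also have "\<dots> \<le> norm (g (fst z)) * L" using norm_H_le[of "fst z" b] b by (intro mult_left_mono) auto
    finally show "norm ((g (fst z) \<bullet> H (fst z) b) *\<^sub>R b) \<le> norm (g (fst z)) * L" using b by simp
  qed
  then have 1: "norm (\<Sum>b\<in>Basis. (g (fst z) \<bullet> H (fst z) b) *\<^sub>R b) \<le> DIM('a) * (norm (g (fst z)) * L)" by simp
  have "norm (nW \<theta> (fst z)) \<le> norm (g (fst z)) + ?c * norm (\<Sum>b\<in>Basis. (g (fst z) \<bullet> H (fst z) b) *\<^sub>R b)"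
    unfolding nW_def
    using norm_triangle_ineq4[of "g (fst z)" "(\<theta> * (\<delta>\<^sup>2 / 4)) *\<^sub>R (\<Sum>b\<in>Basis. (g (fst z) \<bullet> H (fst z) b) *\<^sub>R b)"]
    by simp
  also have "\<dots> \<le> norm (g (fst z)) + ?c * (DIM('a) * (norm (g (fst z)) * L))"
    using 1 by (intro add_left_mono mult_left_mono) auto
  finally have "norm (nW \<theta> (fst z)) \<le> norm (g (fst z)) + (?c * L * DIM('a)) * norm (g (fst z))" by (simp add: mult_ac)
  moreover have "norm (nW \<theta> (fst z), snd z) \<le> norm (nW \<theta> (fst z)) + norm (snd z)" by (rule norm_Pair_le)
  moreover have "norm (snd z) \<le> norm z" by (metis norm_snd_le prod.collapse)
  ultimately show "\<bar>norm (nW \<theta> (fst z), snd z)\<bar> \<le> \<bar>norm (g (fst z)) + (?c * L * DIM('a)) * norm (g (fst z)) + norm z\<bar>"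
    by simp
qed

text \<open>Strong convexity gives m |x - xs|^2 / 2, and the correction consumes at most half of it
  because \<delta> L is small against sqrt m.\<close>

lemma Ht_lower:
  assumes \<theta>: "0 \<le> \<theta>" "\<theta> \<le> 1"
  shows "\<exists>c0 C0. 0 < c0 \<and> (\<forall>z. c0 * (norm z)\<^sup>2 - C0 \<le> Ht \<theta> z)"
proof -
  let ?k = "min (m/4) (1/2)"
  have k: "0 < ?k" using m_pos by simp
  have "?k / 2 * (norm z)\<^sup>2 - (?k * (norm xs)\<^sup>2 - U xs) \<le> Ht \<theta> z" for z
  proof -
    let ?r = "norm (fst z - xs)"
    have "U xs + m/2 * ?r\<^sup>2 \<le> U (fst z)"
      using strong_convexity[of xs "fst z - xs"] g_xs by simp
    moreover have "\<theta> * (\<delta>\<^sup>2 / 8 * (norm (g (fst z)))\<^sup>2) \<le> m / 4 * ?r\<^sup>2"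
    proof -
      have "\<theta> * (\<delta>\<^sup>2 / 8 * (norm (g (fst z)))\<^sup>2) \<le> 1 * (\<delta>\<^sup>2 / 8 * (L * ?r)\<^sup>2)"
        using \<theta> norm_g_le[of "fst z"] by (intro mult_mono power_mono mult_left_mono) auto
      also have "\<dots> = (\<delta> * L)\<^sup>2 * (?r\<^sup>2 / 8)" by (simp add: power_mult_distrib)
      also have "\<dots> \<le> (sqrt m / 264)\<^sup>2 * (?r\<^sup>2 / 8)"
        using \<delta>_sqrt_m \<delta>_pos L_pos by (intro mult_right_mono power_mono) auto
      also have "\<dots> \<le> m / 4 * ?r\<^sup>2" using m_pos by (simp add: power_divide)
      finally show ?thesis .
    qed
    moreover have "?k * ?r\<^sup>2 \<le> m / 4 * ?r\<^sup>2" "?k * (norm (snd z))\<^sup>2 \<le> 1/2 * (norm (snd z))\<^sup>2"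
      by (intro mult_right_mono; simp)+
    moreover have "?k * ((norm z)\<^sup>2 / 2) \<le> ?k * (?r\<^sup>2 + (norm xs)\<^sup>2 + (norm (snd z))\<^sup>2)"
    proof (rule mult_left_mono)
      have "norm (fst z) \<le> ?r + norm xs" by (metis diff_add_cancel norm_triangle_ineq)
      then have "(norm (fst z))\<^sup>2 \<le> (?r + norm xs)\<^sup>2" by (intro power_mono) auto
      also have "\<dots> \<le> 2 * ?r\<^sup>2 + 2 * (norm xs)\<^sup>2" using sum_squares_bound[of ?r "norm xs"] by (simp add: power2_sum)
      finally have "(norm (fst z))\<^sup>2 \<le> 2 * ?r\<^sup>2 + 2 * (norm xs)\<^sup>2" .
      moreover have "(norm z)\<^sup>2 = (norm (fst z))\<^sup>2 + (norm (snd z))\<^sup>2" by (cases z) (simp add: norm_Pair)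
      ultimately show "(norm z)\<^sup>2 / 2 \<le> ?r\<^sup>2 + (norm xs)\<^sup>2 + (norm (snd z))\<^sup>2"
        using zero_le_power2[of "norm (snd z)"] by argo
    qed (use k in simp)
    ultimately show ?thesis unfolding Ht_def Wt_def distrib_left by argo
  qed
  then show ?thesis using k by (intro exI[of _ "?k/2"] exI[of _ "?k * (norm xs)\<^sup>2 - U xs"]) auto
qed

lemma Ht_measurable[measurable]: "Ht \<theta> \<in> borel_measurable borel"
  by (intro borel_measurable_continuous_onI continuous_at_imp_continuous_on ballI has_derivative_continuous[OF Ht_deriv])

lemma poly_integrable:
  assumes "0 \<le> \<theta>" "\<theta> \<le> 1" "poly_bdd f" "f \<in> borel_measurable borel"
  shows "integrable lborel (\<lambda>z. f z * exp (- Ht \<theta> z))"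
proof -
  obtain c0 C0 where "0 < c0" "\<And>z. c0 * (norm z)\<^sup>2 - C0 \<le> Ht \<theta> z" using Ht_lower assms by metis
  then show ?thesis using assms by (intro poly_exp_integrable) auto
qed

lemma Zt_pos: "0 \<le> \<theta> \<Longrightarrow> \<theta> \<le> 1 \<Longrightarrow> 0 < Zt \<theta>"
proof -
  assume t: "0 \<le> \<theta>" "\<theta> \<le> 1"
  have i: "integrable lborel (\<lambda>z. exp (- Ht \<theta> z))" using poly_integrable[OF t poly_bdd_const[of 1]] by simp
  have "Zt \<theta> \<noteq> 0"
  proof
    assume "Zt \<theta> = 0"
    then have "AE z in lborel. exp (- Ht \<theta> z) = 0"
      unfolding Zt_def using i by (subst (asm) integral_nonneg_eq_0_iff_AE) auto
    then have "AE z in (lborel :: ('a \<times> 'a) measure). False" by simp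
    then have "emeasure (lborel :: ('a \<times> 'a) measure) UNIV = 0" by (simp add: AE_iff_null null_sets_def)
    then show False by simp
  qed
  moreover have "0 \<le> Zt \<theta>" unfolding Zt_def by (intro integral_nonneg_AE) auto
  ultimately show ?thesis by simp
qed

text \<open>\<open>moment_bound\<close> for the vector fields given by velocity, force and
  displacement of component j. The correction to the potential weakens the drift of force and
  displacement at most by the factor \<open>c\<close>.\<close>

lemma moments:
  assumes \<theta>: "0 \<le> \<theta>" "\<theta> \<le> 1" and j: "j \<in> J" and q: "2 \<le> q"
  defines "R \<equiv> real DIM('b) + q - 2" and "c \<equiv> 1 - \<theta> * (\<delta>\<^sup>2 * L\<^sup>2 / (4 * m))"
  shows "(\<integral>z. norm (Pr j (snd z)) powr q * exp (- Ht \<theta> z) \<partial>lborel) \<le> (R / c) powr (q / 2) * Zt \<theta>"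
    and "(\<integral>z. norm (gj j (Pr j (fst z))) powr q * exp (- Ht \<theta> z) \<partial>lborel) \<le> (L * R / c) powr (q / 2) * Zt \<theta>"
    and "(\<integral>z. norm (Pr j (fst z) - xj j) powr q * exp (- Ht \<theta> z) \<partial>lborel) \<le> (R / (m * c)) powr (q / 2) * Zt \<theta>"
    and "poly_bdd (\<lambda>z::'a \<times> 'a. norm (Pr j (snd z)))"
    and "poly_bdd (\<lambda>z::'a \<times> 'a. norm (gj j (Pr j (fst z))))"
    and "poly_bdd (\<lambda>z::'a \<times> 'a. norm (Pr j (fst z) - xj j))"
proof -
  interpret C: growth "Uj j" "gj j" "Hj j" m L "xj j" \<gamma> \<delta> l Ll by (rule comp[OF j])
  obtain c0 C0 where c0: "0 < c0" "\<And>z. c0 * (norm z)\<^sup>2 - C0 \<le> Ht \<theta> z" using Ht_lower[OF \<theta>] by metis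
  define e where "e = \<delta>\<^sup>2 * L\<^sup>2 / (4 * m)"
  have small: "L * \<delta>\<^sup>2 / 4 \<le> e" "L\<^sup>2 * \<delta>\<^sup>2 / 4 = m * e" "0 \<le> e" "e \<le> 1/2"
  proof -
    show "0 \<le> e" using m_pos by (simp add: e_def)
    show 2: "L\<^sup>2 * \<delta>\<^sup>2 / 4 = m * e" using m_pos by (simp add: e_def)
    have "m * (L * \<delta>\<^sup>2 / 4) \<le> L * (L * \<delta>\<^sup>2 / 4)" using m_le_L L_pos by (intro mult_right_mono) auto
    also have "\<dots> = m * e" unfolding 2[symmetric] by (simp add: power2_eq_square)
    finally show "L * \<delta>\<^sup>2 / 4 \<le> e" using m_pos by simp
    have "(\<delta> * L)\<^sup>2 \<le> (sqrt m / 264)\<^sup>2" using \<delta>_sqrt_m \<delta>_pos L_pos by (intro power_mono) auto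
    also have "\<dots> \<le> 2 * m" using m_pos by (simp add: power_divide)
    finally show "e \<le> 1/2" using m_pos by (simp add: e_def power_mult_distrib divide_le_eq mult.commute)
  qed
  have ce: "c = 1 - \<theta> * e" by (simp add: c_def e_def)
  have c: "0 < c" "c \<le> 1"
  proof -
    have "\<theta> * e \<le> 1 * (1/2)" using \<theta> small by (intro mult_mono) auto
    then show "0 < c" by (simp add: ce)
    show "c \<le> 1" using \<theta> small by (simp add: ce)
  qed
  have blP: "bounded_linear (Pr j)" and blE: "bounded_linear (E j)"
    using Pr_linear E_linear by (simp_all add: linear_conv_bounded_linear)
  have nHc: "continuous_on UNIV (\<lambda>z. (nW \<theta> (fst z), snd z))"
    by (intro continuous_intros continuous_on_compose2[OF nW_cont]) auto
  have D1: "1 \<le> real DIM('b)" using DIM_positive[where 'a='b] by linarith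
  show pv: "poly_bdd (\<lambda>z::'a \<times> 'a. norm (Pr j (snd z)))"
    by (rule poly_bdd_mono[OF poly_bdd_norm]) (metis abs_norm_cancel norm_Pr_le[OF j] norm_snd_le order_trans prod.collapse)
  show pg: "poly_bdd (\<lambda>z::'a \<times> 'a. norm (gj j (Pr j (fst z))))"
    by (rule poly_bdd_mono[OF g_poly]) (simp add: Pr_g[OF j, symmetric] norm_Pr_le[OF j])
  show px: "poly_bdd (\<lambda>z::'a \<times> 'a. norm (Pr j (fst z) - xj j))"
  proof (rule poly_bdd_mono)
    show "poly_bdd (\<lambda>z::'a \<times> 'a. norm z + norm (xj j))" by (intro poly_bdd_add poly_bdd_const poly_bdd_norm)
    fix z :: "'a \<times> 'a"
    have "norm (Pr j (fst z)) \<le> norm z" by (metis norm_Pr_le[OF j] norm_fst_le order_trans prod.collapse)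
    then show "\<bar>norm (Pr j (fst z) - xj j)\<bar> \<le> \<bar>norm z + norm (xj j)\<bar>"
      using norm_triangle_ineq4[of "Pr j (fst z)" "xj j"] by simp
  qed
  have bpoly: "poly_bdd (\<lambda>z::'a \<times> 'a. K)" for K :: real by (rule poly_bdd_const)
  have trP: "(\<Sum>h\<in>(Basis::('a \<times> 'a) set). (norm (Pr j (fst h)))\<^sup>2) = DIM('b)"
    "(\<Sum>h\<in>(Basis::('a \<times> 'a) set). (norm (Pr j (snd h)))\<^sup>2) = DIM('b)"
    unfolding sum_Basis_pair
    by (simp_all add: sum_norm_Pr_Basis[OF j] linear_0[OF Pr_linear])
  have "(\<integral>z. norm ((0::'a), E j (Pr j (snd z))) powr q * exp (- Ht \<theta> z) \<partial>lborel)
       \<le> (1 * (real DIM('b) + q - 2) / 1) powr (q / 2) * (\<integral>z. exp (- Ht \<theta> z) \<partial>lborel)"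
  proof (rule moment_bound(2)[where DG="\<lambda>z h. (0, E j (Pr j (snd h)))", OF Ht_deriv nHc nHt_poly c0])
    fix z :: "'a \<times> 'a"
    show "((\<lambda>z. (0::'a, E j (Pr j (snd z)))) has_derivative (\<lambda>h. (0, E j (Pr j (snd h))))) (at z)"
      by (auto intro!: derivative_eq_intros bounded_linear.has_derivative[OF blE] bounded_linear.has_derivative[OF blP])
    show "(\<Sum>b\<in>Basis. ((0::'a), E j (Pr j (snd b))) \<bullet> b) \<le> 1 * real DIM('b)"
      using trP(2) by (simp add: inner_prod_def inner_E[OF j] power2_norm_eq_inner)
    show "((0::'a), E j (Pr j (snd z))) \<bullet> (0, E j (Pr j (snd (0::'a, E j (Pr j (snd z)))))) \<le> 1 * (norm ((0::'a), E j (Pr j (snd z))))\<^sup>2"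
      by (simp add: inner_prod_def inner_E[OF j] Pr_E[OF j j] power2_norm_eq_inner)
    show "1 * (norm ((0::'a), E j (Pr j (snd z))))\<^sup>2 \<le> ((0::'a), E j (Pr j (snd z))) \<bullet> (nW \<theta> (fst z), snd z)"
      by (simp add: inner_prod_def inner_E[OF j] Pr_E[OF j j] power2_norm_eq_inner)
  next
    show "poly_bdd (\<lambda>z::'a \<times> 'a. norm ((0::'a), E j (Pr j (snd z))))" using pv by (simp add: norm_Pair norm_E[OF j])
  qed (use q D1 in \<open>auto intro: poly_bdd_const continuous_on_const\<close>)
  then have "(\<integral>z. norm (Pr j (snd z)) powr q * exp (- Ht \<theta> z) \<partial>lborel) \<le> R powr (q / 2) * Zt \<theta>"
    by (simp add: norm_Pair norm_E[OF j] R_def Zt_def)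
  also have "\<dots> \<le> (R / c) powr (q / 2) * Zt \<theta>"
  proof -
    have "R \<le> R / c" using c q D1 by (simp add: le_divide_eq R_def mult_left_le)
    then show ?thesis using q D1 Zt_pos[OF \<theta>] by (intro mult_right_mono powr_mono2) (auto simp: R_def)
  qed
  finally show "(\<integral>z. norm (Pr j (snd z)) powr q * exp (- Ht \<theta> z) \<partial>lborel) \<le> (R / c) powr (q / 2) * Zt \<theta>" .
  \<comment> \<open>Force and displacement are both fields k(x) in the position of the component, so
    they share one computation with their own derivative bound and drift constant.\<close>
  have field: "(\<integral>z. norm (k (Pr j (fst z))) powr q * exp (- Ht \<theta> z) \<partial>lborel) \<le> (Lc * R / a) powr (q / 2) * Zt \<theta>"
    if k: "\<And>x. (k has_derivative Dk x) (at x)" "\<And>h. continuous_on UNIV (\<lambda>x. Dk x h)"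
      and kp: "poly_bdd (\<lambda>z::'a \<times> 'a. norm (k (Pr j (fst z))))"
      and Dk: "\<And>x h. norm (Dk x h) \<le> Lc * norm h" and a: "0 < a" "0 < Lc"
      and dr: "\<And>x. a * (norm (k x))\<^sup>2 \<le> k x \<bullet> gj j x - \<theta> * (\<delta>\<^sup>2 / 4) * (gj j x \<bullet> Hj j x (k x))"
    for k :: "'b \<Rightarrow> 'b" and Dk Lc a
  proof -
    have Dki: "h \<bullet> Dk x h \<le> Lc * (norm h)\<^sup>2" for x h
    proof -
      have "h \<bullet> Dk x h \<le> norm h * norm (Dk x h)" by (rule norm_cauchy_schwarz)
      also have "\<dots> \<le> norm h * (Lc * norm h)" by (intro mult_left_mono Dk) auto
      finally show ?thesis by (simp add: power2_eq_square mult_ac)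
    qed
    have Pc: "continuous_on UNIV (\<lambda>z::'a \<times> 'a. Pr j (fst z))"
      by (intro continuous_on_compose2[OF linear_continuous_on[OF blP, of UNIV]] continuous_intros) auto
    have "(\<integral>z. norm (E j (k (Pr j (fst z))), (0::'a)) powr q * exp (- Ht \<theta> z) \<partial>lborel)
       \<le> (Lc * (real DIM('b) + q - 2) / a) powr (q / 2) * (\<integral>z. exp (- Ht \<theta> z) \<partial>lborel)"
    proof (rule moment_bound(2)[where DG="\<lambda>z h. (E j (Dk (Pr j (fst z)) (Pr j (fst h))), 0)", OF Ht_deriv nHc nHt_poly c0])
      fix z :: "'a \<times> 'a"
      have "((\<lambda>z. Pr j (fst z)) has_derivative (\<lambda>h. Pr j (fst h))) (at z)"
        by (auto intro!: derivative_eq_intros bounded_linear.has_derivative[OF blP])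
      then have "((\<lambda>z. k (Pr j (fst z))) has_derivative (\<lambda>h. Dk (Pr j (fst z)) (Pr j (fst h)))) (at z)"
        by (rule has_derivative_compose[OF _ k(1)])
      then show "((\<lambda>z. (E j (k (Pr j (fst z))), 0::'a)) has_derivative (\<lambda>h. (E j (Dk (Pr j (fst z)) (Pr j (fst h))), 0))) (at z)"
        by (auto intro!: derivative_eq_intros bounded_linear.has_derivative[OF blE])
      have "(\<Sum>b\<in>Basis. (E j (Dk (Pr j (fst z)) (Pr j (fst b))), (0::'a)) \<bullet> b) \<le> (\<Sum>b\<in>(Basis::('a \<times> 'a) set). Lc * (norm (Pr j (fst b)))\<^sup>2)"
      proof (rule sum_mono)
        fix b :: "'a \<times> 'a"
        show "(E j (Dk (Pr j (fst z)) (Pr j (fst b))), (0::'a)) \<bullet> b \<le> Lc * (norm (Pr j (fst b)))\<^sup>2"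
          using Dki[of "Pr j (fst b)" "Pr j (fst z)"]
          by (simp add: inner_prod_def inner_E[OF j] inner_commute[of "Pr j (fst b)"])
      qed
      then show "(\<Sum>b\<in>Basis. (E j (Dk (Pr j (fst z)) (Pr j (fst b))), (0::'a)) \<bullet> b) \<le> Lc * real DIM('b)"
        by (simp add: sum_distrib_left[symmetric] trP)
      show "(E j (k (Pr j (fst z))), (0::'a)) \<bullet> (E j (Dk (Pr j (fst z)) (Pr j (fst (E j (k (Pr j (fst z))), (0::'a))))), 0)
          \<le> Lc * (norm (E j (k (Pr j (fst z))), (0::'a)))\<^sup>2"
        by (simp add: inner_prod_def inner_E[OF j] Pr_E[OF j j] Dki norm_Pair norm_E[OF j])
      have "(E j (k (Pr j (fst z))), (0::'a)) \<bullet> (nW \<theta> (fst z), snd z)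
          = k (Pr j (fst z)) \<bullet> gj j (Pr j (fst z)) - \<theta> * (\<delta>\<^sup>2 / 4) * (gj j (Pr j (fst z)) \<bullet> Hj j (Pr j (fst z)) (k (Pr j (fst z))))"
        by (simp add: inner_prod_def inner_nW g_H_E[OF j] inner_E[OF j] Pr_g[OF j] del: inner_commute)
      then show "a * (norm (E j (k (Pr j (fst z))), (0::'a)))\<^sup>2 \<le> (E j (k (Pr j (fst z))), (0::'a)) \<bullet> (nW \<theta> (fst z), snd z)"
        using dr[of "Pr j (fst z)"] by (simp add: norm_Pair norm_E[OF j])
    next
      fix h :: "'a \<times> 'a"
      have "continuous_on UNIV (\<lambda>z::'a \<times> 'a. Dk (Pr j (fst z)) (Pr j (fst h)))"
        by (rule continuous_on_compose2[OF k(2) Pc]) auto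
      then show "continuous_on UNIV (\<lambda>z::'a \<times> 'a. (E j (Dk (Pr j (fst z)) (Pr j (fst h))), 0::'a))"
        by (intro continuous_on_Pair continuous_on_const continuous_on_compose2[OF linear_continuous_on[OF blE, of UNIV]]) auto
      show "poly_bdd (\<lambda>z::'a \<times> 'a. norm (E j (Dk (Pr j (fst z)) (Pr j (fst h))), 0::'a))"
        by (rule poly_bdd_mono[OF bpoly[of "Lc * norm (Pr j (fst h))"]])
           (use Dk a in \<open>simp add: norm_Pair norm_E[OF j] abs_mult\<close>)
    next
      show "poly_bdd (\<lambda>z::'a \<times> 'a. norm (E j (k (Pr j (fst z))), (0::'a)))" using kp by (simp add: norm_Pair norm_E[OF j])
    qed (use q D1 a in auto)
    then show ?thesis by (simp add: norm_Pair norm_E[OF j] R_def Zt_def)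
  qed
  show "(\<integral>z. norm (gj j (Pr j (fst z))) powr q * exp (- Ht \<theta> z) \<partial>lborel) \<le> (L * R / c) powr (q / 2) * Zt \<theta>"
  proof (rule field[OF C.g_deriv C.H_cont pg C.norm_H_le c(1) L_pos])
    fix x
    have "gj j x \<bullet> Hj j x (gj j x) \<le> norm (gj j x) * norm (Hj j x (gj j x))" by (rule norm_cauchy_schwarz)
    also have "\<dots> \<le> norm (gj j x) * (L * norm (gj j x))" by (intro mult_left_mono C.norm_H_le) auto
    finally have "\<theta> * (\<delta>\<^sup>2 / 4) * (gj j x \<bullet> Hj j x (gj j x)) \<le> \<theta> * (\<delta>\<^sup>2 / 4) * (norm (gj j x) * (L * norm (gj j x)))"
      using \<theta> by (intro mult_left_mono) auto
    also have "\<dots> = \<theta> * (norm (gj j x))\<^sup>2 * (L * \<delta>\<^sup>2 / 4)" by (simp add: power2_eq_square)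
    also have "\<dots> \<le> \<theta> * (norm (gj j x))\<^sup>2 * e" using small \<theta> by (intro mult_left_mono) auto
    finally show "c * (norm (gj j x))\<^sup>2 \<le> gj j x \<bullet> gj j x - \<theta> * (\<delta>\<^sup>2 / 4) * (gj j x \<bullet> Hj j x (gj j x))"
      by (simp add: ce power2_norm_eq_inner algebra_simps)
  qed
  have k1: "((\<lambda>x. x - xj j) has_derivative (\<lambda>h. h)) (at x)" for x by (auto intro!: derivative_eq_intros)
  have k2: "continuous_on UNIV (\<lambda>x::'b. h)" for h :: 'b by (rule continuous_on_const)
  have mc: "0 < m * c" using m_pos c by simp
  have "(\<integral>z. norm (Pr j (fst z) - xj j) powr q * exp (- Ht \<theta> z) \<partial>lborel) \<le> (1 * R / (m * c)) powr (q / 2) * Zt \<theta>"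
  proof (rule field[OF k1 k2 px _ mc])
    fix x
    let ?y = "x - xj j"
    have gle: "norm (gj j x) \<le> L * norm ?y" by (rule C.norm_g_le)
    have "gj j x \<bullet> Hj j x ?y \<le> norm (gj j x) * norm (Hj j x ?y)" by (rule norm_cauchy_schwarz)
    also have "\<dots> \<le> (L * norm ?y) * (L * norm ?y)" using L_pos by (intro mult_mono gle C.norm_H_le) auto
    finally have "\<theta> * (\<delta>\<^sup>2 / 4) * (gj j x \<bullet> Hj j x ?y) \<le> \<theta> * (\<delta>\<^sup>2 / 4) * ((L * norm ?y) * (L * norm ?y))"
      using \<theta> by (intro mult_left_mono) auto
    also have "\<dots> = \<theta> * (norm ?y)\<^sup>2 * (L\<^sup>2 * \<delta>\<^sup>2 / 4)" by (simp add: power2_eq_square)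
    finally have 1: "\<theta> * (\<delta>\<^sup>2 / 4) * (gj j x \<bullet> Hj j x ?y) \<le> \<theta> * (norm ?y)\<^sup>2 * (m * e)" unfolding small(2) .
    have "m * (norm ?y)\<^sup>2 \<le> ?y \<bullet> gj j x" using C.g_mono[of x "xj j"] C.g_xs by simp
    moreover have "m * c * (norm ?y)\<^sup>2 = m * (norm ?y)\<^sup>2 - \<theta> * (norm ?y)\<^sup>2 * (m * e)" by (simp add: ce algebra_simps)
    ultimately show "m * c * (norm ?y)\<^sup>2 \<le> ?y \<bullet> gj j x - \<theta> * (\<delta>\<^sup>2 / 4) * (gj j x \<bullet> Hj j x ?y)" using 1 by linarith
  qed (use px in auto)
  then show "(\<integral>z. norm (Pr j (fst z) - xj j) powr q * exp (- Ht \<theta> z) \<partial>lborel) \<le> (R / (m * c)) powr (q / 2) * Zt \<theta>"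
    by simp
qed

end

section \<open>Wasserstein bounds by coupling\<close>

lemma gauss_pair: "gauss \<Otimes>\<^sub>M gauss = (gauss :: ('a::euclidean_space \<times> 'b::euclidean_space) measure)"
proof -
  have s: "sigma_finite_measure (density lborel (\<lambda>x::'b. ennreal (gd x)))"
    using prob_space_gauss prob_space_imp_sigma_finite unfolding gauss_def by blast
  have "gauss \<Otimes>\<^sub>M gauss = density (lborel \<Otimes>\<^sub>M lborel) (\<lambda>(x::'a, y::'b). ennreal (gd x) * ennreal (gd y))"
    unfolding gauss_def by (rule pair_measure_density) (auto intro: s lborel.sigma_finite_measure_axioms)
  also have "\<dots> = density lborel (\<lambda>z::'a \<times> 'b. ennreal (gd z))"
  proof -
    have "ennreal (gd x) * ennreal (gd y) = ennreal (gd (x, y))" for x :: 'a and y :: 'b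
      by (simp add: ennreal_mult[symmetric] gd_pos less_imp_le)
         (simp add: gd_def power_add norm_Pair exp_add[symmetric] add_divide_distrib diff_divide_distrib)
    then have "(\<lambda>(x, y). ennreal (gd x) * ennreal (gd y)) = (\<lambda>z::'a \<times> 'b. ennreal (gd z))" by auto
    then show ?thesis by (simp only: lborel_prod)
  qed
  finally show ?thesis by (simp add: gauss_def)
qed

lemma poly_gauss_finite:
  fixes f :: "'a::euclidean_space \<Rightarrow> real"
  assumes p: "poly_bdd f" and [measurable]: "f \<in> borel_measurable borel"
  shows "(\<integral>\<^sup>+x. ennreal (f x) \<partial>gauss) < \<infinity>"
proof -
  let ?k = "(1 / sqrt (2 * pi)) ^ DIM('a)"
  have "integrable lborel (\<lambda>x. f x * exp (- ((norm x)\<^sup>2 / 2)))"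
    by (rule poly_exp_integrable[OF p _ _, where c="1/2" and C=0]) auto
  then have i: "integrable lborel (\<lambda>x. ?k * (f x * exp (- ((norm x)\<^sup>2 / 2))))" by (rule integrable_mult_right)
  have "(\<integral>\<^sup>+x. ennreal (f x) \<partial>gauss) = (\<integral>\<^sup>+x. ennreal (f x) * ennreal (gd x) \<partial>lborel)"
    by (rule nn_integral_gauss) measurable
  also have "\<dots> \<le> (\<integral>\<^sup>+x. ennreal (norm (?k * (f x * exp (- ((norm x)\<^sup>2 / 2))))) \<partial>lborel)"
  proof (rule nn_integral_mono)
    fix x :: 'a
    have "ennreal (f x) * ennreal (gd x) \<le> ennreal \<bar>f x\<bar> * ennreal (gd x)" by (intro mult_right_mono ennreal_leI) auto
    also have "\<dots> = ennreal (\<bar>f x\<bar> * gd x)" by (rule ennreal_mult[symmetric]) (auto simp: gd_pos less_imp_le)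
    also have "\<bar>f x\<bar> * gd x = norm (?k * (f x * exp (- ((norm x)\<^sup>2 / 2))))"
      by (simp add: gd_def abs_mult power_abs)
    finally show "ennreal (f x) * ennreal (gd x) \<le> ennreal (norm (?k * (f x * exp (- ((norm x)\<^sup>2 / 2)))))" .
  qed
  also have "\<dots> < \<infinity>" using i unfolding integrable_iff_bounded by blast
  finally show ?thesis .
qed

section \<open>The OBABO chain: measurability, noise moments and moments of invariant
  measures\<close>

context obabo begin

lemma M_linear_bound: "\<exists>K\<ge>0. \<forall>z. M z \<le> K * norm z"
proof -
  have "bounded_linear twist" using linear_twist by (simp add: linear_conv_bounded_linear)
  then obtain K where "0 < K" "\<And>z. norm (twist z) \<le> norm z * K" using bounded_linear.pos_bounded by blast
  then show ?thesis unfolding M_def by (intro exI[of _ K]) (auto simp: mult.commute)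
qed

lemma M_poly: "poly_bdd (\<lambda>z. norm (h z)) \<Longrightarrow> poly_bdd (\<lambda>z. M (h z))"
proof -
  assume h: "poly_bdd (\<lambda>z. norm (h z))"
  obtain K where K: "0 \<le> K" "\<And>z. M z \<le> K * norm z" using M_linear_bound by blast
  have "poly_bdd (\<lambda>z. K * norm (h z))" by (intro poly_bdd_mult poly_bdd_const h)
  then show ?thesis by (rule poly_bdd_mono) (use K M_nonneg in \<open>simp add: abs_mult\<close>)
qed

lemma M_measurable[measurable]: "M \<in> borel_measurable borel"
proof -
  have "bounded_linear twist" using linear_twist by (simp add: linear_conv_bounded_linear)
  then have "continuous_on UNIV M"
    unfolding M_def by (intro continuous_on_norm linear_continuous_on)
  then show ?thesis by (rule borel_measurable_continuous_onI)
qed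

lemma U_measurable[measurable]: "U \<in> borel_measurable borel"
  by (rule borel_measurable_continuous_onI[OF U_cont])

lemma M_diff_triangle: "M (a - c) \<le> M (a - b) + M (b - c)"
  using M_triangle[of "a - b" "b - c"] by simp

lemma verlet_measurable[measurable]: "verlet \<in> borel_measurable borel"
  by (rule vol_pres_measurable[OF vol_pres_verlet])

lemma step_measurable[measurable]:
  assumes [measurable]: "f \<in> borel_measurable N" "h \<in> borel_measurable N"
  shows "(\<lambda>p. step (f p) (h p)) \<in> borel_measurable N"
proof -
  have "(\<lambda>p. verlet (ostep (f p) (fst (h p)))) \<in> borel_measurable N"
    by (rule measurable_compose[OF _ verlet_measurable]) measurable
  then show ?thesis unfolding step_def by measurable
qed

lemma M_minus_commute: "M (z - w) = M (w - z)"
proof -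
  have "twist (z - w) = - twist (w - z)" by (simp add: linear_diff[OF linear_twist])
  then show ?thesis by (simp add: M_def)
qed

text \<open>Started at (xs, 0), where the gradient vanishes, a step moves by an amount at most
  linear in the noise. This is the source term of the Lyapunov inequality.\<close>

lemma step_noise_moment:
  assumes p: "1 \<le> p"
  shows "(\<integral>\<^sup>+\<xi>. ennreal (M (step (xs, 0) \<xi> - (xs, 0)) powr p) \<partial>gauss) < \<infinity>"
proof (rule poly_gauss_finite)
  have "poly_bdd (\<lambda>\<xi>::'a \<times> 'a. norm (step (xs, 0) \<xi> - (xs, 0)))"
  proof (rule poly_bdd_mono)
    let ?a = "\<delta> * sg + et * (sg + \<delta> / 2 * (L * (\<delta> * sg))) + sg"
    show "poly_bdd (\<lambda>\<xi>::'a \<times> 'a. ?a * norm \<xi>)" by (intro poly_bdd_mult poly_bdd_const poly_bdd_norm)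
    fix \<xi> :: "'a \<times> 'a"
    have n: "norm (fst \<xi>) \<le> norm \<xi>" "norm (snd \<xi>) \<le> norm \<xi>"
      by (metis norm_fst_le norm_snd_le prod.collapse)+
    let ?x = "xs + \<delta> *\<^sub>R (sg *\<^sub>R fst \<xi>)"
    have e: "step (xs, 0) \<xi> - (xs, 0) = (\<delta> *\<^sub>R (sg *\<^sub>R fst \<xi>), et *\<^sub>R (sg *\<^sub>R fst \<xi> - (\<delta> / 2) *\<^sub>R g ?x) + sg *\<^sub>R snd \<xi>)"
      by (simp add: step_def ostep_def verlet_def Let_def g_xs)
    have gx: "norm (g ?x) \<le> L * (\<delta> * sg * norm \<xi>)"
    proof -
      have "norm (g ?x) \<le> L * norm (?x - xs)" by (rule norm_g_le)
      also have "norm (?x - xs) = \<delta> * sg * norm (fst \<xi>)" using \<delta>_pos sg_pos by simp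
      also have "L * (\<delta> * sg * norm (fst \<xi>)) \<le> L * (\<delta> * sg * norm \<xi>)"
        using n \<delta>_pos sg_pos L_pos by (intro mult_left_mono) auto
      finally show ?thesis .
    qed
    have "norm (step (xs, 0) \<xi> - (xs, 0)) \<le> norm (\<delta> *\<^sub>R (sg *\<^sub>R fst \<xi>)) + norm (et *\<^sub>R (sg *\<^sub>R fst \<xi> - (\<delta> / 2) *\<^sub>R g ?x) + sg *\<^sub>R snd \<xi>)"
      unfolding e by (rule norm_Pair_le)
    also have "\<dots> \<le> \<delta> * sg * norm \<xi> + (et * (sg * norm \<xi> + \<delta> / 2 * (L * (\<delta> * sg * norm \<xi>))) + sg * norm \<xi>)"
    proof (rule add_mono)
      show "norm (\<delta> *\<^sub>R (sg *\<^sub>R fst \<xi>)) \<le> \<delta> * sg * norm \<xi>"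
        using n \<delta>_pos sg_pos by (simp add: mult_left_mono)
      have "norm (sg *\<^sub>R fst \<xi> - (\<delta> / 2) *\<^sub>R g ?x) \<le> norm (sg *\<^sub>R fst \<xi>) + norm ((\<delta> / 2) *\<^sub>R g ?x)" by (rule norm_triangle_ineq4)
      also have "\<dots> \<le> sg * norm \<xi> + \<delta> / 2 * (L * (\<delta> * sg * norm \<xi>))"
        using n gx \<delta>_pos sg_pos mult_left_mono[OF gx, of "\<delta> / 2"] by (intro add_mono) (auto simp: mult_left_mono)
      finally have 1: "norm (sg *\<^sub>R fst \<xi> - (\<delta> / 2) *\<^sub>R g ?x) \<le> sg * norm \<xi> + \<delta> / 2 * (L * (\<delta> * sg * norm \<xi>))" .
      have "norm (et *\<^sub>R (sg *\<^sub>R fst \<xi> - (\<delta> / 2) *\<^sub>R g ?x) + sg *\<^sub>R snd \<xi>)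
          \<le> et * norm (sg *\<^sub>R fst \<xi> - (\<delta> / 2) *\<^sub>R g ?x) + sg * norm (snd \<xi>)"
        using norm_triangle_ineq[of "et *\<^sub>R (sg *\<^sub>R fst \<xi> - (\<delta> / 2) *\<^sub>R g ?x)" "sg *\<^sub>R snd \<xi>"] et_bounds sg_pos
        by (simp only: norm_scaleR abs_of_pos)
      also have "\<dots> \<le> et * (sg * norm \<xi> + \<delta> / 2 * (L * (\<delta> * sg * norm \<xi>))) + sg * norm \<xi>"
        using 1 n et_bounds sg_pos by (intro add_mono mult_left_mono) auto
      finally show "norm (et *\<^sub>R (sg *\<^sub>R fst \<xi> - (\<delta> / 2) *\<^sub>R g ?x) + sg *\<^sub>R snd \<xi>)
         \<le> et * (sg * norm \<xi> + \<delta> / 2 * (L * (\<delta> * sg * norm \<xi>))) + sg * norm \<xi>" .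
    qed
    also have "\<dots> = ?a * norm \<xi>" by (simp add: algebra_simps)
    finally show "\<bar>norm (step (xs, 0) \<xi> - (xs, 0))\<bar> \<le> \<bar>?a * norm \<xi>\<bar>" by simp
  qed
  then have "poly_bdd (\<lambda>\<xi>. \<bar>M (step (xs, 0) \<xi> - (xs, 0))\<bar> powr p)"
    using p by (intro poly_bdd_powr M_poly) auto
  then show "poly_bdd (\<lambda>\<xi>. M (step (xs, 0) \<xi> - (xs, 0)) powr p)" by (simp add: M_nonneg)
qed measurable

text \<open>Tested on nonnegative functions, with the two noises of a step merged into one Gaussian
  variable, the form in which invariance is iterated and truncated.\<close>

definition invariant :: "('a \<times> 'a) measure \<Rightarrow> bool" where
  "invariant \<nu> \<longleftrightarrow> prob_space \<nu> \<and> sets \<nu> = sets borel \<and>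
     (\<forall>f\<in>borel_measurable borel. (\<integral>\<^sup>+z. (\<integral>\<^sup>+\<xi>. f (step z \<xi>) \<partial>gauss) \<partial>\<nu>) = (\<integral>\<^sup>+z. (f z :: ennreal) \<partial>\<nu>))"

text \<open>Lyapunov argument with the truncation \<open>min V R\<close>, since integrability of \<open>V\<close> is not known a priori.\<close>

lemma invariant_moment:
  assumes inv: "invariant \<nu>" and p: "1 \<le> p"
  shows "(\<integral>\<^sup>+z. ennreal (M (z - (xs, 0)) powr p) \<partial>\<nu>) < \<infinity>"
proof -
  interpret nu: prob_space \<nu> using inv by (simp add: invariant_def)
  have sn[measurable_cong, simp]: "sets \<nu> = sets borel" using inv by (simp add: invariant_def)
  let ?s = "(xs, 0::'a)"
  define \<rho> where "\<rho> = 1 - \<delta> * \<kappa>"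
  have \<rho>: "0 < \<rho>" "\<rho> < 1" using \<delta>\<kappa> by (auto simp: \<rho>_def)
  define V where "V z = ennreal (M (z - ?s) powr p)" for z
  \<comment> \<open>The weight comes from convexity: (\<rho> x + y)^p \<le> \<rho> x^p + (1 -
    \<rho>)^(1 - p) y^p.\<close>
  define Y where "Y \<xi> = ennreal ((1 - \<rho>) powr (1 - p) * M (step ?s \<xi> - ?s) powr p)" for \<xi>
  have [measurable]: "V \<in> borel_measurable borel" unfolding V_def by measurable
  have [measurable]: "Y \<in> borel_measurable borel" unfolding Y_def by measurable
  have VY: "V (step z \<xi>) \<le> ennreal \<rho> * V z + Y \<xi>" for z \<xi>
  proof -
    let ?x = "M (z - ?s)" and ?y = "M (step ?s \<xi> - ?s)"
    have "M (step z \<xi> - ?s) \<le> M (step z \<xi> - step ?s \<xi>) + ?y" by (rule M_diff_triangle)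
    also have "M (step z \<xi> - step ?s \<xi>) \<le> \<rho> * ?x" unfolding \<rho>_def by (rule step_contraction)
    finally have "M (step z \<xi> - ?s) powr p \<le> (\<rho> * ?x + (1 - \<rho>) * (?y / (1 - \<rho>))) powr p"
      using p \<rho> M_nonneg by (intro powr_mono2) auto
    also have "\<dots> \<le> \<rho> * ?x powr p + (1 - \<rho>) * (?y / (1 - \<rho>)) powr p"
      using powr_sum_le[of "{True, False}" "\<lambda>b. if b then \<rho> else 1 - \<rho>" "\<lambda>b. if b then ?x else ?y / (1 - \<rho>)" p] p \<rho> M_nonneg
      by (auto split: if_splits)
    also have "(1 - \<rho>) * (?y / (1 - \<rho>)) powr p = (1 - \<rho>) powr (1 - p) * ?y powr p"
      using \<rho> M_nonneg[of "step ?s \<xi> - ?s"] by (simp add: powr_divide powr_diff)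
    finally show ?thesis
      unfolding V_def Y_def using \<rho> by (simp add: ennreal_mult[symmetric] ennreal_plus[symmetric] del: ennreal_plus) 
  qed
  define K where "K = (\<integral>\<^sup>+\<xi>. Y \<xi> \<partial>gauss)"
  have K: "K < \<infinity>"
  proof -
    have "K = ennreal ((1 - \<rho>) powr (1 - p)) * (\<integral>\<^sup>+\<xi>. ennreal (M (step ?s \<xi> - ?s) powr p) \<partial>gauss)"
      unfolding K_def Y_def by (subst nn_integral_cmult[symmetric]) (auto simp: ennreal_mult)
    then show ?thesis using step_noise_moment[OF p] by (simp add: ennreal_mult_less_top)
  qed
  \<comment> \<open>Pointwise, min (\<rho> V) R + (1 - \<rho>) V 1{V \<le> R} \<le> min V R.
    Invariance and the Lyapunov inequality bound the integral of the right-hand side by that of min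
    (\<rho> V) R plus \<open>K\<close>; the common integral is at most R, hence finite, and
    cancels.\<close>
  have trunc: "ennreal (1 - \<rho>) * (\<integral>\<^sup>+z. V z * indicator {z. V z \<le> ennreal R} z \<partial>\<nu>) \<le> K" if R: "0 \<le> R" for R
  proof -
    let ?R = "ennreal R"
    let ?a = "\<lambda>z. min (ennreal \<rho> * V z) ?R" and ?b = "\<lambda>z. ennreal (1 - \<rho>) * (V z * indicator {z. V z \<le> ?R} z)"
    have fin: "(\<integral>\<^sup>+z. ?a z \<partial>\<nu>) \<le> ?R"
    proof -
      have "(\<integral>\<^sup>+z. ?a z \<partial>\<nu>) \<le> (\<integral>\<^sup>+z. ?R \<partial>\<nu>)" by (intro nn_integral_mono) auto
      then show ?thesis by (simp add: nu.emeasure_space_1)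
    qed
    have "(\<integral>\<^sup>+z. ?a z \<partial>\<nu>) + (\<integral>\<^sup>+z. ?b z \<partial>\<nu>) = (\<integral>\<^sup>+z. ?a z + ?b z \<partial>\<nu>)"
      by (rule nn_integral_add[symmetric]) measurable
    also have "\<dots> \<le> (\<integral>\<^sup>+z. min (V z) ?R \<partial>\<nu>)"
    proof (rule nn_integral_mono)
      fix z
      show "?a z + ?b z \<le> min (V z) ?R"
      proof (cases "V z \<le> ?R")
        case True
        have "ennreal \<rho> * V z + ennreal (1 - \<rho>) * V z = V z"
        proof -
          have "ennreal \<rho> + ennreal (1 - \<rho>) = 1" using \<rho> by (simp add: ennreal_plus[symmetric] del: ennreal_plus)
          then show ?thesis by (simp add: distrib_right[symmetric])
        qed
        moreover have "?a z \<le> ennreal \<rho> * V z" by simp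
        ultimately have "?a z + ?b z \<le> V z" using True add_right_mono[of "?a z" "ennreal \<rho> * V z" "ennreal (1 - \<rho>) * V z"] by simp
        then show ?thesis using True by simp
      next
        case False
        have "?a z \<le> V z"
        proof -
          have "ennreal \<rho> * V z \<le> 1 * V z" using \<rho> by (intro mult_right_mono) auto
          then show ?thesis by (simp add: min.coboundedI1)
        qed
        then show ?thesis using False by simp
      qed
    qed
    also have "\<dots> = (\<integral>\<^sup>+z. (\<integral>\<^sup>+\<xi>. min (V (step z \<xi>)) ?R \<partial>gauss) \<partial>\<nu>)"
    proof -
      have "(\<lambda>z. min (V z) ?R) \<in> borel_measurable borel" by measurable
      from bspec[OF conjunct2[OF conjunct2[OF inv[unfolded invariant_def]]] this] show ?thesis by simp
    qed
    also have "\<dots> \<le> (\<integral>\<^sup>+z. (\<integral>\<^sup>+\<xi>. ?a z + Y \<xi> \<partial>gauss) \<partial>\<nu>)"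
    proof (intro nn_integral_mono)
      fix z \<xi>
      have "min (V (step z \<xi>)) ?R \<le> min (ennreal \<rho> * V z + Y \<xi>) ?R" using VY by (intro min.mono) auto
      also have "\<dots> \<le> ?a z + Y \<xi>"
      proof (cases "ennreal \<rho> * V z \<le> ?R")
        case True then show ?thesis by (simp add: min.coboundedI1)
      next
        case False then show ?thesis by (simp add: min_def add_increasing2)
      qed
      finally show "min (V (step z \<xi>)) ?R \<le> ?a z + Y \<xi>" .
    qed
    also have "\<dots> = (\<integral>\<^sup>+z. ?a z + K \<partial>\<nu>)"
    proof (rule nn_integral_cong)
      fix z
      show "(\<integral>\<^sup>+\<xi>. ?a z + Y \<xi> \<partial>gauss) = ?a z + K"
        using prob_space.emeasure_space_1[OF prob_space_gauss, where 'a1="'a \<times> 'a"] unfolding K_def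
        by (subst nn_integral_add) auto
    qed
    also have "\<dots> = (\<integral>\<^sup>+z. ?a z \<partial>\<nu>) + K" by (subst nn_integral_add) (auto simp: nu.emeasure_space_1)
    finally have "(\<integral>\<^sup>+z. ?b z \<partial>\<nu>) \<le> K"
      using fin by (auto simp: ennreal_add_left_cancel_le top_unique)
    then show ?thesis by (subst nn_integral_cmult[symmetric]) auto
  qed
  have "(\<integral>\<^sup>+z. V z \<partial>\<nu>) = (SUP n. \<integral>\<^sup>+z. V z * indicator {z. V z \<le> ennreal (real n)} z \<partial>\<nu>)"
  proof -
    have "(\<integral>\<^sup>+z. V z \<partial>\<nu>) = (\<integral>\<^sup>+z. (SUP n. V z * indicator {z. V z \<le> ennreal (real n)} z) \<partial>\<nu>)"
    proof (intro nn_integral_cong antisym)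
      fix z
      obtain n :: nat where "M (z - ?s) powr p \<le> real n" using real_arch_simple by blast
      then have "V z \<le> V z * indicator {z. V z \<le> ennreal (real n)} z" by (simp add: V_def ennreal_leI)
      then show "V z \<le> (SUP n. V z * indicator {z. V z \<le> ennreal (real n)} z)" by (rule SUP_upper2[rotated]) simp
      show "(SUP n. V z * indicator {z. V z \<le> ennreal (real n)} z) \<le> V z"
        by (intro SUP_least) (simp split: split_indicator)
    qed
    also have "\<dots> = (SUP n. \<integral>\<^sup>+z. V z * indicator {z. V z \<le> ennreal (real n)} z \<partial>\<nu>)"
    proof (rule nn_integral_monotone_convergence_SUP)
      show "incseq (\<lambda>n z. V z * indicator {z. V z \<le> ennreal (real n)} z)"
      proof (intro incseq_SucI le_funI)
        fix n z
        have "ennreal (real n) \<le> ennreal (real (Suc n))" by (intro ennreal_leI) simp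
        then have "V z \<le> ennreal (real (Suc n))" if "V z \<le> ennreal (real n)" using that by (rule order_trans[rotated])
        then show "V z * indicator {z. V z \<le> ennreal (real n)} z \<le> V z * indicator {z. V z \<le> ennreal (real (Suc n))} z"
          by (auto simp del: of_nat_Suc split: split_indicator)
      qed
    qed measurable
    finally show ?thesis .
  qed
  also have "ennreal (1 - \<rho>) * \<dots> = (SUP n. ennreal (1 - \<rho>) * (\<integral>\<^sup>+z. V z * indicator {z. V z \<le> ennreal (real n)} z \<partial>\<nu>))"
    by (rule SUP_mult_left_ennreal)
  also have "\<dots> \<le> K" by (intro SUP_least trunc) simp
  finally have "ennreal (1 - \<rho>) * (\<integral>\<^sup>+z. V z \<partial>\<nu>) < \<infinity>" using K by (rule order_le_less_trans)
  then show ?thesis unfolding V_def using \<rho> by (auto simp: ennreal_mult_less_top ennreal_eq_0_iff)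
qed

end

section \<open>The exact chain and its coupling with the discretised one\<close>

context split begin

definition target :: "('a \<times> 'a) measure" where
  "target = density lborel (\<lambda>z. ennreal (exp (- energy z) / Zt 0))"

lemma Ht_0: "Ht 0 = energy"
  by (rule ext) (simp add: Ht_def Wt_def energy_def)

lemma sets_target[simp, measurable_cong]: "sets target = sets borel"
  by (simp add: target_def)

lemma space_target[simp]: "space target = UNIV"
  by (simp add: target_def)

lemma nn_integral_target:
  assumes [measurable]: "f \<in> borel_measurable borel"
  shows "(\<integral>\<^sup>+z. f z \<partial>target) = ennreal (1 / Zt 0) * (\<integral>\<^sup>+z. f z \<partial>phase U)"
proof -
  have w: "ennreal (exp (- energy z) / Zt 0) = ennreal (1 / Zt 0) * ennreal (exp (- U (fst z) - (norm (snd z))\<^sup>2 / 2))" for z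
    using Zt_pos[of 0] by (simp add: ennreal_mult[symmetric] energy_def)
  have "(\<integral>\<^sup>+z. f z \<partial>target) = (\<integral>\<^sup>+z. ennreal (exp (- energy z) / Zt 0) * f z \<partial>lborel)"
    unfolding target_def by (rule nn_integral_density) measurable
  also have "\<dots> = ennreal (1 / Zt 0) * (\<integral>\<^sup>+z. ennreal (exp (- U (fst z) - (norm (snd z))\<^sup>2 / 2)) * f z \<partial>lborel)"
    unfolding w mult.assoc by (rule nn_integral_cmult) measurable
  also have "(\<integral>\<^sup>+z. ennreal (exp (- U (fst z) - (norm (snd z))\<^sup>2 / 2)) * f z \<partial>lborel) = (\<integral>\<^sup>+z. f z \<partial>phase U)"
    unfolding phase_def by (rule nn_integral_density[symmetric]) measurable
  finally show ?thesis .
qed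

lemma prob_space_target: "prob_space target"
proof (rule prob_spaceI)
  have i: "integrable lborel (\<lambda>z. exp (- energy z))"
    using poly_integrable[of 0 "\<lambda>_. 1"] poly_bdd_const[of 1] by (simp add: Ht_0)
  have "emeasure target (space target) = (\<integral>\<^sup>+z. ennreal (exp (- energy z) / Zt 0) \<partial>lborel)"
    by (simp add: target_def emeasure_density)
  also have "\<dots> = ennreal (\<integral>z. exp (- energy z) / Zt 0 \<partial>lborel)"
    using i Zt_pos[of 0] by (intro nn_integral_eq_integral) auto
  also have "\<dots> = 1" using Zt_pos[of 0] by (simp add: Zt_def Ht_0)
  finally show "emeasure target (space target) = 1" .
qed

lemma flow_target:
  assumes f: "(f :: 'a \<times> 'a \<Rightarrow> ennreal) \<in> borel_measurable borel"
  shows "(\<integral>\<^sup>+z. f (flow z) \<partial>target) = (\<integral>\<^sup>+z. f z \<partial>target)"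
proof -
  have fm: "(\<lambda>z. f (flow z)) \<in> borel_measurable borel" by (rule measurable_compose[OF flow_measurable f])
  have "emeasure boltzmann UNIV = (\<integral>\<^sup>+z. ennreal (exp (- energy z)) \<partial>lborel)"
    by (simp add: boltzmann_def emeasure_density)
  also have "\<dots> \<noteq> \<infinity>"
  proof -
    have "integrable lborel (\<lambda>z. exp (- energy z))"
      using poly_integrable[of 0 "\<lambda>_. 1"] poly_bdd_const[of 1] by (simp add: Ht_0)
    then show ?thesis by (simp add: integrable_iff_bounded less_top)
  qed
  finally have "distr boltzmann borel flow = boltzmann" by (rule flow_boltzmann)
  then have "(\<integral>\<^sup>+z. f z \<partial>boltzmann) = (\<integral>\<^sup>+z. f z \<partial>distr boltzmann borel flow)" by simp
  also have "\<dots> = (\<integral>\<^sup>+z. f (flow z) \<partial>boltzmann)" by (rule nn_integral_distr) (auto intro: f)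
  finally show ?thesis using f fm by (simp add: nn_integral_target boltzmann_phase)
qed

lemma ostep_target:
  assumes f[measurable]: "(f :: 'a \<times> 'a \<Rightarrow> ennreal) \<in> borel_measurable borel"
  shows "(\<integral>\<^sup>+z. (\<integral>\<^sup>+\<xi>. f (ostep z \<xi>) \<partial>gauss) \<partial>target) = (\<integral>\<^sup>+z. f z \<partial>target)"
proof -
  interpret G: prob_space "gauss :: 'a measure" by (rule prob_space_gauss)
  have "U \<in> borel_measurable borel" by (rule borel_measurable_continuous_onI[OF U_cont])
  moreover have "(\<lambda>z. \<integral>\<^sup>+\<xi>. f (ostep z \<xi>) \<partial>gauss) \<in> borel_measurable borel" by measurable
  ultimately show ?thesis by (simp add: nn_integral_target ostep_invariant)
qed

definition dev :: "'a \<times> 'a \<Rightarrow> real" where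
  "dev z = sqrt ((norm (fst (flow z) - fst (verlet z)))\<^sup>2 + (norm (snd (flow z) - snd (verlet z)))\<^sup>2 / L)"

lemma dev_measurable[measurable]: "dev \<in> borel_measurable borel"
  unfolding dev_def by measurable

lemma dev_nonneg: "0 \<le> dev z"
  using L_pos by (simp add: dev_def)

text \<open>The OBABO step with the exact flow in place of the Verlet map. Flow and O-steps each
  preserve the Gibbs measure, and so does their composition.\<close>

definition flow_step :: "'a \<times> 'a \<Rightarrow> 'a \<times> 'a \<Rightarrow> 'a \<times> 'a" where
  "flow_step z \<xi> = ostep (flow (ostep z (fst \<xi>))) (snd \<xi>)"

lemma flow_step_measurable[measurable]:
  assumes [measurable]: "f \<in> borel_measurable N" "h \<in> borel_measurable N"
  shows "(\<lambda>p. flow_step (f p) (h p)) \<in> borel_measurable N"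
proof -
  have "(\<lambda>p. flow (ostep (f p) (fst (h p)))) \<in> borel_measurable N"
    by (rule measurable_compose[OF _ flow_measurable]) measurable
  then show ?thesis unfolding flow_step_def by measurable
qed

lemma nn_integral_noise:
  assumes [measurable]: "(f :: 'a \<times> 'a \<Rightarrow> ennreal) \<in> borel_measurable borel"
  shows "(\<integral>\<^sup>+\<xi>. f \<xi> \<partial>gauss) = (\<integral>\<^sup>+\<xi>1. (\<integral>\<^sup>+\<xi>2. f (\<xi>1, \<xi>2) \<partial>gauss) \<partial>gauss)"
proof -
  interpret G: prob_space "gauss :: 'a measure" by (rule prob_space_gauss)
  have [measurable]: "f \<in> borel_measurable (gauss \<Otimes>\<^sub>M gauss)" by (simp add: gauss_pair)
  show ?thesis unfolding gauss_pair[symmetric] by (subst G.nn_integral_fst[symmetric]) auto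
qed

lemma flow_step_target:
  assumes f[measurable]: "(f :: 'a \<times> 'a \<Rightarrow> ennreal) \<in> borel_measurable borel"
  shows "(\<integral>\<^sup>+z. (\<integral>\<^sup>+\<xi>. f (flow_step z \<xi>) \<partial>gauss) \<partial>target) = (\<integral>\<^sup>+z. f z \<partial>target)"
proof -
  interpret G: prob_space "gauss :: 'a measure" by (rule prob_space_gauss)
  let ?h = "\<lambda>z. \<integral>\<^sup>+\<xi>. f (ostep z \<xi>) \<partial>gauss"
  have h[measurable]: "?h \<in> borel_measurable borel" by measurable
  have hf: "(\<lambda>z. ?h (flow z)) \<in> borel_measurable borel" by (rule measurable_compose[OF flow_measurable h])
  have "(\<integral>\<^sup>+\<xi>. f (flow_step z \<xi>) \<partial>gauss) = (\<integral>\<^sup>+\<xi>. ?h (flow (ostep z \<xi>)) \<partial>gauss)" for z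
    by (subst nn_integral_noise) (auto simp: flow_step_def)
  then have "(\<integral>\<^sup>+z. (\<integral>\<^sup>+\<xi>. f (flow_step z \<xi>) \<partial>gauss) \<partial>target) = (\<integral>\<^sup>+z. ?h (flow z) \<partial>target)"
    by (simp add: ostep_target[OF hf])
  also have "\<dots> = (\<integral>\<^sup>+z. f z \<partial>target)" by (simp add: flow_target[OF h] ostep_target)
  finally show ?thesis .
qed

text \<open>Both coordinates move with the same noise: the first by the discretised chain, which
  preserves \<nu>, the second by the exact chain, which preserves \<open>target\<close>, so the
  marginals persist. The L^p distance contracts and picks up the one-step error, evaluated under
  \<open>target\<close>. Minkowski's inequality takes the form of \<open>powr_sum_le\<close> with
  weights \<rho> A and \<epsilon>.\<close>

lemma coupling_step:
  assumes inv: "invariant \<nu>" and c: "c \<in> couplings \<nu> target" and p: "1 \<le> p" and A: "0 < A" and \<epsilon>: "0 < \<epsilon>"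
    and cost: "(\<integral>\<^sup>+w. ennreal (M (fst w - snd w) powr p) \<partial>c) \<le> ennreal (A powr p)"
    and err: "(\<integral>\<^sup>+z. ennreal ((sqrt (3/2) * dev z) powr p) \<partial>target) \<le> ennreal (\<epsilon> powr p)"
  shows "\<exists>c'\<in>couplings \<nu> target. (\<integral>\<^sup>+w. ennreal (M (fst w - snd w) powr p) \<partial>c') \<le> ennreal (((1 - \<delta> * \<kappa>) * A + \<epsilon>) powr p)"
proof -
  interpret G: prob_space "gauss :: ('a \<times> 'a) measure" by (rule prob_space_gauss)
  interpret G1: prob_space "gauss :: 'a measure" by (rule prob_space_gauss)
  have cp: "prob_space c" and sc: "sets c = sets (borel \<Otimes>\<^sub>M borel)"
    and c1: "distr c borel fst = \<nu>" and c2: "distr c borel snd = target"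
    using c by (auto simp: couplings_def)
  interpret c: prob_space c by (rule cp)
  interpret P: pair_prob_space c "gauss :: ('a \<times> 'a) measure" ..
  note sc[measurable_cong]
  have [measurable]: "fst \<in> borel_measurable c" "snd \<in> borel_measurable c"
    unfolding measurable_cong_sets[OF sc refl] by simp_all
  have sn: "sets \<nu> = sets borel" using inv by (simp add: invariant_def)
  let ?S = "\<lambda>q. (step (fst (fst q)) (snd q), flow_step (snd (fst q)) (snd q))"
  have Sm[measurable]: "?S \<in> (c \<Otimes>\<^sub>M gauss) \<rightarrow>\<^sub>M (borel \<Otimes>\<^sub>M borel)" by measurable
  define c' where "c' = distr (c \<Otimes>\<^sub>M gauss) (borel \<Otimes>\<^sub>M borel) ?S"
  have nu_int: "(\<integral>\<^sup>+w. f (fst w) \<partial>c) = (\<integral>\<^sup>+z. f z \<partial>\<nu>)" if [measurable]: "f \<in> borel_measurable borel" for f :: "'a \<times> 'a \<Rightarrow> ennreal"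
    unfolding c1[symmetric] by (subst nn_integral_distr) auto
  have ta_int: "(\<integral>\<^sup>+w. f (snd w) \<partial>c) = (\<integral>\<^sup>+z. f z \<partial>target)" if [measurable]: "f \<in> borel_measurable borel" for f :: "'a \<times> 'a \<Rightarrow> ennreal"
    unfolding c2[symmetric] by (subst nn_integral_distr) auto
  have "c' \<in> couplings \<nu> target"
    unfolding couplings_def mem_Collect_eq
  proof (intro conjI)
    show "prob_space c'" unfolding c'_def by (rule P.prob_space_distr[OF Sm])
    show "sets c' = sets (borel \<Otimes>\<^sub>M borel)" by (simp add: c'_def)
    show "distr c' borel fst = \<nu>"
    proof (rule measure_eqI)
      fix B assume "B \<in> sets (distr c' borel fst)"
      then have [measurable]: "B \<in> sets borel" by simp
      have "emeasure (distr c' borel fst) B = (\<integral>\<^sup>+w. indicator B (fst w) \<partial>c')"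
        by (subst nn_integral_indicator[symmetric], simp, subst nn_integral_distr) (auto simp: c'_def)
      also have "\<dots> = (\<integral>\<^sup>+w. (\<integral>\<^sup>+\<xi>. indicator B (step (fst w) \<xi>) \<partial>gauss) \<partial>c)"
        unfolding c'_def by (subst nn_integral_distr, simp, simp, subst G.nn_integral_fst[symmetric]) auto
      also have "\<dots> = (\<integral>\<^sup>+z. (\<integral>\<^sup>+\<xi>. indicator B (step z \<xi>) \<partial>gauss) \<partial>\<nu>)"
        by (rule nu_int[of "\<lambda>z. \<integral>\<^sup>+\<xi>. indicator B (step z \<xi>) \<partial>gauss"]) measurable
      also have "\<dots> = (\<integral>\<^sup>+z. indicator B z \<partial>\<nu>)"
        using inv unfolding invariant_def by (auto intro!: bspec[of _ _ "indicator B"])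
      also have "\<dots> = emeasure \<nu> B" by (simp add: sn)
      finally show "emeasure (distr c' borel fst) B = emeasure \<nu> B" .
    qed (simp add: sn)
    show "distr c' borel snd = target"
    proof (rule measure_eqI)
      fix B assume "B \<in> sets (distr c' borel snd)"
      then have [measurable]: "B \<in> sets borel" by simp
      have "emeasure (distr c' borel snd) B = (\<integral>\<^sup>+w. indicator B (snd w) \<partial>c')"
        by (subst nn_integral_indicator[symmetric], simp, subst nn_integral_distr) (auto simp: c'_def)
      also have "\<dots> = (\<integral>\<^sup>+w. (\<integral>\<^sup>+\<xi>. indicator B (flow_step (snd w) \<xi>) \<partial>gauss) \<partial>c)"
        unfolding c'_def by (subst nn_integral_distr, simp, simp, subst G.nn_integral_fst[symmetric]) auto
      also have "\<dots> = (\<integral>\<^sup>+z. (\<integral>\<^sup>+\<xi>. indicator B (flow_step z \<xi>) \<partial>gauss) \<partial>target)"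
        by (rule ta_int[of "\<lambda>z. \<integral>\<^sup>+\<xi>. indicator B (flow_step z \<xi>) \<partial>gauss"]) measurable
      also have "\<dots> = (\<integral>\<^sup>+z. indicator B z \<partial>target)" by (rule flow_step_target) simp
      also have "\<dots> = emeasure target B" by simp
      finally show "emeasure (distr c' borel snd) B = emeasure target B" .
    qed simp
  qed
  moreover have "(\<integral>\<^sup>+w. ennreal (M (fst w - snd w) powr p) \<partial>c') \<le> ennreal (((1 - \<delta> * \<kappa>) * A + \<epsilon>) powr p)"
  proof -
    define \<rho> where "\<rho> = 1 - \<delta> * \<kappa>"
    have \<rho>: "0 < \<rho>" using \<delta>\<kappa> by (auto simp: \<rho>_def)
    let ?T = "\<rho> * A + \<epsilon>"
    have T: "0 < ?T" using \<rho> A \<epsilon> by (simp add: add_pos_pos)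
    \<comment> \<open>Chosen so that a A^p + b \<epsilon>^p = (\<rho> A + \<epsilon>)^p.\<close>
    define a where "a = ?T powr (p - 1) * (\<rho> * A / A powr p)"
    define b where "b = ?T powr (p - 1) * (\<epsilon> / \<epsilon> powr p)"
    have ab0: "0 \<le> a" "0 \<le> b" using \<rho> A \<epsilon> by (auto simp: a_def b_def)
    have ptw: "M (step z \<xi> - flow_step y \<xi>) powr p \<le> a * M (z - y) powr p + b * (sqrt (3/2) * dev (ostep y (fst \<xi>))) powr p" for z y \<xi>
    proof -
      let ?X = "M (z - y)" and ?Y = "sqrt (3/2) * dev (ostep y (fst \<xi>))"
      have Y0: "0 \<le> ?Y" by (simp add: dev_nonneg)
      have "M (step z \<xi> - flow_step y \<xi>) \<le> M (step z \<xi> - step y \<xi>) + M (step y \<xi> - flow_step y \<xi>)"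
        by (rule M_diff_triangle)
      also have "M (step z \<xi> - step y \<xi>) \<le> \<rho> * ?X" unfolding \<rho>_def by (rule step_contraction)
      also have "M (step y \<xi> - flow_step y \<xi>) \<le> ?Y"
        using M_ostep_diff[of "flow (ostep y (fst \<xi>))" "snd \<xi>" "verlet (ostep y (fst \<xi>))"]
        unfolding M_minus_commute[of "step y \<xi>"] by (simp add: step_def flow_step_def dev_def)
      finally have "M (step z \<xi> - flow_step y \<xi>) powr p \<le> ((\<rho> * A) * (?X / A) + \<epsilon> * (?Y / \<epsilon>)) powr p"
        using p A \<epsilon> M_nonneg by (intro powr_mono2) auto
      also have "\<dots> \<le> ?T powr (p - 1) * ((\<rho> * A) * (?X / A) powr p + \<epsilon> * (?Y / \<epsilon>) powr p)"
        using powr_sum_le[of "{True, False}" "\<lambda>b. if b then \<rho> * A else \<epsilon>" "\<lambda>b. if b then ?X / A else ?Y / \<epsilon>" p] p \<rho> A \<epsilon> M_nonneg Y0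
        by (auto split: if_splits)
      also have "\<dots> = a * ?X powr p + b * ?Y powr p"
        using A \<epsilon> M_nonneg Y0 by (simp add: a_def b_def powr_divide distrib_left)
      finally show ?thesis .
    qed
    have ptw': "ennreal (M (step z \<xi> - flow_step y \<xi>) powr p)
       \<le> ennreal a * ennreal (M (z - y) powr p) + ennreal b * ennreal ((sqrt (3/2) * dev (ostep y (fst \<xi>))) powr p)" for z y \<xi>
    proof -
      have "ennreal a * ennreal (M (z - y) powr p) + ennreal b * ennreal ((sqrt (3/2) * dev (ostep y (fst \<xi>))) powr p)
         = ennreal (a * M (z - y) powr p + b * (sqrt (3/2) * dev (ostep y (fst \<xi>))) powr p)"
        using ab0 by (simp add: ennreal_mult ennreal_plus)
      then show ?thesis using ptw[of z \<xi> y] by (simp add: ennreal_leI)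
    qed
    have "(\<integral>\<^sup>+w. ennreal (M (fst w - snd w) powr p) \<partial>c') = (\<integral>\<^sup>+w. (\<integral>\<^sup>+\<xi>. ennreal (M (step (fst w) \<xi> - flow_step (snd w) \<xi>) powr p) \<partial>gauss) \<partial>c)"
      unfolding c'_def by (subst nn_integral_distr, simp, simp, subst G.nn_integral_fst[symmetric]) auto
    also have "\<dots> \<le> (\<integral>\<^sup>+w. (\<integral>\<^sup>+\<xi>. ennreal a * ennreal (M (fst w - snd w) powr p) + ennreal b * ennreal ((sqrt (3/2) * dev (ostep (snd w) (fst \<xi>))) powr p) \<partial>(gauss :: ('a \<times> 'a) measure)) \<partial>c)"
      by (intro nn_integral_mono ptw')
    also have "\<dots> = (\<integral>\<^sup>+w. ennreal a * ennreal (M (fst w - snd w) powr p) + ennreal b * (\<integral>\<^sup>+\<xi>. ennreal ((sqrt (3/2) * dev (ostep (snd w) \<xi>)) powr p) \<partial>gauss) \<partial>c)"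
    proof (rule nn_integral_cong)
      fix w :: "('a \<times> 'a) \<times> ('a \<times> 'a)"
      have [measurable]: "(\<lambda>\<xi>. dev (ostep (snd w) (fst \<xi>))) \<in> borel_measurable (borel :: ('a \<times> 'a) measure)"
        by (rule measurable_compose[OF _ dev_measurable]) measurable
      have [measurable]: "(\<lambda>\<xi>. dev (ostep (snd w) \<xi>)) \<in> borel_measurable borel"
        by (rule measurable_compose[OF _ dev_measurable]) measurable
      have "(\<integral>\<^sup>+\<xi>. ennreal ((sqrt (3/2) * dev (ostep (snd w) (fst \<xi>))) powr p) \<partial>(gauss :: ('a \<times> 'a) measure))
        = (\<integral>\<^sup>+\<xi>. ennreal ((sqrt (3/2) * dev (ostep (snd w) \<xi>)) powr p) \<partial>gauss)"
        by (subst nn_integral_noise) (auto simp: G1.emeasure_space_1[simplified])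
      then show "(\<integral>\<^sup>+\<xi>. ennreal a * ennreal (M (fst w - snd w) powr p) + ennreal b * ennreal ((sqrt (3/2) * dev (ostep (snd w) (fst \<xi>))) powr p) \<partial>(gauss :: ('a \<times> 'a) measure))
        = ennreal a * ennreal (M (fst w - snd w) powr p) + ennreal b * (\<integral>\<^sup>+\<xi>. ennreal ((sqrt (3/2) * dev (ostep (snd w) \<xi>)) powr p) \<partial>gauss)"
        by (subst nn_integral_add, simp, simp, subst (2) nn_integral_cmult) (auto simp: G.emeasure_space_1[simplified])
    qed
    also have "\<dots> = ennreal a * (\<integral>\<^sup>+w. ennreal (M (fst w - snd w) powr p) \<partial>c) + ennreal b * (\<integral>\<^sup>+z. (\<integral>\<^sup>+\<xi>. ennreal ((sqrt (3/2) * dev (ostep z \<xi>)) powr p) \<partial>gauss) \<partial>target)"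
    proof -
      have [measurable]: "(\<lambda>q. dev (ostep (fst q) (snd q))) \<in> borel_measurable (borel \<Otimes>\<^sub>M borel)"
        by (rule measurable_compose[OF _ dev_measurable]) measurable
      have Im[measurable]: "(\<lambda>z. \<integral>\<^sup>+\<xi>. ennreal ((sqrt (3/2) * dev (ostep z \<xi>)) powr p) \<partial>gauss) \<in> borel_measurable borel"
        by measurable
      have Im'[measurable]: "(\<lambda>w. \<integral>\<^sup>+\<xi>. ennreal ((sqrt (3/2) * dev (ostep (snd w) \<xi>)) powr p) \<partial>gauss) \<in> borel_measurable c"
        by (rule measurable_compose[OF _ Im]) measurable
      show ?thesis
        unfolding ta_int[OF Im, symmetric]
        by (subst nn_integral_add, simp, simp, subst nn_integral_cmult, simp, subst nn_integral_cmult) auto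
    qed
    also have "(\<integral>\<^sup>+z. (\<integral>\<^sup>+\<xi>. ennreal ((sqrt (3/2) * dev (ostep z \<xi>)) powr p) \<partial>gauss) \<partial>target) = (\<integral>\<^sup>+z. ennreal ((sqrt (3/2) * dev z) powr p) \<partial>target)"
      by (rule ostep_target) measurable
    also have "ennreal a * (\<integral>\<^sup>+w. ennreal (M (fst w - snd w) powr p) \<partial>c) + ennreal b * (\<integral>\<^sup>+z. ennreal ((sqrt (3/2) * dev z) powr p) \<partial>target)
        \<le> ennreal a * ennreal (A powr p) + ennreal b * ennreal (\<epsilon> powr p)"
      by (intro add_mono mult_left_mono cost err) auto
    also have "\<dots> = ennreal (a * A powr p + b * \<epsilon> powr p)"
      using ab0 by (simp add: ennreal_mult ennreal_plus)
    also have "a * A powr p + b * \<epsilon> powr p = ?T powr (p - 1) * ?T"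
      using A \<epsilon> by (simp add: a_def b_def distrib_left)
    also have "\<dots> = ?T powr p" using T by (metis diff_add_cancel powr_add powr_one less_imp_le)
    finally show ?thesis by (simp add: \<rho>_def)
  qed
  ultimately show ?thesis by blast
qed

lemma M_moment_target:
  assumes p: "1 \<le> p" shows "(\<integral>\<^sup>+z. ennreal (M (z - w) powr p) \<partial>target) < \<infinity>"
proof -
  have "poly_bdd (\<lambda>z::'a \<times> 'a. norm (z - w))"
    by (rule poly_bdd_mono[OF poly_bdd_add[OF poly_bdd_norm poly_bdd_const[of "norm w"]]])
       (use norm_triangle_ineq4 in auto)
  then have "poly_bdd (\<lambda>z. \<bar>M (z - w)\<bar> powr p)" using p by (intro poly_bdd_powr M_poly) auto
  then have "integrable lborel (\<lambda>z. M (z - w) powr p * exp (- energy z))"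
    using poly_integrable[of 0 "\<lambda>z. M (z - w) powr p"] by (simp add: M_nonneg Ht_0)
  then have "(\<integral>\<^sup>+z. ennreal (M (z - w) powr p * exp (- energy z)) \<partial>lborel) < \<infinity>"
    by (simp add: integrable_iff_bounded)
  moreover have "(\<integral>\<^sup>+z. ennreal (M (z - w) powr p) \<partial>phase U) = (\<integral>\<^sup>+z. ennreal (M (z - w) powr p * exp (- energy z)) \<partial>lborel)"
    unfolding boltzmann_phase[symmetric] boltzmann_def
    by (subst nn_integral_density) (auto simp: ennreal_mult mult.commute)
  ultimately show ?thesis by (subst nn_integral_target) (auto simp: ennreal_mult_less_top)
qed

text \<open>The product measure is a coupling, and its cost is finite because both marginals have
  p-th moments.\<close>

lemma initial_coupling:
  assumes inv: "invariant \<nu>" and p: "1 \<le> p"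
  shows "\<exists>A>0. \<exists>c\<in>couplings \<nu> target. (\<integral>\<^sup>+w. ennreal (M (fst w - snd w) powr p) \<partial>c) \<le> ennreal (A powr p)"
proof -
  interpret nu: prob_space \<nu> using inv by (simp add: invariant_def)
  interpret ta: prob_space target by (rule prob_space_target)
  have sn[measurable_cong, simp]: "sets \<nu> = sets borel" using inv by (simp add: invariant_def)
  interpret P: pair_prob_space \<nu> target ..
  let ?s = "(xs, 0::'a)"
  let ?c = "\<nu> \<Otimes>\<^sub>M target"
  have sets_c: "sets ?c = sets (borel \<Otimes>\<^sub>M borel)" by (intro sets_pair_measure_cong) auto
  have c: "?c \<in> couplings \<nu> target"
  proof -
    have "distr ?c borel fst = distr ?c \<nu> fst" by (intro distr_cong) auto
    also have "\<dots> = \<nu>" by (rule ta.distr_pair_fst)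
    finally have 1: "distr ?c borel fst = \<nu>" .
    have "distr ?c borel snd = distr ?c target snd" by (intro distr_cong) auto
    also have "\<dots> = target"
    proof (rule measure_eqI)
      fix B assume "B \<in> sets (distr ?c target snd)"
      then have B[measurable]: "B \<in> sets borel" by simp
      have sp: "space \<nu> = UNIV" using sets_eq_imp_space_eq[OF sn] by simp
      have "emeasure (distr ?c target snd) B = emeasure ?c (space \<nu> \<times> B)"
        using B by (subst emeasure_distr) (auto simp: space_pair_measure sp intro!: arg_cong2[where f=emeasure])
      also have "\<dots> = emeasure target B"
        using B nu.emeasure_space_1 by (subst ta.emeasure_pair_measure_Times) (auto simp: sp)
      finally show "emeasure (distr ?c target snd) B = emeasure target B" .
    qed simp
    finally have 2: "distr ?c borel snd = target" .
    show ?thesis unfolding couplings_def using 1 2 P.prob_space_axioms sets_c by auto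
  qed
  have ptw: "ennreal (M (z - y) powr p) \<le> ennreal (2 powr (p - 1)) * (ennreal (M (z - ?s) powr p) + ennreal (M (y - ?s) powr p))" for z y
  proof -
    have "M (z - y) \<le> M (z - ?s) + M (?s - y)" by (rule M_diff_triangle)
    then have "M (z - y) powr p \<le> (M (z - ?s) + M (y - ?s)) powr p"
      unfolding M_minus_commute[of ?s y] using p M_nonneg by (intro powr_mono2) auto
    also have "\<dots> \<le> 2 powr (p - 1) * (M (z - ?s) powr p + M (y - ?s) powr p)"
      using powr_sum_le[of "{True, False}" "\<lambda>_. 1" "\<lambda>b. if b then M (z - ?s) else M (y - ?s)" p] p M_nonneg
      by (auto split: if_splits)
    finally show ?thesis by (simp add: ennreal_mult[symmetric] ennreal_plus[symmetric] ennreal_leI del: ennreal_plus)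
  qed
  have "(\<integral>\<^sup>+w. ennreal (M (fst w - snd w) powr p) \<partial>?c) = (\<integral>\<^sup>+z. (\<integral>\<^sup>+y. ennreal (M (z - y) powr p) \<partial>target) \<partial>\<nu>)"
    by (subst ta.nn_integral_fst[symmetric]) auto
  also have "\<dots> \<le> (\<integral>\<^sup>+z. (\<integral>\<^sup>+y. ennreal (2 powr (p - 1)) * (ennreal (M (z - ?s) powr p) + ennreal (M (y - ?s) powr p)) \<partial>target) \<partial>\<nu>)"
    by (intro nn_integral_mono ptw)
  also have "\<dots> = ennreal (2 powr (p - 1)) * ((\<integral>\<^sup>+z. ennreal (M (z - ?s) powr p) \<partial>\<nu>) + (\<integral>\<^sup>+y. ennreal (M (y - ?s) powr p) \<partial>target))"
  proof -
    have "(\<integral>\<^sup>+y. ennreal (2 powr (p - 1)) * (ennreal (M (z - ?s) powr p) + ennreal (M (y - ?s) powr p)) \<partial>target)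
      = ennreal (2 powr (p - 1)) * (ennreal (M (z - ?s) powr p) + (\<integral>\<^sup>+y. ennreal (M (y - ?s) powr p) \<partial>target))" for z
      by (subst nn_integral_cmult, simp, subst nn_integral_add) (auto simp: ta.emeasure_space_1[simplified])
    then show ?thesis
      by (simp, subst nn_integral_cmult, simp, subst nn_integral_add) (auto simp: nu.emeasure_space_1)
  qed
  also have "\<dots> < \<infinity>"
    using M_moment_target[OF p, of ?s] invariant_moment[OF inv p] by (simp add: ennreal_mult_less_top)
  finally have fin: "(\<integral>\<^sup>+w. ennreal (M (fst w - snd w) powr p) \<partial>?c) < \<infinity>" .
  then obtain r where r: "0 \<le> r" "(\<integral>\<^sup>+w. ennreal (M (fst w - snd w) powr p) \<partial>?c) = ennreal r"
    by (auto simp: less_top_ennreal)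
  \<comment> \<open>Adding 1 keeps the bound positive when the cost is zero.\<close>
  let ?A = "(r + 1) powr (1 / p)"
  have "?A powr p = r + 1" using r p by (simp add: powr_powr)
  then have "(\<integral>\<^sup>+w. ennreal (M (fst w - snd w) powr p) \<partial>?c) \<le> ennreal (?A powr p)"
    unfolding r(2) by (intro ennreal_leI) simp
  then show ?thesis using c r by (intro exI[of _ ?A]) (auto intro!: bexI[of _ ?c])
qed

text \<open>Since the marginals never change, the coupling step can be iterated on one pair of
  measures. The cost recursion A \<mapsto> \<rho> A + \<epsilon> has the fixed point \<epsilon> /
  (\<delta> \<kappa>); \<eta> absorbs what is left of the initial cost after finitely many
  steps.\<close>

lemma near_optimal_coupling:
  assumes inv: "invariant \<nu>" and p: "1 \<le> p" and \<epsilon>: "0 < \<epsilon>" and \<eta>: "0 < \<eta>"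
    and err: "(\<integral>\<^sup>+z. ennreal ((sqrt (3/2) * dev z) powr p) \<partial>target) \<le> ennreal (\<epsilon> powr p)"
  shows "\<exists>c\<in>couplings \<nu> target. (\<integral>\<^sup>+w. ennreal (M (fst w - snd w) powr p) \<partial>c) \<le> ennreal ((\<epsilon> / (\<delta> * \<kappa>) + \<eta>) powr p)"
proof -
  define \<rho> where "\<rho> = 1 - \<delta> * \<kappa>"
  have \<rho>: "0 < \<rho>" "\<rho> < 1" "1 - \<rho> = \<delta> * \<kappa>" using \<delta>\<kappa> by (auto simp: \<rho>_def)
  obtain A where A: "0 < A" and c0: "\<exists>c\<in>couplings \<nu> target. (\<integral>\<^sup>+w. ennreal (M (fst w - snd w) powr p) \<partial>c) \<le> ennreal (A powr p)"
    using initial_coupling[OF inv p] by blast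
  have e0: "0 < \<epsilon> / (\<delta> * \<kappa>)" using \<epsilon> \<delta>\<kappa> by simp
  have iter: "\<exists>c\<in>couplings \<nu> target. (\<integral>\<^sup>+w. ennreal (M (fst w - snd w) powr p) \<partial>c) \<le> ennreal ((\<rho> ^ n * A + \<epsilon> / (\<delta> * \<kappa>)) powr p)" for n
  proof (induction n)
    case 0
    have "A powr p \<le> (\<rho> ^ 0 * A + \<epsilon> / (\<delta> * \<kappa>)) powr p" using A e0 p by (intro powr_mono2) auto
    then show ?case using c0 by (meson ennreal_leI order_trans)
  next
    case (Suc n)
    then obtain c where c: "c \<in> couplings \<nu> target"
      and cost: "(\<integral>\<^sup>+w. ennreal (M (fst w - snd w) powr p) \<partial>c) \<le> ennreal ((\<rho> ^ n * A + \<epsilon> / (\<delta> * \<kappa>)) powr p)" by blast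
    have "\<exists>c'\<in>couplings \<nu> target. (\<integral>\<^sup>+w. ennreal (M (fst w - snd w) powr p) \<partial>c') \<le> ennreal (((1 - \<delta> * \<kappa>) * (\<rho> ^ n * A + \<epsilon> / (\<delta> * \<kappa>)) + \<epsilon>) powr p)"
      using A e0 \<rho> by (intro coupling_step[OF inv c p _ \<epsilon> cost err]) (auto simp: add_pos_pos)
    moreover have "(1 - \<delta> * \<kappa>) * (\<rho> ^ n * A + \<epsilon> / (\<delta> * \<kappa>)) + \<epsilon> = \<rho> ^ Suc n * A + \<epsilon> / (\<delta> * \<kappa>)"
    proof -
      define d where "d = \<delta> * \<kappa>"
      have "d \<noteq> 0" unfolding d_def using \<delta>\<kappa>(1) by (metis less_irrefl)
      then show ?thesis unfolding \<rho>_def d_def[symmetric] by (simp add: algebra_simps diff_divide_distrib)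
    qed
    ultimately show ?case by simp
  qed
  have "(\<lambda>n. \<rho> ^ n * A) \<longlonglongrightarrow> 0 * A" using \<rho> by (intro tendsto_mult_right LIMSEQ_realpow_zero) auto
  then have "\<forall>\<^sub>F n in sequentially. \<rho> ^ n * A < \<eta>" using \<eta> by (intro order_tendstoD(2)) auto
  then obtain n where n: "\<rho> ^ n * A < \<eta>" by (auto simp: eventually_sequentially)
  have "(\<rho> ^ n * A + \<epsilon> / (\<delta> * \<kappa>)) powr p \<le> (\<epsilon> / (\<delta> * \<kappa>) + \<eta>) powr p"
    using n A \<rho> e0 p by (intro powr_mono2) auto
  then show ?thesis using iter[of n] by (meson ennreal_leI order_trans)
qed

text \<open>\<open>norm_le_M\<close> converts the cost of the couplings into the Euclidean one, and
  the slack \<eta> disappears in the infimum.\<close>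

lemma wasserstein_le:
  assumes inv: "invariant \<nu>" and p: "1 \<le> p" and \<epsilon>: "0 < \<epsilon>"
    and err: "(\<integral>\<^sup>+z. ennreal ((sqrt (3/2) * dev z) powr p) \<partial>target) \<le> ennreal (\<epsilon> powr p)"
  shows "wasserstein p \<nu> target \<le> ennreal (sqrt 2 * max 1 (sqrt L) * (\<epsilon> / (\<delta> * \<kappa>)))"
proof -
  let ?K = "sqrt 2 * max 1 (sqrt L)" and ?B = "\<epsilon> / (\<delta> * \<kappa>)"
  have K0: "0 < ?K" by (simp add: less_max_iff_disj)
  have B0: "0 < ?B" using \<epsilon> \<delta>\<kappa> by simp
  let ?I = "INF c\<in>couplings \<nu> target. \<integral>\<^sup>+w. ennreal (dist (fst w) (snd w) powr p) \<partial>c"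
  have le: "?I \<le> ennreal ((?K * (?B + \<eta>)) powr p)" if \<eta>: "0 < \<eta>" for \<eta>
  proof -
    obtain c where c: "c \<in> couplings \<nu> target"
      and cost: "(\<integral>\<^sup>+w. ennreal (M (fst w - snd w) powr p) \<partial>c) \<le> ennreal ((?B + \<eta>) powr p)"
      using near_optimal_coupling[OF inv p \<epsilon> \<eta> err] by blast
    have sc: "sets c = sets (borel \<Otimes>\<^sub>M borel)" using c by (simp add: couplings_def)
    note sc[measurable_cong]
    have [measurable]: "fst \<in> borel_measurable c" "snd \<in> borel_measurable c"
      unfolding measurable_cong_sets[OF sc refl] by simp_all
    have "?I \<le> (\<integral>\<^sup>+w. ennreal (dist (fst w) (snd w) powr p) \<partial>c)" by (rule INF_lower[OF c])
    also have "\<dots> \<le> (\<integral>\<^sup>+w. ennreal (?K powr p) * ennreal (M (fst w - snd w) powr p) \<partial>c)"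
    proof (rule nn_integral_mono)
      fix w :: "('a \<times> 'a) \<times> ('a \<times> 'a)"
      have "dist (fst w) (snd w) powr p \<le> (?K * M (fst w - snd w)) powr p"
        using norm_le_M[of "fst w - snd w"] p by (intro powr_mono2) (auto simp: dist_norm)
      also have "\<dots> = ?K powr p * M (fst w - snd w) powr p" by (rule powr_mult)
      finally show "ennreal (dist (fst w) (snd w) powr p) \<le> ennreal (?K powr p) * ennreal (M (fst w - snd w) powr p)"
        by (simp add: ennreal_mult[symmetric] ennreal_leI)
    qed
    also have "\<dots> = ennreal (?K powr p) * (\<integral>\<^sup>+w. ennreal (M (fst w - snd w) powr p) \<partial>c)"
      by (rule nn_integral_cmult) measurable
    also have "\<dots> \<le> ennreal (?K powr p) * ennreal ((?B + \<eta>) powr p)" by (intro mult_left_mono cost) auto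
    also have "\<dots> = ennreal ((?K * (?B + \<eta>)) powr p)" by (simp add: ennreal_mult[symmetric] powr_mult)
    finally show ?thesis .
  qed
  have fin: "?I \<noteq> \<top>" by (rule neq_top_trans[OF ennreal_neq_top le[OF zero_less_one]])
  define i where "i = enn2real ?I"
  have i: "?I = ennreal i" "0 \<le> i" using ennreal_enn2real[of ?I] fin unfolding i_def less_top by simp_all
  have "i powr (1 / p) \<le> ?K * (?B + \<eta>)" if \<eta>: "0 < \<eta>" for \<eta>
  proof -
    have nn: "0 \<le> ?K * (?B + \<eta>)" using K0 B0 \<eta> by simp
    have "i \<le> (?K * (?B + \<eta>)) powr p" using le[OF \<eta>] unfolding i(1) by (simp add: ennreal_le_iff)
    then have "i powr (1 / p) \<le> ((?K * (?B + \<eta>)) powr p) powr (1 / p)" using p i by (intro powr_mono2) auto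
    also have "\<dots> = ?K * (?B + \<eta>)" using p nn by (simp add: powr_powr)
    finally show ?thesis .
  qed
  then have "i powr (1 / p) \<le> ?K * ?B + e" if "0 < e" for e
    using K0 that by (metis (no_types, opaque_lifting) distrib_left divide_pos_pos nonzero_mult_div_cancel_left less_irrefl times_divide_eq_right)
  then have "i powr (1 / p) \<le> ?K * ?B" by (rule field_le_epsilon)
  then show ?thesis unfolding wasserstein_def ennreal_root_def if_not_P[OF fin] i_def by (rule ennreal_leI)
qed

end

section \<open>Moments of the one-step error\<close>

lemma powr_sum4_le:
  fixes c0 c1 c2 c3 a b d p :: real
  assumes "0 \<le> c0" "0 \<le> c1" "0 \<le> c2" "0 \<le> c3" "0 \<le> a" "0 \<le> b" "0 \<le> d" "1 \<le> p"
  shows "(c0 + c1 * a + c2 * b + c3 * d) powr p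
    \<le> (c0 + c1 + c2 + c3) powr (p - 1) * (c0 + c1 * a powr p + c2 * b powr p + c3 * d powr p)"
proof -
  let ?c = "\<lambda>i. [c0, c1, c2, c3] ! i" and ?y = "\<lambda>i. [1, a, b, d] ! i"
  have "(\<Sum>i\<in>{0,1,2,3}. ?c i * ?y i) powr p \<le> (\<Sum>i\<in>{0,1,2,3}. ?c i) powr (p - 1) * (\<Sum>i\<in>{0,1,2,3}. ?c i * ?y i powr p)"
    using assms by (intro powr_sum_le) auto
  then show ?thesis by (simp add: add.assoc)
qed

context split begin

definition pj :: "'j \<Rightarrow> 'a \<times> 'a \<Rightarrow> 'b \<times> 'b" where
  "pj j z = (Pr j (fst z), Pr j (snd z))"

definition vp :: "real \<Rightarrow> real \<Rightarrow> 'j \<Rightarrow> 'a \<times> 'a \<Rightarrow> real" where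
  "vp R s j z = (norm (Pr j (snd z)) / sqrt R) powr s"

definition gp :: "real \<Rightarrow> real \<Rightarrow> 'j \<Rightarrow> 'a \<times> 'a \<Rightarrow> real" where
  "gp R s j z = (norm (gj j (Pr j (fst z))) / sqrt L / sqrt R) powr s"

definition xp :: "real \<Rightarrow> real \<Rightarrow> 'j \<Rightarrow> 'a \<times> 'a \<Rightarrow> real" where
  "xp R s j z = (sqrt m * norm (Pr j (fst z) - xj j) / sqrt R) powr s"

definition ct :: "real \<Rightarrow> real" where
  "ct \<theta> = 1 - \<theta> * (\<delta>\<^sup>2 * L\<^sup>2 / (4 * m))"

lemma D_ge_1: "1 \<le> real DIM('b)"
  using DIM_positive[where 'a='b] by linarith

lemma Pr_measurable[measurable]: "Pr j \<in> borel_measurable borel"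
  using Pr_linear by (intro borel_measurable_continuous_onI linear_continuous_on) (simp add: linear_conv_bounded_linear)

lemma gj_measurable[measurable]: "j \<in> J \<Longrightarrow> gj j \<in> borel_measurable borel"
proof -
  assume j: "j \<in> J"
  interpret C: growth "Uj j" "gj j" "Hj j" m L "xj j" \<gamma> \<delta> l Ll by (rule comp[OF j])
  show ?thesis by measurable
qed

text \<open>After scaling, velocity, force and displacement obey the same bound, which is Zt 0 at
  \<theta> = 0: every normalised Gibbs moment of the order matched to \<open>R\<close> is at most
  one.\<close>

lemma normalised_moments:
  assumes \<theta>: "0 \<le> \<theta>" "\<theta> \<le> 1" and j: "j \<in> J" and q: "2 \<le> q" and c: "0 < ct \<theta>"
  defines "R \<equiv> real DIM('b) + q - 2"
  shows "(\<integral>z. vp R q j z * exp (- Ht \<theta> z) \<partial>lborel) \<le> (1 / ct \<theta>) powr (q / 2) * Zt \<theta>"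
    and "(\<integral>z. gp R q j z * exp (- Ht \<theta> z) \<partial>lborel) \<le> (1 / ct \<theta>) powr (q / 2) * Zt \<theta>"
    and "(\<integral>z. xp R q j z * exp (- Ht \<theta> z) \<partial>lborel) \<le> (1 / ct \<theta>) powr (q / 2) * Zt \<theta>"
    and "integrable lborel (\<lambda>z. vp R q j z * exp (- Ht \<theta> z))"
    and "integrable lborel (\<lambda>z. gp R q j z * exp (- Ht \<theta> z))"
    and "integrable lborel (\<lambda>z. xp R q j z * exp (- Ht \<theta> z))"
proof -
  note [measurable] = gj_measurable[OF j]
  have R: "1 \<le> R" unfolding R_def using q D_ge_1 by linarith
  note mom = moments[OF \<theta> j q, folded R_def ct_def]
  have pd: "poly_bdd (\<lambda>z. (norm (f z)) powr q)" if "poly_bdd (\<lambda>z. norm (f z))" for f :: "'a \<times> 'a \<Rightarrow> 'b"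
    using poly_bdd_powr[OF that, of q] q by simp
  have sq: "sqrt t powr q = t powr (q / 2)" if "0 \<le> t" for t
    using that by (simp add: powr_half_sqrt[symmetric] powr_powr)
  have v: "vp R q j = (\<lambda>z. (1 / R powr (q / 2)) * norm (Pr j (snd z)) powr q)"
    using R by (intro ext) (simp add: vp_def powr_divide sq)
  have g': "gp R q j = (\<lambda>z. (1 / (L * R) powr (q / 2)) * norm (gj j (Pr j (fst z))) powr q)"
    using R L_pos by (intro ext) (simp add: gp_def powr_divide sq powr_mult)
  have x: "xp R q j = (\<lambda>z. (m powr (q / 2) / R powr (q / 2)) * norm (Pr j (fst z) - xj j) powr q)"
    using R m_pos by (intro ext) (simp add: xp_def powr_divide sq powr_mult)
  have i: "integrable lborel (\<lambda>z. norm (Pr j (snd z)) powr q * exp (- Ht \<theta> z))"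
      "integrable lborel (\<lambda>z. norm (gj j (Pr j (fst z))) powr q * exp (- Ht \<theta> z))"
      "integrable lborel (\<lambda>z. norm (Pr j (fst z) - xj j) powr q * exp (- Ht \<theta> z))"
    by (intro poly_integrable \<theta> pd mom(4-6); measurable)+
  show "integrable lborel (\<lambda>z. vp R q j z * exp (- Ht \<theta> z))"
    "integrable lborel (\<lambda>z. gp R q j z * exp (- Ht \<theta> z))"
    "integrable lborel (\<lambda>z. xp R q j z * exp (- Ht \<theta> z))"
    unfolding v g' x mult.assoc by (intro integrable_mult_right i)+
  have "(\<integral>z. vp R q j z * exp (- Ht \<theta> z) \<partial>lborel) \<le> (1 / R powr (q / 2)) * ((R / ct \<theta>) powr (q / 2) * Zt \<theta>)"
    unfolding v mult.assoc integral_mult_right_zero by (intro mult_left_mono mom(1)) auto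
  also have "\<dots> = (1 / ct \<theta>) powr (q / 2) * Zt \<theta>" using R c by (simp add: powr_divide)
  finally show "(\<integral>z. vp R q j z * exp (- Ht \<theta> z) \<partial>lborel) \<le> (1 / ct \<theta>) powr (q / 2) * Zt \<theta>" .
  have "(\<integral>z. gp R q j z * exp (- Ht \<theta> z) \<partial>lborel) \<le> (1 / (L * R) powr (q / 2)) * ((L * R / ct \<theta>) powr (q / 2) * Zt \<theta>)"
    unfolding g' mult.assoc integral_mult_right_zero by (intro mult_left_mono mom(2)[unfolded mult.assoc]) auto
  also have "\<dots> = (1 / ct \<theta>) powr (q / 2) * Zt \<theta>" using R c L_pos by (simp add: powr_divide)
  finally show "(\<integral>z. gp R q j z * exp (- Ht \<theta> z) \<partial>lborel) \<le> (1 / ct \<theta>) powr (q / 2) * Zt \<theta>" .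
  have "(\<integral>z. xp R q j z * exp (- Ht \<theta> z) \<partial>lborel) \<le> (m powr (q / 2) / R powr (q / 2)) * ((R / (m * ct \<theta>)) powr (q / 2) * Zt \<theta>)"
    unfolding x mult.assoc integral_mult_right_zero by (intro mult_left_mono mom(3)) auto
  also have "\<dots> = (1 / ct \<theta>) powr (q / 2) * Zt \<theta>" using R c m_pos by (simp add: powr_divide powr_mult)
  finally show "(\<integral>z. xp R q j z * exp (- Ht \<theta> z) \<partial>lborel) \<le> (1 / ct \<theta>) powr (q / 2) * Zt \<theta>" .
qed

text \<open>The bound of \<open>edev_le\<close> with every normalised power replaced by one: 3/10 =
  1/5 + 1/10 and 7/22 = (1 + 2 * 3) / 22.\<close>

definition cerr :: "real \<Rightarrow> real" where
  "cerr R = \<delta>^3 * R powr (l / 2) * (3/10 * L + 7/22 * (Ll * 2 powr (l - 2) * (1 + m powr (- (l / 2))) / sqrt L))"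

definition edev :: "'j \<Rightarrow> 'a \<times> 'a \<Rightarrow> real" where
  "edev j z = norm (Pr j (fst (flow z) - fst (verlet z))) + norm (Pr j (snd (flow z) - snd (verlet z))) / sqrt L"

text \<open>Projection maps a path of the full system to a path of the component and commutes with
  the Verlet map, so the local error of the component applies.\<close>

lemma edev_le:
  assumes j: "j \<in> J" and R: "1 \<le> R"
  shows "edev j z \<le> \<delta>^3 * R powr (l / 2) * (L * (1/5 * ((vp R l j z + (l - 1)) / l) + 1/10 * ((gp R l j z + (l - 1)) / l))
      + Ll * 2 powr (l - 2) * (1 + m powr (- (l / 2))) / sqrt L * (1/22) * (1 + 2 * (vp R l j z + gp R l j z + xp R l j z)))"
proof -
  interpret C: growth "Uj j" "gj j" "Hj j" m L "xj j" \<gamma> \<delta> l Ll by (rule comp[OF j])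
  have bl: "bounded_linear (Pr j)" using Pr_linear by (simp add: linear_conv_bounded_linear)
  have path: "C.is_path (pj j z) (\<lambda>s. Pr j (Xp z s)) (\<lambda>s. Pr j (Vp z s))"
    using is_path[of z] unfolding is_path_def C.is_path_def pj_def
    by (auto intro!: bounded_linear.has_vector_derivative[OF bl, THEN has_vector_derivative_eq_rhs]
        simp: linear_neg[OF Pr_linear] Pr_g[OF j])
  have ver: "C.verlet (pj j z) = pj j (verlet z)"
    by (simp add: C.verlet_def verlet_def pj_def Let_def linear_add[OF Pr_linear] linear_diff[OF Pr_linear]
        linear_cmul[OF Pr_linear] Pr_g[OF j])
  have "edev j z = norm (Pr j (Xp z \<delta>) - fst (C.verlet (pj j z))) + norm (Pr j (Vp z \<delta>) - snd (C.verlet (pj j z))) / sqrt L"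
    unfolding edev_def flow_def ver by (simp add: pj_def linear_diff[OF Pr_linear])
  also note C.local_error[OF R path]
  finally show ?thesis
    by (simp add: C.vel_pow_def C.grad_pow_def C.pos_pow_def vp_def gp_def xp_def pj_def)
qed

lemma edev_nonneg: "0 \<le> edev j z"
  using L_pos by (simp add: edev_def)

lemma edev_measurable[measurable]: "edev j \<in> borel_measurable borel"
  unfolding edev_def by measurable

lemma nn_integral_target_real:
  assumes f: "f \<in> borel_measurable borel" "\<And>z. 0 \<le> f z" and i: "integrable lborel (\<lambda>z. f z * exp (- Ht 0 z))"
  shows "(\<integral>\<^sup>+z. ennreal (f z) \<partial>target) = ennreal ((\<integral>z. f z * exp (- Ht 0 z) \<partial>lborel) / Zt 0)"
proof -
  note [measurable] = f(1)
  have "(\<integral>\<^sup>+z. ennreal (f z) \<partial>target) = (\<integral>\<^sup>+z. ennreal (exp (- energy z) / Zt 0) * ennreal (f z) \<partial>lborel)"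
    unfolding target_def by (rule nn_integral_density) measurable
  also have "\<dots> = (\<integral>\<^sup>+z. ennreal (f z * exp (- Ht 0 z) / Zt 0) \<partial>lborel)"
    using f Zt_pos[of 0] by (intro nn_integral_cong) (simp add: ennreal_mult[symmetric] Ht_0 mult.commute)
  also have "\<dots> = ennreal (\<integral>z. f z * exp (- Ht 0 z) / Zt 0 \<partial>lborel)"
    using i f Zt_pos[of 0] by (intro nn_integral_eq_integral) auto
  finally show ?thesis by simp
qed

text \<open>With q = l p, the p-th powers of the normalised l-th powers are normalised q-th powers,
  whose means are at most one for this \<open>R\<close>. Weighted Jensen then bounds the L^p norm of
  the error by the sum of its coefficients, which is \<open>cerr R\<close>.\<close>

lemma edev_moment:
  assumes j: "j \<in> J" and p: "1 \<le> p"
  shows "(\<integral>\<^sup>+z. ennreal (edev j z powr p) \<partial>target) \<le> ennreal (cerr (real DIM('b) + l * p - 2) powr p)"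
proof -
  note [measurable] = gj_measurable[OF j]
  define R where "R = real DIM('b) + l * p - 2"
  define q where "q = l * p"
  have q: "2 \<le> q" using mult_mono[of 2 l 1 p] l_ge p by (simp add: q_def)
  have R: "1 \<le> R" unfolding R_def using q D_ge_1 unfolding q_def by linarith
  have Rq: "R = real DIM('b) + q - 2" by (simp add: R_def q_def)
  define B where "B = \<delta>^3 * R powr (l / 2)"
  define F where "F = Ll * 2 powr (l - 2) * (1 + m powr (- (l / 2))) / sqrt L"
  have B0: "0 \<le> B" using \<delta>_pos by (simp add: B_def)
  have F0: "0 \<le> F" unfolding F_def using Ll_pos L_pos by (intro divide_nonneg_nonneg mult_nonneg_nonneg) auto
  define c0 where "c0 = B * (L * (3/10 * ((l - 1) / l)) + F / 22)"
  define c1 where "c1 = B * (L * (1/5 / l) + F / 11)"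
  define c2 where "c2 = B * (L * (1/10 / l) + F / 11)"
  define c3 where "c3 = B * (F / 11)"
  have c_nn: "0 \<le> c0" "0 \<le> c1" "0 \<le> c2" "0 \<le> c3"
    unfolding c0_def c1_def c2_def c3_def using B0 F0 L_pos l_ge by (auto intro!: mult_nonneg_nonneg add_nonneg_nonneg)
  have c_sum: "c0 + c1 + c2 + c3 = cerr R"
    using l_ge unfolding c0_def c1_def c2_def c3_def cerr_def B_def[symmetric] F_def[symmetric]
    by (simp add: field_simps)
  have le: "edev j z \<le> c0 + c1 * vp R l j z + c2 * gp R l j z + c3 * xp R l j z" for z
  proof -
    have "B * (L * (1/5 * ((vp R l j z + (l - 1)) / l) + 1/10 * ((gp R l j z + (l - 1)) / l))
      + F * (1/22) * (1 + 2 * (vp R l j z + gp R l j z + xp R l j z)))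
      = c0 + c1 * vp R l j z + c2 * gp R l j z + c3 * xp R l j z"
      using l_ge unfolding c0_def c1_def c2_def c3_def by (simp add: field_simps)
    then show ?thesis using edev_le[OF j R, of z] unfolding B_def F_def by simp
  qed
  have pow: "vp R l j z powr p = vp R q j z" "gp R l j z powr p = gp R q j z" "xp R l j z powr p = xp R q j z" for z
    by (simp_all add: vp_def gp_def xp_def powr_powr q_def)
  have nn: "0 \<le> vp R s j z" "0 \<le> gp R s j z" "0 \<le> xp R s j z" for s z by (simp_all add: vp_def gp_def xp_def)
  let ?C = "c0 + c1 + c2 + c3"
  let ?f = "\<lambda>z. ?C powr (p - 1) * (c0 + c1 * vp R q j z + c2 * gp R q j z + c3 * xp R q j z)"
  have ptw: "edev j z powr p \<le> ?f z" for z
  proof -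
    have "edev j z powr p \<le> (c0 + c1 * vp R l j z + c2 * gp R l j z + c3 * xp R l j z) powr p"
      using le p edev_nonneg by (intro powr_mono2) auto
    also have "\<dots> \<le> ?f z" unfolding pow[symmetric] using c_nn nn p by (intro powr_sum4_le) auto
    finally show ?thesis .
  qed
  have ct0: "ct 0 = 1" by (simp add: ct_def)
  note nm = normalised_moments[of 0 j q, folded Rq, unfolded ct0, simplified]
  have fm: "?f \<in> borel_measurable borel" unfolding vp_def gp_def xp_def by measurable
  have f0: "0 \<le> ?f z" for z using c_nn nn by (intro mult_nonneg_nonneg add_nonneg_nonneg) auto
  have one: "integrable lborel (\<lambda>z. exp (- Ht 0 z))" using poly_integrable[of 0 "\<lambda>_. 1"] poly_bdd_const[of 1] by simp
  have fe: "(\<lambda>z. ?f z * exp (- Ht 0 z)) = (\<lambda>z. ?C powr (p - 1) * (c0 * exp (- Ht 0 z) + c1 * (vp R q j z * exp (- Ht 0 z))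
      + c2 * (gp R q j z * exp (- Ht 0 z)) + c3 * (xp R q j z * exp (- Ht 0 z))))"
    by (intro ext) (simp add: algebra_simps)
  have fi: "integrable lborel (\<lambda>z. ?f z * exp (- Ht 0 z))"
    unfolding fe using nm(4-6)[OF j q] one
    by (intro integrable_mult_right Bochner_Integration.integrable_add) auto
  have "(\<integral>z. ?f z * exp (- Ht 0 z) \<partial>lborel) = ?C powr (p - 1) * (c0 * Zt 0 + c1 * (\<integral>z. vp R q j z * exp (- Ht 0 z) \<partial>lborel)
     + c2 * (\<integral>z. gp R q j z * exp (- Ht 0 z) \<partial>lborel) + c3 * (\<integral>z. xp R q j z * exp (- Ht 0 z) \<partial>lborel))"
    unfolding fe using nm(4-6)[OF j q] one
    by (subst integral_mult_right_zero, (subst Bochner_Integration.integral_add; (intro integrable_mult_right Bochner_Integration.integrable_add)?)+)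
       (auto simp: Zt_def)
  also have "\<dots> \<le> ?C powr (p - 1) * (c0 * Zt 0 + c1 * Zt 0 + c2 * Zt 0 + c3 * Zt 0)"
    using nm(1-3)[OF j q] c_nn by (intro mult_left_mono add_mono) auto
  also have "\<dots> = ?C powr p * Zt 0"
  proof -
    have "?C powr (p - 1) * ?C = ?C powr p"
      using c_nn by (cases "?C = 0") (simp_all add: powr_diff)
    then show ?thesis by (simp add: distrib_right[symmetric] mult.assoc[symmetric])
  qed
  finally have int: "(\<integral>z. ?f z * exp (- Ht 0 z) \<partial>lborel) / Zt 0 \<le> ?C powr p"
    using Zt_pos[of 0] by (simp add: divide_le_eq)
  have "(\<integral>\<^sup>+z. ennreal (edev j z powr p) \<partial>target) \<le> (\<integral>\<^sup>+z. ennreal (?f z) \<partial>target)"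
    by (intro nn_integral_mono ennreal_leI ptw)
  also have "\<dots> = ennreal ((\<integral>z. ?f z * exp (- Ht 0 z) \<partial>lborel) / Zt 0)"
    by (rule nn_integral_target_real[OF fm f0 fi])
  also have "\<dots> \<le> ennreal (?C powr p)" by (rule ennreal_leI[OF int])
  finally show ?thesis unfolding c_sum R_def .
qed

lemma dev_sq_le: "(dev z)\<^sup>2 \<le> (\<Sum>j\<in>J. (edev j z)\<^sup>2)"
proof -
  have "(dev z)\<^sup>2 = (\<Sum>j\<in>J. (norm (Pr j (fst (flow z) - fst (verlet z))))\<^sup>2 + (norm (Pr j (snd (flow z) - snd (verlet z))))\<^sup>2 / L)"
    unfolding dev_def using L_pos by (simp add: norm_sq_split[symmetric] sum.distrib sum_divide_distrib[symmetric])
  also have "\<dots> \<le> (\<Sum>j\<in>J. (edev j z)\<^sup>2)"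
    using L_pos by (intro sum_mono) (simp add: edev_def power2_sum power_divide)
  finally show ?thesis .
qed

lemma cerr_pos: "0 < R \<Longrightarrow> 0 < cerr R"
  unfolding cerr_def using \<delta>_pos L_pos Ll_pos
  by (intro mult_pos_pos add_pos_nonneg mult_nonneg_nonneg divide_nonneg_nonneg) auto

text \<open>The component errors are added in \<ell>1, giving a factor N = \<open>card J\<close> for
  all p, or in \<ell>2, giving sqrt N for p \<ge> 2. Both cases lead to the same pointwise estimate
  by nf^p / N times the sum of p-th powers.\<close>

lemma dev_moment:
  assumes p: "1 \<le> p" and nf: "nf = real (card J) \<or> (2 \<le> p \<and> nf = sqrt (real (card J)))"
  shows "(\<integral>\<^sup>+z. ennreal ((sqrt (3/2) * dev z) powr p) \<partial>target)
     \<le> ennreal ((sqrt (3/2) * (nf * cerr (real DIM('b) + l * p - 2))) powr p)"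
proof -
  let ?N = "real (card J)" and ?E = "cerr (real DIM('b) + l * p - 2)"
  have N: "1 \<le> ?N" using finJ J_ne by (simp add: Suc_leI card_gt_0_iff)
  have "2 * 1 \<le> l * p" using l_ge p by (intro mult_mono) auto
  then have "0 < real DIM('b) + l * p - 2" using D_ge_1 by linarith
  then have "0 < ?E" by (rule cerr_pos)
  have nf0: "0 < nf" using nf N by auto
  have ptw: "dev z powr p \<le> (nf powr p / ?N) * (\<Sum>j\<in>J. edev j z powr p)" for z
    using nf
  proof
    assume t: "nf = ?N"
    have "(dev z)\<^sup>2 \<le> (\<Sum>j\<in>J. edev j z)\<^sup>2"
    proof -
      have "(\<Sum>j\<in>J. (edev j z)\<^sup>2) \<le> (\<Sum>j\<in>J. edev j z * (\<Sum>i\<in>J. edev i z))"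
        unfolding power2_eq_square using finJ edev_nonneg
        by (intro sum_mono mult_left_mono member_le_sum) auto
      then show ?thesis using dev_sq_le[of z] by (simp add: power2_eq_square sum_distrib_right[symmetric])
    qed
    then have "dev z \<le> (\<Sum>j\<in>J. edev j z)" by (rule power2_le_imp_le) (simp add: sum_nonneg edev_nonneg)
    then have "dev z powr p \<le> (\<Sum>j\<in>J. 1 * edev j z) powr p" using p dev_nonneg by (intro powr_mono2) auto
    also have "\<dots> \<le> (\<Sum>j\<in>J. 1) powr (p - 1) * (\<Sum>j\<in>J. 1 * edev j z powr p)"
      using finJ p edev_nonneg by (intro powr_sum_le) auto
    finally show ?thesis using N by (simp add: t powr_diff)
  next
    assume t: "2 \<le> p \<and> nf = sqrt ?N"
    have "dev z powr p = ((dev z)\<^sup>2) powr (p / 2)"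
      using dev_nonneg[of z] by (cases "dev z = 0") (simp_all add: powr_powr flip: powr_numeral)
    also have "\<dots> \<le> (\<Sum>j\<in>J. 1 * (edev j z)\<^sup>2) powr (p / 2)" using dev_sq_le p by (intro powr_mono2) auto
    also have "\<dots> \<le> (\<Sum>j\<in>J. 1) powr (p / 2 - 1) * (\<Sum>j\<in>J. 1 * ((edev j z)\<^sup>2) powr (p / 2))"
      using finJ t by (intro powr_sum_le) auto
    also have "(\<Sum>j\<in>J. 1 * ((edev j z)\<^sup>2) powr (p / 2)) = (\<Sum>j\<in>J. edev j z powr p)"
    proof (rule sum.cong[OF refl])
      fix j
      show "1 * ((edev j z)\<^sup>2) powr (p / 2) = edev j z powr p"
        using edev_nonneg[of j z] by (cases "edev j z = 0") (simp_all add: powr_powr flip: powr_numeral)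
    qed
    also have "(\<Sum>j\<in>J. (1::real)) powr (p / 2 - 1) = nf powr p / ?N"
      using N t by (simp add: powr_diff powr_half_sqrt[symmetric] powr_powr)
    finally show ?thesis .
  qed
  let ?k = "sqrt (3/2) powr p * (nf powr p / ?N)"
  have k0: "0 \<le> ?k" using N by simp
  have "(\<integral>\<^sup>+z. ennreal ((sqrt (3/2) * dev z) powr p) \<partial>target) \<le> (\<integral>\<^sup>+z. ennreal ?k * (\<Sum>j\<in>J. ennreal (edev j z powr p)) \<partial>target)"
  proof (rule nn_integral_mono)
    fix z
    have "(sqrt (3/2) * dev z) powr p = sqrt (3/2) powr p * dev z powr p" by (rule powr_mult)
    also have "\<dots> \<le> sqrt (3/2) powr p * ((nf powr p / ?N) * (\<Sum>j\<in>J. edev j z powr p))"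
      by (intro mult_left_mono ptw) auto
    finally have "(sqrt (3/2) * dev z) powr p \<le> ?k * (\<Sum>j\<in>J. edev j z powr p)" by (simp add: mult.assoc)
    then have "ennreal ((sqrt (3/2) * dev z) powr p) \<le> ennreal (?k * (\<Sum>j\<in>J. edev j z powr p))" by (rule ennreal_leI)
    also have "\<dots> = ennreal ?k * (\<Sum>j\<in>J. ennreal (edev j z powr p))"
      using k0 by (subst ennreal_mult) (auto simp: sum_nonneg)
    finally show "ennreal ((sqrt (3/2) * dev z) powr p) \<le> ennreal ?k * (\<Sum>j\<in>J. ennreal (edev j z powr p))" .
  qed
  also have "\<dots> = ennreal ?k * (\<Sum>j\<in>J. \<integral>\<^sup>+z. ennreal (edev j z powr p) \<partial>target)"
    by (subst nn_integral_cmult, measurable, subst nn_integral_sum) auto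
  also have "\<dots> \<le> ennreal ?k * (\<Sum>j\<in>J. ennreal (?E powr p))"
    using edev_moment[OF _ p] by (intro mult_left_mono sum_mono) auto
  also have "\<dots> = ennreal (?k * (?N * ?E powr p))"
    using k0 by (subst ennreal_mult) (auto simp: ennreal_of_nat_eq_real_of_nat ennreal_mult)
  also have "?k * (?N * ?E powr p) = (sqrt (3/2) * (nf * ?E)) powr p"
    using N \<open>0 < ?E\<close> nf0 by (simp add: powr_mult)
  finally show ?thesis .
qed

lemma wasserstein_target:
  assumes inv: "invariant \<nu>" and p: "1 \<le> p" and nf: "nf = real (card J) \<or> (2 \<le> p \<and> nf = sqrt (real (card J)))"
  shows "wasserstein p \<nu> target \<le> ennreal (sqrt 3 * max 1 (sqrt L) * (nf * cerr (real DIM('b) + l * p - 2) / (\<delta> * \<kappa>)))"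
proof -
  let ?E = "cerr (real DIM('b) + l * p - 2)"
  have N: "1 \<le> real (card J)" using finJ J_ne by (simp add: Suc_leI card_gt_0_iff)
  have "2 * 1 \<le> l * p" using l_ge p by (intro mult_mono) auto
  then have "0 < real DIM('b) + l * p - 2" using D_ge_1 by linarith
  then have E: "0 < ?E" by (rule cerr_pos)
  have nf0: "0 < nf" using nf N by auto
  have "wasserstein p \<nu> target \<le> ennreal (sqrt 2 * max 1 (sqrt L) * (sqrt (3/2) * (nf * ?E) / (\<delta> * \<kappa>)))"
    using E nf0 by (intro wasserstein_le[OF inv p _ dev_moment[OF p nf]]) simp
  \<comment> \<open>The two equivalence constants of \<open>M\<close> multiply to the sqrt 3 in
    \<open>K1\<close>.\<close>
  moreover have "sqrt 2 * sqrt (3/2) = sqrt (3::real)" by (simp add: real_sqrt_mult[symmetric])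
  then have "sqrt 2 * k * (sqrt (3/2) * e / d) = sqrt 3 * k * (e / d)" for k e d :: real
    by (metis (no_types, opaque_lifting) mult.assoc mult.left_commute times_divide_eq_right)
  ultimately show ?thesis by (simp only:)
qed

end

section \<open>Total variation bounds\<close>

text \<open>The Hellinger bound on the total variation distance between a Gaussian and its translate.\<close>

lemma gauss_shift_positive_part:
  fixes h :: "'a::euclidean_space"
  shows "(\<integral>\<^sup>+\<xi>. ennreal (gd (\<xi> - h) - gd \<xi>) \<partial>lborel) \<le> ennreal (norm h / 2)"
proof (cases "h = 0")
  case False
  then have h0: "0 < norm h" by simp
  let ?p = "\<lambda>\<xi>. gd (\<xi> - h)" and ?r = "\<lambda>\<xi>. sqrt (gd (\<xi> - h)) * sqrt (gd \<xi>)"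
  have gi: "integrable lborel (gd :: 'a \<Rightarrow> real)"
    by (rule integrableI_nonneg) (auto simp: nn_integral_gd gd_pos less_imp_le)
  have g1: "(\<integral>\<xi>. gd (\<xi> :: 'a) \<partial>lborel) = 1"
    by (rule integral_eq_nn_integral[THEN trans]) (auto simp: nn_integral_gd gd_pos less_imp_le)
  have tr: "integrable lborel (\<lambda>\<xi>. gd (\<xi> - k))" "(\<integral>\<xi>. gd (\<xi> - k) \<partial>lborel) = 1" for k :: 'a
  proof -
    have "integrable (distr lborel borel ((+) (- k))) (gd :: 'a \<Rightarrow> real)" using gi by (simp add: lborel_distr_plus)
    then show "integrable lborel (\<lambda>\<xi>. gd (\<xi> - k))" by (subst (asm) integrable_distr_eq) auto
    have "(\<integral>\<xi>. gd (\<xi> :: 'a) \<partial>distr lborel borel ((+) (- k))) = 1" using g1 by (simp add: lborel_distr_plus)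
    then show "(\<integral>\<xi>. gd (\<xi> - k) \<partial>lborel) = 1" by (subst (asm) integral_distr) auto
  qed
  \<comment> \<open>The Hellinger affinity of the two Gaussians: the geometric mean of their
    densities is this number times the density centred halfway.\<close>
  let ?B = "exp (- (norm h)\<^sup>2 / 8)"
  have r: "?r \<xi> = ?B * gd (\<xi> - (1/2) *\<^sub>R h)" for \<xi>
  proof -
    have "sqrt (gd x) = sqrt ((1 / sqrt (2 * pi)) ^ DIM('a)) * exp (- (norm x)\<^sup>2 / 4)" for x :: 'a
    proof -
      have "exp (- (norm x)\<^sup>2 / 2) = (exp (- (norm x)\<^sup>2 / 4))\<^sup>2" by (simp add: exp_double[symmetric])
      then show ?thesis by (simp add: gd_def real_sqrt_mult)
    qed
    moreover have "(norm (\<xi> - h))\<^sup>2 / 4 + (norm \<xi>)\<^sup>2 / 4 = (norm h)\<^sup>2 / 8 + (norm (\<xi> - (1/2) *\<^sub>R h))\<^sup>2 / 2"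
      unfolding power2_norm_eq_inner by (simp add: inner_diff_left inner_diff_right inner_commute algebra_simps add_divide_distrib diff_divide_distrib)
    then have "exp (- (norm (\<xi> - h))\<^sup>2 / 4) * exp (- (norm \<xi>)\<^sup>2 / 4) = ?B * exp (- (norm (\<xi> - (1/2) *\<^sub>R h))\<^sup>2 / 2)"
      unfolding exp_add[symmetric] by (simp add: algebra_simps)
    ultimately show ?thesis by (simp add: gd_def mult_ac)
  qed
  have ri: "integrable lborel ?r" "(\<integral>\<xi>. ?r \<xi> \<partial>lborel) = ?B" unfolding r using tr by auto
  have pi': "integrable lborel ?p" "(\<integral>\<xi>. ?p \<xi> \<partial>lborel) = 1" by (rule tr)+
  \<comment> \<open>The weight of Young's inequality for |a - b| (a + b); with it both terms
    contribute at most |h| / 2 to the integral.\<close>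
  let ?k = "4 / norm h"
  let ?b = "\<lambda>\<xi>. 1/2 * (?k * (?p \<xi> + gd \<xi> - 2 * ?r \<xi>) + (?p \<xi> + gd \<xi> + 2 * ?r \<xi>) / ?k)"
  have bound: "\<bar>?p \<xi> - gd \<xi>\<bar> \<le> ?b \<xi>" for \<xi>
  proof -
    define a b where "a = sqrt (?p \<xi>)" and "b = sqrt (gd \<xi>)"
    have ab: "?p \<xi> = a\<^sup>2" "gd \<xi> = b\<^sup>2" "0 \<le> a" "0 \<le> b" by (auto simp: a_def b_def gd_pos less_imp_le)
    have k0: "0 < ?k" using h0 by simp
    have "\<bar>a\<^sup>2 - b\<^sup>2\<bar> = \<bar>a - b\<bar> * (a + b)" using ab by (simp add: abs_mult power2_eq_square square_diff_square_factored)
    also have "\<dots> \<le> 1/2 * (?k * (a - b)\<^sup>2 + (a + b)\<^sup>2 / ?k)"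
    proof -
      have "0 \<le> (sqrt ?k * \<bar>a - b\<bar> - (a + b) / sqrt ?k)\<^sup>2" by simp
      also have "\<dots> = ?k * (a - b)\<^sup>2 - 2 * (\<bar>a - b\<bar> * (a + b)) + (a + b)\<^sup>2 / ?k"
        using k0 by (simp add: power2_diff power_mult_distrib power_divide)
      finally show ?thesis by simp
    qed
    also have "\<dots> = 1/2 * (?k * (a\<^sup>2 + b\<^sup>2 - 2 * (a * b)) + (a\<^sup>2 + b\<^sup>2 + 2 * (a * b)) / ?k)"
      by (simp add: power2_diff power2_sum)
    finally show ?thesis unfolding ab(1) ab(2) using ab by simp
  qed
  have di: "integrable lborel (\<lambda>\<xi>. ?p \<xi> - gd \<xi>)" using pi' gi by auto
  have bi: "integrable lborel ?b" using pi' gi ri by (intro integrable_mult_right Bochner_Integration.integrable_add integrable_divide Bochner_Integration.integrable_diff) auto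
  have "(\<integral>\<xi>. \<bar>?p \<xi> - gd \<xi>\<bar> \<partial>lborel) \<le> (\<integral>\<xi>. ?b \<xi> \<partial>lborel)"
    using di bi bound by (intro integral_mono integrable_abs) auto
  also have "\<dots> = 1/2 * (?k * (2 - 2 * ?B) + (2 + 2 * ?B) / ?k)"
    using pi' gi ri g1 by simp
  also have "\<dots> \<le> norm h"
  proof -
    have "1 - (norm h)\<^sup>2 / 8 \<le> ?B" using exp_ge_add_one_self[of "- (norm h)\<^sup>2 / 8"] by simp
    then have 1: "?k * (2 - 2 * ?B) \<le> ?k * ((norm h)\<^sup>2 / 4)" using h0 by (intro mult_left_mono) auto
    have 2: "(2 + 2 * ?B) / ?k \<le> 4 / ?k" using h0 by (intro divide_right_mono) auto
    have "?k * ((norm h)\<^sup>2 / 4) = norm h" "4 / ?k = norm h" using h0 by (simp_all add: power2_eq_square)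
    then show ?thesis using 1 2 by simp
  qed
  finally have abs_le: "(\<integral>\<xi>. \<bar>?p \<xi> - gd \<xi>\<bar> \<partial>lborel) \<le> norm h" .
  have zero: "(\<integral>\<xi>. ?p \<xi> - gd \<xi> \<partial>lborel) = 0" using pi' gi g1 by simp
  have mi: "integrable lborel (\<lambda>\<xi>. max 0 (?p \<xi> - gd \<xi>))" using di by (intro integrable_max) auto
  have "(\<integral>\<xi>. max 0 (?p \<xi> - gd \<xi>) \<partial>lborel) = (\<integral>\<xi>. 1/2 * (\<bar>?p \<xi> - gd \<xi>\<bar> + (?p \<xi> - gd \<xi>)) \<partial>lborel)"
    by (intro Bochner_Integration.integral_cong) (auto simp: max_def)
  also have "\<dots> = 1/2 * ((\<integral>\<xi>. \<bar>?p \<xi> - gd \<xi>\<bar> \<partial>lborel) + (\<integral>\<xi>. ?p \<xi> - gd \<xi> \<partial>lborel))"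
    unfolding integral_mult_right_zero using di by (subst Bochner_Integration.integral_add) (auto intro: integrable_abs)
  also have "\<dots> \<le> norm h / 2" unfolding zero using abs_le by simp
  finally have le: "(\<integral>\<xi>. max 0 (?p \<xi> - gd \<xi>) \<partial>lborel) \<le> norm h / 2" .
  have "(\<integral>\<^sup>+\<xi>. ennreal (?p \<xi> - gd \<xi>) \<partial>lborel) = (\<integral>\<^sup>+\<xi>. ennreal (max 0 (?p \<xi> - gd \<xi>)) \<partial>lborel)"
    by (simp add: ennreal_max_0)
  also have "\<dots> = ennreal (\<integral>\<xi>. max 0 (?p \<xi> - gd \<xi>) \<partial>lborel)" using mi by (intro nn_integral_eq_integral) auto
  also have "\<dots> \<le> ennreal (norm h / 2)" using le by (rule ennreal_leI)
  finally show ?thesis .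
qed simp

text \<open>For 0 \<le> F \<le> 1 only the positive part of the difference of densities counts,
  whence the factor 1/2.\<close>

lemma gauss_shift:
  fixes F :: "'a::euclidean_space \<Rightarrow> ennreal"
  assumes [measurable]: "F \<in> borel_measurable borel" and F1: "\<And>\<xi>. F \<xi> \<le> 1"
  shows "(\<integral>\<^sup>+\<xi>. F (\<xi> + h) \<partial>gauss) \<le> (\<integral>\<^sup>+\<xi>. F \<xi> \<partial>gauss) + ennreal (norm h / 2)"
proof -
  have "(\<integral>\<^sup>+\<xi>. F (\<xi> + h) \<partial>gauss) = (\<integral>\<^sup>+\<xi>. F (\<xi> + h) * ennreal (gd \<xi>) \<partial>lborel)" by (rule nn_integral_gauss) measurable
  also have "\<dots> = (\<integral>\<^sup>+\<xi>. F (\<xi> + h) * ennreal (gd (\<xi> + h - h)) \<partial>lborel)" by simp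
  also have "\<dots> = (\<integral>\<^sup>+\<xi>. F \<xi> * ennreal (gd (\<xi> - h)) \<partial>lborel)"
    by (rule nn_integral_lborel_translation[of "\<lambda>\<xi>. F \<xi> * ennreal (gd (\<xi> - h))"]) measurable
  also have "\<dots> \<le> (\<integral>\<^sup>+\<xi>. F \<xi> * ennreal (gd \<xi>) + ennreal (gd (\<xi> - h) - gd \<xi>) \<partial>lborel)"
  proof (rule nn_integral_mono)
    fix \<xi>
    have "ennreal (gd (\<xi> - h)) \<le> ennreal (gd \<xi>) + ennreal (gd (\<xi> - h) - gd \<xi>)"
    proof (cases "gd \<xi> \<le> gd (\<xi> - h)")
      case True
      then have "ennreal (gd \<xi>) + ennreal (gd (\<xi> - h) - gd \<xi>) = ennreal (gd (\<xi> - h))"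
        by (subst ennreal_plus[symmetric]) (auto simp: gd_pos less_imp_le)
      then show ?thesis by simp
    next
      case False
      then have "ennreal (gd (\<xi> - h)) \<le> ennreal (gd \<xi>)" by (intro ennreal_leI) simp
      then show ?thesis by (rule add_increasing2[rotated]) simp
    qed
    then have "F \<xi> * ennreal (gd (\<xi> - h)) \<le> F \<xi> * (ennreal (gd \<xi>) + ennreal (gd (\<xi> - h) - gd \<xi>))" by (rule mult_left_mono) simp
    also have "\<dots> \<le> F \<xi> * ennreal (gd \<xi>) + 1 * ennreal (gd (\<xi> - h) - gd \<xi>)"
      unfolding distrib_left by (intro add_left_mono mult_right_mono F1) simp
    finally show "F \<xi> * ennreal (gd (\<xi> - h)) \<le> F \<xi> * ennreal (gd \<xi>) + ennreal (gd (\<xi> - h) - gd \<xi>)" by simp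
  qed
  also have "\<dots> = (\<integral>\<^sup>+\<xi>. F \<xi> * ennreal (gd \<xi>) \<partial>lborel) + (\<integral>\<^sup>+\<xi>. ennreal (gd (\<xi> - h) - gd \<xi>) \<partial>lborel)"
    by (rule nn_integral_add) measurable
  also have "(\<integral>\<^sup>+\<xi>. F \<xi> * ennreal (gd \<xi>) \<partial>lborel) = (\<integral>\<^sup>+\<xi>. F \<xi> \<partial>gauss)" by (rule nn_integral_gauss[symmetric]) measurable
  finally show ?thesis using gauss_shift_positive_part[of h] by (meson add_left_mono order_trans)
qed

section \<open>Maximal couplings for the total variation distance\<close>

lemma sum_of_measures:
  fixes M N :: "'a measure"
  assumes N: "sets N = sets M"
  obtains S where "sets S = sets M" "\<And>A. A \<in> sets M \<Longrightarrow> emeasure S A = emeasure M A + emeasure N A"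
proof
  let ?S = "measure_of (space M) (sets M) (\<lambda>A. emeasure M A + emeasure N A)"
  show "sets ?S = sets M" by simp
  fix A assume A: "A \<in> sets M"
  show "emeasure ?S A = emeasure M A + emeasure N A"
  proof (rule emeasure_measure_of_sigma[OF _ _ _ A])
    show "sigma_algebra (space M) (sets M)" ..
    show "positive (sets M) (\<lambda>A. emeasure M A + emeasure N A)" by (simp add: positive_def)
    show "countably_additive (sets M) (\<lambda>A. emeasure M A + emeasure N A)"
    proof (rule countably_additiveI)
      fix B :: "nat \<Rightarrow> 'a set" assume B: "range B \<subseteq> sets M" "disjoint_family B"
      have "(\<Sum>i. emeasure M (B i) + emeasure N (B i)) = (\<Sum>i. emeasure M (B i)) + (\<Sum>i. emeasure N (B i))"
        by (rule suminf_add[symmetric]) auto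
      also have "\<dots> = emeasure M (\<Union>i. B i) + emeasure N (\<Union>i. B i)"
        using B by (simp add: suminf_emeasure N)
      finally show "(\<Sum>i. emeasure M (B i) + emeasure N (B i)) = emeasure M (\<Union>i. B i) + emeasure N (\<Union>i. B i)" .
    qed
  qed
qed

text \<open>The part of \<mu> - \<nu> carried by a set on which \<mu> dominates. The
  characterisation is additive, so that later cancellations in \<open>ennreal\<close> need only
  finiteness.\<close>

lemma excess_measure:
  fixes \<mu> \<nu> :: "'a measure"
  assumes fin: "finite_measure \<mu>" "finite_measure \<nu>" and s: "sets \<nu> = sets \<mu>" and Y: "Y \<in> sets \<mu>"
    and le: "\<And>X. X \<in> sets \<mu> \<Longrightarrow> X \<subseteq> Y \<Longrightarrow> emeasure \<nu> X \<le> emeasure \<mu> X"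
  obtains \<alpha> where "finite_measure \<alpha>" "sets \<alpha> = sets \<mu>"
    "\<And>A. A \<in> sets \<mu> \<Longrightarrow> emeasure \<alpha> A + emeasure \<nu> (A \<inter> Y) = emeasure \<mu> (A \<inter> Y)"
proof -
  interpret m: finite_measure \<mu> by fact
  interpret n: finite_measure \<nu> by fact
  let ?a = "density \<mu> (indicator Y)" and ?b = "density \<nu> (indicator Y)"
  have Y': "Y \<in> sets \<nu>" using Y s by simp
  have ea: "emeasure ?a A = emeasure \<mu> (A \<inter> Y)" if "A \<in> sets \<mu>" for A
    using that Y by (subst emeasure_density) (auto simp: indicator_inter_arith[symmetric] Int_commute simp flip: nn_integral_indicator)
  have eb: "emeasure ?b A = emeasure \<nu> (A \<inter> Y)" if "A \<in> sets \<mu>" for A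
    using that Y' s by (subst emeasure_density) (auto simp: indicator_inter_arith[symmetric] Int_commute simp flip: nn_integral_indicator)
  have top: "space \<mu> \<in> sets \<mu>" by simp
  have fa: "finite_measure ?a" by (rule finite_measureI) (simp add: ea)
  have fb: "finite_measure ?b" by (rule finite_measureI) (simp add: eb sets_eq_imp_space_eq[OF s])
  let ?d = "diff_measure ?a ?b"
  have lab: "emeasure ?b A \<le> emeasure ?a A" if "A \<in> sets ?a" for A
    using that Y le[of "A \<inter> Y"] by (simp add: ea eb)
  have d: "emeasure ?d A = emeasure ?a A - emeasure ?b A" if "A \<in> sets \<mu>" for A
    using that by (intro emeasure_diff_measure fa fb lab) (auto simp: s)
  have sd: "sets ?d = sets \<mu>" by simp
  show thesis
  proof (rule that[OF _ sd])
    fix A assume A: "A \<in> sets \<mu>"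
    then show "emeasure ?d A + emeasure \<nu> (A \<inter> Y) = emeasure \<mu> (A \<inter> Y)"
      using lab[of A] by (simp add: d ea eb diff_add_cancel_ennreal)
  next
    have "emeasure ?d (space ?d) \<le> emeasure ?a (space \<mu>)"
      using d[OF top] sets_eq_imp_space_eq[OF sd] by (simp add: diff_le_self_ennreal)
    then show "finite_measure ?d"
      by (intro finite_measureI) (auto simp: ea top_unique)
  qed
qed

text \<open>The maximal coupling. A Hahn decomposition splits each measure into a common part,
  placed on the diagonal, and an excess; the two excesses have the same mass and are coupled
  independently. That mass is \<mu>(Y) - \<nu>(Y), hence at most t.\<close>

lemma tv_dist_le:
  fixes \<mu> \<nu> :: "'a::euclidean_space measure"
  assumes \<mu>: "prob_space \<mu>" "sets \<mu> = sets borel" and \<nu>: "prob_space \<nu>" "sets \<nu> = sets borel"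
    and le: "\<And>A. A \<in> sets borel \<Longrightarrow> emeasure \<mu> A \<le> emeasure \<nu> A + ennreal t"
  shows "tv_dist \<mu> \<nu> \<le> 2 * ennreal t"
proof -
  interpret m: prob_space \<mu> by (rule \<mu>)
  interpret n: prob_space \<nu> by (rule \<nu>)
  note [measurable_cong] = \<mu>(2) \<nu>(2)
  have sp: "space \<mu> = UNIV" "space \<nu> = UNIV" using \<mu>(2) \<nu>(2) by (auto dest!: sets_eq_imp_space_eq)
  have "\<exists>Y\<in>sets \<mu>. (\<forall>X\<in>sets \<mu>. X \<subseteq> Y \<longrightarrow> emeasure \<nu> X \<le> emeasure \<mu> X) \<and> (\<forall>X\<in>sets \<mu>. X \<inter> Y = {} \<longrightarrow> emeasure \<mu> X \<le> emeasure \<nu> X)"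
    by (rule finite_unsigned_Hahn_decomposition[OF m.finite_measure_axioms n.finite_measure_axioms]) (simp add: \<mu> \<nu>)
  then obtain Y where Y[measurable]: "Y \<in> sets borel"
    and Y1: "\<And>X. X \<in> sets borel \<Longrightarrow> X \<subseteq> Y \<Longrightarrow> emeasure \<nu> X \<le> emeasure \<mu> X"
    and Y2': "\<And>X. X \<in> sets borel \<Longrightarrow> X \<inter> Y = {} \<Longrightarrow> emeasure \<mu> X \<le> emeasure \<nu> X"
    unfolding \<mu>(2) by (elim bexE conjE) (metis (no_types, lifting) that)
  have Y2: "emeasure \<mu> X \<le> emeasure \<nu> X" if "X \<in> sets borel" "X \<subseteq> - Y" for X
    using that by (intro Y2') auto
  have mfin: "emeasure \<mu> A \<noteq> \<top>" "emeasure \<nu> A \<noteq> \<top>" for A by (rule m.emeasure_finite n.emeasure_finite)+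
  obtain \<alpha> where a: "finite_measure \<alpha>" "sets \<alpha> = sets borel"
    "\<And>A. A \<in> sets borel \<Longrightarrow> emeasure \<alpha> A + emeasure \<nu> (A \<inter> Y) = emeasure \<mu> (A \<inter> Y)"
    using excess_measure[of \<mu> \<nu> Y] m.finite_measure_axioms n.finite_measure_axioms \<mu>(2) \<nu>(2) Y1 Y by metis
  obtain \<beta> where b: "finite_measure \<beta>" "sets \<beta> = sets borel"
    "\<And>A. A \<in> sets borel \<Longrightarrow> emeasure \<beta> A + emeasure \<mu> (A \<inter> - Y) = emeasure \<nu> (A \<inter> - Y)"
    using excess_measure[of \<nu> \<mu> "- Y"] m.finite_measure_axioms n.finite_measure_axioms \<mu>(2) \<nu>(2) Y2 Y by (metis borel_comp)
  interpret a: finite_measure \<alpha> by (rule a)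
  interpret b: finite_measure \<beta> by (rule b)
  have spab: "space \<alpha> = UNIV" "space \<beta> = UNIV" using a(2) b(2) by (auto dest!: sets_eq_imp_space_eq)
  note [measurable_cong] = a(2) b(2)
  define s where "s = emeasure \<alpha> UNIV"
  have split1: "emeasure \<mu> A = emeasure \<mu> (A \<inter> Y) + emeasure \<mu> (A \<inter> - Y)"
    and split2: "emeasure \<nu> A = emeasure \<nu> (A \<inter> Y) + emeasure \<nu> (A \<inter> - Y)" if "A \<in> sets borel" for A
  proof -
    have e: "A \<inter> Y \<union> A \<inter> - Y = A" by blast
    show "emeasure \<mu> A = emeasure \<mu> (A \<inter> Y) + emeasure \<mu> (A \<inter> - Y)"
      using that \<mu>(2) by (subst plus_emeasure) (auto simp: e)
    show "emeasure \<nu> A = emeasure \<nu> (A \<inter> Y) + emeasure \<nu> (A \<inter> - Y)"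
      using that \<nu>(2) by (subst plus_emeasure) (auto simp: e)
  qed
  have s_b: "emeasure \<beta> UNIV = s"
  proof -
    let ?x = "emeasure \<nu> Y" and ?y = "emeasure \<mu> (- Y)"
    have "s + ?x + ?y = 1" using a(3)[of UNIV] split1[of UNIV] m.emeasure_space_1 by (simp add: s_def sp)
    moreover have "emeasure \<beta> UNIV + ?y + ?x = 1" using b(3)[of UNIV] split2[of UNIV] n.emeasure_space_1 by (simp add: sp add.commute)
    ultimately have "(?x + ?y) + s = (?x + ?y) + emeasure \<beta> UNIV" by (simp add: ac_simps)
    then show ?thesis using mfin by (simp add: ennreal_add_left_cancel)
  qed
  have s_fin: "s \<noteq> \<top>" by (simp add: s_def)
  have s_t: "s \<le> ennreal t"
  proof -
    have "s + emeasure \<nu> Y \<le> emeasure \<nu> Y + ennreal t"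
      using a(3)[of UNIV] le[OF Y] by (simp add: s_def)
    then show ?thesis using mfin by (simp add: add.commute[of s] ennreal_add_left_cancel_le)
  qed
  \<comment> \<open>The common part of \<mu> and \<nu>.\<close>
  obtain \<kappa> where k: "sets \<kappa> = sets borel"
    "\<And>A. A \<in> sets borel \<Longrightarrow> emeasure \<kappa> A = emeasure \<nu> (A \<inter> Y) + emeasure \<mu> (A \<inter> - Y)"
  proof -
    have e: "emeasure (density \<nu> (indicator Y)) A = emeasure \<nu> (A \<inter> Y)" "emeasure (density \<mu> (indicator (- Y))) A = emeasure \<mu> (A \<inter> - Y)"
      if "A \<in> sets borel" for A
      using that \<mu>(2) \<nu>(2)
      by (subst emeasure_density; auto simp: indicator_inter_arith[symmetric] Int_commute simp flip: nn_integral_indicator)+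
    have sd: "sets (density \<mu> (indicator (- Y))) = sets borel" "sets (density \<nu> (indicator Y)) = sets borel"
      using \<mu>(2) \<nu>(2) by simp_all
    obtain S where "sets S = sets borel" "\<And>A. A \<in> sets borel \<Longrightarrow> emeasure S A = emeasure (density \<nu> (indicator Y)) A + emeasure (density \<mu> (indicator (- Y))) A"
      by (rule sum_of_measures[of "density \<mu> (indicator (- Y))" "density \<nu> (indicator Y)", unfolded sd, OF refl]) blast
    then show thesis by (intro that[of S]) (simp_all add: e)
  qed
  note [measurable_cong] = k(1)
  have spk: "space \<kappa> = UNIV" using sets_eq_imp_space_eq[OF k(1)] by simp
  let ?D = "distr \<kappa> (borel \<Otimes>\<^sub>M borel) (\<lambda>x. (x, x))"
  \<comment> \<open>Dividing by the mass \<open>s\<close> gives the product of the excesses the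
    right marginals.\<close>
  let ?R = "scale_measure (1 / s) (\<alpha> \<Otimes>\<^sub>M \<beta>)"
  have sR: "sets (\<alpha> \<Otimes>\<^sub>M \<beta>) = sets (borel \<Otimes>\<^sub>M borel)" by (intro sets_pair_measure_cong a b)
  obtain c where c: "sets c = sets (borel \<Otimes>\<^sub>M (borel :: 'a measure))"
    "\<And>A. A \<in> sets (borel \<Otimes>\<^sub>M (borel :: 'a measure)) \<Longrightarrow> emeasure c A = emeasure ?D A + emeasure ?R A"
    by (rule sum_of_measures[of ?R ?D]) (auto simp: sR)
  note [measurable_cong] = c(1)
  have spc: "space c = UNIV" using sets_eq_imp_space_eq[OF c(1)] by (simp add: space_pair_measure)
  have diag: "(\<lambda>x. (x, x)) -` (A \<times> B) = A \<inter> B" for A B :: "'a set" by auto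
  \<comment> \<open>For s = 0 the factor 1 / s is infinite, but it multiplies 0, and that product is
    0 in \<open>ennreal\<close>.\<close>
  have cancel: "1 / s * (x * s) = x" if "x \<le> s" for x
  proof (cases "s = 0")
    case False
    have "1 / s * s = 1" using False s_fin by (simp add: ennreal_divide_times divide_eq_1_ennreal)
    moreover have "1 / s * (x * s) = x * (1 / s * s)" by (rule mult.left_commute)
    ultimately show ?thesis by simp
  qed (use that in simp)
  have ale: "emeasure \<alpha> A \<le> s" "emeasure \<beta> A \<le> s" for A
    using emeasure_space[of \<alpha> A] emeasure_space[of \<beta> A] unfolding spab s_b s_def[symmetric] by simp_all
  have "distr c borel fst = \<mu>"
  proof (rule measure_eqI)
    fix A assume "A \<in> sets (distr c borel fst)"
    then have A[measurable]: "A \<in> sets borel" by simp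
    have AU: "A \<times> UNIV \<in> sets (borel \<Otimes>\<^sub>M (borel :: 'a measure))" by simp
    have "emeasure (distr c borel fst) A = emeasure c (A \<times> UNIV)"
      by (subst emeasure_distr) (auto simp: spc intro!: arg_cong2[where f=emeasure])
    also have "\<dots> = emeasure \<kappa> A + 1 / s * (emeasure \<alpha> A * s)"
      unfolding c(2)[OF AU] using AU by (simp add: diag emeasure_distr spk b.emeasure_pair_measure_Times a b s_b)
    also have "\<dots> = emeasure \<mu> A"
      unfolding cancel[OF ale(1)] k(2)[OF A] split1[OF A] a(3)[OF A, symmetric] by (simp only: ac_simps)
    finally show "emeasure (distr c borel fst) A = emeasure \<mu> A" .
  qed (simp add: \<mu>)
  moreover have "distr c borel snd = \<nu>"
  proof (rule measure_eqI)
    fix A assume "A \<in> sets (distr c borel snd)"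
    then have A[measurable]: "A \<in> sets borel" by simp
    have AU: "UNIV \<times> A \<in> sets ((borel :: 'a measure) \<Otimes>\<^sub>M borel)" by simp
    have "emeasure (distr c borel snd) A = emeasure c (UNIV \<times> A)"
      by (subst emeasure_distr) (auto simp: spc intro!: arg_cong2[where f=emeasure])
    also have "\<dots> = emeasure \<kappa> A + 1 / s * (emeasure \<beta> A * s)"
      unfolding c(2)[OF AU] using AU by (simp add: diag emeasure_distr spk b.emeasure_pair_measure_Times a b s_def[symmetric] mult.commute)
    also have "\<dots> = emeasure \<nu> A"
      unfolding cancel[OF ale(2)] k(2)[OF A] split2[OF A] b(3)[OF A, symmetric] by (simp only: ac_simps)
    finally show "emeasure (distr c borel snd) A = emeasure \<nu> A" .
  qed (simp add: \<nu>)
  moreover have "prob_space c"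
  proof (rule prob_spaceI)
    have "emeasure c (space c) = emeasure (distr c borel fst) UNIV"
      by (subst emeasure_distr) auto
    then show "emeasure c (space c) = 1" using \<open>distr c borel fst = \<mu>\<close> m.emeasure_space_1 by (simp add: sp)
  qed
  ultimately have cc: "c \<in> couplings \<mu> \<nu>" using c(1) by (simp add: couplings_def)
  have off: "{z \<in> space c. fst z \<noteq> snd z} \<in> sets (borel \<Otimes>\<^sub>M (borel :: 'a measure))"
  proof -
    have "{z \<in> space (borel \<Otimes>\<^sub>M (borel :: 'a measure)). fst z \<noteq> snd z} \<in> sets (borel \<Otimes>\<^sub>M (borel :: 'a measure))" by measurable
    then show ?thesis by (simp add: spc space_pair_measure)
  qed
  have "emeasure c {z \<in> space c. fst z \<noteq> snd z} = 1 / s * emeasure (\<alpha> \<Otimes>\<^sub>M \<beta>) {z \<in> space c. fst z \<noteq> snd z}"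
    using off by (simp add: c(2) emeasure_distr)
  also have "\<dots> \<le> 1 / s * emeasure (\<alpha> \<Otimes>\<^sub>M \<beta>) (space (\<alpha> \<Otimes>\<^sub>M \<beta>))"
    by (intro mult_left_mono emeasure_space) simp
  also have "\<dots> = 1 / s * (s * s)"
    using b.emeasure_pair_measure_Times[of UNIV \<alpha> UNIV] a(2) b(2) by (simp add: space_pair_measure spab s_b s_def)
  also have "\<dots> = s" by (simp add: cancel)
  finally have "emeasure c {z \<in> space c. fst z \<noteq> snd z} \<le> ennreal t" using s_t by simp
  then have "2 * emeasure c {z \<in> space c. fst z \<noteq> snd z} \<le> 2 * ennreal t" by (intro mult_left_mono) auto
  then show ?thesis unfolding tv_dist_def using cc by (meson INF_lower2)
qed

section \<open>Regularisation by the noise of a step\<close>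

context obabo begin

text \<open>The two noises of a single step can absorb any difference of starting points.\<close>

definition shift :: "'a \<times> 'a \<Rightarrow> 'a \<times> 'a \<Rightarrow> 'a \<times> 'a" where
  "shift z w = (let k = (1 / \<delta>) *\<^sub>R (fst z - fst w) + et *\<^sub>R (snd z - snd w) - (\<delta> / 2) *\<^sub>R (g (fst z) - g (fst w))
     in ((1 / sg) *\<^sub>R k, - (et / (\<delta> * sg)) *\<^sub>R (fst z - fst w)))"

lemma step_shift: "step w (\<xi> + shift z w) = step z \<xi>"
proof -
  have sg0: "sg \<noteq> 0" "\<delta> \<noteq> 0" using sg_pos \<delta>_pos by auto
  have x: "fst (verlet (ostep w (fst (\<xi> + shift z w)))) = fst (verlet (ostep z (fst \<xi>)))"
    using sg0 by (simp add: verlet_def ostep_def shift_def Let_def algebra_simps power2_eq_square)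
  then show ?thesis
    using sg0 by (simp add: step_def verlet_def ostep_def shift_def Let_def algebra_simps power2_eq_square)
qed

definition Creg :: real where "Creg = sqrt 2 * (201/200) / (\<delta> * sg)"

text \<open>A position difference x needs a shift of about |x| / (\<delta> sg) in each of the two
  noises; velocity and gradient differences are smaller by a factor \<delta> sqrt L. With |x| \<le>
  sqrt 2 M and the final division by 2 this gives \<open>Creg\<close>.\<close>

lemma norm_shift: "norm (shift z w) / 2 \<le> Creg * M (z - w)"
proof -
  let ?x = "fst z - fst w" and ?v = "snd z - snd w" and ?m = "sqrt 2 * M (z - w)"
  let ?k = "(1 / \<delta>) *\<^sub>R ?x + et *\<^sub>R ?v - (\<delta> / 2) *\<^sub>R (g (fst z) - g (fst w))"
  have m0: "0 \<le> ?m" by (simp add: M_nonneg)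
  have x: "norm ?x \<le> ?m" using norm_fst_le_M[of "z - w"] by simp
  have v: "norm ?v \<le> sqrt L * ?m" using norm_snd_le_M[of "z - w"] by (simp add: mult_ac)
  have g': "norm (g (fst z) - g (fst w)) \<le> L * ?m"
    using g_lip[of "fst z" "fst w"] mult_left_mono[OF x, of L] L_pos by linarith
  have k: "norm ?k \<le> 201/200 * ?m / \<delta>"
  proof -
    have "norm ?k \<le> norm ((1 / \<delta>) *\<^sub>R ?x) + norm (et *\<^sub>R ?v) + norm ((\<delta> / 2) *\<^sub>R (g (fst z) - g (fst w)))"
      by (rule order_trans[OF norm_triangle_ineq4 add_right_mono[OF norm_triangle_ineq]])
    also have "\<dots> \<le> (1 / \<delta>) * ?m + 1 * (sqrt L * ?m) + (\<delta> / 2) * (L * ?m)"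
      unfolding norm_scaleR using x v g' \<delta>_pos et_bounds L_pos m0
      by (intro add_mono mult_mono) (auto intro: less_imp_le)
    also have "\<dots> = (1 + \<delta> * sqrt L + (\<delta> * sqrt L)\<^sup>2 / 2) * ?m / \<delta>"
      using \<delta>_pos L_pos by (simp add: field_simps power2_eq_square)
    also have "\<dots> \<le> 201/200 * ?m / \<delta>"
    proof -
      have "(\<delta> * sqrt L)\<^sup>2 \<le> (1/264)\<^sup>2" using \<delta>_sqrt_L \<delta>_pos L_pos by (intro power_mono) auto
      then have "1 + \<delta> * sqrt L + (\<delta> * sqrt L)\<^sup>2 / 2 \<le> 201/200" using \<delta>_sqrt_L unfolding power_divide one_power2 by (simp add: field_simps)
      then show ?thesis using m0 \<delta>_pos by (intro divide_right_mono mult_right_mono) auto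
    qed
    finally show ?thesis .
  qed
  have "norm (shift z w) \<le> norm ((1 / sg) *\<^sub>R ?k) + norm (- (et / (\<delta> * sg)) *\<^sub>R ?x)"
    unfolding shift_def Let_def by (rule norm_Pair_le)
  also have "\<dots> = (1 / sg) * norm ?k + et / (\<delta> * sg) * norm ?x"
    using sg_pos \<delta>_pos et_bounds by simp
  also have "\<dots> \<le> (1 / sg) * (201/200 * ?m / \<delta>) + 1 / (\<delta> * sg) * ?m"
    using k x sg_pos \<delta>_pos et_bounds m0
    by (intro add_mono mult_left_mono mult_mono divide_right_mono) auto
  also have "\<dots> = (401/200) * (?m / (\<delta> * sg))" using sg_pos \<delta>_pos by (simp add: field_simps)
  finally have 1: "norm (shift z w) \<le> (401/200) * (?m / (\<delta> * sg))" .
  have "0 \<le> ?m / (\<delta> * sg)" using M_nonneg[of "z - w"] sg_pos \<delta>_pos by (intro divide_nonneg_nonneg mult_nonneg_nonneg) auto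
  then have "norm (shift z w) / 2 \<le> 201/200 * (?m / (\<delta> * sg))" using 1 by linarith
  then show ?thesis by (simp add: Creg_def mult_ac)
qed

fun iter :: "('a \<times> 'a \<Rightarrow> ennreal) \<Rightarrow> nat \<Rightarrow> 'a \<times> 'a \<Rightarrow> ennreal" where
  "iter f 0 = f"
| "iter f (Suc n) = (\<lambda>z. \<integral>\<^sup>+\<xi>. iter f n (step z \<xi>) \<partial>gauss)"

lemma iter_measurable[measurable]:
  assumes [measurable]: "f \<in> borel_measurable borel"
  shows "iter f n \<in> borel_measurable borel"
proof (induction n)
  case (Suc n)
  interpret G: prob_space "gauss :: ('a \<times> 'a) measure" by (rule prob_space_gauss)
  note Suc[measurable]
  show ?case by simp
qed simp

lemma iter_le_1:
  assumes "\<And>z. f z \<le> 1"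
  shows "iter f n z \<le> 1"
proof (induction n arbitrary: z)
  case (Suc n)
  interpret G: prob_space "gauss :: ('a \<times> 'a) measure" by (rule prob_space_gauss)
  have "(\<integral>\<^sup>+\<xi>. iter f n (step z \<xi>) \<partial>gauss) \<le> (\<integral>\<^sup>+\<xi>. 1 \<partial>(gauss :: ('a \<times> 'a) measure))" by (intro nn_integral_mono Suc)
  then show ?case by (simp add: G.emeasure_space_1[simplified])
qed (use assms in simp)

text \<open>The last step smooths: its noise absorbs the difference of the starting points. Each of
  the n preceding steps, run with common noise, multiplies the Lipschitz constant by 1 - \<delta>
  \<kappa>.\<close>

lemma iter_regular:
  assumes [measurable]: "f \<in> borel_measurable borel" and f1: "\<And>z. f z \<le> 1"
  shows "iter f (Suc n) z \<le> iter f (Suc n) w + ennreal ((1 - \<delta> * \<kappa>) ^ n * Creg * M (z - w))"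
proof (induction n arbitrary: z w)
  case 0
  have "(\<integral>\<^sup>+\<xi>. f (step w (\<xi> + shift z w)) \<partial>gauss) \<le> (\<integral>\<^sup>+\<xi>. f (step w \<xi>) \<partial>gauss) + ennreal (norm (shift z w) / 2)"
    by (rule gauss_shift) (auto simp: f1)
  also have "\<dots> \<le> (\<integral>\<^sup>+\<xi>. f (step w \<xi>) \<partial>gauss) + ennreal (Creg * M (z - w))"
    by (intro add_left_mono ennreal_leI norm_shift)
  finally show ?case by (simp add: step_shift)
next
  case (Suc n)
  interpret G: prob_space "gauss :: ('a \<times> 'a) measure" by (rule prob_space_gauss)
  let ?\<rho> = "1 - \<delta> * \<kappa>"
  have r: "0 < ?\<rho>" "0 < Creg" using \<delta>\<kappa> sg_pos \<delta>_pos by (auto simp: Creg_def)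
  have "iter f (Suc (Suc n)) z = (\<integral>\<^sup>+\<xi>. iter f (Suc n) (step z \<xi>) \<partial>gauss)" by simp
  also have "\<dots> \<le> (\<integral>\<^sup>+\<xi>. iter f (Suc n) (step w \<xi>) + ennreal (?\<rho> ^ Suc n * Creg * M (z - w)) \<partial>gauss)"
  proof (rule nn_integral_mono)
    fix \<xi>
    have "?\<rho> ^ n * Creg * M (step z \<xi> - step w \<xi>) \<le> ?\<rho> ^ n * Creg * (?\<rho> * M (z - w))"
      using r by (intro mult_left_mono step_contraction) auto
    then have "ennreal (?\<rho> ^ n * Creg * M (step z \<xi> - step w \<xi>)) \<le> ennreal (?\<rho> ^ Suc n * Creg * M (z - w))"
      by (intro ennreal_leI) (simp add: mult_ac)
    then show "iter f (Suc n) (step z \<xi>) \<le> iter f (Suc n) (step w \<xi>) + ennreal (?\<rho> ^ Suc n * Creg * M (z - w))"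
      by (rule order_trans[OF Suc add_left_mono])
  qed
  also have "\<dots> = iter f (Suc (Suc n)) w + ennreal (?\<rho> ^ Suc n * Creg * M (z - w))"
  proof -
    have [measurable]: "(\<lambda>\<xi>. iter f (Suc n) (step w \<xi>)) \<in> borel_measurable (gauss :: ('a \<times> 'a) measure)"
      by (rule measurable_compose[OF _ iter_measurable]) measurable
    show ?thesis by (subst nn_integral_add) (auto simp: G.emeasure_space_1[simplified])
  qed
  finally show ?case .
qed

lemma iter_invariant:
  assumes inv: "invariant \<nu>" and f: "f \<in> borel_measurable borel"
  shows "(\<integral>\<^sup>+z. iter f n z \<partial>\<nu>) = (\<integral>\<^sup>+z. f z \<partial>\<nu>)"
proof (induction n)
  case (Suc n)
  then show ?case using inv iter_measurable[OF f, of n] by (simp add: invariant_def)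
qed simp

end

section \<open>The almost invariant modified measure\<close>

context split begin

lemma Wt_measurable[measurable]: "Wt \<theta> \<in> borel_measurable borel"
  unfolding Wt_def[abs_def] by measurable

lemma nn_integral_phase:
  assumes [measurable]: "(f :: 'a \<times> 'a \<Rightarrow> ennreal) \<in> borel_measurable borel"
  shows "(\<integral>\<^sup>+z. f z \<partial>phase (Wt \<theta>)) = (\<integral>\<^sup>+z. f z * ennreal (exp (- Ht \<theta> z)) \<partial>lborel)"
proof -
  have "(\<integral>\<^sup>+z. f z \<partial>phase (Wt \<theta>)) = (\<integral>\<^sup>+z. ennreal (exp (- Wt \<theta> (fst z) - (norm (snd z))\<^sup>2 / 2)) * f z \<partial>lborel)"
    unfolding phase_def by (rule nn_integral_density) measurable
  then show ?thesis by (simp add: Ht_def mult.commute)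
qed

definition defect :: "'a \<times> 'a \<Rightarrow> real" where
  "defect z = Ht 1 (verlet z) - Ht 1 z"

lemma defect_measurable[measurable]: "defect \<in> borel_measurable borel"
proof -
  have "(\<lambda>z. Ht 1 (verlet z)) \<in> borel_measurable borel" by (rule measurable_compose[OF verlet_measurable Ht_measurable])
  then show ?thesis unfolding defect_def[abs_def] by measurable
qed

text \<open>The kinetic energy changes by -(y - x).(g(x) + g(y)) / 2 plus (\<delta>^2 / 8) (|g(y)|^2
  - |g(x)|^2), where y is the new position. The correction in \<open>Ht 1\<close> removes exactly
  the second term.\<close>

lemma defect_eq:
  "defect z = U (fst (verlet z)) - U (fst z) - (fst (verlet z) - fst z) \<bullet> (g (fst z) + g (fst (verlet z))) / 2"
proof -
  obtain x v where z: "z = (x, v)" by (cases z)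
  define y where "y = x + \<delta> *\<^sub>R v - (\<delta>\<^sup>2 / 2) *\<^sub>R g x"
  have v: "verlet (x, v) = (y, v - (\<delta> / 2) *\<^sub>R (g x + g y))" by (simp add: verlet_def y_def Let_def)
  have d: "y - x = \<delta> *\<^sub>R v - (\<delta>\<^sup>2 / 2) *\<^sub>R g x" by (simp add: y_def)
  show ?thesis
    unfolding defect_def z v Ht_def Wt_def fst_conv snd_conv d power2_norm_eq_inner
    by (simp add: inner_add_left inner_add_right inner_diff_left inner_diff_right inner_commute power2_eq_square
        algebra_simps add_divide_distrib diff_divide_distrib)
qed

text \<open>O-steps preserve the modified measure and the Verlet map preserves volume, so the only
  loss comes from comparing the weight before and after the Verlet map.\<close>

lemma step_almost_invariant:
  assumes f[measurable]: "f \<in> borel_measurable borel" and f1: "\<And>z. f z \<le> 1"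
  shows "(\<integral>\<^sup>+z. (\<integral>\<^sup>+\<xi>. f (step z \<xi>) \<partial>gauss) \<partial>phase (Wt 1))
    \<le> (\<integral>\<^sup>+z. f z \<partial>phase (Wt 1)) + (\<integral>\<^sup>+z. ennreal \<bar>defect z\<bar> \<partial>phase (Wt 1))"
proof -
  interpret G: prob_space "gauss :: 'a measure" by (rule prob_space_gauss)
  define F where "F z = (\<integral>\<^sup>+\<xi>. f (ostep z \<xi>) \<partial>gauss)" for z
  have Fm[measurable]: "F \<in> borel_measurable borel" unfolding F_def by measurable
  have F1: "F z \<le> 1" for z
  proof -
    have "F z \<le> (\<integral>\<^sup>+\<xi>. 1 \<partial>(gauss :: 'a measure))" unfolding F_def by (intro nn_integral_mono f1)
    then show ?thesis by (simp add: G.emeasure_space_1[simplified])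
  qed
  have Fv[measurable]: "(\<lambda>z. F (verlet z)) \<in> borel_measurable borel" by (rule measurable_compose[OF verlet_measurable Fm])
  have "(\<integral>\<^sup>+\<xi>. f (step z \<xi>) \<partial>gauss) = (\<integral>\<^sup>+\<xi>. F (verlet (ostep z \<xi>)) \<partial>gauss)" for z
    by (subst nn_integral_noise) (auto simp: step_def F_def)
  then have "(\<integral>\<^sup>+z. (\<integral>\<^sup>+\<xi>. f (step z \<xi>) \<partial>gauss) \<partial>phase (Wt 1)) = (\<integral>\<^sup>+z. F (verlet z) \<partial>phase (Wt 1))"
    using ostep_invariant[OF Fv Wt_measurable] by simp
  also have "\<dots> = (\<integral>\<^sup>+z. F (verlet z) * ennreal (exp (- Ht 1 z)) \<partial>lborel)" by (rule nn_integral_phase[OF Fv])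
  also have "\<dots> \<le> (\<integral>\<^sup>+z. F (verlet z) * ennreal (exp (- Ht 1 (verlet z))) + ennreal \<bar>defect z\<bar> * ennreal (exp (- Ht 1 z)) \<partial>lborel)"
  proof (rule nn_integral_mono)
    fix z
    \<comment> \<open>The inequality 1 \<le> exp (- d) + |d|, with d the defect.\<close>
    have "exp (- Ht 1 z) * 1 \<le> exp (- Ht 1 z) * (exp (- defect z) + \<bar>defect z\<bar>)"
      using exp_ge_add_one_self[of "- defect z"] by (intro mult_left_mono) auto
    also have "\<dots> = exp (- Ht 1 (verlet z)) + \<bar>defect z\<bar> * exp (- Ht 1 z)"
      by (simp add: distrib_left exp_add[symmetric] defect_def mult.commute)
    finally have "ennreal (exp (- Ht 1 z)) \<le> ennreal (exp (- Ht 1 (verlet z)) + \<bar>defect z\<bar> * exp (- Ht 1 z))"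
      by (intro ennreal_leI) simp
    also have "\<dots> = ennreal (exp (- Ht 1 (verlet z))) + ennreal \<bar>defect z\<bar> * ennreal (exp (- Ht 1 z))"
      by (simp add: ennreal_plus ennreal_mult)
    finally have "F (verlet z) * ennreal (exp (- Ht 1 z)) \<le> F (verlet z) * (ennreal (exp (- Ht 1 (verlet z))) + ennreal \<bar>defect z\<bar> * ennreal (exp (- Ht 1 z)))"
      by (rule mult_left_mono) simp
    also have "\<dots> \<le> F (verlet z) * ennreal (exp (- Ht 1 (verlet z))) + 1 * (ennreal \<bar>defect z\<bar> * ennreal (exp (- Ht 1 z)))"
      unfolding distrib_left by (intro add_left_mono mult_right_mono F1) simp
    finally show "F (verlet z) * ennreal (exp (- Ht 1 z)) \<le> F (verlet z) * ennreal (exp (- Ht 1 (verlet z))) + ennreal \<bar>defect z\<bar> * ennreal (exp (- Ht 1 z))"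
      by simp
  qed
  also have "\<dots> = (\<integral>\<^sup>+z. F (verlet z) * ennreal (exp (- Ht 1 (verlet z))) \<partial>lborel) + (\<integral>\<^sup>+z. ennreal \<bar>defect z\<bar> * ennreal (exp (- Ht 1 z)) \<partial>lborel)"
  proof (rule nn_integral_add)
    show "(\<lambda>z. F (verlet z) * ennreal (exp (- Ht 1 (verlet z)))) \<in> borel_measurable lborel"
      using measurable_compose[OF verlet_measurable, of "\<lambda>z. F z * ennreal (exp (- Ht 1 z))" borel] by simp
  qed measurable
  also have "(\<integral>\<^sup>+z. F (verlet z) * ennreal (exp (- Ht 1 (verlet z))) \<partial>lborel) = (\<integral>\<^sup>+z. F z * ennreal (exp (- Ht 1 z)) \<partial>lborel)"
    by (rule nn_integral_vol_pres[OF vol_pres_verlet]) measurable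
  also have "\<dots> = (\<integral>\<^sup>+z. F z \<partial>phase (Wt 1))" by (rule nn_integral_phase[OF Fm, symmetric])
  also have "\<dots> = (\<integral>\<^sup>+z. f z \<partial>phase (Wt 1))" unfolding F_def by (rule ostep_invariant) measurable
  also have "(\<integral>\<^sup>+z. ennreal \<bar>defect z\<bar> * ennreal (exp (- Ht 1 z)) \<partial>lborel) = (\<integral>\<^sup>+z. ennreal \<bar>defect z\<bar> \<partial>phase (Wt 1))"
    by (rule nn_integral_phase[symmetric]) measurable
  finally show ?thesis .
qed

lemma iter_almost_invariant:
  assumes f[measurable]: "f \<in> borel_measurable borel" and f1: "\<And>z. f z \<le> 1"
  shows "(\<integral>\<^sup>+z. iter f n z \<partial>phase (Wt 1))
    \<le> (\<integral>\<^sup>+z. f z \<partial>phase (Wt 1)) + of_nat n * (\<integral>\<^sup>+z. ennreal \<bar>defect z\<bar> \<partial>phase (Wt 1))"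
proof (induction n)
  case (Suc n)
  let ?T = "\<integral>\<^sup>+z. ennreal \<bar>defect z\<bar> \<partial>phase (Wt 1)"
  have "(\<integral>\<^sup>+z. iter f (Suc n) z \<partial>phase (Wt 1)) \<le> (\<integral>\<^sup>+z. iter f n z \<partial>phase (Wt 1)) + ?T"
    using step_almost_invariant[of "iter f n", OF iter_measurable[OF f] iter_le_1[OF f1]] by simp
  also have "\<dots> \<le> (\<integral>\<^sup>+z. f z \<partial>phase (Wt 1)) + of_nat n * ?T + ?T" by (rule add_right_mono[OF Suc])
  also have "\<dots> = (\<integral>\<^sup>+z. f z \<partial>phase (Wt 1)) + of_nat (Suc n) * ?T"
    by (simp add: distrib_right add.assoc add.commute)
  finally show ?case .
qed simp

lemma Ht_antimono: "0 \<le> \<theta> \<Longrightarrow> Ht \<theta> z \<le> Ht 0 z"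
  by (simp add: Ht_def Wt_def)

lemma exp_Ht_integrable: "0 \<le> \<theta> \<Longrightarrow> \<theta> \<le> 1 \<Longrightarrow> integrable lborel (\<lambda>z. exp (- Ht \<theta> z))"
  using poly_integrable[of \<theta> "\<lambda>_. 1"] poly_bdd_const[of 1] by simp

text \<open>The passage to the modified measure happens once, outside the iteration. The
  unnormalised Gibbs weight lies below the modified one, so entering costs nothing, and returning
  costs Zt 1 - Zt 0 because f \<le> 1.\<close>

lemma iter_target:
  assumes f[measurable]: "f \<in> borel_measurable borel" and f1: "\<And>z. f z \<le> 1"
    and T: "(\<integral>\<^sup>+z. ennreal \<bar>defect z\<bar> \<partial>phase (Wt 1)) \<le> ennreal T" "0 \<le> T"
  shows "(\<integral>\<^sup>+z. iter f n z \<partial>target) \<le> (\<integral>\<^sup>+z. f z \<partial>target) + ennreal ((real n * T + (Zt 1 - Zt 0)) / Zt 0)"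
proof -
  have Z0: "0 < Zt 0" by (rule Zt_pos) auto
  have e0: "exp (- Ht 0 z) \<le> exp (- Ht 1 z)" for z using Ht_antimono[of 1 z] by simp
  have Z01: "Zt 0 \<le> Zt 1" unfolding Zt_def by (intro integral_mono exp_Ht_integrable e0) auto
  have WU: "Wt 0 = U" by (rule ext) (simp add: Wt_def)
  have up: "(\<integral>\<^sup>+z. f z \<partial>phase (Wt 1)) \<le> (\<integral>\<^sup>+z. f z \<partial>phase U) + ennreal (Zt 1 - Zt 0)"
  proof -
    have "(\<integral>\<^sup>+z. f z \<partial>phase (Wt 1)) = (\<integral>\<^sup>+z. f z * ennreal (exp (- Ht 1 z)) \<partial>lborel)" by (rule nn_integral_phase[OF f])
    also have "\<dots> \<le> (\<integral>\<^sup>+z. f z * ennreal (exp (- Ht 0 z)) + ennreal (exp (- Ht 1 z) - exp (- Ht 0 z)) \<partial>lborel)"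
    proof (rule nn_integral_mono)
      fix z
      have "ennreal (exp (- Ht 1 z)) = ennreal (exp (- Ht 0 z)) + ennreal (exp (- Ht 1 z) - exp (- Ht 0 z))"
        using e0[of z] by (simp add: ennreal_plus[symmetric] del: ennreal_plus)
      then have "f z * ennreal (exp (- Ht 1 z)) = f z * ennreal (exp (- Ht 0 z)) + f z * ennreal (exp (- Ht 1 z) - exp (- Ht 0 z))"
        by (simp only: distrib_left)
      also have "\<dots> \<le> f z * ennreal (exp (- Ht 0 z)) + 1 * ennreal (exp (- Ht 1 z) - exp (- Ht 0 z))"
        by (intro add_left_mono mult_right_mono f1) simp
      finally show "f z * ennreal (exp (- Ht 1 z)) \<le> f z * ennreal (exp (- Ht 0 z)) + ennreal (exp (- Ht 1 z) - exp (- Ht 0 z))" by simp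
    qed
    also have "\<dots> = (\<integral>\<^sup>+z. f z * ennreal (exp (- Ht 0 z)) \<partial>lborel) + (\<integral>\<^sup>+z. ennreal (exp (- Ht 1 z) - exp (- Ht 0 z)) \<partial>lborel)"
      by (rule nn_integral_add) measurable
    also have "(\<integral>\<^sup>+z. ennreal (exp (- Ht 1 z) - exp (- Ht 0 z)) \<partial>lborel) = ennreal (Zt 1 - Zt 0)"
    proof -
      have i: "integrable lborel (\<lambda>z. exp (- Ht 1 z))" "integrable lborel (\<lambda>z. exp (- Ht 0 z))"
        by (intro exp_Ht_integrable; simp)+
      have "(\<integral>\<^sup>+z. ennreal (exp (- Ht 1 z) - exp (- Ht 0 z)) \<partial>lborel) = ennreal (\<integral>z. exp (- Ht 1 z) - exp (- Ht 0 z) \<partial>lborel)"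
        using i e0 by (intro nn_integral_eq_integral) auto
      also have "(\<integral>z. exp (- Ht 1 z) - exp (- Ht 0 z) \<partial>lborel) = Zt 1 - Zt 0"
        unfolding Zt_def by (rule Bochner_Integration.integral_diff[OF i])
      finally show ?thesis .
    qed
    also have "(\<integral>\<^sup>+z. f z * ennreal (exp (- Ht 0 z)) \<partial>lborel) = (\<integral>\<^sup>+z. f z \<partial>phase U)"
      using nn_integral_phase[OF f, of 0] by (simp add: WU)
    finally show ?thesis .
  qed
  have im: "iter f n \<in> borel_measurable borel" by (rule iter_measurable[OF f])
  have "(\<integral>\<^sup>+z. iter f n z \<partial>phase U) \<le> (\<integral>\<^sup>+z. iter f n z \<partial>phase (Wt 1))"
    unfolding nn_integral_phase[OF im] nn_integral_phase[OF im, of 0, unfolded WU]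
    by (intro nn_integral_mono mult_left_mono ennreal_leI e0) simp
  also have "\<dots> \<le> (\<integral>\<^sup>+z. f z \<partial>phase (Wt 1)) + of_nat n * (\<integral>\<^sup>+z. ennreal \<bar>defect z\<bar> \<partial>phase (Wt 1))"
    by (rule iter_almost_invariant[OF f f1])
  also have "\<dots> \<le> (\<integral>\<^sup>+z. f z \<partial>phase U) + ennreal (Zt 1 - Zt 0) + of_nat n * ennreal T"
    by (intro add_mono up mult_left_mono T) simp
  also have "\<dots> = (\<integral>\<^sup>+z. f z \<partial>phase U) + ennreal (real n * T + (Zt 1 - Zt 0))"
    using T Z01 by (simp add: ennreal_plus ennreal_mult ennreal_of_nat_eq_real_of_nat ac_simps)
  finally have "ennreal (1 / Zt 0) * (\<integral>\<^sup>+z. iter f n z \<partial>phase U)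
    \<le> ennreal (1 / Zt 0) * ((\<integral>\<^sup>+z. f z \<partial>phase U) + ennreal (real n * T + (Zt 1 - Zt 0)))" by (rule mult_left_mono) simp
  also have "\<dots> = (\<integral>\<^sup>+z. f z \<partial>target) + ennreal ((real n * T + (Zt 1 - Zt 0)) / Zt 0)"
    using T Z0 Z01 by (simp add: distrib_left nn_integral_target ennreal_mult[symmetric] add_divide_distrib del: ennreal_plus)
  finally show ?thesis by (simp add: nn_integral_target[OF im])
qed

text \<open>Invariance rewrites \<nu>(A) as the \<nu>-integral of the indicator propagated for n + 1
  steps. This function is Lipschitz, so a coupling exchanges \<nu> for \<open>target\<close>, and
  almost invariance of \<open>target\<close> removes the propagation.\<close>

lemma invariant_le_target:
  assumes inv: "invariant \<nu>" and A: "A \<in> sets borel"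
    and c: "c \<in> couplings \<nu> target" "(\<integral>\<^sup>+w. ennreal (M (fst w - snd w)) \<partial>c) \<le> ennreal W" "0 \<le> W"
    and T: "(\<integral>\<^sup>+z. ennreal \<bar>defect z\<bar> \<partial>phase (Wt 1)) \<le> ennreal T" "0 \<le> T"
  shows "emeasure \<nu> A \<le> emeasure target A
    + ennreal ((1 - \<delta> * \<kappa>) ^ n * Creg * W + (real (Suc n) * T + (Zt 1 - Zt 0)) / Zt 0)"
proof -
  let ?f = "indicator A :: 'a \<times> 'a \<Rightarrow> ennreal" and ?r = "(1 - \<delta> * \<kappa>) ^ n * Creg"
  have f[measurable]: "?f \<in> borel_measurable borel" and f1: "?f z \<le> 1" for z
    using A by (auto simp: indicator_def)
  have r: "0 \<le> ?r" using \<delta>\<kappa> sg_pos \<delta>_pos by (intro mult_nonneg_nonneg zero_le_power) (auto simp: Creg_def)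
  have sn: "sets \<nu> = sets borel" using inv by (simp add: invariant_def)
  have sc: "sets c = sets (borel \<Otimes>\<^sub>M borel)" and cn: "distr c borel fst = \<nu>" "distr c borel snd = target"
    using c by (auto simp: couplings_def)
  note [measurable_cong] = sc
  have [measurable]: "fst \<in> borel_measurable c" "snd \<in> borel_measurable c"
    unfolding measurable_cong_sets[OF sc refl] by simp_all
  have marginal: "(\<integral>\<^sup>+z. h z \<partial>\<nu>) = (\<integral>\<^sup>+w. h (fst w) \<partial>c)" "(\<integral>\<^sup>+z. h z \<partial>target) = (\<integral>\<^sup>+w. h (snd w) \<partial>c)"
    if [measurable]: "h \<in> borel_measurable borel" for h :: "'a \<times> 'a \<Rightarrow> ennreal"
    unfolding cn[symmetric] by (rule nn_integral_distr; measurable)+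
  let ?g = "iter ?f (Suc n)"
  have gm[measurable]: "?g \<in> borel_measurable borel" by (rule iter_measurable[OF f])
  have [measurable]: "(\<lambda>w. ?g (snd w)) \<in> borel_measurable c" by (rule measurable_compose[OF _ gm]) measurable
  have "emeasure \<nu> A = (\<integral>\<^sup>+z. ?f z \<partial>\<nu>)" using A sn by simp
  also have "\<dots> = (\<integral>\<^sup>+z. ?g z \<partial>\<nu>)" by (rule iter_invariant[OF inv f, symmetric])
  also have "\<dots> = (\<integral>\<^sup>+w. ?g (fst w) \<partial>c)" by (rule marginal(1)[OF gm])
  also have "\<dots> \<le> (\<integral>\<^sup>+w. ?g (snd w) + ennreal ?r * ennreal (M (fst w - snd w)) \<partial>c)"
  proof (rule nn_integral_mono)
    fix w
    show "?g (fst w) \<le> ?g (snd w) + ennreal ?r * ennreal (M (fst w - snd w))"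
      using iter_regular[OF f f1, of n "fst w" "snd w"] r by (simp add: ennreal_mult M_nonneg del: iter.simps)
  qed
  also have "\<dots> = (\<integral>\<^sup>+w. ?g (snd w) \<partial>c) + ennreal ?r * (\<integral>\<^sup>+w. ennreal (M (fst w - snd w)) \<partial>c)"
    by (subst nn_integral_add, measurable, subst nn_integral_cmult) auto
  also have "(\<integral>\<^sup>+w. ?g (snd w) \<partial>c) = (\<integral>\<^sup>+z. ?g z \<partial>target)"
    by (rule marginal(2)[OF gm, symmetric])
  also have "(\<integral>\<^sup>+z. ?g z \<partial>target) + ennreal ?r * (\<integral>\<^sup>+w. ennreal (M (fst w - snd w)) \<partial>c)
     \<le> ((\<integral>\<^sup>+z. ?f z \<partial>target) + ennreal ((real (Suc n) * T + (Zt 1 - Zt 0)) / Zt 0)) + ennreal ?r * ennreal W"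
    by (intro add_mono iter_target[OF f f1 T] mult_left_mono c(2)) simp
  also have "\<dots> = emeasure target A + ennreal (?r * W + (real (Suc n) * T + (Zt 1 - Zt 0)) / Zt 0)"
  proof -
    have "Zt 0 \<le> Zt 1" unfolding Zt_def by (intro integral_mono exp_Ht_integrable) (auto simp: Ht_antimono)
    moreover have "0 < Zt 0" by (rule Zt_pos) auto
    ultimately have "0 \<le> (real (Suc n) * T + (Zt 1 - Zt 0)) / Zt 0" using T by (intro divide_nonneg_pos add_nonneg_nonneg) auto
    then show ?thesis using A r c(3) by (simp add: ennreal_plus ennreal_mult ac_simps)
  qed
  finally show ?thesis .
qed

text \<open>Potential and inner product split over the components, and the Verlet map commutes with
  the projections, so the trapezoid errors add up.\<close>

lemma abs_defect_le:
  assumes R: "1 \<le> R"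
  shows "\<bar>defect z\<bar> \<le> \<delta>^3 * Ll * 2 powr (l - 2) * (1 + m powr (- ((l + 1) / 2))) * R powr ((l + 1) / 2) * (1/22)
    * (\<Sum>j\<in>J. 1 + 2 * (vp R (l + 1) j z + gp R (l + 1) j z + xp R (l + 1) j z))"
proof -
  let ?x = "fst z" and ?y = "fst (verlet z)"
  let ?d = "\<lambda>j. Uj j (Pr j ?y) - Uj j (Pr j ?x) - (Pr j ?y - Pr j ?x) \<bullet> (gj j (Pr j ?x) + gj j (Pr j ?y)) / 2"
  have "defect z = (\<Sum>j\<in>J. ?d j)"
  proof -
    have "(?y - ?x) \<bullet> (g ?x + g ?y) = (\<Sum>j\<in>J. (Pr j ?y - Pr j ?x) \<bullet> (gj j (Pr j ?x) + gj j (Pr j ?y)))"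
      by (subst Pr_inner) (simp add: linear_diff[OF Pr_linear] linear_add[OF Pr_linear] Pr_g)
    then show ?thesis unfolding defect_eq U_split by (simp add: sum_subtractf sum_divide_distrib)
  qed
  also have "\<bar>\<dots>\<bar> \<le> (\<Sum>j\<in>J. \<bar>?d j\<bar>)" by (rule sum_abs)
  also have "\<dots> \<le> (\<Sum>j\<in>J. \<delta>^3 * Ll * 2 powr (l - 2) * (1 + m powr (- ((l + 1) / 2))) * R powr ((l + 1) / 2) * (1/22)
    * (1 + 2 * (vp R (l + 1) j z + gp R (l + 1) j z + xp R (l + 1) j z)))"
  proof (rule sum_mono)
    fix j assume j: "j \<in> J"
    interpret C: growth "Uj j" "gj j" "Hj j" m L "xj j" \<gamma> \<delta> l Ll by (rule comp[OF j])
    have ver: "fst (C.verlet (pj j z)) = Pr j ?y"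
      by (simp add: C.verlet_def verlet_def pj_def Let_def linear_add[OF Pr_linear] linear_diff[OF Pr_linear]
        linear_cmul[OF Pr_linear] Pr_g[OF j])
    show "\<bar>?d j\<bar> \<le> \<delta>^3 * Ll * 2 powr (l - 2) * (1 + m powr (- ((l + 1) / 2))) * R powr ((l + 1) / 2) * (1/22)
      * (1 + 2 * (vp R (l + 1) j z + gp R (l + 1) j z + xp R (l + 1) j z))"
      using C.energy_defect[OF R, of "pj j z", unfolded ver]
      by (simp add: pj_def C.vel_pow_def C.grad_pow_def C.pos_pow_def vp_def gp_def xp_def)
  qed
  finally show ?thesis unfolding sum_distrib_left .
qed

text \<open>The exponent l + 1 is matched to the scale DIM('b) + l - 1. The three normalised moments
  enter with factor 2, whence 1 + 6 times their common bound.\<close>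

lemma defect_moment:
  assumes c: "0 < ct 1"
  shows "(\<integral>\<^sup>+z. ennreal \<bar>defect z\<bar> \<partial>phase (Wt 1))
    \<le> ennreal (\<delta>^3 * Ll * 2 powr (l - 2) * (1 + m powr (- ((l + 1) / 2))) * (real DIM('b) + l - 1) powr ((l + 1) / 2) * (1/22)
       * (real (card J) * (1 + 6 * (1 / ct 1) powr ((l + 1) / 2))) * Zt 1)"
proof -
  define R where "R = real DIM('b) + l - 1"
  have Rq: "R = real DIM('b) + (l + 1) - 2" by (simp add: R_def)
  have R: "1 \<le> R" unfolding R_def using l_ge D_ge_1 by linarith
  define B where "B = \<delta>^3 * Ll * 2 powr (l - 2) * (1 + m powr (- ((l + 1) / 2))) * R powr ((l + 1) / 2) * (1/22)"
  have B0: "0 \<le> B" unfolding B_def using \<delta>_pos Ll_pos by (intro mult_nonneg_nonneg) auto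
  define h where "h j z = 1 + 2 * (vp R (l + 1) j z + gp R (l + 1) j z + xp R (l + 1) j z)" for j z
  let ?cf = "(1 / ct 1) powr ((l + 1) / 2)"
  have int: "integrable lborel (\<lambda>z. h j z * exp (- Ht 1 z))" and le: "(\<integral>z. h j z * exp (- Ht 1 z) \<partial>lborel) \<le> (1 + 6 * ?cf) * Zt 1"
    if j: "j \<in> J" for j
  proof -
    have q: "2 \<le> l + 1" using l_ge by simp
    note nm = normalised_moments[of 1 j "l + 1", folded Rq, OF _ _ j q c, simplified]
    have e: "(\<lambda>z. h j z * exp (- Ht 1 z)) = (\<lambda>z. exp (- Ht 1 z) + 2 * (vp R (l + 1) j z * exp (- Ht 1 z)
      + gp R (l + 1) j z * exp (- Ht 1 z) + xp R (l + 1) j z * exp (- Ht 1 z)))"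
      by (intro ext) (simp add: h_def algebra_simps)
    have one: "integrable lborel (\<lambda>z. exp (- Ht 1 z))" by (intro exp_Ht_integrable) auto
    show "integrable lborel (\<lambda>z. h j z * exp (- Ht 1 z))"
      unfolding e by (intro Bochner_Integration.integrable_add integrable_mult_right one nm)
    have "(\<integral>z. h j z * exp (- Ht 1 z) \<partial>lborel) = Zt 1 + 2 * ((\<integral>z. vp R (l + 1) j z * exp (- Ht 1 z) \<partial>lborel)
       + (\<integral>z. gp R (l + 1) j z * exp (- Ht 1 z) \<partial>lborel) + (\<integral>z. xp R (l + 1) j z * exp (- Ht 1 z) \<partial>lborel))"
      unfolding e Zt_def using nm(4-6) one by (simp add: Bochner_Integration.integral_add)
    also have "\<dots> \<le> (1 + 6 * ?cf) * Zt 1" using nm(1-3) by (simp add: algebra_simps)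
    finally show "(\<integral>z. h j z * exp (- Ht 1 z) \<partial>lborel) \<le> (1 + 6 * ?cf) * Zt 1" .
  qed
  have hn: "0 \<le> h j z" for j z by (simp add: h_def vp_def gp_def xp_def)
  have "(\<integral>\<^sup>+z. ennreal \<bar>defect z\<bar> \<partial>phase (Wt 1)) = (\<integral>\<^sup>+z. ennreal \<bar>defect z\<bar> * ennreal (exp (- Ht 1 z)) \<partial>lborel)"
    by (rule nn_integral_phase) measurable
  also have "\<dots> \<le> (\<integral>\<^sup>+z. ennreal (B * (\<Sum>j\<in>J. h j z * exp (- Ht 1 z))) \<partial>lborel)"
  proof (rule nn_integral_mono)
    fix z
    have "\<bar>defect z\<bar> * exp (- Ht 1 z) \<le> (B * (\<Sum>j\<in>J. h j z)) * exp (- Ht 1 z)"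
      using abs_defect_le[OF R, of z] unfolding B_def h_def by (intro mult_right_mono) auto
    then show "ennreal \<bar>defect z\<bar> * ennreal (exp (- Ht 1 z)) \<le> ennreal (B * (\<Sum>j\<in>J. h j z * exp (- Ht 1 z)))"
      by (simp add: ennreal_mult[symmetric] ennreal_leI sum_distrib_right mult.assoc)
  qed
  also have "\<dots> = ennreal (\<integral>z. B * (\<Sum>j\<in>J. h j z * exp (- Ht 1 z)) \<partial>lborel)"
    using int hn B0 by (intro nn_integral_eq_integral integrable_mult_right Bochner_Integration.integrable_sum) (auto intro!: sum_nonneg mult_nonneg_nonneg)
  also have "(\<integral>z. B * (\<Sum>j\<in>J. h j z * exp (- Ht 1 z)) \<partial>lborel) = B * (\<Sum>j\<in>J. \<integral>z. h j z * exp (- Ht 1 z) \<partial>lborel)"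
    using int by (simp add: Bochner_Integration.integral_sum)
  also have "\<dots> \<le> B * (\<Sum>j\<in>J. (1 + 6 * ?cf) * Zt 1)"
    by (intro mult_left_mono sum_mono le B0)
  also have "\<dots> = B * (real (card J) * (1 + 6 * ?cf)) * Zt 1" by (simp add: mult.assoc)
  finally show ?thesis unfolding B_def R_def by (simp add: ennreal_leI)
qed

text \<open>By 1 - exp (- q) \<le> q with q = \<delta>^2 |\<nabla>U|^2 / 8, the change of
  normalisation is a second moment of the gradient.\<close>

lemma Zt_diff_le:
  assumes c: "0 < ct 1"
  shows "Zt 1 - Zt 0 \<le> \<delta>\<^sup>2 / 8 * (real (card J) * (L * real DIM('b) / ct 1)) * Zt 1"
proof -
  have i: "integrable lborel (\<lambda>z. exp (- Ht 1 z))" "integrable lborel (\<lambda>z. exp (- Ht 0 z))"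
    by (intro exp_Ht_integrable; simp)+
  let ?h = "\<lambda>j z. (norm (gj j (Pr j (fst z)))) powr 2 * exp (- Ht 1 z)"
  have hi: "integrable lborel (?h j)" and hl: "(\<integral>z. ?h j z \<partial>lborel) \<le> (L * real DIM('b) / ct 1) * Zt 1" if j: "j \<in> J" for j
  proof -
    note [measurable] = gj_measurable[OF j]
    note mom = moments[of 1 j 2, folded ct_def, OF _ _ j]
    have "poly_bdd (\<lambda>z::'a \<times> 'a. norm (gj j (Pr j (fst z))) powr 2)"
      using poly_bdd_powr[OF mom(5), of 2] by simp
    then show "integrable lborel (?h j)" by (intro poly_integrable) auto
    show "(\<integral>z. ?h j z \<partial>lborel) \<le> (L * real DIM('b) / ct 1) * Zt 1"
      using mom(2) c L_pos by simp
  qed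
  have "Zt 1 - Zt 0 = (\<integral>z. exp (- Ht 1 z) - exp (- Ht 0 z) \<partial>lborel)"
    unfolding Zt_def by (rule Bochner_Integration.integral_diff[OF i, symmetric])
  also have "\<dots> \<le> (\<integral>z. \<delta>\<^sup>2 / 8 * (\<Sum>j\<in>J. ?h j z) \<partial>lborel)"
  proof (rule integral_mono)
    show "integrable lborel (\<lambda>z. exp (- Ht 1 z) - exp (- Ht 0 z))" using i by (intro Bochner_Integration.integrable_diff) auto
    show "integrable lborel (\<lambda>z. \<delta>\<^sup>2 / 8 * (\<Sum>j\<in>J. ?h j z))" using hi by (intro integrable_mult_right Bochner_Integration.integrable_sum)
    fix z :: "'a \<times> 'a"
    let ?q = "\<delta>\<^sup>2 / 8 * (norm (g (fst z)))\<^sup>2"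
    have "exp (- Ht 0 z) = exp (- Ht 1 z) * exp (- ?q)" by (simp add: Ht_def Wt_def exp_add[symmetric])
    then have "exp (- Ht 1 z) - exp (- Ht 0 z) = exp (- Ht 1 z) * (1 - exp (- ?q))" by (simp add: algebra_simps)
    also have "\<dots> \<le> exp (- Ht 1 z) * ?q" using exp_ge_add_one_self[of "- ?q"] by (intro mult_left_mono) auto
    also have "(norm (g (fst z)))\<^sup>2 = (\<Sum>j\<in>J. (norm (gj j (Pr j (fst z)))) powr 2)"
      unfolding norm_sq_split[of "g (fst z)"] by (intro sum.cong) (auto simp: Pr_g powr_numeral)
    finally show "exp (- Ht 1 z) - exp (- Ht 0 z) \<le> \<delta>\<^sup>2 / 8 * (\<Sum>j\<in>J. ?h j z)"
      by (simp add: sum_distrib_left sum_distrib_right mult_ac)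
  qed
  also have "\<dots> = \<delta>\<^sup>2 / 8 * (\<Sum>j\<in>J. \<integral>z. ?h j z \<partial>lborel)" using hi by (simp add: Bochner_Integration.integral_sum)
  also have "\<dots> \<le> \<delta>\<^sup>2 / 8 * (\<Sum>j\<in>J. (L * real DIM('b) / ct 1) * Zt 1)" by (intro mult_left_mono sum_mono hl) auto
  finally show ?thesis by (simp add: mult_ac)
qed

text \<open>The number n of smoothing and contracting steps is still free here. The factor 1001/1000
  pays for using a coupling that is optimal only up to W / 1000.\<close>

lemma tv_target:
  assumes inv: "invariant \<nu>" and c: "0 < ct 1"
  defines "N \<equiv> real (card J)" and "D \<equiv> real DIM('b)"
  shows "tv_dist \<nu> target \<le> ennreal (2 * ((1 - \<delta> * \<kappa>) ^ n * Creg * (1001/1000 * (sqrt (3/2) * (N * cerr (D + l - 2)) / (\<delta> * \<kappa>)))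
    + (real (Suc n) * (\<delta>^3 * Ll * 2 powr (l - 2) * (1 + m powr (- ((l + 1) / 2))) * (D + l - 1) powr ((l + 1) / 2) * (1/22)
        * (N * (1 + 6 * (1 / ct 1) powr ((l + 1) / 2))) * Zt 1)
       + \<delta>\<^sup>2 / 8 * (N * (L * D / ct 1)) * Zt 1) / Zt 0))"
proof -
  define W where "W = sqrt (3/2) * (N * cerr (D + l - 2)) / (\<delta> * \<kappa>)"
  define T where "T = \<delta>^3 * Ll * 2 powr (l - 2) * (1 + m powr (- ((l + 1) / 2))) * (D + l - 1) powr ((l + 1) / 2) * (1/22)
        * (N * (1 + 6 * (1 / ct 1) powr ((l + 1) / 2))) * Zt 1"
  define Q where "Q = \<delta>\<^sup>2 / 8 * (N * (L * D / ct 1)) * Zt 1"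
  have Z: "0 < Zt 0" "0 < Zt 1" by (intro Zt_pos; simp)+
  have N: "1 \<le> N" unfolding N_def using finJ J_ne by (simp add: Suc_leI card_gt_0_iff)
  have "0 < D + l - 2" unfolding D_def using D_ge_1 l_ge by linarith
  then have ce: "0 < sqrt (3/2) * (N * cerr (D + l - 2))" using N cerr_pos by simp
  then have W0: "0 < W" unfolding W_def using \<delta>\<kappa> by simp
  have T0: "0 \<le> T" unfolding T_def using \<delta>_pos Ll_pos N Z by (intro mult_nonneg_nonneg) auto
  have err: "(\<integral>\<^sup>+z. ennreal ((sqrt (3/2) * dev z) powr 1) \<partial>target) \<le> ennreal ((sqrt (3/2) * (N * cerr (D + l - 2))) powr 1)"
    using dev_moment[of 1 N] by (simp add: N_def D_def)
  have "0 < W / 1000" using W0 by simp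
  from near_optimal_coupling[OF inv order_refl ce this err, folded W_def]
  obtain cp where cp: "cp \<in> couplings \<nu> target"
    "(\<integral>\<^sup>+w. ennreal (M (fst w - snd w) powr 1) \<partial>cp) \<le> ennreal ((W + W / 1000) powr 1)"
    by blast
  have cost: "(\<integral>\<^sup>+w. ennreal (M (fst w - snd w)) \<partial>cp) \<le> ennreal (1001/1000 * W)"
    using cp(2) W0 by (simp add: M_nonneg)
  let ?t = "(1 - \<delta> * \<kappa>) ^ n * Creg * (1001/1000 * W) + (real (Suc n) * T + Q) / Zt 0"
  have "tv_dist \<nu> target \<le> 2 * ennreal ?t"
  proof (rule tv_dist_le)
    fix A :: "('a \<times> 'a) set" assume A: "A \<in> sets borel"
    have "emeasure \<nu> A \<le> emeasure target A
      + ennreal ((1 - \<delta> * \<kappa>) ^ n * Creg * (1001/1000 * W) + (real (Suc n) * T + (Zt 1 - Zt 0)) / Zt 0)"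
      using W0 by (intro invariant_le_target[OF inv A cp(1) cost _ _ T0] defect_moment[OF c, folded N_def D_def, folded T_def]) auto
    also have "\<dots> \<le> emeasure target A + ennreal ?t"
      using Zt_diff_le[OF c, folded N_def D_def, folded Q_def] Z
      by (intro add_left_mono ennreal_leI divide_right_mono) auto
    finally show "emeasure \<nu> A \<le> emeasure target A + ennreal ?t" .
  qed (use inv prob_space_target in \<open>auto simp: invariant_def\<close>)
  also have "2 * ennreal t = ennreal (2 * t)" for t by (simp add: ennreal_mult')
  finally show ?thesis unfolding W_def T_def Q_def .
qed

end

section \<open>Comparison of the constants\<close>

context obabo begin

lemma K1_eq: "K1 L = sqrt 3 * max (sqrt L) (1 / sqrt L)"
  using L_pos by (simp add: K1_def powr_half_sqrt powr_minus_divide)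

lemma K1_sq: "(K1 L)\<^sup>2 = 3 * max L (1 / L)"
proof -
  have "(max (sqrt L) (1 / sqrt L))\<^sup>2 = max L (1 / L)"
  proof (cases "1 \<le> L")
    case True
    then have "1 / L \<le> L" "1 / sqrt L \<le> sqrt L" by (auto simp: divide_le_eq intro: order_trans[of 1 L] mult_mono[of 1 L 1 L, simplified])
    then show ?thesis using L_pos by (simp add: max_def)
  next
    case False
    then have l: "L \<le> 1" by simp
    have "L * L \<le> 1 * 1" using l L_pos by (intro mult_mono) auto
    then have "L \<le> 1 / L" "sqrt L \<le> 1 / sqrt L" using l L_pos by (auto simp: le_divide_eq)
    then show ?thesis using L_pos by (simp add: max_def power_divide)
  qed
  then show ?thesis by (simp add: K1_eq power_mult_distrib)
qed

text \<open>The maximum in \<open>K2\<close> is at least 2, and (7/20)^2 = 49/400 \<le> 1/8 \<le> 1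
  / (2 pi).\<close>

lemma K2_ge: "7/10 * (sqrt \<delta> / sg) \<le> K2 \<delta> \<gamma> L"
proof -
  have s2: "sg\<^sup>2 = 1 - (eta \<delta> \<gamma>)\<^sup>2" using sg_sq by (simp add: et_def)
  have "7/10 * (sqrt \<delta> / sg) = 7/20 * (sqrt \<delta> / sg) * 2" by simp
  also have "\<dots> \<le> sqrt (\<delta> / (2 * pi * (1 - (eta \<delta> \<gamma>)\<^sup>2))) * max (2 + 3 * \<delta>\<^sup>2 * L / 2) (3 * \<delta>)"
  proof (rule mult_mono)
    have "(7/20 * (sqrt \<delta> / sg))\<^sup>2 = (49/400) * (\<delta> / sg\<^sup>2)" using \<delta>_pos by (simp add: power_mult_distrib power_divide)
    also have "\<dots> \<le> (1 / (2 * pi)) * (\<delta> / sg\<^sup>2)"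
      using \<delta>_pos sg_pos pi_less_4 pi_gt_zero by (intro mult_right_mono) (auto simp: le_divide_eq)
    also have "\<dots> = \<delta> / (2 * pi * (1 - (eta \<delta> \<gamma>)\<^sup>2))" by (simp add: s2)
    finally show "7/20 * (sqrt \<delta> / sg) \<le> sqrt (\<delta> / (2 * pi * (1 - (eta \<delta> \<gamma>)\<^sup>2)))" by (rule real_le_rsqrt)
    show "2 \<le> max (2 + 3 * \<delta>\<^sup>2 * L / 2) (3 * \<delta>)" using L_pos by (simp add: le_max_iff_disj)
    show "0 \<le> sqrt (\<delta> / (2 * pi * (1 - (eta \<delta> \<gamma>)\<^sup>2)))" unfolding s2[symmetric] using \<delta>_pos by simp
  qed simp
  finally show ?thesis by (simp add: K2_def)
qed

lemma K5_ge: "L / 6 \<le> K5 \<delta> m L"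
proof -
  have "L / 6 * 1 * 1 * 1 \<le> L / 6 * (1 + \<delta> * ((L + 1) / 2) + \<delta>^3 * (L / 40)) * exp (L * \<delta>\<^sup>2) * (1 + \<delta> * L / (2 * sqrt m))"
    using L_pos \<delta>_pos m_pos by (intro mult_mono) auto
  moreover have "0 \<le> L / (4 * sqrt m)" using L_pos m_pos by simp
  ultimately show ?thesis by (simp add: K5_def)
qed

lemma K6_ge: "2 \<le> l \<Longrightarrow> 2 powr (l - 2) * (1 + m powr (- (l / 2))) \<le> K6 \<delta> m L l"
proof -
  assume l: "2 \<le> l"
  have "2 powr (l - 2) * 1 * 1 * 1 * (1 + 1 / m powr (l / 2)) \<le> K6 \<delta> m L l"
    unfolding K6_def using L_pos \<delta>_pos l
    by (intro mult_mono mult_nonneg_nonneg add_nonneg_nonneg ge_one_powr_ge_zero) auto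
  then show ?thesis by (simp add: powr_minus_divide)
qed

lemma K7_ge: "L \<le> K7 \<delta> m L"
proof -
  have "L * 1 * 1 \<le> K7 \<delta> m L"
    unfolding K7_def using L_pos \<delta>_pos m_pos by (intro mult_mono) auto
  then show ?thesis by simp
qed

lemma K8_ge: "2 \<le> l \<Longrightarrow> 2 powr (l - 2) * (1 + m powr (- ((l + 1) / 2))) \<le> K8 \<delta> m L l"
proof -
  assume l: "2 \<le> l"
  have "2 powr (l - 2) * 1 * 1 * (1 + 1 / m powr ((l + 1) / 2)) \<le> K8 \<delta> m L l"
    unfolding K8_def using L_pos \<delta>_pos l
    by (intro mult_mono mult_nonneg_nonneg add_nonneg_nonneg ge_one_powr_ge_zero one_le_power powr_mono) auto
  then show ?thesis by (simp add: powr_minus_divide)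
qed

lemma sg_le: "sg \<le> sqrt (\<delta> * \<gamma>)"
proof -
  have "et\<^sup>2 = exp (- (\<delta> * \<gamma>))" by (simp add: et_def eta_def exp_double[symmetric])
  then have "1 - et\<^sup>2 \<le> \<delta> * \<gamma>" using exp_ge_add_one_self[of "- (\<delta> * \<gamma>)"] by simp
  then show ?thesis unfolding sg_def by simp
qed

text \<open>The noise of an O-step is small, sg^2 = 1 - exp (- \<delta> \<gamma>) \<le> \<delta>
  \<gamma>, so the factor sqrt \<delta> / sg contained in \<open>K2\<close> is at least 1 / sqrt
  \<gamma>.\<close>

lemma \<gamma>_noise: "sqrt \<gamma> \<le> \<gamma> * (sqrt \<delta> / sg)"
proof -
  have "sqrt \<gamma> * sg \<le> sqrt \<gamma> * sqrt (\<delta> * \<gamma>)" using sg_le \<gamma>_pos by (intro mult_left_mono) auto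
  also have "\<dots> = \<gamma> * sqrt \<delta>" using \<gamma>_pos by (simp add: real_sqrt_mult)
  finally show ?thesis using sg_pos by (simp add: le_divide_eq)
qed

end

text \<open>Bernoulli's inequality, which is \<open>young_powr\<close> at P = 1.\<close>

lemma powr_inverse_bernoulli:
  fixes e s :: real assumes "0 \<le> e" "1 \<le> s" "s * e < 1"
  shows "(1 / (1 - e)) powr s \<le> 1 / (1 - s * e)"
proof -
  have e1: "e < 1" using assms mult_right_mono[of 1 s e] by linarith
  have "1 - s * e \<le> (1 - e) powr s"
    using young_powr[of 1 "1 - e" s] assms e1 by (simp add: field_simps)
  then have "1 / (1 - e) powr s \<le> 1 / (1 - s * e)" using assms by (intro divide_left_mono mult_pos_pos) (use e1 in auto)
  then show ?thesis using e1 by (simp add: powr_divide)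
qed

lemma tv_dist_le_2:
  fixes \<mu> \<nu> :: "'a::euclidean_space measure"
  assumes "prob_space \<mu>" "sets \<mu> = sets borel" and "prob_space \<nu>" "sets \<nu> = sets borel"
  shows "tv_dist \<mu> \<nu> \<le> 2"
proof -
  have "tv_dist \<mu> \<nu> \<le> 2 * ennreal 1"
    by (rule tv_dist_le[OF assms]) (simp add: add_increasing prob_space.emeasure_le_1[OF assms(1)])
  then show ?thesis by simp
qed

section \<open>The bounds in terms of the stated constants\<close>

context split begin

text \<open>The norm factor max 1 (sqrt L) is at most the maximum in \<open>K1\<close>, also after
  division by sqrt L. The coefficients fit because 3/10 \<le> 2/6 and 7/22 \<le> 2.\<close>

lemma comparison_factor:
  "sqrt 3 * max 1 (sqrt L) * (3/10 * L + 7/22 * (Ll * 2 powr (l - 2) * (1 + m powr (- (l / 2))) / sqrt L))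
     \<le> 2 * K1 L * (K5 \<delta> m L + Ll * K6 \<delta> m L l)"
proof -
  define P where "P = Ll * (2 powr (l - 2) * (1 + m powr (- (l / 2))))"
  have P0: "0 \<le> P" unfolding P_def using Ll_pos by (intro mult_nonneg_nonneg add_nonneg_nonneg) auto
  have sL: "0 < sqrt L" using L_pos by simp
  let ?k = "max (sqrt L) (1 / sqrt L)"
  have k1: "max 1 (sqrt L) \<le> ?k" "max 1 (sqrt L) / sqrt L \<le> ?k"
    using sL by (auto simp: max_def divide_le_eq le_divide_eq mult_le_one)
  have k0: "0 \<le> ?k" using sL by (simp add: le_max_iff_disj)
  have "max 1 (sqrt L) * (3/10 * L + 7/22 * (P / sqrt L)) = max 1 (sqrt L) * (3/10 * L) + (max 1 (sqrt L) / sqrt L) * (7/22 * P)"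
    by (simp add: distrib_left)
  also have "\<dots> \<le> ?k * (3/10 * L) + ?k * (7/22 * P)"
    using k1 P0 L_pos by (intro add_mono mult_right_mono) auto
  also have "\<dots> \<le> ?k * (2 * (L / 6)) + ?k * (2 * P)"
    using k0 P0 L_pos by (intro add_mono mult_left_mono) auto
  also have "\<dots> = ?k * (2 * (L / 6 + P))" by (simp add: algebra_simps)
  also have "\<dots> \<le> ?k * (2 * (K5 \<delta> m L + Ll * K6 \<delta> m L l))"
    using k0 K5_ge K6_ge[OF l_ge] Ll_pos unfolding P_def by (intro mult_left_mono add_mono) auto
  finally have "sqrt 3 * (max 1 (sqrt L) * (3/10 * L + 7/22 * (P / sqrt L))) \<le> sqrt 3 * (?k * (2 * (K5 \<delta> m L + Ll * K6 \<delta> m L l)))"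
    by (rule mult_left_mono) simp
  then show ?thesis unfolding K1_eq P_def by (simp only: mult_ac)
qed

lemma wasserstein_bound:
  assumes inv: "invariant \<nu>" and p: "1 \<le> p" and nf: "nf = real (card J) \<or> (2 \<le> p \<and> nf = sqrt (real (card J)))"
  shows "wasserstein p \<nu> target \<le> ennreal (\<delta>\<^sup>2 * nf * (real DIM('b) + l * p - 2) powr (l / 2)
    * (2 * K1 L * (K5 \<delta> m L + Ll * K6 \<delta> m L l) / \<kappa>))"
proof -
  define R where "R = real DIM('b) + l * p - 2"
  define A where "A = 3/10 * L + 7/22 * (Ll * 2 powr (l - 2) * (1 + m powr (- (l / 2))) / sqrt L)"
  have nf0: "0 \<le> nf" using nf by auto
  have d: "\<delta> \<noteq> 0" "\<kappa> > 0" "0 < \<delta>" using \<delta>_pos \<delta>\<kappa> by (auto simp: zero_less_mult_iff)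
  have "sqrt 3 * max 1 (sqrt L) * (nf * cerr R / (\<delta> * \<kappa>)) = (\<delta>\<^sup>2 * nf * R powr (l / 2) / \<kappa>) * (sqrt 3 * max 1 (sqrt L) * A)"
    unfolding cerr_def A_def[symmetric] using d by (simp add: power2_eq_square power3_eq_cube)
  also have "\<dots> \<le> (\<delta>\<^sup>2 * nf * R powr (l / 2) / \<kappa>) * (2 * K1 L * (K5 \<delta> m L + Ll * K6 \<delta> m L l))"
    using d nf0 comparison_factor unfolding A_def by (intro mult_left_mono) auto
  finally have "sqrt 3 * max 1 (sqrt L) * (nf * cerr R / (\<delta> * \<kappa>)) \<le> \<delta>\<^sup>2 * nf * R powr (l / 2) * (2 * K1 L * (K5 \<delta> m L + Ll * K6 \<delta> m L l) / \<kappa>)"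
    by simp
  then show ?thesis
    using wasserstein_target[OF inv p nf] unfolding R_def by (meson ennreal_leI order_trans)
qed

text \<open>If the right-hand side is at least 2, the bound is trivial. Otherwise it forces
  \<delta>^2 L^2 / m to be so small that moments and normalisation of the modified measure differ
  from the Gibbs ones by at most a tenth. The right-hand side has three parts: \<open>RA\<close>
  pays for the Wasserstein cost, \<open>R8\<close> for the drift of the modified measure,
  \<open>R7\<close> and a quarter of \<open>RA\<close> for the change of normalisation.\<close>

lemma tv_bound:
  assumes inv: "invariant \<nu>"
  defines "N \<equiv> real (card J)" and "D' \<equiv> real DIM('b) + l - 1"
  shows "tv_dist \<nu> target \<le> ennreal (\<delta>\<^sup>2 * N * (2 + \<bar>ln (\<delta>^3 * D')\<bar>) * D' powr ((l + 1) / 2)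
    * ((2 * (K1 L)\<^sup>2 * K2 \<delta> \<gamma> L * (K5 \<delta> m L + Ll * K6 \<delta> m L l) + K7 \<delta> m L + Ll * K8 \<delta> m L l) / \<kappa>))"
    (is "_ \<le> ennreal ?RHS")
proof (cases "2 \<le> ?RHS")
  case True
  have "tv_dist \<nu> target \<le> ennreal 2"
    using tv_dist_le_2[of \<nu> target] inv prob_space_target by (simp add: invariant_def)
  also have "\<dots> \<le> ennreal ?RHS" by (rule ennreal_leI[OF True])
  finally show ?thesis .
next
  case False
  define k where "k = \<kappa>"
  define ll where "ll = 2 + \<bar>ln (\<delta>^3 * D')\<bar>"
  define X where "X = N * \<delta>\<^sup>2 * D' powr ((l + 1) / 2)"
  define a where "a = max L (1 / L)"
  define s where "s = sqrt \<delta> / sg"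
  define B where "B = K5 \<delta> m L + Ll * K6 \<delta> m L l"
  define P where "P = Ll * (2 powr (l - 2) * (1 + m powr (- (l / 2))))"
  define S where "S = Ll * (2 powr (l - 2) * (1 + m powr (- ((l + 1) / 2))))"
  define RA where "RA = X * ll / k * (2 * (K1 L)\<^sup>2 * K2 \<delta> \<gamma> L * B)"
  define R7 where "R7 = X * ll / k * K7 \<delta> m L"
  define R8 where "R8 = X * ll / k * (Ll * K8 \<delta> m L l)"
  \<comment> \<open>Exactly 4 N D'^((l + 1) / 2) times the relative loss \<open>e\<close> of drift
    in the modified measure.\<close>
  define u where "u = X * L\<^sup>2 / m"
  have k0: "0 < k" using \<delta>\<kappa> \<delta>_pos by (auto simp: zero_less_mult_iff k_def)
  have km: "1 / k = 3 * \<gamma> / m" by (simp add: k_def \<kappa>_def)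
  have RHS: "?RHS = RA + R7 + R8"
    by (simp add: RA_def R7_def R8_def X_def ll_def B_def k_def algebra_simps add_divide_distrib)
  have N: "1 \<le> N" unfolding N_def using finJ J_ne by (simp add: Suc_leI card_gt_0_iff)
  have D': "2 \<le> D'" "l \<le> D'" "real DIM('b) + l - 2 \<le> D'" "real DIM('b) \<le> D'"
    unfolding D'_def using D_ge_1 l_ge by linarith+
  have Dp: "D' \<le> D' powr ((l + 1) / 2)"
  proof -
    have "D' powr 1 \<le> D' powr ((l + 1) / 2)" using D' l_ge by (intro powr_mono) auto
    then show ?thesis using D' by simp
  qed
  have X0: "0 < X" unfolding X_def using N D' \<delta>_pos by simp
  have ll: "2 \<le> ll" by (simp add: ll_def)
  have P0: "0 \<le> P" and S0: "0 \<le> S" unfolding P_def S_def using Ll_pos by (auto intro!: mult_nonneg_nonneg add_nonneg_nonneg)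
  have s0: "0 < s" using \<delta>_pos sg_pos by (simp add: s_def)
  have a: "1 \<le> a" "L \<le> a" "1 / sqrt L \<le> a"
  proof -
    show "1 \<le> a" "L \<le> a" unfolding a_def using L_pos by (auto simp: le_max_iff_disj le_divide_eq)
    show "1 / sqrt L \<le> a"
    proof (cases "1 \<le> L")
      case True
      then have "1 / sqrt L \<le> 1" using real_sqrt_ge_one[OF True] by (simp add: divide_le_eq)
      then show ?thesis using \<open>1 \<le> a\<close> by (rule order_trans)
    next
      case False
      have "L \<le> sqrt L" using False L_pos by (intro real_le_rsqrt) (auto simp: power2_eq_square mult_le_one mult_left_le)
      then have "1 / sqrt L \<le> 1 / L" using L_pos by (intro divide_left_mono) auto
      then show ?thesis by (simp add: a_def le_max_iff_disj)
    qed
  qed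
  have B: "L / 6 + P \<le> B"
    unfolding B_def P_def using K5_ge K6_ge[OF l_ge] Ll_pos by (intro add_mono mult_left_mono) auto
  have B0: "0 \<le> B" using B P0 L_pos by linarith
  have Xk: "X * 2 / k \<le> X * ll / k" using X0 ll k0 by (intro divide_right_mono mult_left_mono) auto
  have Xk0: "0 \<le> X * 2 / k" "0 \<le> X * ll / k" using X0 ll k0 by auto
  have RA: "42/5 * (a * s * B * X / k) \<le> RA"
  proof -
    have "X * 2 / k * (2 * (3 * a) * (7/10 * s) * B) \<le> RA"
      unfolding RA_def K1_sq a_def[symmetric] using Xk Xk0 K2_ge a B0 s0
      by (intro mult_mono mult_nonneg_nonneg mult_left_mono) (auto simp: s_def)
    then show ?thesis by (simp add: mult_ac)
  qed
  have R7: "6 * (\<gamma> * X * L / m) \<le> R7"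
  proof -
    have "X * 2 / k * L \<le> R7" unfolding R7_def using Xk Xk0 K7_ge L_pos by (intro mult_mono) auto
    moreover have "X * 2 / k * L = X * 2 * L * (1 / k)" by simp
    ultimately show ?thesis unfolding km by (simp add: mult_ac)
  qed
  have R8: "X * ll / k * S \<le> R8"
    unfolding R8_def S_def using Xk0 K8_ge[OF l_ge] Ll_pos by (intro mult_left_mono) auto
  have R8_0: "0 \<le> R8" using R8 Xk0 S0 by (meson mult_nonneg_nonneg order_trans)
  have "0 \<le> 6 * (\<gamma> * X * L / m)" using \<gamma>_pos X0 L_pos m_pos by (intro mult_nonneg_nonneg divide_nonneg_nonneg) auto
  then have R7_0: "0 \<le> R7" using R7 by (rule order_trans)
  have "0 \<le> 42/5 * (a * s * B * X / k)" using a s0 B0 X0 k0 by (intro mult_nonneg_nonneg divide_nonneg_nonneg) auto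
  then have RA0: "0 \<le> RA" using RA by (rule order_trans)
  have u0: "0 < u" unfolding u_def using X0 L_pos m_pos by simp
  \<comment> \<open>For L \<ge> 1 the friction is at least 2, so \<gamma> s \<ge> sqrt \<gamma>
    \<ge> 7/5, and \<open>RA\<close> controls \<open>u\<close>. For L < 1, \<gamma> \<ge> 2 sqrt L
    \<ge> 2 L and \<open>R7\<close> controls it.\<close>
  have dich: "147/25 * u \<le> RA \<or> 12 * u \<le> R7"
  proof (cases "1 \<le> L")
    case True
    have "2 \<le> \<gamma>" using \<gamma>_ge real_sqrt_ge_one[OF True] by linarith
    then have "(7/5)\<^sup>2 \<le> \<gamma>" by (simp add: power2_eq_square)
    then have "7/5 \<le> sqrt \<gamma>" by (rule real_le_rsqrt)
    then have gs: "7/5 \<le> \<gamma> * s" unfolding s_def using \<gamma>_noise by (rule order_trans)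
    have "147/25 * u = 42/5 * (L * (7/5) * (L / 6) * X * (3 / m))" by (simp add: u_def power2_eq_square)
    also have "\<dots> \<le> 42/5 * (a * (\<gamma> * s) * B * X * (3 / m))"
      using a gs B P0 L_pos X0 m_pos \<gamma>_pos s0 by (intro mult_left_mono mult_right_mono mult_mono) auto
    also have "\<dots> = 42/5 * (a * s * B * X * (1 / k))" unfolding km by simp
    also have "\<dots> \<le> RA" using RA by simp
    finally show ?thesis by simp
  next
    case False
    have "L \<le> sqrt L" using False L_pos by (intro real_le_rsqrt) (auto simp: power2_eq_square mult_left_le)
    then have "2 * L \<le> \<gamma>" using \<gamma>_ge by linarith
    have "12 * u = 6 * ((2 * L) * X * L / m)" by (simp add: u_def power2_eq_square)
    also have "\<dots> \<le> 6 * (\<gamma> * X * L / m)"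
      using \<open>2 * L \<le> \<gamma>\<close> X0 L_pos m_pos by (intro mult_left_mono divide_right_mono mult_right_mono) auto
    finally show ?thesis using R7 by simp
  qed
  \<comment> \<open>The right-hand side is below 2, and 2 / (147/25) \<le> 7/20.\<close>
  have u_small: "u \<le> 7/20" using dich False R8_0 R7_0 RA0 u0 unfolding RHS by auto
  define e where "e = \<delta>\<^sup>2 * L\<^sup>2 / (4 * m)"
  have e0: "0 \<le> e" unfolding e_def using m_pos by simp
  have ct1: "ct 1 = 1 - e" by (simp add: ct_def e_def)
  have eD: "D' powr ((l + 1) / 2) * e \<le> u / 4"
  proof -
    have "1 * (D' powr ((l + 1) / 2) * e) \<le> N * (D' powr ((l + 1) / 2) * e)" using N e0 by (intro mult_right_mono) auto
    also have "\<dots> = u / 4" by (simp add: u_def X_def e_def mult_ac)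
    finally show ?thesis by simp
  qed
  have le: "(l + 1) / 2 * e \<le> 7/80"
  proof -
    have "(l + 1) / 2 * e \<le> D' powr ((l + 1) / 2) * e"
      using Dp D' l_ge e0 by (intro mult_right_mono) auto
    then show ?thesis using eD u_small by linarith
  qed
  have cf: "(1 / ct 1) powr ((l + 1) / 2) \<le> 11/10"
  proof -
    define y where "y = (l + 1) / 2 * e"
    have y: "y \<le> 7/80" using le by (simp add: y_def)
    then have "(l + 1) / 2 * e < 1" unfolding y_def by linarith
    then have "(1 / ct 1) powr ((l + 1) / 2) \<le> 1 / (1 - y)"
      unfolding ct1 y_def using e0 l_ge by (intro powr_inverse_bernoulli) auto
    also have "\<dots> \<le> 11/10" using y by (simp add: divide_le_eq)
    finally show ?thesis .
  qed
  have ct: "9/10 \<le> ct 1"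
  proof -
    have "1 * e \<le> (l + 1) / 2 * e" using e0 l_ge by (intro mult_right_mono) auto
    then show ?thesis using le ct1 by linarith
  qed
  have Z: "0 < Zt 0" "0 < Zt 1" by (intro Zt_pos; simp)+
  define q where "q = \<delta>\<^sup>2 / 8 * (N * (L * real DIM('b) / ct 1))"
  have q: "q \<le> 7/50 * u"
  proof -
    have Lm: "L \<le> L\<^sup>2 / m" using m_le_L m_pos L_pos by (simp add: le_divide_eq power2_eq_square)
    have "N * (L * real DIM('b) / ct 1) \<le> N * (L\<^sup>2 / m * D' powr ((l + 1) / 2) / (9/10))"
      using Lm D' Dp ct L_pos m_pos N by (intro mult_left_mono divide_mono mult_mono) (auto intro: order_trans)
    then have "q \<le> \<delta>\<^sup>2 / 8 * (N * (L\<^sup>2 / m * D' powr ((l + 1) / 2) / (9/10)))"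
      unfolding q_def by (rule mult_left_mono) simp
    also have "\<dots> = 5/36 * u" by (simp add: u_def X_def)
    finally show ?thesis using u0 by linarith
  qed
  have ZZ: "Zt 1 \<le> 11/10 * Zt 0"
  proof -
    have "Zt 1 - Zt 0 \<le> q * Zt 1" using Zt_diff_le ct by (simp add: q_def N_def)
    also have "\<dots> \<le> 1/20 * Zt 1" using q u_small Z by (intro mult_right_mono) auto
    finally show ?thesis using Z by linarith
  qed
  \<comment> \<open>Enough steps to bring the contraction factor below sqrt (\<delta>^3 D').
    Multiplied by the factor 1 / (\<delta> sg) of \<open>Creg\<close> this leaves (sqrt \<delta> /
    sg) sqrt D': the noise factor of \<open>K2\<close> and the half power that turns the exponent l
    / 2 into (l + 1) / 2.\<close>
  define n where "n = nat \<lceil>\<bar>ln (\<delta>^3 * D')\<bar> / (2 * (\<delta> * k))\<rceil>"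
  have dk: "0 < \<delta> * k" "\<delta> * k < 1/100" using \<delta>\<kappa> by (auto simp: k_def)
  have n_ge: "\<bar>ln (\<delta>^3 * D')\<bar> / 2 \<le> real n * (\<delta> * k)"
  proof -
    have "\<bar>ln (\<delta>^3 * D')\<bar> / (2 * (\<delta> * k)) \<le> real n" unfolding n_def by linarith
    then show ?thesis using dk by (simp add: divide_le_eq mult_ac)
  qed
  have cancel: "(x / (2 * w) + 2) * (2 * w) = x + 4 * w" if "0 < w" for x w :: real using that by (simp add: distrib_right)
  \<comment> \<open>The summand 2 beside the logarithm covers the rounding of n and the smoothing
    step.\<close>
  have n_le: "2 * (real (Suc n) * (\<delta> * k)) \<le> ll"
  proof -
    have "0 \<le> \<bar>ln (\<delta>^3 * D')\<bar> / (2 * (\<delta> * k))" using dk by simp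
    then have "real (Suc n) \<le> \<bar>ln (\<delta>^3 * D')\<bar> / (2 * (\<delta> * k)) + 2" unfolding n_def by linarith
    then have "real (Suc n) * (2 * (\<delta> * k)) \<le> (\<bar>ln (\<delta>^3 * D')\<bar> / (2 * (\<delta> * k)) + 2) * (2 * (\<delta> * k))"
      using dk by (intro mult_right_mono) auto
    also have "\<dots> = \<bar>ln (\<delta>^3 * D')\<bar> + 4 * (\<delta> * k)" by (rule cancel[OF dk(1)])
    also have "\<dots> \<le> ll" using dk by (simp add: ll_def)
    finally show ?thesis by (simp add: mult_ac)
  qed
  have rho: "(1 - \<delta> * k) ^ n \<le> sqrt (\<delta>^3 * D')"
  proof -
    have y0: "0 < \<delta>^3 * D'" using \<delta>_pos D' by simp
    have "(1 - \<delta> * k) ^ n \<le> exp (- (\<delta> * k)) ^ n"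
      using exp_ge_add_one_self[of "- (\<delta> * k)"] dk by (intro power_mono) auto
    also have "\<dots> = exp (- (real n * (\<delta> * k)))" by (simp add: exp_of_nat_mult[symmetric])
    also have "\<dots> \<le> exp (ln (\<delta>^3 * D') / 2)" using n_ge by simp
    also have "\<dots> = sqrt (\<delta>^3 * D')"
      using y0 by (intro real_sqrt_unique[symmetric]) (auto simp: exp_double[symmetric])
    finally show ?thesis .
  qed
  define A where "A = 3/10 * L + 7/22 * (P / sqrt L)"
  have A0: "0 \<le> A" unfolding A_def using L_pos P0 by simp
  let ?W = "1001/1000 * (sqrt (3/2) * (N * cerr (real DIM('b) + l - 2)) / (\<delta> * k))"
  \<comment> \<open>The Wasserstein cost uses three quarters of \<open>RA\<close>; the last quarter
    is kept for the change of normalisation.\<close>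
  have first: "2 * ((1 - \<delta> * k) ^ n * Creg * ?W) \<le> 3/4 * RA"
  proof -
    have Dr: "0 \<le> real DIM('b) + l - 2" using D_ge_1 l_ge by linarith
    have "cerr (real DIM('b) + l - 2) = \<delta>^3 * (real DIM('b) + l - 2) powr (l / 2) * A"
      by (simp add: cerr_def A_def P_def mult.assoc)
    also have "\<dots> \<le> \<delta>^3 * D' powr (l / 2) * A"
      using \<delta>_pos A0 Dr D' l_ge by (intro mult_right_mono mult_left_mono powr_mono2) auto
    finally have cerr: "cerr (real DIM('b) + l - 2) \<le> \<delta>^3 * D' powr (l / 2) * A" .
    have Creg0: "0 \<le> Creg" using \<delta>_pos sg_pos by (simp add: Creg_def)
    have W: "?W \<le> 1001/1000 * (sqrt (3/2) * (N * (\<delta>^3 * D' powr (l / 2) * A)) / (\<delta> * k))"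
      using cerr N dk by (intro mult_left_mono divide_right_mono) auto
    have W0: "0 \<le> ?W"
    proof -
      have "0 < cerr (real DIM('b) + l - 2)" by (rule cerr_pos) (use D_ge_1 l_ge in linarith)
      then show ?thesis using N \<delta>_pos k0 by (intro mult_nonneg_nonneg divide_nonneg_nonneg) auto
    qed
    have rc: "(1 - \<delta> * k) ^ n * Creg \<le> sqrt (\<delta>^3 * D') * Creg" using rho Creg0 by (rule mult_right_mono)
    have "2 * ((1 - \<delta> * k) ^ n * Creg * ?W)
      \<le> 2 * (sqrt (\<delta>^3 * D') * Creg * (1001/1000 * (sqrt (3/2) * (N * (\<delta>^3 * D' powr (l / 2) * A)) / (\<delta> * k))))"
      by (intro mult_left_mono mult_mono[OF rc W] W0) (use Creg0 D' \<delta>_pos in auto)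
    also have "\<dots> = 2 * (201/200) * (1001/1000) * (sqrt 2 * sqrt (3/2)) * (s * A * X / k)"
    proof -
      have 1: "sqrt (\<delta>^3 * D') = \<delta> * sqrt \<delta> * sqrt D'" using \<delta>_pos by (simp add: real_sqrt_mult power3_eq_cube)
      have 2: "D' powr ((l + 1) / 2) = sqrt D' * D' powr (l / 2)"
        using D' by (simp add: powr_half_sqrt[symmetric] powr_add[symmetric] add_divide_distrib add.commute)
      show ?thesis unfolding 1 Creg_def s_def X_def 2 using \<delta>_pos sg_pos k0
        by (simp add: power3_eq_cube power2_eq_square mult_ac)
    qed
    also have "\<dots> \<le> 2 * (201/200) * (1001/1000) * (17321/10000) * (s * A * X / k)"
    proof -
      have "sqrt 2 * sqrt (3/2) = sqrt (3::real)" by (simp add: real_sqrt_mult[symmetric])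
      also have "\<dots> \<le> 17321/10000" by (rule real_le_lsqrt) (auto simp: power2_eq_square)
      finally show ?thesis using s0 A0 X0 k0 by (intro mult_right_mono mult_left_mono) auto
    qed
    also have "\<dots> \<le> 3/4 * (42/5 * (a * s * B * X / k))"
    proof -
      have "349/100 * A \<le> 63/10 * (a * B)"
      proof -
        define Q where "Q = P / sqrt L"
        have 1: "L \<le> a * L" using a L_pos by simp
        have 2: "Q \<le> a * P" using mult_right_mono[OF a(3) P0] by (simp add: Q_def)
        have "a * (L / 6 + P) \<le> a * B" using B a by (intro mult_left_mono) auto
        then have 3: "a * L + 6 * (a * P) \<le> 6 * (a * B)" by (simp add: distrib_left)
        have 4: "0 \<le> a * P" using a P0 by simp
        have "1047 * L + 1111 * Q \<le> 6300 * (a * B)" using 1 2 3 4 L_pos by linarith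
        moreover have "0 \<le> Q" using P0 L_pos by (simp add: Q_def)
        ultimately show ?thesis unfolding A_def Q_def[symmetric] by (simp add: field_simps)
      qed
      then have "349/100 * A * (s * X / k) \<le> 63/10 * (a * B) * (s * X / k)" using s0 X0 k0 by (intro mult_right_mono) auto
      moreover have "0 \<le> A * (s * X / k)" using A0 s0 X0 k0 by simp
      ultimately show ?thesis by (simp add: mult_ac)
    qed
    also have "\<dots> \<le> 3/4 * RA" by (rule mult_left_mono[OF RA]) simp
    finally show ?thesis .
  qed
  let ?T = "\<delta>^3 * Ll * 2 powr (l - 2) * (1 + m powr (- ((l + 1) / 2))) * D' powr ((l + 1) / 2) * (1/22)
        * (N * (1 + 6 * (1 / ct 1) powr ((l + 1) / 2))) * Zt 1"
  have second: "2 * (real (Suc n) * ?T / Zt 0) \<le> R8"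
  proof -
    have "?T \<le> \<delta> * X * S * (1/22) * (8 * (11/10 * Zt 0))"
    proof -
      have "(1 + 6 * (1 / ct 1) powr ((l + 1) / 2)) * Zt 1 \<le> 8 * (11/10 * Zt 0)"
        using cf ZZ Z by (intro mult_mono) auto
      then have "\<delta> * X * S * (1/22) * ((1 + 6 * (1 / ct 1) powr ((l + 1) / 2)) * Zt 1) \<le> \<delta> * X * S * (1/22) * (8 * (11/10 * Zt 0))"
        using \<delta>_pos X0 S0 by (intro mult_left_mono) auto
      then show ?thesis by (simp add: X_def S_def power3_eq_cube power2_eq_square mult_ac)
    qed
    then have "?T / Zt 0 \<le> 2/5 * (\<delta> * X * S)" using Z by (simp add: divide_le_eq mult_ac)
    then have "2 * (real (Suc n) * (?T / Zt 0)) \<le> 2 * (real (Suc n) * (2/5 * (\<delta> * X * S)))"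
      by (intro mult_left_mono) auto
    also have "\<dots> = 2/5 * (2 * (real (Suc n) * (\<delta> * k)) * (X / k * S))" using k0 by simp
    also have "\<dots> \<le> 2/5 * (ll * (X / k * S))"
      using n_le X0 k0 S0 by (intro mult_left_mono mult_right_mono) auto
    also have "\<dots> \<le> ll * (X / k * S)" by (rule mult_left_le_one_le) (use ll X0 k0 S0 in auto)
    also have "\<dots> \<le> R8" using R8 by (simp add: mult_ac)
    finally show ?thesis by simp
  qed
  \<comment> \<open>A fixed small multiple of \<open>u\<close>, so by \<open>dich\<close> either a
    quarter of \<open>RA\<close> or \<open>R7\<close> alone suffices.\<close>
  have third: "2 * (q * Zt 1 / Zt 0) \<le> 1/4 * RA + R7"
  proof -
    have q0: "0 \<le> q" unfolding q_def using \<delta>_pos N L_pos ct by (intro mult_nonneg_nonneg divide_nonneg_nonneg) auto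
    have "q * Zt 1 \<le> 7/50 * u * (11/10 * Zt 0)" using q ZZ Z q0 u0 by (intro mult_mono) auto
    then have "q * Zt 1 / Zt 0 \<le> 77/500 * u" using Z by (simp add: divide_le_eq)
    then have "2 * (q * Zt 1 / Zt 0) \<le> 2 * (77/500 * u)" by (rule mult_left_mono) simp
    also have "\<dots> \<le> 1/4 * RA + R7" using dich u0 RA0 R7_0 by auto
    finally show ?thesis .
  qed
  have c0: "0 < ct 1" using ct by linarith
  have "tv_dist \<nu> target \<le> ennreal (2 * ((1 - \<delta> * k) ^ n * Creg * ?W + (real (Suc n) * ?T + q * Zt 1) / Zt 0))"
    using tv_target[OF inv c0, of n] unfolding N_def D'_def k_def q_def by (simp only:)
  also have "2 * ((1 - \<delta> * k) ^ n * Creg * ?W + (real (Suc n) * ?T + q * Zt 1) / Zt 0)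
     = 2 * ((1 - \<delta> * k) ^ n * Creg * ?W) + 2 * (real (Suc n) * ?T / Zt 0) + 2 * (q * Zt 1 / Zt 0)"
    by (simp only: add_divide_distrib distrib_left add.assoc)
  also have "\<dots> \<le> 3/4 * RA + R8 + (1/4 * RA + R7)" by (intro add_mono first second third)
  also have "\<dots> = ?RHS" unfolding RHS by simp
  finally show ?thesis by (simp add: ennreal_leI)
qed

end

section \<open>The chain of the statement\<close>

text \<open>Riesz representation on the standard basis; uniqueness of derivatives identifies the
  representing vector with the definite description in \<open>grad\<close>.\<close>

lemma grad_derivative:
  fixes U :: "real^'n \<Rightarrow> real"
  assumes "U differentiable (at x)"
  shows "(U has_derivative (\<lambda>h. grad U x \<bullet> h)) (at x)"
proof -
  obtain f' where f': "(U has_derivative f') (at x)" using assms by (auto simp: differentiable_def)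
  interpret f': bounded_linear f' using f' by (rule has_derivative_bounded_linear)
  define D where "D = (\<Sum>b\<in>Basis. f' b *\<^sub>R b)"
  have "f' h = h \<bullet> D" for h
  proof -
    have "f' h = f' (\<Sum>b\<in>Basis. (h \<bullet> b) *\<^sub>R b)" by (simp add: euclidean_representation)
    also have "\<dots> = h \<bullet> D" by (simp add: D_def f'.sum f'.scaleR inner_sum_right mult.commute)
    finally show ?thesis .
  qed
  then have D: "GDERIV U x :> D" unfolding gderiv_def using f' by presburger
  have "grad U x = D"
    unfolding grad_def
  proof (rule the_equality)
    show "GDERIV U x :> D" by (rule D)
    fix E assume "GDERIV U x :> E"
    then have "(\<lambda>h. h \<bullet> E) = (\<lambda>h. h \<bullet> D)" using D unfolding gderiv_def by (rule has_derivative_unique)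
    then show "E = D" by (metis vector_eq_ldot)
  qed
  then show ?thesis using D by (simp add: gderiv_def inner_commute)
qed

lemma grad_eqI:
  fixes U :: "real^'n \<Rightarrow> real"
  assumes "(U has_derivative (\<lambda>h. D \<bullet> h)) (at x)" shows "grad U x = D"
proof -
  have "U differentiable (at x)" using assms by (auto simp: differentiable_def)
  then have "(\<lambda>h. grad U x \<bullet> h) = (\<lambda>h. D \<bullet> h)"
    using has_derivative_unique[OF grad_derivative assms] by blast
  then show ?thesis by (metis vector_eq_rdot)
qed

lemma grad_at_minimum:
  fixes U :: "real^'n \<Rightarrow> real"
  assumes "U differentiable (at x)" "\<And>y. U x \<le> U y" shows "grad U x = 0"
proof -
  have "(\<lambda>h. grad U x \<bullet> h) = (\<lambda>h. 0)"
    by (rule has_derivative_local_min[OF grad_derivative[OF assms(1)]]) (simp add: assms(2))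
  then show ?thesis by (metis inner_eq_zero_iff)
qed

lemma norm_opnorm: "norm (A *v h) \<le> opnorm A * norm h"
  unfolding opnorm_def by (rule onorm) (rule matrix_vector_mul_bounded_linear)

lemma C2_potential:
  fixes U :: "real^'n \<Rightarrow> real"
  assumes C2: "C2 U" and m: "0 < m" "m \<le> L"
    and lip: "\<And>x y. norm (grad U x - grad U y) \<le> L * norm (x - y)"
    and mono: "\<And>x y. (x - y) \<bullet> (grad U x - grad U y) \<ge> m * (norm (x - y))\<^sup>2"
    and xs: "\<And>y. U xs \<le> U y"
  shows "potential U (grad U) (\<lambda>x h. hess U x *v h) m L xs"
proof
  show "(U has_derivative (\<bullet>) (grad U x)) (at x)" for x
    using C2 by (intro grad_derivative) (simp add: C2_def)
  show "(grad U has_derivative (*v) (hess U x)) (at x)" for x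
    using C2 jacobian_works[of "grad U" "at x"] by (simp add: C2_def hess_def)
  show "continuous_on UNIV (\<lambda>x. hess U x *v h)" for h
  proof -
    have "linear (\<lambda>A :: real^'n^'n. A *v h)"
      by (rule linearI) (simp_all add: matrix_vector_mult_add_rdistrib scaleR_matrix_vector_assoc)
    then have "bounded_linear (\<lambda>A :: real^'n^'n. A *v h)" by (simp add: linear_conv_bounded_linear)
    moreover have "continuous_on UNIV (hess U)" using C2 by (simp add: C2_def)
    ultimately show ?thesis by (rule bounded_linear.continuous_on)
  qed
  show "grad U xs = 0" using C2 xs by (intro grad_at_minimum) (auto simp: C2_def)
qed (use m lip mono in auto)

context obabo begin

text \<open>Invariance on sets says that the image of the product of \<nu> with the noise under the
  step map is \<nu> itself; equality of measures then carries over to all nonnegative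
  functions.\<close>

lemma invariantI:
  assumes "prob_space \<nu>" and sets: "sets \<nu> = sets borel"
    and inv: "\<And>A. A \<in> sets borel \<Longrightarrow> (\<integral>\<^sup>+z. emeasure (distr gauss borel (step z)) A \<partial>\<nu>) = emeasure \<nu> A"
  shows "invariant \<nu>"
  unfolding invariant_def
proof (intro conjI ballI)
  fix f :: "'a \<times> 'a \<Rightarrow> ennreal" assume f[measurable]: "f \<in> borel_measurable borel"
  interpret G: prob_space "gauss :: ('a \<times> 'a) measure" by (rule prob_space_gauss)
  note sets[measurable_cong]
  let ?S = "\<lambda>q. step (fst q) (snd q)"
  have S[measurable]: "?S \<in> borel_measurable (\<nu> \<Otimes>\<^sub>M gauss)" by measurable
  have iterated: "(\<integral>\<^sup>+z. h z \<partial>distr (\<nu> \<Otimes>\<^sub>M gauss) borel ?S) = (\<integral>\<^sup>+z. (\<integral>\<^sup>+\<xi>. h (step z \<xi>) \<partial>gauss) \<partial>\<nu>)"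
    if [measurable]: "h \<in> borel_measurable borel" for h :: "'a \<times> 'a \<Rightarrow> ennreal"
    by (subst nn_integral_distr; (subst G.nn_integral_fst[symmetric])?; simp)
  have "distr (\<nu> \<Otimes>\<^sub>M gauss) borel ?S = \<nu>"
  proof (rule measure_eqI)
    fix A assume "A \<in> sets (distr (\<nu> \<Otimes>\<^sub>M gauss) borel ?S)"
    then have A[measurable]: "A \<in> sets borel" by simp
    have "emeasure (distr (\<nu> \<Otimes>\<^sub>M gauss) borel ?S) A = (\<integral>\<^sup>+z. indicator A z \<partial>distr (\<nu> \<Otimes>\<^sub>M gauss) borel ?S)" by simp
    also have "\<dots> = (\<integral>\<^sup>+z. (\<integral>\<^sup>+\<xi>. indicator A (step z \<xi>) \<partial>gauss) \<partial>\<nu>)" by (rule iterated) measurable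
    also have "\<dots> = (\<integral>\<^sup>+z. emeasure (distr gauss borel (step z)) A \<partial>\<nu>)"
    proof (rule nn_integral_cong)
      fix z
      have [measurable]: "step z \<in> borel_measurable gauss" by measurable
      have "emeasure (distr gauss borel (step z)) A = (\<integral>\<^sup>+y. indicator A y \<partial>distr gauss borel (step z))" by simp
      also have "\<dots> = (\<integral>\<^sup>+\<xi>. indicator A (step z \<xi>) \<partial>gauss)" by (rule nn_integral_distr) measurable
      finally show "(\<integral>\<^sup>+\<xi>. indicator A (step z \<xi>) \<partial>gauss) = emeasure (distr gauss borel (step z)) A" by simp
    qed
    also have "\<dots> = emeasure \<nu> A" by (rule inv[OF A])
    finally show "emeasure (distr (\<nu> \<Otimes>\<^sub>M gauss) borel ?S) A = emeasure \<nu> A" .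
  qed (simp add: sets)
  then show "(\<integral>\<^sup>+z. (\<integral>\<^sup>+\<xi>. f (step z \<xi>) \<partial>gauss) \<partial>\<nu>) = (\<integral>\<^sup>+z. f z \<partial>\<nu>)"
    using iterated[OF f] by simp
qed (use assms in auto)

end

lemma obabo_step_eq:
  fixes U :: "real^'n \<Rightarrow> real"
  assumes "obabo U (grad U) H m L xs \<gamma> \<delta>"
  shows "obabo_step U \<delta> \<gamma> z = obabo.step (grad U) \<gamma> \<delta> z"
proof
  fix \<xi> :: "(real^'n) \<times> (real^'n)"
  interpret obabo U "grad U" H m L xs \<gamma> \<delta> by (rule assms)
  show "obabo_step U \<delta> \<gamma> z \<xi> = step z \<xi>"
    unfolding obabo_step_def split_beta Let_def et_def[symmetric] sg_def[symmetric]
    by (simp add: step_def verlet_def ostep_def Let_def scaleR_add_right scaleR_diff_right power2_eq_square add.commute add.left_commute add_diff_eq diff_add_eq mult.commute)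
qed

lemma invariant_prob_obabo:
  fixes U :: "real^'n \<Rightarrow> real"
  assumes "obabo U (grad U) H m L xs \<gamma> \<delta>" and inv: "invariant_prob (obabo_kernel U \<delta> \<gamma>) \<nu>"
  shows "obabo.invariant (grad U) \<gamma> \<delta> \<nu>"
proof -
  interpret obabo U "grad U" H m L xs \<gamma> \<delta> by (rule assms)
  have "obabo_kernel U \<delta> \<gamma> z = distr gauss borel (step z)" for z
    by (simp add: obabo_kernel_def std_gaussian_eq gauss_pair obabo_step_eq[OF assms(1)])
  then show ?thesis using inv by (intro invariantI) (auto simp: invariant_prob_def)
qed

lemma gibbs_eq_target:
  fixes U :: "real^'n \<Rightarrow> real"
  assumes "split U (grad U) H m L xs \<gamma> \<delta> J Pr E Uj gj Hj xj l Ll"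
  shows "gibbs U = split.target U (grad U) \<delta>"
proof -
  interpret split U "grad U" H m L xs \<gamma> \<delta> J Pr E Uj gj Hj xj l Ll by (rule assms)
  have w: "gibbs_weight U z = exp (- energy z)" for z
    by (simp add: gibbs_weight_def energy_def split_beta)
  show ?thesis unfolding gibbs_def target_def w Zt_def Ht_0 ..
qed

text \<open>The general case is a decomposition with one index and identity projections, so that the
  cardinality factor is 1 and the component has full dimension.\<close>

lemma single_split:
  fixes U :: "'a::euclidean_space \<Rightarrow> real"
  assumes "growth U g H m L xs \<gamma> \<delta> l Ll"
  shows "split U g H m L xs \<gamma> \<delta> {()} (\<lambda>_ x. x) (\<lambda>_ x. x) (\<lambda>_. U) (\<lambda>_. g) (\<lambda>_. H) (\<lambda>_. xs) l Ll"
proof -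
  interpret growth U g H m L xs \<gamma> \<delta> l Ll by (rule assms)
  show ?thesis by unfold_locales (auto simp: linear_id[unfolded id_def] assms growth_axioms)
qed

text \<open>At t = 0 and l = 2 both sides are 1, by the convention built into
  \<open>rpow\<close>.\<close>

lemma rpow_of_nat: "0 \<le> t \<Longrightarrow> 2 \<le> l \<Longrightarrow> rpow t (real l - 2) = t ^ (l - 2)"
proof -
  assume t: "0 \<le> t" and l: "2 \<le> l"
  obtain k where k: "l = k + 2" using l by (metis add.commute le_Suc_ex)
  show ?thesis
    using t by (cases "t = 0") (auto simp: rpow_def k powr_realpow)
qed

lemma C2_real_derivs:
  assumes "C2_real u"
  shows "(u has_real_derivative deriv u t) (at t)" "(deriv u has_real_derivative deriv (deriv u) t) (at t)"
proof -
  have "u differentiable (at t)" "deriv u differentiable (at t)" using assms by (auto simp: C2_real_def)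
  then show "(u has_real_derivative deriv u t) (at t)" "(deriv u has_real_derivative deriv (deriv u) t) (at t)"
    by (metis DERIV_deriv_iff_real_differentiable)+
qed

section \<open>Separable potentials in the orthonormal basis of columns\<close>

locale separable =
  fixes U :: "real^'n \<Rightarrow> real" and Us :: "'n \<Rightarrow> real \<Rightarrow> real" and Q :: "real^'n^'n" and xi :: "'n \<Rightarrow> real"
  assumes Q: "orthogonal_matrix Q" and U_sep: "\<And>x. U (Q *v x) = (\<Sum>i\<in>UNIV. Us i (x $ i))"
    and Us_C2: "\<And>i. C2_real (Us i)" and xi_min: "\<And>i t. Us i (xi i) \<le> Us i t"
begin

definition c :: "'n \<Rightarrow> real^'n" where "c i = column i Q"

lemma c_orthonormal: "c i \<bullet> c j = (if i = j then 1 else 0)"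
  using Q unfolding orthogonal_matrix_orthonormal_columns c_def
  by (auto simp: orthogonal_def dot_square_norm)

lemma Q_c: "Q *v x = (\<Sum>i\<in>UNIV. (x $ i) *\<^sub>R c i)"
  unfolding matrix_mult_sum c_def by (simp add: scalar_mult_eq_scaleR)

lemma transpose_Q_c: "(transpose Q *v x) $ i = c i \<bullet> x"
  by (simp add: matrix_vector_mul_component transpose_def column_def c_def del: transpose_matrix_vector)

lemma Q_transpose_Q: "Q *v (transpose Q *v x) = x"
  using Q by (simp add: matrix_vector_mul_assoc orthogonal_matrix_def del: transpose_matrix_vector)

lemma U_c: "U x = (\<Sum>i\<in>UNIV. Us i (c i \<bullet> x))"
  using U_sep[of "transpose Q *v x"] by (simp add: Q_transpose_Q transpose_Q_c del: transpose_matrix_vector)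

lemma inner_c: "x \<bullet> y = (\<Sum>i\<in>UNIV. (c i \<bullet> x) * (c i \<bullet> y))"
proof -
  have "x \<bullet> y = (\<Sum>i\<in>UNIV. (c i \<bullet> x) *\<^sub>R c i) \<bullet> y"
    using Q_c[of "transpose Q *v x"] by (simp add: Q_transpose_Q transpose_Q_c del: transpose_matrix_vector)
  then show ?thesis by (simp add: inner_sum_left)
qed

lemma grad_c: "grad U x = (\<Sum>i\<in>UNIV. deriv (Us i) (c i \<bullet> x) *\<^sub>R c i)"
proof (rule grad_eqI)
  have "((\<lambda>x. Us i (c i \<bullet> x)) has_derivative (\<lambda>h. (c i \<bullet> h) * deriv (Us i) (c i \<bullet> x))) (at x)" for i
    using has_derivative_compose[OF has_derivative_inner_right[OF has_derivative_ident]
        C2_real_derivs(1)[OF Us_C2, unfolded has_field_derivative_def]]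
    by (simp add: mult.commute)
  then have "((\<lambda>x. \<Sum>i\<in>UNIV. Us i (c i \<bullet> x)) has_derivative (\<lambda>h. \<Sum>i\<in>UNIV. (c i \<bullet> h) * deriv (Us i) (c i \<bullet> x))) (at x)"
    by (rule has_derivative_sum)
  then show "(U has_derivative (\<lambda>h. (\<Sum>i\<in>UNIV. deriv (Us i) (c i \<bullet> x) *\<^sub>R c i) \<bullet> h)) (at x)"
    unfolding U_c[abs_def, symmetric] by (simp add: inner_sum_left mult.commute U_c[symmetric])
qed

lemma c_grad: "c i \<bullet> grad U x = deriv (Us i) (c i \<bullet> x)"
proof -
  have "c i \<bullet> grad U x = (\<Sum>j\<in>UNIV. if i = j then deriv (Us j) (c j \<bullet> x) else 0)"
    unfolding grad_c inner_sum_right by (intro sum.cong) (auto simp: c_orthonormal)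
  then show ?thesis by simp
qed

lemma U_min: "U (Q *v (\<chi> i. xi i)) \<le> U y"
  unfolding U_sep unfolding U_c[of y] by (intro sum_mono) (simp add: xi_min)

text \<open>Along the line spanned by the unit vector \<open>c i\<close>, the gradient of
  \<open>U\<close> has i-th coordinate the derivative of \<open>Us i\<close>; the constants m and L
  of \<open>U\<close> are therefore inherited by every coordinate potential.\<close>

lemma coordinate_growth:
  fixes l :: nat
  assumes ob: "obabo U (grad U) H m L xs \<gamma> \<delta>" and l: "2 \<le> l" and Ll: "0 < Ll"
    and gr: "\<And>i x y. \<bar>deriv (deriv (Us i)) y - deriv (deriv (Us i)) x\<bar>
           \<le> Ll / 4 * \<bar>x - y\<bar> * (2 + \<bar>x - xi i\<bar> ^ (l - 2) + \<bar>y - xi i\<bar> ^ (l - 2))"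
  shows "growth (Us i) (deriv (Us i)) (\<lambda>t h. deriv (deriv (Us i)) t * h) m L (xi i) \<gamma> \<delta> (real l) Ll"
proof -
  interpret obabo U "grad U" H m L xs \<gamma> \<delta> by (rule ob)
  have cn: "norm (c i) = 1" using c_orthonormal[of i i] by (simp add: norm_eq_1)
  have cE: "c i \<bullet> (t *\<^sub>R c i) = t" for t by (simp add: c_orthonormal)
  have dd: "c i \<bullet> (grad U (s *\<^sub>R c i) - grad U (t *\<^sub>R c i)) = deriv (Us i) s - deriv (Us i) t" for s t
    by (simp only: inner_diff_right c_grad cE)
  have diff: "s *\<^sub>R c i - t *\<^sub>R c i = (s - t) *\<^sub>R c i" for s t by (simp add: scaleR_diff_left)
  show ?thesis
  proof
    show "(Us i has_derivative (\<bullet>) (deriv (Us i) x)) (at x)" for x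
      using C2_real_derivs(1)[OF Us_C2, of i x] by (simp add: has_field_derivative_def inner_real_def[abs_def])
    show "(deriv (Us i) has_derivative (*) (deriv (deriv (Us i)) x)) (at x)" for x
      using C2_real_derivs(2)[OF Us_C2, of i x] by (simp add: has_field_derivative_def)
    show "continuous_on UNIV (\<lambda>x. deriv (deriv (Us i)) x * h)" for h
      using Us_C2[of i] unfolding C2_real_def by (intro continuous_intros) auto
    show "norm (deriv (Us i) s - deriv (Us i) t) \<le> L * norm (s - t)" for s t
    proof -
      have "norm (deriv (Us i) s - deriv (Us i) t) \<le> norm (c i) * norm (grad U (s *\<^sub>R c i) - grad U (t *\<^sub>R c i))"
        unfolding dd[symmetric] real_norm_def by (rule Cauchy_Schwarz_ineq2)
      also have "\<dots> \<le> L * norm (s *\<^sub>R c i - t *\<^sub>R c i)" using g_lip by (simp add: cn)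
      also have "\<dots> = L * norm (s - t)" by (simp add: diff cn)
      finally show ?thesis .
    qed
    show "m * (norm (s - t))\<^sup>2 \<le> (s - t) \<bullet> (deriv (Us i) s - deriv (Us i) t)" for s t
      using g_mono[of "s *\<^sub>R c i" "t *\<^sub>R c i"] unfolding diff inner_scaleR_left dd by (simp add: cn)
    show "deriv (Us i) (xi i) = 0"
      using C2_real_derivs(1)[OF Us_C2, of i "xi i"] xi_min
      by (intro DERIV_local_min[of "Us i" _ "xi i" 1]) auto
    show "norm (deriv (deriv (Us i)) y * h - deriv (deriv (Us i)) x * h)
      \<le> Ll / 4 * norm (x - y) * (2 + rpow (norm (x - xi i)) (real l - 2) + rpow (norm (y - xi i)) (real l - 2)) * norm h" for x y h
    proof -
      have "\<bar>deriv (deriv (Us i)) y * h - deriv (deriv (Us i)) x * h\<bar> = \<bar>deriv (deriv (Us i)) y - deriv (deriv (Us i)) x\<bar> * \<bar>h\<bar>"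
        by (metis abs_mult left_diff_distrib)
      moreover have "\<bar>deriv (deriv (Us i)) y - deriv (deriv (Us i)) x\<bar> * \<bar>h\<bar>
        \<le> Ll / 4 * \<bar>x - y\<bar> * (2 + \<bar>x - xi i\<bar> ^ (l - 2) + \<bar>y - xi i\<bar> ^ (l - 2)) * \<bar>h\<bar>"
        by (rule mult_right_mono[OF gr]) simp
      ultimately show ?thesis unfolding real_norm_def rpow_of_nat[OF abs_ge_zero l] by simp
    qed
  qed (use m_pos m_le_L \<gamma>_ge \<delta>_pos \<delta>_le l Ll in auto)
qed

lemma coordinate_split:
  fixes l :: nat
  assumes ob: "obabo U (grad U) H m L xs \<gamma> \<delta>" and l: "2 \<le> l" and Ll: "0 < Ll"
    and gr: "\<And>i x y. \<bar>deriv (deriv (Us i)) y - deriv (deriv (Us i)) x\<bar>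
           \<le> Ll / 4 * \<bar>x - y\<bar> * (2 + \<bar>x - xi i\<bar> ^ (l - 2) + \<bar>y - xi i\<bar> ^ (l - 2))"
  shows "split U (grad U) H m L xs \<gamma> \<delta> UNIV (\<lambda>i x. c i \<bullet> x) (\<lambda>i t. t *\<^sub>R c i) Us (\<lambda>i. deriv (Us i))
    (\<lambda>i t h. deriv (deriv (Us i)) t * h) xi (real l) Ll"
proof -
  interpret obabo U "grad U" H m L xs \<gamma> \<delta> by (rule ob)
  show ?thesis
  proof (rule split.intro[OF obabo_axioms split_axioms.intro])
    show "linear ((\<bullet>) (c i))" "linear (\<lambda>t. t *\<^sub>R c i)" for i
      by (auto intro!: linearI simp: inner_add_right scaleR_add_left)
    show "x \<bullet> y = (\<Sum>i\<in>UNIV. (c i \<bullet> x) \<bullet> (c i \<bullet> y))" for x y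
      unfolding inner_real_def by (rule inner_c)
    show "growth (Us i) (deriv (Us i)) (\<lambda>t. (*) (deriv (deriv (Us i)) t)) m L (xi i) \<gamma> \<delta> (real l) Ll" for i
      by (rule coordinate_growth[OF ob l Ll gr])
  qed (auto simp: c_orthonormal c_grad U_c)
qed

end

text \<open>The constants are continuous in the time step at 0, the bases of all real powers being
  positive there, so each limit is the value at 0.\<close>

lemma K_limits:
  fixes m L l :: real
  assumes "0 < m"
  shows "((\<lambda>t. K5 t m L) \<longlongrightarrow> L / (4 * sqrt m) + L / 6) (at_right 0)"
    and "((\<lambda>t. K6 t m L l) \<longlongrightarrow> 2 powr (l - 2) * (1 + m powr (- l / 2))) (at_right 0)"
    and "((\<lambda>t. K7 t m L) \<longlongrightarrow> L) (at_right 0)"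
    and "((\<lambda>t. K8 t m L l) \<longlongrightarrow> 2 powr (l + 1) * (1 + m powr (- (l + 1) / 2))) (at_right 0)"
proof -
  have lim: "(f \<longlongrightarrow> y) (at_right 0)" if "isCont f 0" "f 0 = y" for f :: "real \<Rightarrow> real" and y
    using that by (metis continuous_at_imp_continuous_at_within continuous_within)
  show "((\<lambda>t. K5 t m L) \<longlongrightarrow> L / (4 * sqrt m) + L / 6) (at_right 0)"
    using assms unfolding K5_def by (intro lim continuous_intros) auto
  show "((\<lambda>t. K6 t m L l) \<longlongrightarrow> 2 powr (l - 2) * (1 + m powr (- l / 2))) (at_right 0)"
    using assms unfolding K6_def by (intro lim continuous_intros) (auto simp: powr_minus_divide)
  show "((\<lambda>t. K7 t m L) \<longlongrightarrow> L) (at_right 0)"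
    using assms unfolding K7_def by (intro lim continuous_intros) auto
  show "((\<lambda>t. K8 t m L l) \<longlongrightarrow> 2 powr (l + 1) * (1 + m powr (- (l + 1) / 2))) (at_right 0)"
  proof -
    have "m powr (- (l + 1) / 2) = 1 / m powr ((l + 1) / 2)"
      using powr_minus_divide[of m "(l + 1) / 2"] by (simp only: minus_divide_left)
    then show ?thesis using assms unfolding K8_def by (intro lim continuous_intros) auto
  qed
qed

theorem proposition12:
  fixes U :: "real^'n \<Rightarrow> real" and m L \<gamma> \<delta> :: real
    and \<pi>\<^sub>\<delta> :: "((real^'n) \<times> (real^'n)) measure"
  assumes "C2 U"
    and "0 < m" and "m \<le> L"
    and "\<And>x y. norm (grad U x - grad U y) \<le> L * norm (x - y)"
    and "\<And>x y. (x - y) \<bullet> (grad U x - grad U y) \<ge> m * (norm (x - y))\<^sup>2"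
    and "\<gamma> \<ge> 2 * sqrt L"
    and "0 < \<delta>" and "\<delta> \<le> m / (33 * \<gamma>^3)"
    and "invariant_prob (obabo_kernel U \<delta> \<gamma>) \<pi>\<^sub>\<delta>"
  shows
    "((\<lambda>t. K5 t m L) \<longlongrightarrow> L / (4 * sqrt m) + L / 6) (at_right 0) \<and>
     (\<forall>l\<ge>2. ((\<lambda>t. K6 t m L l) \<longlongrightarrow> 2 powr (l - 2) * (1 + m powr (- l / 2))) (at_right 0)) \<and>
     ((\<lambda>t. K7 t m L) \<longlongrightarrow> L) (at_right 0) \<and>
     (\<forall>l\<ge>2. ((\<lambda>t. K8 t m L l) \<longlongrightarrow> 2 powr (l + 1) * (1 + m powr (- (l + 1) / 2))) (at_right 0)) \<and>
     (\<forall>(l::real) (Ll::real) (xs::real^'n).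
        l \<ge> 2 \<and> Ll > 0 \<and> (\<forall>y. U xs \<le> U y) \<and>
        (\<forall>x y. opnorm (hess U y - hess U x)
           \<le> Ll / 4 * norm (x - y) * (2 + rpow (norm (x - xs)) (l - 2) + rpow (norm (y - xs)) (l - 2)))
        \<longrightarrow>
        (\<forall>p\<ge>1. wasserstein p \<pi>\<^sub>\<delta> (gibbs U)
           \<le> ennreal (\<delta>\<^sup>2 * (real CARD('n) + l * p - 2) powr (l / 2)
               * (2 * K1 L * (K5 \<delta> m L + Ll * K6 \<delta> m L l) / kappa m \<gamma>))) \<and>
        tv_dist \<pi>\<^sub>\<delta> (gibbs U)
           \<le> ennreal (\<delta>\<^sup>2 * (2 + \<bar>ln (\<delta>^3 * (real CARD('n) + l - 1))\<bar>)
               * (real CARD('n) + l - 1) powr ((l + 1) / 2)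
               * ((2 * (K1 L)\<^sup>2 * K2 \<delta> \<gamma> L * (K5 \<delta> m L + Ll * K6 \<delta> m L l)
                    + K7 \<delta> m L + Ll * K8 \<delta> m L l) / kappa m \<gamma>))) \<and>
     (\<forall>(l::nat) (Ll::real) (Q::real^'n^'n) (Us::'n \<Rightarrow> real \<Rightarrow> real) (xs::'n \<Rightarrow> real).
        l \<ge> 2 \<and> Ll > 0 \<and> orthogonal_matrix Q \<and> (\<forall>i. C2_real (Us i)) \<and>
        (\<forall>x. U (Q *v x) = (\<Sum>i\<in>UNIV. Us i (x $ i))) \<and>
        (\<forall>i t. Us i (xs i) \<le> Us i t) \<and>
        (\<forall>i x y. \<bar>deriv (deriv (Us i)) y - deriv (deriv (Us i)) x\<bar>
           \<le> Ll / 4 * \<bar>x - y\<bar> * (2 + \<bar>x - xs i\<bar> ^ (l - 2) + \<bar>y - xs i\<bar> ^ (l - 2)))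
        \<longrightarrow>
        (\<forall>p\<ge>2. wasserstein p \<pi>\<^sub>\<delta> (gibbs U)
           \<le> ennreal (\<delta>\<^sup>2 * sqrt (real CARD('n))
               * (2 * K1 L * (K5 \<delta> m L + Ll * K6 \<delta> m L (real l))
                    * (real l * p - 1) powr (real l / 2) / kappa m \<gamma>))) \<and>
        tv_dist \<pi>\<^sub>\<delta> (gibbs U)
           \<le> ennreal (\<delta>\<^sup>2 * real CARD('n) * (2 + \<bar>ln (\<delta>^3 * real l)\<bar>)
               * real l powr ((real l + 1) / 2)
               * ((2 * (K1 L)\<^sup>2 * K2 \<delta> \<gamma> L * (K5 \<delta> m L + Ll * K6 \<delta> m L (real l))
                    + K7 \<delta> m L + Ll * K8 \<delta> m L (real l)) / kappa m \<gamma>)))"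
    (is "?K5 \<and> ?K6 \<and> ?K7 \<and> ?K8 \<and> ?general \<and> ?separable")
proof -
  let ?H = "\<lambda>x h. hess U x *v h"
  have ob: "obabo U (grad U) ?H m L xs \<gamma> \<delta>" if "\<And>y. U xs \<le> U y" for xs
  proof -
    interpret potential U "grad U" ?H m L xs by (rule C2_potential) (use assms that in auto)
    show ?thesis by unfold_locales (use assms in auto)
  qed
  have ?general
  proof (intro allI impI, elim conjE)
    fix l Ll :: real and xs :: "real^'n"
    assume l: "2 \<le> l" and Ll: "0 < Ll" and xs: "\<forall>y. U xs \<le> U y"
      and gr: "\<forall>x y. opnorm (hess U y - hess U x)
           \<le> Ll / 4 * norm (x - y) * (2 + rpow (norm (x - xs)) (l - 2) + rpow (norm (y - xs)) (l - 2))"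
    interpret obabo U "grad U" ?H m L xs \<gamma> \<delta> using ob xs by blast
    interpret growth U "grad U" ?H m L xs \<gamma> \<delta> l Ll
    proof
      show "norm (hess U y *v h - hess U x *v h)
        \<le> Ll / 4 * norm (x - y) * (2 + rpow (norm (x - xs)) (l - 2) + rpow (norm (y - xs)) (l - 2)) * norm h" for x y h
        using norm_opnorm[of "hess U y - hess U x" h] mult_right_mono[OF gr[rule_format, of y x], of "norm h"]
        by (simp add: matrix_vector_mult_diff_rdistrib)
    qed (use l Ll in auto)
    note sp = single_split[OF growth_axioms]
    interpret split U "grad U" ?H m L xs \<gamma> \<delta> "{()}" "\<lambda>_ x. x" "\<lambda>_ x. x" "\<lambda>_. U" "\<lambda>_. grad U" "\<lambda>_. ?H" "\<lambda>_. xs" l Ll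
      by (rule sp)
    have inv: "invariant \<pi>\<^sub>\<delta>" by (rule invariant_prob_obabo[OF obabo_axioms assms(9)])
    show "(\<forall>p\<ge>1. wasserstein p \<pi>\<^sub>\<delta> (gibbs U)
           \<le> ennreal (\<delta>\<^sup>2 * (real CARD('n) + l * p - 2) powr (l / 2)
               * (2 * K1 L * (K5 \<delta> m L + Ll * K6 \<delta> m L l) / kappa m \<gamma>))) \<and>
        tv_dist \<pi>\<^sub>\<delta> (gibbs U)
           \<le> ennreal (\<delta>\<^sup>2 * (2 + \<bar>ln (\<delta>^3 * (real CARD('n) + l - 1))\<bar>)
               * (real CARD('n) + l - 1) powr ((l + 1) / 2)
               * ((2 * (K1 L)\<^sup>2 * K2 \<delta> \<gamma> L * (K5 \<delta> m L + Ll * K6 \<delta> m L l)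
                    + K7 \<delta> m L + Ll * K8 \<delta> m L l) / kappa m \<gamma>))"
      \<comment> \<open>One component, so \<open>nf\<close> = 1 is admissible for every p \<ge>
        1.\<close>
      using wasserstein_bound[OF inv, of _ 1] tv_bound[OF inv]
      by (simp add: gibbs_eq_target[OF sp] \<kappa>_def kappa_def)
  qed
  moreover have ?separable
  proof (intro allI impI, elim conjE)
    fix l :: nat and Ll :: real and Q :: "real^'n^'n" and Us :: "'n \<Rightarrow> real \<Rightarrow> real" and xs :: "'n \<Rightarrow> real"
    assume l: "2 \<le> l" and Ll: "0 < Ll" and Q: "orthogonal_matrix Q" and Us: "\<forall>i. C2_real (Us i)"
      and sep: "\<forall>x. U (Q *v x) = (\<Sum>i\<in>UNIV. Us i (x $ i))" and xs: "\<forall>i t. Us i (xs i) \<le> Us i t"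
      and gr: "\<forall>i x y. \<bar>deriv (deriv (Us i)) y - deriv (deriv (Us i)) x\<bar>
           \<le> Ll / 4 * \<bar>x - y\<bar> * (2 + \<bar>x - xs i\<bar> ^ (l - 2) + \<bar>y - xs i\<bar> ^ (l - 2))"
    interpret S: separable U Us Q xs using Q Us sep xs by unfold_locales auto
    interpret obabo U "grad U" ?H m L "Q *v (\<chi> i. xs i)" \<gamma> \<delta> by (rule ob[OF S.U_min])
    note sp = S.coordinate_split[OF obabo_axioms l Ll gr[rule_format]]
    interpret split U "grad U" ?H m L "Q *v (\<chi> i. xs i)" \<gamma> \<delta> UNIV "\<lambda>i x. S.c i \<bullet> x" "\<lambda>i t. t *\<^sub>R S.c i" Us "\<lambda>i. deriv (Us i)"
      "\<lambda>i t h. deriv (deriv (Us i)) t * h" xs "real l" Ll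
      by (rule sp)
    have inv: "invariant \<pi>\<^sub>\<delta>" by (rule invariant_prob_obabo[OF obabo_axioms assms(9)])
    show "(\<forall>p\<ge>2. wasserstein p \<pi>\<^sub>\<delta> (gibbs U)
           \<le> ennreal (\<delta>\<^sup>2 * sqrt (real CARD('n))
               * (2 * K1 L * (K5 \<delta> m L + Ll * K6 \<delta> m L (real l))
                    * (real l * p - 1) powr (real l / 2) / kappa m \<gamma>))) \<and>
        tv_dist \<pi>\<^sub>\<delta> (gibbs U)
           \<le> ennreal (\<delta>\<^sup>2 * real CARD('n) * (2 + \<bar>ln (\<delta>^3 * real l)\<bar>)
               * real l powr ((real l + 1) / 2)
               * ((2 * (K1 L)\<^sup>2 * K2 \<delta> \<gamma> L * (K5 \<delta> m L + Ll * K6 \<delta> m L (real l))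
                    + K7 \<delta> m L + Ll * K8 \<delta> m L (real l)) / kappa m \<gamma>))"
    proof (intro conjI allI impI)
      fix p :: real assume p: "2 \<le> p"
      show "wasserstein p \<pi>\<^sub>\<delta> (gibbs U)
           \<le> ennreal (\<delta>\<^sup>2 * sqrt (real CARD('n))
               * (2 * K1 L * (K5 \<delta> m L + Ll * K6 \<delta> m L (real l))
                    * (real l * p - 1) powr (real l / 2) / kappa m \<gamma>))"
      proof -
        \<comment> \<open>Components are real lines, so the moment scale is l p - 1, and the
          dimension d enters only through \<open>nf\<close> = sqrt d.\<close>
        have e: "real DIM(real) + real l * p - 2 = real l * p - 1" by simp
        show ?thesis
          using wasserstein_bound[OF inv, of p "sqrt (real CARD('n))"] p
          unfolding e gibbs_eq_target[OF sp] \<kappa>_def kappa_def times_divide_eq_right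
          by (simp only: mult_ac) simp
      qed
    next
      show "tv_dist \<pi>\<^sub>\<delta> (gibbs U)
           \<le> ennreal (\<delta>\<^sup>2 * real CARD('n) * (2 + \<bar>ln (\<delta>^3 * real l)\<bar>)
               * real l powr ((real l + 1) / 2)
               * ((2 * (K1 L)\<^sup>2 * K2 \<delta> \<gamma> L * (K5 \<delta> m L + Ll * K6 \<delta> m L (real l))
                    + K7 \<delta> m L + Ll * K8 \<delta> m L (real l)) / kappa m \<gamma>))"
        using tv_bound[OF inv] by (simp add: gibbs_eq_target[OF sp] \<kappa>_def kappa_def)
    qed
  qed
  moreover have ?K5 ?K7 by (rule K_limits[OF assms(2)])+
  moreover have ?K6 ?K8 by (intro allI impI K_limits[OF assms(2)])+
  ultimately show ?thesis by - (intro conjI; assumption)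
qed

end
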